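(* Let $S$ be a countable right LCM semigroup and $N$ be a nontrivial scale on $S$ such that the partially ordered set $(\ker N)/(\ker N)^*$ is directed. Assume the abscissa of convergence $\beta_c$ of the series $\sum_{[s] \in S/{\sim_N}} N(s)^{-\beta}$ is finite. Then, for every $\beta>\beta_c$, there exists an affine homeomorphism between the $\sigma^N$-KMS$_\beta$-states on $C^*(S)$ and the tracial states on $C^*(\ker N)$, or equivalently, on the group C$^*$-algebra $C^*(I_\ell(\ker N)/\gamma)$. Explicitly, the KMS$_\beta$-state $\varphi_{\tau,\beta}$ corresponding to a tracial state $\tau$ on $C^*(\ker N)$ is given, for $s,t\in S$, by $$\varphi_{\tau,\beta}(v_sv_t^* )=\frac{N(s)^{-\beta}}{\zeta_N(\beta)}\sum_{[x]\in S/{\sim_N}:\,[sx]=[tx]}N(x)^{-\beta}\,\tau(v_{q_x}v_{p_x}^* ),$$ where $p_x,q_x\in\ker N$ are such that $sxp_x=txq_x$.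
   Context: A right LCM semigroup is a left cancellative semigroup $S$ with identity element $e$ such that for all $s,t\in S$ either $sS\cap tS=\emptyset$ or $sS\cap tS=rS$ for some $r\in S$. A scale on $S$ is a semigroup homomorphism $N\colon S\to([1,+\infty),\cdot)$; it is nontrivial if not identically $1$; $\ker N:=N^{-1}(1)$. For a right LCM semigroup $S$, $C^*(S)$ is the (universal) C$^*$-algebra generated by isometries $v_s$, $s\in S$, with relations $v_e=1$, $v_sv_t=v_{st}$, and $v_sv_s^*v_tv_t^*=v_rv_r^*$ if $sS\cap tS=rS$, $v_sv_s^*v_tv_t^*=0$ if $sS\cap tS=\emptyset$. The dynamics $\sigma^N$ is given by $\sigma^N_t(v_s)=N(s)^{it}v_s$. A $\sigma^N$-KMS$_\beta$-state is a state $\varphi$ on $C^*(S)$ such that $\varphi(ab)=\varphi(b\,\sigma^N_{i\beta}(a))$ for all $a,b$ in a dense subspace of $\sigma^N$-analytic elements. State spaces carry the weak$^*$ topology. For a submonoid $T\subset S$, $T^*$ is its group of invertible elements and $T/T^*$ is partially ordered by: $t_1T^*$ is larger than $t_2T^*$ iff $t_1T\subset t_2T$. Directedness of $(\ker N)/(\ker N)^*$ means $t_1(\ker N)\cap t_2(\ker N)\neq\emptyset$ for all $t_1,t_2\in\ker N$. Then $s\sim_N t$ iff $sa=tb$ for some $a,b\in\ker N$ defines an equivalence relation on $S$; $[s]$ is the class of $s$, and $N$ is constant on classes. $\zeta_N(\beta):=\sum_{[s]\in S/{\sim_N}}N(s)^{-\beta}$. Under the hypotheses of the theorem, $\ker N$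 is itself a right LCM semigroup, so $C^*(\ker N)$ is defined as the (universal) C$^*$-algebra generated by isometries $v_s$, $s\in\ker N$, with relations $v_e=1$, $v_sv_t=v_{st}$, and $v_sv_s^*v_tv_t^*=v_rv_r^*$ if $s(\ker N)\cap t(\ker N)=r(\ker N)$ (the intersection is never empty, by directedness). $I_\ell(\ker N)$ denotes the left inverse hull of $\ker N$ without $0$, i.e. the inverse semigroup $\{\lambda_s\lambda_t^{-1}\mid s,t\in\ker N\}$ of partial bijections of $\ker N$, where $\lambda_s\colon \ker N\to s\ker N$, $x\mapsto sx$. For an inverse semigroup $I$ without $0$, $\gamma$ is the congruence $x\gamma y$ iff $xp=yp$ for some idempotent $p\in I$, and $I/\gamma$ is the maximal group homomorphic image of $I$.
   Formalization: In the definition of KMS-state the dense subspace of analytic elements is required to be invariant under the dynamics (the standard convention); without this the claim fails, e.g. for S = ℕ, N(n) = e^n and the character v ↦ 1 of the Toeplitz algebra. *)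

theory Defs
  imports
    "HOL-Analysis.Analysis"
    "HOL-Library.Poly_Mapping"
    "HOL-Algebra.Coset"
    "HOL-Algebra.Module"
begin

section \<open>Right LCM semigroups and scales\<close>

locale right_lcm_semigroup = monoid S for S (structure) +
  assumes left_cancel:
      "\<lbrakk>s \<in> carrier S; t \<in> carrier S; u \<in> carrier S; s \<otimes> t = s \<otimes> u\<rbrakk> \<Longrightarrow> t = u"
    and right_lcm:
      "\<lbrakk>s \<in> carrier S; t \<in> carrier S\<rbrakk> \<Longrightarrow>
        (s <# carrier S) \<inter> (t <# carrier S) = {} \<or>
        (\<exists>r\<in>carrier S. (s <# carrier S) \<inter> (t <# carrier S) = r <# carrier S)"

definition scale :: "('s, 'm) monoid_scheme \<Rightarrow> ('s \<Rightarrow> real) \<Rightarrow> bool" where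
  "scale S N \<longleftrightarrow>
     (\<forall>s\<in>carrier S. 1 \<le> N s) \<and>
     (\<forall>s\<in>carrier S. \<forall>t\<in>carrier S. N (s \<otimes>\<^bsub>S\<^esub> t) = N s * N t)"

definition nontrivial_scale :: "('s, 'm) monoid_scheme \<Rightarrow> ('s \<Rightarrow> real) \<Rightarrow> bool" where
  "nontrivial_scale S N \<longleftrightarrow> scale S N \<and> (\<exists>s\<in>carrier S. N s \<noteq> 1)"

definition scale_ker :: "('s, 'm) monoid_scheme \<Rightarrow> ('s \<Rightarrow> real) \<Rightarrow> ('s, 'm) monoid_scheme" where
  "scale_ker S N = S\<lparr>carrier := {s \<in> carrier S. N s = 1}\<rparr>"

text \<open>The quotient \<open>T/T\<^sup>*\<close> of a monoid by its group of units, with its partial order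
  (\<open>t\<^sub>1T\<^sup>* \<le> t\<^sub>2T\<^sup>*\<close> iff \<open>t\<^sub>2T \<subseteq> t\<^sub>1T\<close>; the ideal \<open>tT\<close> depends only on the coset \<open>tT\<^sup>*\<close>).\<close>

definition unit_cosets :: "('s, 'm) monoid_scheme \<Rightarrow> 's set set" where
  "unit_cosets T = (\<lambda>t. t <#\<^bsub>T\<^esub> Units T) ` carrier T"

definition unit_coset_le :: "('s, 'm) monoid_scheme \<Rightarrow> 's set \<Rightarrow> 's set \<Rightarrow> bool" where
  "unit_coset_le T A B \<longleftrightarrow> (\<exists>a\<in>A. \<exists>b\<in>B. b <#\<^bsub>T\<^esub> carrier T \<subseteq> a <#\<^bsub>T\<^esub> carrier T)"

definition unit_cosets_directed :: "('s, 'm) monoid_scheme \<Rightarrow> bool" where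
  "unit_cosets_directed T \<longleftrightarrow>
     (\<forall>A\<in>unit_cosets T. \<forall>B\<in>unit_cosets T.
        \<exists>C\<in>unit_cosets T. unit_coset_le T A C \<and> unit_coset_le T B C)"

definition scale_rel :: "('s, 'm) monoid_scheme \<Rightarrow> ('s \<Rightarrow> real) \<Rightarrow> ('s \<times> 's) set" where
  "scale_rel S N =
     {(s, t). s \<in> carrier S \<and> t \<in> carrier S \<and>
        (\<exists>a\<in>carrier (scale_ker S N). \<exists>b\<in>carrier (scale_ker S N). s \<otimes>\<^bsub>S\<^esub> a = t \<otimes>\<^bsub>S\<^esub> b)}"

abbreviation scale_class :: "('s, 'm) monoid_scheme \<Rightarrow> ('s \<Rightarrow> real) \<Rightarrow> 's \<Rightarrow> 's set" where
  "scale_class S N s \<equiv> scale_rel S N `` {s}"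

abbreviation scale_classes :: "('s, 'm) monoid_scheme \<Rightarrow> ('s \<Rightarrow> real) \<Rightarrow> 's set set" where
  "scale_classes S N \<equiv> carrier S // scale_rel S N"

text \<open>\<open>N\<close> is constant on classes, so the choice of representative below is immaterial.\<close>

definition class_scale :: "('s \<Rightarrow> real) \<Rightarrow> 's set \<Rightarrow> real" where
  "class_scale N c = N (SOME s. s \<in> c)"

definition scale_zeta :: "('s, 'm) monoid_scheme \<Rightarrow> ('s \<Rightarrow> real) \<Rightarrow> real \<Rightarrow> real" where
  "scale_zeta S N \<beta> = (\<Sum>\<^sub>\<infinity>c\<in>scale_classes S N. class_scale N c powr (- \<beta>))"

definition scale_abscissa :: "('s, 'm) monoid_scheme \<Rightarrow> ('s \<Rightarrow> real) \<Rightarrow> ereal" where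
  "scale_abscissa S N =
     Inf (ereal ` {\<beta>. (\<lambda>c. class_scale N c powr (- \<beta>)) summable_on scale_classes S N})"


section \<open>Left inverse hulls and maximal group images\<close>

text \<open>Partial bijections are partial functions, composed by \<open>\<circ>\<^sub>m\<close>
  (first the right factor, then the left one).\<close>

definition left_mult :: "('s, 'm) monoid_scheme \<Rightarrow> 's \<Rightarrow> 's \<rightharpoonup> 's" where
  "left_mult T s = (\<lambda>x. if x \<in> carrier T then Some (s \<otimes>\<^bsub>T\<^esub> x) else None)"

definition partial_inv :: "('a \<rightharpoonup> 'b) \<Rightarrow> 'b \<rightharpoonup> 'a" where
  "partial_inv f = (\<lambda>y. if y \<in> ran f then Some (THE x. f x = Some y) else None)"

definition left_inverse_hull :: "('s, 'm) monoid_scheme \<Rightarrow> ('s \<rightharpoonup> 's) monoid" where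
  "left_inverse_hull T =
     \<lparr>carrier = {left_mult T s \<circ>\<^sub>m partial_inv (left_mult T t) | s t.
                   s \<in> carrier T \<and> t \<in> carrier T},
      monoid.mult = (\<circ>\<^sub>m),
      one = left_mult T \<one>\<^bsub>T\<^esub>\<rparr>"

definition group_congruence :: "('a, 'm) monoid_scheme \<Rightarrow> ('a \<times> 'a) set" where
  "group_congruence I =
     {(x, y). x \<in> carrier I \<and> y \<in> carrier I \<and>
        (\<exists>p\<in>carrier I. p \<otimes>\<^bsub>I\<^esub> p = p \<and> x \<otimes>\<^bsub>I\<^esub> p = y \<otimes>\<^bsub>I\<^esub> p)}"

definition max_group_image :: "('a, 'm) monoid_scheme \<Rightarrow> 'a set monoid" where
  "max_group_image I =
     \<lparr>carrier = carrier I // group_congruence I,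
      monoid.mult = (\<lambda>A B. \<Union>x\<in>A. \<Union>y\<in>B. group_congruence I `` {x \<otimes>\<^bsub>I\<^esub> y}),
      one = group_congruence I `` {\<one>\<^bsub>I\<^esub>}\<rparr>"


section \<open>The free unital *-algebra\<close>

text \<open>Words in the letters \<open>g\<close>, \<open>g\<^sup>*\<close> form the free *-monoid. The convolution product of
  \<^typ>\<open>'w \<Rightarrow>\<^sub>0 complex\<close> over such words is the multiplication of noncommutative *-polynomials;
  to have it, the word monoid is written additively.\<close>

datatype 'g letter = Gen 'g | Adj 'g

datatype 'g star_word = Word (letters: "'g letter list")

instantiation star_word :: (type) monoid_add
begin

definition zero_star_word :: "'a star_word" where
  "zero_star_word = Word []"

definition plus_star_word :: "'a star_word \<Rightarrow> 'a star_word \<Rightarrow> 'a star_word" where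
  "plus_star_word v w = Word (letters v @ letters w)"

instance
  by standard (simp_all add: zero_star_word_def plus_star_word_def)

end

fun letter_adj :: "'g letter \<Rightarrow> 'g letter" where
  "letter_adj (Gen g) = Adj g"
| "letter_adj (Adj g) = Gen g"

definition word_adj :: "'g star_word \<Rightarrow> 'g star_word" where
  "word_adj w = Word (rev (map letter_adj (letters w)))"

lemma letter_adj_invol [simp]: "letter_adj (letter_adj l) = l"
  by (cases l) auto

lemma word_adj_invol [simp]: "word_adj (word_adj w) = w"
  by (simp add: word_adj_def rev_map o_def)

type_synonym 'g star_poly = "'g star_word \<Rightarrow>\<^sub>0 complex"

lift_definition poly_adj :: "'g star_poly \<Rightarrow> 'g star_poly"
  is "\<lambda>f w. cnj (f (word_adj w))"
proof -
  fix f :: "'g star_word \<Rightarrow> complex"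
  assume "finite {w. f w \<noteq> 0}"
  moreover have "{w. cnj (f (word_adj w)) \<noteq> 0} \<subseteq> word_adj ` {w. f w \<noteq> 0}"
    by (auto intro: image_eqI[of _ _ "word_adj _"])
  ultimately show "finite {w. cnj (f (word_adj w)) \<noteq> 0}"
    using finite_surj by blast
qed

definition poly_scale :: "complex \<Rightarrow> 'g star_poly \<Rightarrow> 'g star_poly" where
  "poly_scale c f = Poly_Mapping.single 0 c * f"

definition poly_gen :: "'g \<Rightarrow> 'g star_poly" where
  "poly_gen g = Poly_Mapping.single (Word [Gen g]) 1"

definition star_polys :: "'g set \<Rightarrow> 'g star_poly set" where
  "star_polys X =
     {f. \<forall>w\<in>Poly_Mapping.keys f. set (letters w) \<subseteq> Gen ` X \<union> Adj ` X}"


section \<open>Universal C*-algebras given by generators and relations\<close>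

record 'a star_algebra = "(complex, 'a) module" +
  invol :: "'a \<Rightarrow> 'a"
  cnorm :: "'a \<Rightarrow> real"

definition cstar_seminorm :: "'g set \<Rightarrow> ('g star_poly \<Rightarrow> real) \<Rightarrow> bool" where
  "cstar_seminorm X p \<longleftrightarrow>
     (\<forall>f\<in>star_polys X. 0 \<le> p f) \<and>
     (\<forall>c. \<forall>f\<in>star_polys X. p (poly_scale c f) = cmod c * p f) \<and>
     (\<forall>f\<in>star_polys X. \<forall>g\<in>star_polys X. p (f + g) \<le> p f + p g) \<and>
     (\<forall>f\<in>star_polys X. \<forall>g\<in>star_polys X. p (f * g) \<le> p f * p g) \<and>
     (\<forall>f\<in>star_polys X. p (poly_adj f * f) = (p f)\<^sup>2)"

text \<open>The C*-seminorms vanishing on \<open>R\<close> are exactly the functions \<open>f \<mapsto> \<parallel>\<pi>(f)\<parallel>\<close> for the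
  *-homomorphisms \<open>\<pi>\<close> of the free *-algebra into C*-algebras that respect the relations
  \<open>r = 0\<close>, \<open>r \<in> R\<close>. Hence \<open>univ_norm\<close> is the norm of the universal C*-algebra, provided the
  relations bound the norms of the generators (otherwise the supremum is over an unbounded set).
  For the isometries and unitaries used below the bound is 1.\<close>

definition univ_norm :: "'g set \<Rightarrow> 'g star_poly set \<Rightarrow> 'g star_poly \<Rightarrow> real" where
  "univ_norm X R f = (SUP p\<in>{p. cstar_seminorm X p \<and> (\<forall>r\<in>R. p r = 0)}. p f)"

text \<open>Hausdorff completion: elements are classes of Cauchy sequences modulo null sequences.\<close>

definition cauchy_seqs :: "'g set \<Rightarrow> 'g star_poly set \<Rightarrow> (nat \<Rightarrow> 'g star_poly) set" where
  "cauchy_seqs X R =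
     {x. (\<forall>n. x n \<in> star_polys X) \<and>
         (\<forall>e>0. \<exists>M. \<forall>m\<ge>M. \<forall>n\<ge>M. univ_norm X R (x m - x n) < e)}"

definition cauchy_class ::
  "'g set \<Rightarrow> 'g star_poly set \<Rightarrow> (nat \<Rightarrow> 'g star_poly) \<Rightarrow> (nat \<Rightarrow> 'g star_poly) set" where
  "cauchy_class X R x = {y \<in> cauchy_seqs X R. (\<lambda>n. univ_norm X R (x n - y n)) \<longlonglongrightarrow> 0}"

definition universal_cstar ::
  "'g set \<Rightarrow> 'g star_poly set \<Rightarrow> (nat \<Rightarrow> 'g star_poly) set star_algebra" where
  "universal_cstar X R =
     \<lparr>carrier = cauchy_class X R ` cauchy_seqs X R,
      monoid.mult = (\<lambda>\<xi> \<eta>. \<Union>x\<in>\<xi>. \<Union>y\<in>\<eta>. cauchy_class X R (\<lambda>n. x n * y n)),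
      one = cauchy_class X R (\<lambda>_. 1),
      zero = cauchy_class X R (\<lambda>_. 0),
      add = (\<lambda>\<xi> \<eta>. \<Union>x\<in>\<xi>. \<Union>y\<in>\<eta>. cauchy_class X R (\<lambda>n. x n + y n)),
      smult = (\<lambda>c \<xi>. \<Union>x\<in>\<xi>. cauchy_class X R (\<lambda>n. poly_scale c (x n))),
      invol = (\<lambda>\<xi>. \<Union>x\<in>\<xi>. cauchy_class X R (\<lambda>n. poly_adj (x n))),
      cnorm = (\<lambda>\<xi>. lim (\<lambda>n. univ_norm X R ((SOME x. x \<in> \<xi>) n)))\<rparr>"

definition universal_gen ::
  "'g set \<Rightarrow> 'g star_poly set \<Rightarrow> 'g \<Rightarrow> (nat \<Rightarrow> 'g star_poly) set" where
  "universal_gen X R g = cauchy_class X R (\<lambda>_. poly_gen g)"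


subsection \<open>Semigroup and group C*-algebras\<close>

definition range_proj :: "'s \<Rightarrow> 's star_poly" where
  "range_proj s = poly_gen s * poly_adj (poly_gen s)"

definition semigroup_relations :: "('s, 'm) monoid_scheme \<Rightarrow> 's star_poly set" where
  "semigroup_relations S =
     {poly_adj (poly_gen s) * poly_gen s - 1 | s. s \<in> carrier S} \<union>
     {poly_gen \<one>\<^bsub>S\<^esub> - 1} \<union>
     {poly_gen s * poly_gen t - poly_gen (s \<otimes>\<^bsub>S\<^esub> t) | s t. s \<in> carrier S \<and> t \<in> carrier S} \<union>
     {range_proj s * range_proj t - range_proj r | s t r.
        s \<in> carrier S \<and> t \<in> carrier S \<and> r \<in> carrier S \<and>
        (s <#\<^bsub>S\<^esub> carrier S) \<inter> (t <#\<^bsub>S\<^esub> carrier S) = r <#\<^bsub>S\<^esub> carrier S} \<union>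
     {range_proj s * range_proj t | s t.
        s \<in> carrier S \<and> t \<in> carrier S \<and>
        (s <#\<^bsub>S\<^esub> carrier S) \<inter> (t <#\<^bsub>S\<^esub> carrier S) = {}}"

definition semigroup_cstar ::
  "('s, 'm) monoid_scheme \<Rightarrow> (nat \<Rightarrow> 's star_poly) set star_algebra" where
  "semigroup_cstar S = universal_cstar (carrier S) (semigroup_relations S)"

definition semigroup_gen ::
  "('s, 'm) monoid_scheme \<Rightarrow> 's \<Rightarrow> (nat \<Rightarrow> 's star_poly) set" where
  "semigroup_gen S s = universal_gen (carrier S) (semigroup_relations S) s"

definition group_relations :: "('s, 'm) monoid_scheme \<Rightarrow> 's star_poly set" where
  "group_relations G =
     {poly_adj (poly_gen g) * poly_gen g - 1 | g. g \<in> carrier G} \<union>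
     {poly_gen g * poly_adj (poly_gen g) - 1 | g. g \<in> carrier G} \<union>
     {poly_gen g * poly_gen h - poly_gen (g \<otimes>\<^bsub>G\<^esub> h) | g h. g \<in> carrier G \<and> h \<in> carrier G}"

definition group_cstar ::
  "('s, 'm) monoid_scheme \<Rightarrow> (nat \<Rightarrow> 's star_poly) set star_algebra" where
  "group_cstar G = universal_cstar (carrier G) (group_relations G)"


section \<open>States, traces and KMS states\<close>

definition states :: "('a, 'm) star_algebra_scheme \<Rightarrow> ('a \<Rightarrow> complex) set" where
  "states A =
     {\<phi> \<in> extensional (carrier A).
        (\<forall>a\<in>carrier A. \<forall>b\<in>carrier A. \<phi> (a \<oplus>\<^bsub>A\<^esub> b) = \<phi> a + \<phi> b) \<and>
        (\<forall>c. \<forall>a\<in>carrier A. \<phi> (c \<odot>\<^bsub>A\<^esub> a) = c * \<phi> a) \<and>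
        (\<forall>a\<in>carrier A. \<phi> (invol A a \<otimes>\<^bsub>A\<^esub> a) \<in> \<real>\<^sub>\<ge>\<^sub>0) \<and>
        \<phi> \<one>\<^bsub>A\<^esub> = 1}"

definition tracial_states :: "('a, 'm) star_algebra_scheme \<Rightarrow> ('a \<Rightarrow> complex) set" where
  "tracial_states A =
     {\<tau> \<in> states A. \<forall>a\<in>carrier A. \<forall>b\<in>carrier A. \<tau> (a \<otimes>\<^bsub>A\<^esub> b) = \<tau> (b \<otimes>\<^bsub>A\<^esub> a)}"

text \<open>The conditions on \<^const>\<open>cnorm\<close> and \<open>extensional\<close> are not restrictions:
  *-automorphisms of C*-algebras are isometric, and \<open>extensional\<close> fixes the values off the carrier.\<close>

definition star_automorphism :: "('a, 'm) star_algebra_scheme \<Rightarrow> ('a \<Rightarrow> 'a) \<Rightarrow> bool" where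
  "star_automorphism A \<alpha> \<longleftrightarrow>
     \<alpha> \<in> extensional (carrier A) \<and> bij_betw \<alpha> (carrier A) (carrier A) \<and>
     (\<forall>a\<in>carrier A. \<forall>b\<in>carrier A. \<alpha> (a \<oplus>\<^bsub>A\<^esub> b) = \<alpha> a \<oplus>\<^bsub>A\<^esub> \<alpha> b) \<and>
     (\<forall>a\<in>carrier A. \<forall>b\<in>carrier A. \<alpha> (a \<otimes>\<^bsub>A\<^esub> b) = \<alpha> a \<otimes>\<^bsub>A\<^esub> \<alpha> b) \<and>
     (\<forall>c. \<forall>a\<in>carrier A. \<alpha> (c \<odot>\<^bsub>A\<^esub> a) = c \<odot>\<^bsub>A\<^esub> \<alpha> a) \<and>
     (\<forall>a\<in>carrier A. \<alpha> (invol A a) = invol A (\<alpha> a)) \<and>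
     (\<forall>a\<in>carrier A. cnorm A (\<alpha> a) = cnorm A a)"

definition scale_dynamics ::
  "('s, 'm) monoid_scheme \<Rightarrow> ('s \<Rightarrow> real) \<Rightarrow> real \<Rightarrow>
     (nat \<Rightarrow> 's star_poly) set \<Rightarrow> (nat \<Rightarrow> 's star_poly) set" where
  "scale_dynamics S N t =
     (THE \<alpha>. star_automorphism (semigroup_cstar S) \<alpha> \<and>
        (\<forall>s\<in>carrier S. \<alpha> (semigroup_gen S s) =
           (complex_of_real (N s) powr (\<i> * complex_of_real t))
             \<odot>\<^bsub>semigroup_cstar S\<^esub> semigroup_gen S s))"

text \<open>\<open>F\<close> is the (unique) entire extension \<open>z \<mapsto> \<sigma>\<^sub>z(a)\<close> of \<open>t \<mapsto> \<sigma>\<^sub>t(a)\<close>; the element \<open>a\<close> is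
  analytic iff there is one.\<close>

definition entire_extension ::
  "('a, 'm) star_algebra_scheme \<Rightarrow> (real \<Rightarrow> 'a \<Rightarrow> 'a) \<Rightarrow> 'a \<Rightarrow> (complex \<Rightarrow> 'a) \<Rightarrow> bool" where
  "entire_extension A \<sigma> a F \<longleftrightarrow>
     (\<forall>z. F z \<in> carrier A) \<and>
     (\<forall>t. F (complex_of_real t) = \<sigma> t a) \<and>
     (\<forall>z. \<exists>d\<in>carrier A.
        ((\<lambda>h. cnorm A ((1 / h) \<odot>\<^bsub>A\<^esub> (F (z + h) \<ominus>\<^bsub>A\<^esub> F z) \<ominus>\<^bsub>A\<^esub> d)) \<longlongrightarrow> 0) (at 0))"

definition dense_subspace :: "('a, 'm) star_algebra_scheme \<Rightarrow> 'a set \<Rightarrow> bool" where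
  "dense_subspace A D \<longleftrightarrow>
     D \<subseteq> carrier A \<and> \<zero>\<^bsub>A\<^esub> \<in> D \<and>
     (\<forall>a\<in>D. \<forall>b\<in>D. a \<oplus>\<^bsub>A\<^esub> b \<in> D) \<and>
     (\<forall>c. \<forall>a\<in>D. c \<odot>\<^bsub>A\<^esub> a \<in> D) \<and>
     (\<forall>a\<in>carrier A. \<forall>e>0. \<exists>b\<in>D. cnorm A (a \<ominus>\<^bsub>A\<^esub> b) < e)"

text \<open>The dense subspace has to be \<open>\<sigma>\<close>-invariant, as usual in the definition of KMS states.
  Without invariance the condition is too weak: for the rotation action \<open>\<sigma>\<^sub>t(f)(z) = f(e\<^sup>i\<^sup>tz)\<close> on
  \<open>C(\<T>)\<close> and \<open>\<beta> \<noteq> 0\<close> the Laurent polynomials \<open>f\<close> with \<open>f(e\<^sup>-\<^sup>\<beta>) = f(1)\<close> are dense, and evaluation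
  at 1 would satisfy the KMS identity on them.\<close>

definition kms_states ::
  "('a, 'm) star_algebra_scheme \<Rightarrow> (real \<Rightarrow> 'a \<Rightarrow> 'a) \<Rightarrow> real \<Rightarrow> ('a \<Rightarrow> complex) set" where
  "kms_states A \<sigma> \<beta> =
     {\<phi> \<in> states A.
        \<exists>D. dense_subspace A D \<and> (\<forall>t. \<forall>a\<in>D. \<sigma> t a \<in> D) \<and>
          (\<forall>a\<in>D. \<exists>F. entire_extension A \<sigma> a F \<and>
             (\<forall>b\<in>D. \<phi> (a \<otimes>\<^bsub>A\<^esub> b) = \<phi> (b \<otimes>\<^bsub>A\<^esub> F (\<i> * complex_of_real \<beta>))))}"

definition weak_star ::
  "('a, 'm) star_algebra_scheme \<Rightarrow> ('a \<Rightarrow> complex) set \<Rightarrow> ('a \<Rightarrow> complex) topology" where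
  "weak_star A K = subtopology (product_topology (\<lambda>_. euclidean) (carrier A)) K"

definition convex_comb ::
  "('a, 'm) star_algebra_scheme \<Rightarrow> real \<Rightarrow> ('a \<Rightarrow> complex) \<Rightarrow> ('a \<Rightarrow> complex) \<Rightarrow> 'a \<Rightarrow> complex" where
  "convex_comb A r \<phi> \<psi> =
     (\<lambda>a\<in>carrier A. complex_of_real (1 - r) * \<phi> a + complex_of_real r * \<psi> a)"

definition affine_homeomorphism ::
  "('a, 'm) star_algebra_scheme \<Rightarrow> ('a \<Rightarrow> complex) set \<Rightarrow>
   ('b, 'n) star_algebra_scheme \<Rightarrow> ('b \<Rightarrow> complex) set \<Rightarrow>
   (('a \<Rightarrow> complex) \<Rightarrow> 'b \<Rightarrow> complex) \<Rightarrow> bool" where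
  "affine_homeomorphism A K B L \<Phi> \<longleftrightarrow>
     homeomorphic_map (weak_star A K) (weak_star B L) \<Phi> \<and>
     (\<forall>\<phi>\<in>K. \<forall>\<psi>\<in>K. \<forall>r\<in>{0..1}.
        \<Phi> (convex_comb A r \<phi> \<psi>) = convex_comb B r (\<Phi> \<phi>) (\<Phi> \<psi>))"

end

theory Submission
  imports Defs "HOL-Complex_Analysis.Complex_Analysis"
begin

text \<open>Let \<open>G\<close> be the maximal group image of the left inverse hull of \<open>ker N\<close>. The traces on the algebras
  of \<open>ker N\<close> and of \<open>G\<close> both amount to characters of \<open>G\<close>, because a trace makes the isometries unitary
  and every word in them reduces to some \<open>v\<^sub>q v\<^sub>p\<^sup>*\<close>.

  A character \<open>\<kappa>\<close> induces a KMS state: choosing representatives, \<open>S\<close> acts by partial bijections of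
  \<open>S/\<sim> \<times> G\<close> commuting with right multiplication on \<open>G\<close>, and the positive functionals obtained from \<open>\<kappa>\<close>
  at the classes \<open>c\<close> are averaged with weights \<open>N(c)\<^sup>-\<^sup>\<beta>/\<zeta>\<close>.

  Conversely, let \<open>\<phi>\<close> be a KMS state. Its compression \<open>\<psi>\<close> by the product of all \<open>1 - v\<^sub>s v\<^sub>s\<^sup>*\<close>, \<open>s \<notin> ker N\<close>,
  is tracial on \<open>ker N\<close>, and \<open>v\<^sub>s v\<^sub>s\<^sup>* = 1\<close> modulo \<open>\<phi>\<close> for \<open>s \<in> ker N\<close>. Listing finitely many classes
  \<open>c\<^sub>1, \<dots>, c\<^sub>n\<close>, including that of \<open>1\<close>, by increasing scale, the projections
  \<open>P\<^sub>i (1 - P\<^sub>i\<^sub>+\<^sub>1) \<dots> (1 - P\<^sub>n)\<close> have sum 1 modulo \<open>\<phi>\<close>. As the list grows, the \<open>i\<close>-th one tends to the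
  translate by \<open>c\<^sub>i\<close> of the corner defining \<open>\<psi>\<close>. Hence \<open>\<phi>\<close> is a sum of translates of \<open>\<psi>\<close>, and is induced
  from the character of \<open>G\<close> given by \<open>\<zeta> \<psi>\<close>.\<close>

section \<open>Linear functionals on star polynomials\<close>

text \<open>No Hilbert space or weak closure is formed. A state of the completion is the same as a
  positive unital functional on star polynomials that kills the ideal of the relations: such a
  functional is dominated by a C*-seminorm obtained from Cauchy-Schwarz, and conversely algebraic
  positivity forces continuity through square roots of 1 - h. The rest happens on words. The
  infinite product cutting out the corner is replaced by limits of phi(Q f) over finite products Q.

  The KMS identity is given only on some dense invariant subspace, perhaps without any word in it,
  and reaches the words by comparing entire functions along two lines. The exponent beta is nonzero,
  as otherwise infinitely many classes would each contribute 1 to the series; hence the value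
  N(s)^(-beta) of phi at the range projection of s determines N(s), and this enters the proof that
  the corner is tracial. The trace spaces are compact and the KMS space is Hausdorff, so one
  continuous bijection is enough.\<close>

abbreviation wpoly :: "'g star_word \<Rightarrow> 'g star_poly" where
  "wpoly w \<equiv> Poly_Mapping.single w 1"

definition lin :: "('w \<Rightarrow> complex) \<Rightarrow> ('w \<Rightarrow>\<^sub>0 complex) \<Rightarrow> complex" where
  "lin \<phi> f = (\<Sum>w\<in>Poly_Mapping.keys f. Poly_Mapping.lookup f w * \<phi> w)"

lemma lin_superset:
  assumes "finite A" "Poly_Mapping.keys f \<subseteq> A"
  shows "lin \<phi> f = (\<Sum>w\<in>A. Poly_Mapping.lookup f w * \<phi> w)"
  unfolding lin_def by (rule sum.mono_neutral_left) (use assms in \<open>auto simp: in_keys_iff\<close>)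

lemma lin_zero [simp]: "lin \<phi> 0 = 0"
  by (simp add: lin_def)

lemma lin_single [simp]: "lin \<phi> (Poly_Mapping.single w c) = c * \<phi> w"
  by (simp add: lin_def)

lemma lin_one [simp]: "lin \<phi> 1 = \<phi> 0"
  by (simp flip: single_one)

lemma lin_add: "lin \<phi> (f + g) = lin \<phi> f + lin \<phi> g"
proof -
  let ?A = "Poly_Mapping.keys f \<union> Poly_Mapping.keys g"
  have "Poly_Mapping.keys (f + g) \<subseteq> ?A" by (rule keys_add)
  then show ?thesis
    by (simp add: lin_superset[of ?A] lookup_add distrib_right sum.distrib)
qed

lemma lin_uminus: "lin \<phi> (- f) = - lin \<phi> f"
  using lin_add[of \<phi> f "- f"] by (simp add: eq_neg_iff_add_eq_0 add.commute)

lemma lin_diff: "lin \<phi> (f - g) = lin \<phi> f - lin \<phi> g"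
  using lin_add[of \<phi> f "- g"] by (simp add: lin_uminus)

lemma lin_sum: "lin \<phi> (\<Sum>i\<in>I. f i) = (\<Sum>i\<in>I. lin \<phi> (f i))"
  by (induction I rule: infinite_finite_induct) (auto simp: lin_add)

lemma star_poly_expand:
  fixes f :: "'w \<Rightarrow>\<^sub>0 'c::comm_monoid_add"
  shows "f = (\<Sum>w\<in>Poly_Mapping.keys f. Poly_Mapping.single w (Poly_Mapping.lookup f w))"
  by (rule poly_mapping_eqI)
     (simp add: lookup_sum lookup_single when_def in_keys_iff if_distrib cong: if_cong)

lemma star_poly_induct [case_names zero single add]:
  fixes f :: "'w \<Rightarrow>\<^sub>0 'c::comm_monoid_add"
  assumes zero: "P 0" and single: "\<And>w c. P (Poly_Mapping.single w c)"
    and add: "\<And>f g. P f \<Longrightarrow> P g \<Longrightarrow> P (f + g)"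
  shows "P f"
proof -
  have "P (\<Sum>w\<in>A. Poly_Mapping.single w (Poly_Mapping.lookup f w))" if "finite A" for A
    using that by (induction A rule: finite_induct) (auto intro: zero add single)
  from this[of "Poly_Mapping.keys f"] show ?thesis
    by (simp flip: star_poly_expand)
qed

lemma single_0_commute:
  fixes f :: "'w::monoid_add \<Rightarrow>\<^sub>0 complex"
  shows "f * Poly_Mapping.single 0 c = Poly_Mapping.single 0 c * f"
  by (induction f rule: star_poly_induct) (simp_all add: mult_single algebra_simps)

lemma lin_scale [simp]: "lin \<phi> (poly_scale c f) = c * lin \<phi> f"
  unfolding poly_scale_def
  by (induction f rule: star_poly_induct) (simp_all add: mult_single lin_add algebra_simps)

lemma poly_scale_mult_left: "poly_scale c f * g = poly_scale c (f * g)"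
  by (simp add: poly_scale_def mult.assoc)

lemma poly_scale_mult_right: "f * poly_scale c g = poly_scale c (f * g)"
  unfolding poly_scale_def by (metis mult.assoc single_0_commute)

lemma poly_scale_add: "poly_scale c (f + g) = poly_scale c f + poly_scale c g"
  by (simp add: poly_scale_def algebra_simps)

lemma poly_scale_diff: "poly_scale c (f - g) = poly_scale c f - poly_scale c g"
  by (simp add: poly_scale_def algebra_simps)

lemma poly_scale_add_left: "poly_scale (c + d) f = poly_scale c f + poly_scale d f"
  by (simp add: poly_scale_def algebra_simps single_add)

lemma poly_scale_scale: "poly_scale c (poly_scale d f) = poly_scale (c * d) f"
  by (simp add: poly_scale_def mult_single flip: mult.assoc)

lemma poly_scale_1 [simp]: "poly_scale 1 f = f"
  by (simp add: poly_scale_def)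

lemma poly_scale_0 [simp]: "poly_scale 0 f = 0"
  by (simp add: poly_scale_def)

lemma poly_scale_neg1: "poly_scale (-1) f = - f"
  by (simp add: poly_scale_def single_uminus)

lemma poly_scale_single [simp]:
  "poly_scale c (Poly_Mapping.single w d) = Poly_Mapping.single w (c * d)"
  by (simp add: poly_scale_def mult_single)

lemma word_adj_0 [simp]: "word_adj 0 = 0"
  by (simp add: word_adj_def zero_star_word_def)

lemma word_adj_plus: "word_adj (v + w) = word_adj w + word_adj v"
  by (simp add: word_adj_def plus_star_word_def)

lemma lookup_poly_adj: "Poly_Mapping.lookup (poly_adj f) w = cnj (Poly_Mapping.lookup f (word_adj w))"
  by transfer simp

lemma poly_adj_add: "poly_adj (f + g) = poly_adj f + poly_adj g"
  by (rule poly_mapping_eqI) (simp add: lookup_poly_adj lookup_add)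

lemma poly_adj_zero [simp]: "poly_adj 0 = 0"
  by (rule poly_mapping_eqI) (simp add: lookup_poly_adj)

lemma poly_adj_uminus: "poly_adj (- f) = - poly_adj f"
  using poly_adj_add[of f "- f"] by (simp add: eq_neg_iff_add_eq_0 add.commute)

lemma poly_adj_diff: "poly_adj (f - g) = poly_adj f - poly_adj g"
  using poly_adj_add[of f "- g"] by (simp add: poly_adj_uminus)

lemma poly_adj_single [simp]:
  "poly_adj (Poly_Mapping.single w c) = Poly_Mapping.single (word_adj w) (cnj c)"
  by (rule poly_mapping_eqI) (auto simp: lookup_poly_adj lookup_single when_def)

lemma poly_adj_one [simp]: "poly_adj 1 = 1"
  by (simp flip: single_one)

lemma poly_adj_sum: "poly_adj (\<Sum>i\<in>I. f i) = (\<Sum>i\<in>I. poly_adj (f i))"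
  by (induction I rule: infinite_finite_induct) (auto simp: poly_adj_add)

lemma poly_adj_adj [simp]: "poly_adj (poly_adj f) = f"
  by (rule poly_mapping_eqI) (simp add: lookup_poly_adj)

lemma poly_adj_mult: "poly_adj (f * g) = poly_adj g * poly_adj f"
proof (induction f rule: star_poly_induct)
  case (single w c)
  show ?case
    by (induction g rule: star_poly_induct)
       (simp_all add: mult_single word_adj_plus poly_adj_add algebra_simps)
qed (simp_all add: poly_adj_add algebra_simps)

lemma poly_adj_scale: "poly_adj (poly_scale c f) = poly_scale (cnj c) (poly_adj f)"
  by (simp add: poly_scale_def poly_adj_mult single_0_commute)

section \<open>Polynomials over a set of generators\<close>

definition words_over :: "'g set \<Rightarrow> 'g star_word set" where
  "words_over X = {w. set (letters w) \<subseteq> Gen ` X \<union> Adj ` X}"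

lemma words_over_0 [simp]: "0 \<in> words_over X"
  by (simp add: words_over_def zero_star_word_def)

lemma words_over_plus [simp]: "v + w \<in> words_over X \<longleftrightarrow> v \<in> words_over X \<and> w \<in> words_over X"
  by (auto simp: words_over_def plus_star_word_def)

lemma words_over_adj [simp]: "word_adj w \<in> words_over X \<longleftrightarrow> w \<in> words_over X"
proof -
  have "v \<in> words_over X \<Longrightarrow> word_adj v \<in> words_over X" for v :: "'a star_word"
    unfolding words_over_def word_adj_def mem_Collect_eq star_word.sel set_rev set_map
    by (intro image_subsetI) (erule (1) subsetD [THEN UnE]; force)
  from this[of w] this[of "word_adj w"] show ?thesis by auto
qed

lemma words_over_Gen [simp]: "Word [Gen x] \<in> words_over X \<longleftrightarrow> x \<in> X"
  by (auto simp: words_over_def)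

lemma words_over_Adj [simp]: "Word [Adj x] \<in> words_over X \<longleftrightarrow> x \<in> X"
  by (auto simp: words_over_def)

lemma star_polys_iff: "f \<in> star_polys X \<longleftrightarrow> Poly_Mapping.keys f \<subseteq> words_over X"
  by (auto simp: star_polys_def words_over_def)

lemma star_polys_zero [simp]: "0 \<in> star_polys X"
  by (simp add: star_polys_iff)

lemma star_polys_one [simp]: "1 \<in> star_polys X"
  by (simp add: star_polys_iff)

lemma star_polys_single: "w \<in> words_over X \<Longrightarrow> Poly_Mapping.single w c \<in> star_polys X"
  by (simp add: star_polys_iff)

lemma star_polys_add: "f \<in> star_polys X \<Longrightarrow> g \<in> star_polys X \<Longrightarrow> f + g \<in> star_polys X"
  unfolding star_polys_iff using keys_add[of f g] by blast

lemma star_polys_uminus: "f \<in> star_polys X \<Longrightarrow> - f \<in> star_polys X"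
  unfolding star_polys_iff by (auto simp: in_keys_iff)

lemma star_polys_diff: "f \<in> star_polys X \<Longrightarrow> g \<in> star_polys X \<Longrightarrow> f - g \<in> star_polys X"
  using star_polys_add[of f X "- g"] star_polys_uminus[of g X] by simp

lemma star_polys_mult: "f \<in> star_polys X \<Longrightarrow> g \<in> star_polys X \<Longrightarrow> f * g \<in> star_polys X"
  unfolding star_polys_iff using keys_mult[of f g] by fastforce

lemma star_polys_scale: "f \<in> star_polys X \<Longrightarrow> poly_scale c f \<in> star_polys X"
  unfolding poly_scale_def by (intro star_polys_mult star_polys_single) auto

lemma star_polys_adj: "f \<in> star_polys X \<Longrightarrow> poly_adj f \<in> star_polys X"
  unfolding star_polys_iff by (auto simp: in_keys_iff lookup_poly_adj subset_iff)

lemma star_polys_sum: "(\<And>i. i \<in> I \<Longrightarrow> f i \<in> star_polys X) \<Longrightarrow> (\<Sum>i\<in>I. f i) \<in> star_polys X"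
  by (induction I rule: infinite_finite_induct) (auto intro: star_polys_add)

lemmas star_polys_intros =
  star_polys_zero star_polys_one star_polys_add star_polys_uminus star_polys_diff star_polys_mult
  star_polys_scale star_polys_adj

lemma star_polys_induct [consumes 1, case_names zero single add]:
  assumes "f \<in> star_polys X" "P 0"
    and single: "\<And>w c. w \<in> words_over X \<Longrightarrow> P (Poly_Mapping.single w c)"
    and add: "\<And>f g. f \<in> star_polys X \<Longrightarrow> g \<in> star_polys X \<Longrightarrow> P f \<Longrightarrow> P g \<Longrightarrow> P (f + g)"
  shows "P f"
proof -
  have "P (\<Sum>w\<in>A. Poly_Mapping.single w (Poly_Mapping.lookup f w)) \<and>
      (\<Sum>w\<in>A. Poly_Mapping.single w (Poly_Mapping.lookup f w)) \<in> star_polys X"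
    if "finite A" "A \<subseteq> Poly_Mapping.keys f" for A
    using that
  proof (induction A rule: finite_induct)
    case (insert w A)
    then have "w \<in> words_over X" using assms(1) by (auto simp: star_polys_iff)
    with insert show ?case by (auto intro!: add single star_polys_add star_polys_single)
  qed (simp add: assms)
  from this[of "Poly_Mapping.keys f"] show ?thesis
    using star_poly_expand[of f] by simp
qed

text \<open>Sending the letters outside \<open>X\<close> to 0 is a *-homomorphism, so a functional on
  \<^term>\<open>star_polys X\<close> may be extended by zero to all star polynomials without losing
  positivity or any relation. This removes membership conditions from most computations.\<close>

definition restrict_poly :: "'g set \<Rightarrow> 'g star_poly \<Rightarrow> 'g star_poly" where
  "restrict_poly X f =
     (\<Sum>w\<in>Poly_Mapping.keys f \<inter> words_over X. Poly_Mapping.single w (Poly_Mapping.lookup f w))"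

lemma lookup_restrict_poly:
  "Poly_Mapping.lookup (restrict_poly X f) w = (if w \<in> words_over X then Poly_Mapping.lookup f w else 0)"
  by (auto simp: restrict_poly_def lookup_sum lookup_single when_def in_keys_iff if_distrib cong: if_cong)

lemma restrict_poly_add: "restrict_poly X (f + g) = restrict_poly X f + restrict_poly X g"
  by (rule poly_mapping_eqI) (simp add: lookup_restrict_poly lookup_add)

lemma restrict_poly_single:
  "restrict_poly X (Poly_Mapping.single w c) = (if w \<in> words_over X then Poly_Mapping.single w c else 0)"
  by (rule poly_mapping_eqI) (auto simp: lookup_restrict_poly lookup_single when_def)

lemma restrict_poly_zero [simp]: "restrict_poly X 0 = 0"
  by (simp add: restrict_poly_def)

lemma restrict_poly_mem: "restrict_poly X f \<in> star_polys X"
  unfolding restrict_poly_def by (intro star_polys_sum star_polys_single) auto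

lemma restrict_poly_id: "f \<in> star_polys X \<Longrightarrow> restrict_poly X f = f"
  by (rule poly_mapping_eqI) (auto simp: lookup_restrict_poly star_polys_iff in_keys_iff)

lemma restrict_poly_adj: "restrict_poly X (poly_adj f) = poly_adj (restrict_poly X f)"
  by (rule poly_mapping_eqI) (auto simp: lookup_restrict_poly lookup_poly_adj)

lemma restrict_poly_mult: "restrict_poly X (f * g) = restrict_poly X f * restrict_poly X g"
proof (induction f rule: star_poly_induct)
  case (single w c)
  show ?case
    by (induction g rule: star_poly_induct)
       (auto simp: mult_single restrict_poly_single restrict_poly_add algebra_simps)
qed (simp_all add: restrict_poly_add algebra_simps)

lemma lin_restrict_poly:
  assumes "\<And>w. w \<notin> words_over X \<Longrightarrow> \<phi> w = 0"
  shows "lin \<phi> (restrict_poly X f) = lin \<phi> f"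
  by (induction f rule: star_poly_induct)
     (auto simp: restrict_poly_single restrict_poly_add lin_add assms)

section \<open>Positive functionals\<close>

locale pos_functional =
  fixes \<phi> :: "'g star_word \<Rightarrow> complex"
  assumes pos: "lin \<phi> (poly_adj f * f) \<in> \<real>\<^sub>\<ge>\<^sub>0"
begin

text \<open>The seminorm of \<open>f\<close> as a vector of the GNS space of
  \<open>\<phi>\<close>.\<close>

definition nrm :: "'g star_poly \<Rightarrow> real" where
  "nrm f = sqrt (Re (lin \<phi> (poly_adj f * f)))"

lemma Re_pos: "0 \<le> Re (lin \<phi> (poly_adj f * f))"
  using pos[of f] by (simp add: complex_nonneg_Reals_iff)

lemma Im_pos: "Im (lin \<phi> (poly_adj f * f)) = 0"
  using pos[of f] by (simp add: complex_nonneg_Reals_iff)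

lemma nrm_nonneg [simp]: "0 \<le> nrm f"
  by (simp add: nrm_def Re_pos)

lemma lin_eq_nrm: "lin \<phi> (poly_adj f * f) = complex_of_real ((nrm f)\<^sup>2)"
  by (simp add: nrm_def Re_pos complex_eq_iff Im_pos)

text \<open>Polarization: positivity makes the mixed terms in the expansion for f + c g real, and c
  = 1 and c = \<i> give the two parts of the identity.\<close>

lemma inner_hermitian: "lin \<phi> (poly_adj g * f) = cnj (lin \<phi> (poly_adj f * g))"
proof -
  have *: "lin \<phi> (poly_adj (f + poly_scale c g) * (f + poly_scale c g)) =
      lin \<phi> (poly_adj f * f) + c * lin \<phi> (poly_adj f * g) + cnj c * lin \<phi> (poly_adj g * f)
      + c * cnj c * lin \<phi> (poly_adj g * g)" for c
    by (simp add: poly_adj_add poly_adj_scale poly_scale_mult_left poly_scale_mult_right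
        distrib_left distrib_right lin_add poly_scale_add)
  have "Im (c * lin \<phi> (poly_adj f * g) + cnj c * lin \<phi> (poly_adj g * f)) = 0" for c
    using arg_cong[OF *[of c], of Im] by (simp add: Im_pos Im_pos[of f] Im_pos[of g])
  from this[of 1] this[of \<i>] show ?thesis by (simp add: complex_eq_iff)
qed

lemma Cauchy_Schwarz: "cmod (lin \<phi> (poly_adj f * g)) \<le> nrm f * nrm g"
proof -
  define a where "a = lin \<phi> (poly_adj f * g)"
  have exp: "(nrm (poly_scale c f + g))\<^sup>2 = (cmod c)\<^sup>2 * (nrm f)\<^sup>2 + 2 * Re (cnj c * a) + (nrm g)\<^sup>2" for c
  proof -
    have "lin \<phi> (poly_adj (poly_scale c f + g) * (poly_scale c f + g)) =
      cnj c * c * lin \<phi> (poly_adj f * f) + cnj c * a + c * lin \<phi> (poly_adj g * f)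
      + lin \<phi> (poly_adj g * g)"
      by (simp add: a_def poly_adj_add poly_adj_scale poly_scale_mult_left poly_scale_mult_right
        distrib_left distrib_right lin_add poly_scale_add)
    then show ?thesis
      unfolding inner_hermitian[of g f] lin_eq_nrm a_def[symmetric]
      by (simp add: complex_eq_iff cmod_power2) (simp add: power2_eq_square algebra_simps)
  qed
  show ?thesis
  proof (cases "nrm f = 0")
    case True
    have "a = 0"
    proof (rule ccontr)
      assume "a \<noteq> 0"
      \<comment> \<open>A null vector \<open>f\<close> with \<open>a \<noteq> 0\<close> would make a
        square negative: this \<open>t\<close> turns the quadratic into
        \<open>- (nrm g)\<^sup>2 - 2\<close>.\<close>
      define t where "t = ((nrm g)\<^sup>2 + 1) / (cmod a)\<^sup>2"
      have "0 \<le> (nrm (poly_scale (of_real (-t) * a) f + g))\<^sup>2" by simp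
      also have "\<dots> = 2 * Re (of_real (-t) * (cnj a * a)) + (nrm g)\<^sup>2"
        unfolding exp by (simp add: True algebra_simps)
      also have "cnj a * a = of_real ((cmod a)\<^sup>2)"
        by (metis complex_norm_square mult.commute)
      also have "Re (of_real (-t) * of_real ((cmod a)\<^sup>2)) = - ((nrm g)\<^sup>2 + 1)"
        using \<open>a \<noteq> 0\<close> by (simp add: t_def)
      finally show False using zero_le_power2[of "nrm g"] by (smt (verit))
    qed
    then show ?thesis by (simp add: a_def True)
  next
    case False
    \<comment> \<open>The vertex of the quadratic: the coefficient c = - s a minimizes the
      right-hand side of \<open>exp\<close>.\<close>
    define s where "s = 1 / (nrm f)\<^sup>2"
    have aa: "cnj a * a = of_real ((cmod a)\<^sup>2)"
      by (metis complex_norm_square mult.commute)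
    have "0 \<le> (nrm (poly_scale (of_real (-s) * a) f + g))\<^sup>2" by simp
    also have "\<dots> = (s * cmod a)\<^sup>2 * (nrm f)\<^sup>2 + 2 * Re (of_real (-s) * (cnj a * a)) + (nrm g)\<^sup>2"
      unfolding exp by (simp add: norm_mult algebra_simps power_mult_distrib)
    also have "\<dots> = s * (s * (nrm f)\<^sup>2) * (cmod a)\<^sup>2 - 2 * s * (cmod a)\<^sup>2 + (nrm g)\<^sup>2"
      unfolding aa by (simp add: power2_eq_square algebra_simps)
    also have "s * (nrm f)\<^sup>2 = 1" using False by (simp add: s_def)
    finally have "s * (cmod a)\<^sup>2 \<le> (nrm g)\<^sup>2" by simp
    then have "(cmod a)\<^sup>2 \<le> (nrm f * nrm g)\<^sup>2"
      using False by (simp add: s_def field_simps power_mult_distrib)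
    then show ?thesis unfolding a_def[symmetric]
      by (rule power2_le_imp_le) simp
  qed
qed

lemma lin_le_nrm: "cmod (lin \<phi> (f * g)) \<le> nrm (poly_adj f) * nrm g"
  using Cauchy_Schwarz[of "poly_adj f" g] by simp

lemma lin_adj: "lin \<phi> (poly_adj f) = cnj (lin \<phi> f)"
  using inner_hermitian[of f 1] by simp

lemma nrm_triangle: "nrm (f + g) \<le> nrm f + nrm g"
proof (rule power2_le_imp_le)
  have "lin \<phi> (poly_adj (f + g) * (f + g)) =
      lin \<phi> (poly_adj f * f) + lin \<phi> (poly_adj f * g) + cnj (lin \<phi> (poly_adj f * g)) + lin \<phi> (poly_adj g * g)"
    using inner_hermitian[of g f] by (simp add: poly_adj_add distrib_left distrib_right lin_add)
  from arg_cong[OF this, of Re]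
  have "(nrm (f + g))\<^sup>2 = (nrm f)\<^sup>2 + 2 * Re (lin \<phi> (poly_adj f * g)) + (nrm g)\<^sup>2"
    by (simp add: lin_eq_nrm)
  also have "Re (lin \<phi> (poly_adj f * g)) \<le> nrm f * nrm g"
    using Cauchy_Schwarz[of f g] complex_Re_le_cmod order_trans by blast
  finally show "(nrm (f + g))\<^sup>2 \<le> (nrm f + nrm g)\<^sup>2"
    by (simp add: power2_sum)
qed simp

lemma nrm_scale: "nrm (poly_scale c f) = cmod c * nrm f"
proof -
  have "lin \<phi> (poly_adj (poly_scale c f) * poly_scale c f) = of_real ((cmod c * nrm f)\<^sup>2)"
    by (simp only: poly_adj_scale poly_scale_mult_left poly_scale_mult_right lin_scale lin_eq_nrm)
       (simp add: complex_norm_square[symmetric] power_mult_distrib mult.assoc[symmetric] mult.commute)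
  then have "nrm (poly_scale c f) = \<bar>cmod c * nrm f\<bar>"
    unfolding nrm_def[of "poly_scale c f"] by simp
  then show ?thesis by (simp add: abs_mult)
qed

lemma nrm_zero [simp]: "nrm 0 = 0"
  by (simp add: nrm_def)

end

text \<open>A state of \<open>universal_cstar X R\<close> as seen on words: \<open>rel\<close> says
  that \<open>\<phi>\<close> kills the two-sided ideal generated by the relations. Vanishing off the
  words over \<open>X\<close> lets \<open>f\<close>, \<open>g\<close>, \<open>h\<close> range over
  all star polynomials.\<close>

locale alg_state = 
  fixes X :: "'g set" and R :: "'g star_poly set" and \<phi> :: "'g star_word \<Rightarrow> complex"
  assumes outside: "w \<notin> words_over X \<Longrightarrow> \<phi> w = 0"
    and unit: "\<phi> 0 = 1"
    and pos_lin: "lin \<phi> (poly_adj f * f) \<in> \<real>\<^sub>\<ge>\<^sub>0"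
    and rel: "r \<in> R \<Longrightarrow> lin \<phi> (g * r * h) = 0"

text \<open>Only presentations by isometries are considered; this makes the supremum in
  \<^const>\<open>univ_norm\<close> finite.\<close>

locale isometric_presentation =
  fixes X :: "'g set" and R :: "'g star_poly set"
  assumes R_mem: "R \<subseteq> star_polys X"
    and isom: "x \<in> X \<Longrightarrow> poly_adj (poly_gen x) * poly_gen x - 1 \<in> R"

sublocale alg_state \<subseteq> pos_functional \<phi>
  by standard (rule pos_lin)

lemma poly_gen_mem: "x \<in> X \<Longrightarrow> poly_gen x \<in> star_polys X"
  unfolding poly_gen_def by (rule star_polys_single) simp

lemma star_word_Cons: "Word (l # ls) = Word [l] + Word ls"
  by (simp add: plus_star_word_def)

lemma star_word_induct [case_names zero cons]:
  assumes "P 0" "\<And>l w. P w \<Longrightarrow> P (Word [l] + w)"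
  shows "P w"
proof -
  have "P (Word ls)" for ls
  proof (induction ls)
    case Nil then show ?case using assms(1) by (simp add: zero_star_word_def)
  next
    case (Cons l ls) then show ?case using assms(2)[of "Word ls" l] by (simp add: star_word_Cons[of l ls])
  qed
  then show ?thesis by (cases w) auto
qed

lemma wpoly_plus: "wpoly (v + w) = wpoly v * wpoly w"
  by (simp add: mult_single)

lemma adj_poly_gen: "poly_adj (poly_gen x) = wpoly (Word [Adj x])"
  by (simp add: poly_gen_def word_adj_def)

locale bounded_alg_state = alg_state + isometric_presentation
begin

lemma outside_mult: "w \<notin> words_over X \<Longrightarrow> lin \<phi> (f * wpoly w * g) = 0"
proof (induction f rule: star_poly_induct)
  case (single v c)
  then show ?case
    by (induction g rule: star_poly_induct)
       (auto simp: mult_single lin_add distrib_left outside)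
qed (simp_all add: lin_add algebra_simps)

text \<open>In the GNS space a generator is isometric, and its adjoint is contractive by Pythagoras
  for the projection 1 - v v*. Letters outside \<open>X\<close> act as zero.\<close>

lemma nrm_letter: "nrm (wpoly (Word [l]) * g) \<le> nrm g"
proof (cases "Word [l] \<in> words_over X")
  case False
  have "nrm (wpoly (Word [l]) * g) = 0"
    using outside_mult[OF False, of "poly_adj (wpoly (Word [l]) * g)" g] False
    by (simp add: nrm_def mult.assoc)
  then show ?thesis by simp
next
  case True
  show ?thesis
  proof (cases l)
    case (Gen x)
    with True have x: "x \<in> X" by simp
    define v where "v = poly_gen x"
    have "lin \<phi> (poly_adj (v * g) * (v * g)) - lin \<phi> (poly_adj g * g)
        = lin \<phi> (poly_adj g * (poly_adj v * v - 1) * g)"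
      by (simp add: poly_adj_mult algebra_simps flip: lin_diff)
    also have "\<dots> = 0" unfolding v_def by (intro rel isom x)
    finally have "nrm (v * g) = nrm g" by (simp add: nrm_def)
    then show ?thesis by (simp add: v_def Gen poly_gen_def)
  next
    case (Adj x)
    with True have x: "x \<in> X" by simp
    define v where "v = poly_gen x"
    define h where "h = (1 - v * poly_adj v) * g"
    have "poly_adj h * h = poly_adj g * g - poly_adj (poly_adj v * g) * (poly_adj v * g)
        + (poly_adj g * v) * (poly_adj v * v - 1) * (poly_adj v * g)"
      by (simp add: h_def poly_adj_mult poly_adj_diff algebra_simps)
    then have "lin \<phi> (poly_adj h * h) = lin \<phi> (poly_adj g * g)
        - lin \<phi> (poly_adj (poly_adj v * g) * (poly_adj v * g))"
      using rel[OF isom[OF x], of "poly_adj g * v" "poly_adj v * g"]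
      by (simp add: lin_add lin_diff v_def)
    from arg_cong[OF this, of Re] have "(nrm h)\<^sup>2 = (nrm g)\<^sup>2 - (nrm (poly_adj v * g))\<^sup>2"
      by (simp add: lin_eq_nrm)
    then have "(nrm (poly_adj v * g))\<^sup>2 \<le> (nrm g)\<^sup>2" using zero_le_power2[of "nrm h"] by linarith
    then have "nrm (poly_adj v * g) \<le> nrm g" by (rule power2_le_imp_le) simp
    then show ?thesis by (simp add: v_def Adj adj_poly_gen)
  qed
qed

lemma nrm_word: "nrm (wpoly w * g) \<le> nrm g"
proof (induction w rule: star_word_induct)
  case (cons l w)
  have "nrm (wpoly (Word [l] + w) * g) \<le> nrm (wpoly w * g)"
    using nrm_letter[of l "wpoly w * g"] by (simp only: wpoly_plus mult.assoc)
  with cons show ?case by linarith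
qed simp

lemma nrm_one: "nrm 1 = 1"
  by (simp add: nrm_def unit)

lemma nrm_mult_bound: "\<exists>K\<ge>0. \<forall>g. nrm (f * g) \<le> K * nrm g"
proof (induction f rule: star_poly_induct)
  case (single w c)
  have "nrm (Poly_Mapping.single w c * g) \<le> cmod c * nrm g" for g
  proof -
    have "Poly_Mapping.single w c * g = poly_scale c (wpoly w * g)"
      by (metis mult.right_neutral poly_scale_mult_left poly_scale_single)
    then show ?thesis by (simp add: nrm_scale nrm_word mult_left_mono)
  qed
  then show ?case using norm_ge_zero by blast
next
  case (add f g)
  then obtain K L where K: "K \<ge> 0" "\<And>h. nrm (f * h) \<le> K * nrm h" "L \<ge> 0" "\<And>h. nrm (g * h) \<le> L * nrm h"
    by blast
  have "nrm ((f + g) * h) \<le> (K + L) * nrm h" for h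
  proof -
    have "nrm ((f + g) * h) \<le> nrm (f * h) + nrm (g * h)"
      using nrm_triangle[of "f * h" "g * h"] by (simp add: distrib_right)
    also have "\<dots> \<le> K * nrm h + L * nrm h" using K by (intro add_mono) auto
    finally show ?thesis by (simp add: distrib_right)
  qed
  then show ?case using K by (meson add_nonneg_nonneg)
qed auto

text \<open>The norm of left multiplication by \<open>f\<close> on the GNS space, taken over the
  unit ball of the seminorm so that neither a quotient nor a completion is formed.\<close>

definition opnorm :: "'a star_poly \<Rightarrow> real" where
  "opnorm f = (SUP g\<in>{g. nrm g \<le> 1}. nrm (f * g))"

lemma opnorm_bdd: "bdd_above ((\<lambda>g. nrm (f * g)) ` {g. nrm g \<le> 1})"
proof -
  obtain K where "K \<ge> 0" "\<And>g. nrm (f * g) \<le> K * nrm g" using nrm_mult_bound by blast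
  then show ?thesis by (intro bdd_aboveI2[of _ _ K]) (smt (verit) mem_Collect_eq mult_left_le)
qed

lemma opnorm_upper: "nrm g \<le> 1 \<Longrightarrow> nrm (f * g) \<le> opnorm f"
  unfolding opnorm_def by (rule cSUP_upper[OF _ opnorm_bdd]) simp

lemma opnorm_least: "(\<And>g. nrm g \<le> 1 \<Longrightarrow> nrm (f * g) \<le> K) \<Longrightarrow> opnorm f \<le> K"
  unfolding opnorm_def by (rule cSUP_least) (auto intro: exI[of _ 0])

lemma opnorm_nonneg [simp]: "0 \<le> opnorm f"
  using opnorm_upper[of 0 f] by simp

lemma opnorm_bound: "nrm (f * g) \<le> opnorm f * nrm g"
proof (cases "nrm g = 0")
  case True
  \<comment> \<open>A null vector cannot be normalized, but bounded multiplication sends it to a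
    null vector.\<close>
  obtain K where "\<And>g. nrm (f * g) \<le> K * nrm g" using nrm_mult_bound by blast
  from this[of g] True show ?thesis by simp
next
  case False
  define h where "h = poly_scale (of_real (1 / nrm g)) g"
  have "nrm h = 1" using False by (simp add: h_def nrm_scale norm_divide)
  then have "nrm (f * h) \<le> opnorm f" by (intro opnorm_upper) simp
  moreover have "nrm (f * h) = nrm (f * g) / nrm g"
    unfolding h_def poly_scale_mult_right nrm_scale by (simp add: norm_divide)
  ultimately show ?thesis using False by (simp add: field_simps less_le)
qed

lemma opnorm_mult: "opnorm (f * g) \<le> opnorm f * opnorm g"
proof (rule opnorm_least)
  fix h assume h: "nrm h \<le> 1"
  have "nrm (f * g * h) \<le> opnorm f * nrm (g * h)" by (simp add: mult.assoc opnorm_bound)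
  also have "\<dots> \<le> opnorm f * opnorm g" by (intro mult_left_mono opnorm_upper h) simp
  finally show "nrm (f * g * h) \<le> opnorm f * opnorm g" .
qed

text \<open>The substantial half of the C*-identity: the squared norm of f g is the inner product of
  g with f* f g, to which Cauchy-Schwarz applies.\<close>

lemma opnorm_square_le: "(opnorm f)\<^sup>2 \<le> opnorm (poly_adj f * f)"
proof -
  have "opnorm f \<le> sqrt (opnorm (poly_adj f * f))"
  proof (rule opnorm_least)
    fix g assume g: "nrm g \<le> 1"
    have "lin \<phi> (poly_adj (f * g) * (f * g)) = lin \<phi> (poly_adj g * (poly_adj f * f * g))"
      by (simp add: poly_adj_mult mult.assoc)
    then have "(nrm (f * g))\<^sup>2 = cmod (lin \<phi> (poly_adj g * (poly_adj f * f * g)))"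
      by (metis lin_eq_nrm norm_of_real abs_of_nonneg zero_le_power2)
    also have "\<dots> \<le> nrm g * nrm (poly_adj f * f * g)" by (rule Cauchy_Schwarz)
    also have "\<dots> \<le> 1 * opnorm (poly_adj f * f)" by (intro mult_mono g opnorm_upper) auto
    finally show "nrm (f * g) \<le> sqrt (opnorm (poly_adj f * f))" by (simp add: real_le_rsqrt)
  qed
  then show ?thesis by (metis opnorm_nonneg real_sqrt_ge_zero power_mono real_sqrt_pow2)
qed

lemma opnorm_adj_le: "opnorm f \<le> opnorm (poly_adj f)"
proof (cases "opnorm f = 0")
  case False
  have "opnorm f * opnorm f \<le> opnorm (poly_adj f) * opnorm f"
    using opnorm_square_le[of f] opnorm_mult[of "poly_adj f" f] by (simp add: power2_eq_square)
  then show ?thesis using False opnorm_nonneg[of f] by (simp add: less_le)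
qed simp

lemma opnorm_adj: "opnorm (poly_adj f) = opnorm f"
  using opnorm_adj_le[of f] opnorm_adj_le[of "poly_adj f"] by simp

lemma opnorm_scale_le: "opnorm (poly_scale c f) \<le> cmod c * opnorm f"
  by (rule opnorm_least) (simp add: poly_scale_mult_left nrm_scale mult_left_mono opnorm_upper)

lemma opnorm_scale: "opnorm (poly_scale c f) = cmod c * opnorm f"
proof (cases "c = 0")
  case True
  then show ?thesis using opnorm_scale_le[of c f] opnorm_nonneg[of "poly_scale c f"] by (intro antisym) auto
next
  case False
  have "opnorm f = opnorm (poly_scale (inverse c) (poly_scale c f))"
    using False by (simp add: poly_scale_scale)
  also have "\<dots> \<le> cmod (inverse c) * opnorm (poly_scale c f)" by (rule opnorm_scale_le)
  finally have *: "opnorm f \<le> cmod (inverse c) * opnorm (poly_scale c f)" .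
  have "cmod c * opnorm f \<le> cmod c * (cmod (inverse c) * opnorm (poly_scale c f))"
    by (rule mult_left_mono[OF *]) simp
  also have "\<dots> = opnorm (poly_scale c f)"
    using False by (simp add: norm_inverse flip: mult.assoc)
  finally have "cmod c * opnorm f \<le> opnorm (poly_scale c f)" .
  then show ?thesis using opnorm_scale_le[of c f] by simp
qed

lemma opnorm_seminorm: "cstar_seminorm X opnorm"
  unfolding cstar_seminorm_def
proof (intro conjI ballI allI)
  fix f g :: "'a star_poly"
  show "opnorm (f + g) \<le> opnorm f + opnorm g"
  proof (rule opnorm_least)
    fix h assume "nrm h \<le> 1"
    then have "nrm (f * h) + nrm (g * h) \<le> opnorm f + opnorm g" by (intro add_mono opnorm_upper)
    then show "nrm ((f + g) * h) \<le> opnorm f + opnorm g"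
      using nrm_triangle[of "f * h" "g * h"] by (simp add: distrib_right)
  qed
  show "opnorm (poly_adj f * f) = (opnorm f)\<^sup>2"
    using opnorm_square_le[of f] opnorm_mult[of "poly_adj f" f]
    by (simp add: opnorm_adj power2_eq_square)
qed (simp_all add: opnorm_mult opnorm_scale)

lemma opnorm_rel: "r \<in> R \<Longrightarrow> opnorm r = 0"
proof -
  assume r: "r \<in> R"
  have "nrm (r * g) = 0" for g
    using rel[OF r, of "poly_adj (r * g)" g] by (simp add: nrm_def mult.assoc)
  then have "opnorm r \<le> 0" by (intro opnorm_least) simp
  then show ?thesis by (simp add: antisym)
qed

text \<open>\<open>\<phi>\<close> is the vector functional of 1, which has norm 1. As
  \<open>opnorm\<close> is one of the seminorms under the supremum in \<open>univ_norm\<close>, this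
  is what bounds \<open>\<phi>\<close> on the universal algebra.\<close>

lemma lin_le_opnorm: "cmod (lin \<phi> f) \<le> opnorm f"
  using Cauchy_Schwarz[of 1 f] opnorm_upper[of 1 f] by (simp add: nrm_one)

end

section \<open>The universal seminorm\<close>

context isometric_presentation
begin

definition seminorms :: "('g star_poly \<Rightarrow> real) set" where
  "seminorms = {p. cstar_seminorm X p \<and> (\<forall>r\<in>R. p r = 0)}"

abbreviation u :: "'g star_poly \<Rightarrow> real" where
  "u \<equiv> univ_norm X R"

lemma u_def: "u f = (SUP p\<in>seminorms. p f)"
  by (simp add: univ_norm_def seminorms_def)

text \<open>Keeps the supremum in \<open>univ_norm\<close> from ranging over the empty set.\<close>

lemma zero_seminorm: "(\<lambda>_. 0) \<in> seminorms"
  by (simp add: seminorms_def cstar_seminorm_def)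

lemma seminormD:
  assumes "p \<in> seminorms"
  shows "f \<in> star_polys X \<Longrightarrow> 0 \<le> p f"
    and "f \<in> star_polys X \<Longrightarrow> p (poly_scale c f) = cmod c * p f"
    and "f \<in> star_polys X \<Longrightarrow> g \<in> star_polys X \<Longrightarrow> p (f + g) \<le> p f + p g"
    and "f \<in> star_polys X \<Longrightarrow> g \<in> star_polys X \<Longrightarrow> p (f * g) \<le> p f * p g"
    and "f \<in> star_polys X \<Longrightarrow> p (poly_adj f * f) = (p f)\<^sup>2"
    and "r \<in> R \<Longrightarrow> p r = 0"
  using assms by (auto simp: seminorms_def cstar_seminorm_def)

lemma seminorm_adj_le:
  assumes p: "p \<in> seminorms" and f: "f \<in> star_polys X"
  shows "p f \<le> p (poly_adj f)"
proof (cases "p f = 0")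
  case True then show ?thesis using seminormD(1)[OF p star_polys_adj[OF f]] by simp
next
  case False
  have "p f * p f \<le> p (poly_adj f) * p f"
    using seminormD(4)[OF p star_polys_adj[OF f] f] seminormD(5)[OF p f] by (simp add: power2_eq_square)
  then show ?thesis using False seminormD(1)[OF p f] by (simp add: less_le)
qed

lemma seminorm_adj:
  assumes p: "p \<in> seminorms" and f: "f \<in> star_polys X"
  shows "p (poly_adj f) = p f"
  using seminorm_adj_le[OF p f] seminorm_adj_le[OF p star_polys_adj[OF f]] by simp

text \<open>By the C*-identity the value at 1 is its own square, so it is 0 or 1.\<close>

lemma seminorm_one: "p \<in> seminorms \<Longrightarrow> p 1 \<le> 1"
proof -
  assume p: "p \<in> seminorms"
  have "p 1 = (p 1)\<^sup>2" using seminormD(5)[OF p, of 1] by simp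
  then have "p 1 = 0 \<or> p 1 = 1" by (simp add: power2_eq_square)
  then show ?thesis by auto
qed

lemma seminorm_gen:
  assumes p: "p \<in> seminorms" and x: "x \<in> X"
  shows "p (poly_gen x) \<le> 1"
proof -
  let ?v = "poly_gen x"
  have v: "?v \<in> star_polys X" by (rule poly_gen_mem[OF x])
  have r: "poly_adj ?v * ?v - 1 \<in> star_polys X" using R_mem isom[OF x] by auto
  have "(p ?v)\<^sup>2 = p ((poly_adj ?v * ?v - 1) + 1)" using seminormD(5)[OF p v] by simp
  also have "\<dots> \<le> p (poly_adj ?v * ?v - 1) + p 1" by (intro seminormD(3)[OF p r] star_polys_one)
  also have "\<dots> \<le> 1" using seminormD(6)[OF p isom[OF x]] seminorm_one[OF p] by simp
  finally show ?thesis using power2_le_imp_le[of "p ?v" 1] by simp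
qed

lemma seminorm_word:
  assumes p: "p \<in> seminorms"
  shows "w \<in> words_over X \<Longrightarrow> p (wpoly w) \<le> 1"
proof (induction w rule: star_word_induct)
  case zero then show ?case using seminorm_one[OF p] by simp
next
  case (cons l w)
  then have l: "Word [l] \<in> words_over X" and w: "w \<in> words_over X" by auto
  have "p (wpoly (Word [l])) \<le> 1"
  proof (cases l)
    case (Gen x) with l show ?thesis using seminorm_gen[OF p, of x] by (simp add: poly_gen_def)
  next
    case (Adj x)
    with l have x: "x \<in> X" by simp
    then show ?thesis
      using seminorm_gen[OF p x] seminorm_adj[OF p poly_gen_mem[OF x]] by (simp add: Adj adj_poly_gen)
  qed
  moreover have "p (wpoly w) \<le> 1" using cons w by simp
  moreover have "p (wpoly (Word [l] + w)) \<le> p (wpoly (Word [l])) * p (wpoly w)"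
    unfolding wpoly_plus by (intro seminormD(4)[OF p] star_polys_single l w)
  moreover have "0 \<le> p (wpoly (Word [l]))" "0 \<le> p (wpoly w)"
    by (intro seminormD(1)[OF p] star_polys_single l w)+
  ultimately show ?case using mult_le_one[of "p (wpoly (Word [l]))" "p (wpoly w)"] by linarith
qed

lemma seminorms_bounded: "f \<in> star_polys X \<Longrightarrow> \<exists>K. \<forall>p\<in>seminorms. p f \<le> K"
proof (induction rule: star_polys_induct)
  case zero
  have "p 0 = 0" if "p \<in> seminorms" for p
    using seminormD(2)[OF that, of 0 0] by simp
  then show ?case by (intro exI[of _ 0]) (simp add: eq_refl)
next
  case (single w c)
  have "p (Poly_Mapping.single w c) \<le> cmod c" if p: "p \<in> seminorms" for p
  proof -
    have "p (Poly_Mapping.single w c) = cmod c * p (wpoly w)"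
      using seminormD(2)[OF p, of "wpoly w" c] single by (simp add: star_polys_single)
    then show ?thesis using seminorm_word[OF p single] by (simp add: mult_left_le)
  qed
  then show ?case by blast
next
  case (add f g)
  then obtain K L where "\<forall>p\<in>seminorms. p f \<le> K" "\<forall>p\<in>seminorms. p g \<le> L" by blast
  then have "\<forall>p\<in>seminorms. p (f + g) \<le> K + L" using add seminormD(3) by (meson add_mono order_trans)
  then show ?case by blast
qed

lemma u_bdd: "f \<in> star_polys X \<Longrightarrow> bdd_above ((\<lambda>p. p f) ` seminorms)"
  using seminorms_bounded by (auto simp: bdd_above_def)

lemma u_upper: "p \<in> seminorms \<Longrightarrow> f \<in> star_polys X \<Longrightarrow> p f \<le> u f"
  unfolding u_def by (rule cSUP_upper[OF _ u_bdd])

lemma u_least: "(\<And>p. p \<in> seminorms \<Longrightarrow> p f \<le> K) \<Longrightarrow> u f \<le> K"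
  unfolding u_def by (rule cSUP_least) (use zero_seminorm in auto)

lemma u_nonneg: "f \<in> star_polys X \<Longrightarrow> 0 \<le> u f"
  using u_upper[OF zero_seminorm] by simp

lemma u_add: "f \<in> star_polys X \<Longrightarrow> g \<in> star_polys X \<Longrightarrow> u (f + g) \<le> u f + u g"
  by (rule u_least) (meson add_mono order_trans seminormD(3) u_upper)

lemma u_mult: "f \<in> star_polys X \<Longrightarrow> g \<in> star_polys X \<Longrightarrow> u (f * g) \<le> u f * u g"
  by (rule u_least) (meson mult_mono order_trans seminormD(1) seminormD(4) u_nonneg u_upper)

lemma u_scale_le: "f \<in> star_polys X \<Longrightarrow> u (poly_scale c f) \<le> cmod c * u f"
  by (rule u_least) (simp add: mult_left_mono seminormD(2) u_upper)

lemma u_adj_le: "f \<in> star_polys X \<Longrightarrow> u (poly_adj f) \<le> u f"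
  by (rule u_least) (simp add: seminorm_adj u_upper)

lemma u_adj: "f \<in> star_polys X \<Longrightarrow> u (poly_adj f) = u f"
  using u_adj_le[of f] u_adj_le[of "poly_adj f"] star_polys_adj[of f X] by simp

lemma u_zero [simp]: "u 0 = 0"
  using u_scale_le[of 0 0] u_nonneg[of 0] by simp

lemma u_uminus: "f \<in> star_polys X \<Longrightarrow> u (- f) = u f"
  using u_scale_le[of f "-1"] u_scale_le[of "- f" "-1"] star_polys_uminus[of f X]
  by (simp add: poly_scale_neg1)

lemma u_diff_commute: "f \<in> star_polys X \<Longrightarrow> g \<in> star_polys X \<Longrightarrow> u (f - g) = u (g - f)"
  using u_uminus[of "f - g"] star_polys_diff[of f X g] by simp

lemma u_triangle:
  "f \<in> star_polys X \<Longrightarrow> g \<in> star_polys X \<Longrightarrow> h \<in> star_polys X \<Longrightarrow> u (f - h) \<le> u (f - g) + u (g - h)"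
  using u_add[of "f - g" "g - h"] star_polys_diff[of f X g] star_polys_diff[of g X h] by simp

lemma u_diff_abs: "f \<in> star_polys X \<Longrightarrow> g \<in> star_polys X \<Longrightarrow> \<bar>u f - u g\<bar> \<le> u (f - g)"
  using u_add[of "f - g" g] u_add[of "g - f" f] u_diff_commute[of f g] star_polys_diff[of f X g]
    star_polys_diff[of g X f] by simp

lemma u_rel: "r \<in> R \<Longrightarrow> u r = 0"
proof -
  assume r: "r \<in> R"
  then have "u r \<le> 0" by (intro u_least) (simp add: seminormD(6))
  moreover have "0 \<le> u r" using r R_mem by (intro u_nonneg) auto
  ultimately show ?thesis by simp
qed

lemma alg_state_le_u:
  assumes "alg_state X R \<phi>" "f \<in> star_polys X"
  shows "cmod (lin \<phi> f) \<le> u f"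
proof -
  interpret alg_state X R \<phi> by fact
  interpret bounded_alg_state X R \<phi> by standard
  have "opnorm \<in> seminorms"
    by (simp add: seminorms_def opnorm_seminorm opnorm_rel)
  then show ?thesis using lin_le_opnorm[of f] u_upper[OF _ assms(2)] by (meson order_trans)
qed

end


section \<open>Continuity of complex-valued maps\<close>

lemma continuous_map_cmult:
  fixes f :: "'x \<Rightarrow> complex"
  shows "continuous_map Z euclidean f \<Longrightarrow> continuous_map Z euclidean (\<lambda>x. c * f x)"
  by (simp add: continuous_map_atin tendsto_mult)

text \<open>The uniform limit theorem. It serves twice: for values of states at limits of
  polynomials, and for sums over infinitely many classes.\<close>

lemma continuous_map_approx:
  fixes g :: "'x \<Rightarrow> complex"
  assumes "\<And>e. e > 0 \<Longrightarrow> \<exists>f. continuous_map Z euclidean f \<and> (\<forall>z\<in>topspace Z. cmod (f z - g z) < e)"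
  shows "continuous_map Z euclidean g"
proof -
  have "\<exists>f. \<forall>n. continuous_map Z euclidean (f n) \<and> (\<forall>z\<in>topspace Z. cmod (f n z - g z) < inverse (real (Suc n)))"
    using assms by (intro choice allI) simp
  then obtain f where f: "\<And>n. continuous_map Z euclidean (f n)"
    "\<And>n z. z \<in> topspace Z \<Longrightarrow> cmod (f n z - g z) < inverse (real (Suc n))" by blast
  have "continuous_map Z (Met_TC.mtopology) g"
  proof (rule Met_TC.continuous_map_uniform_limit[where F = sequentially and f = f])
    fix e :: real assume "e > 0"
    then obtain n where n: "inverse (real (Suc n)) < e" using reals_Archimedean by blast
    have "dist (f m z) (g z) < e" if "m \<ge> n" "z \<in> topspace Z" for m z
    proof -
      have "inverse (real (Suc m)) \<le> inverse (real (Suc n))" using that by simp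
      then show ?thesis using f(2)[OF that(2), of m] n unfolding dist_norm by linarith
    qed
    then show "\<forall>\<^sub>F m in sequentially. \<forall>z\<in>topspace Z. g z \<in> UNIV \<and> dist (f m z) (g z) < e"
      by (auto simp: eventually_sequentially)
  qed (use f(1) in auto)
  then show ?thesis by simp
qed

section \<open>The completion\<close>

context isometric_presentation
begin

abbreviation A :: "(nat \<Rightarrow> 'g star_poly) set star_algebra" where
  "A \<equiv> universal_cstar X R"

abbreviation cs :: "(nat \<Rightarrow> 'g star_poly) set" where
  "cs \<equiv> cauchy_seqs X R"

abbreviation cl :: "(nat \<Rightarrow> 'g star_poly) \<Rightarrow> (nat \<Rightarrow> 'g star_poly) set" where
  "cl \<equiv> cauchy_class X R"

abbreviation el :: "'g star_poly \<Rightarrow> (nat \<Rightarrow> 'g star_poly) set" where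
  "el f \<equiv> cl (\<lambda>_. f)"

lemma cs_mem: "x \<in> cs \<Longrightarrow> x n \<in> star_polys X"
  by (simp add: cauchy_seqs_def)

lemma cs_cauchy: "x \<in> cs \<Longrightarrow> 0 < e \<Longrightarrow> \<exists>M. \<forall>m\<ge>M. \<forall>n\<ge>M. u (x m - x n) < e"
  by (simp add: cauchy_seqs_def)

lemma u_diff_nonneg: "f \<in> star_polys X \<Longrightarrow> g \<in> star_polys X \<Longrightarrow> 0 \<le> u (f - g)"
  by (intro u_nonneg star_polys_diff)

text \<open>One criterion for all operations on Cauchy sequences: increments controlled by those of
  two given sequences. Unary operations take the constant sequence 0 as \<open>y\<close>.\<close>

lemma cs_dominated:
  assumes x: "x \<in> cs" and y: "y \<in> cs" and z: "\<And>n. z n \<in> star_polys X"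
    and K: "\<And>m n. u (z m - z n) \<le> K * (u (x m - x n) + u (y m - y n))"
  shows "z \<in> cs"
  unfolding cauchy_seqs_def
proof (intro CollectI conjI allI impI z)
  fix e :: real assume e: "e > 0"
  \<comment> \<open>The absolute value and the + 1 admit every real \<open>K\<close>, zero and
    negative ones included.\<close>
  define d where "d = e / (2 * (\<bar>K\<bar> + 1))"
  have d: "d > 0" using e by (simp add: d_def)
  obtain M1 where M1: "\<And>m n. m \<ge> M1 \<Longrightarrow> n \<ge> M1 \<Longrightarrow> u (x m - x n) < d" using cs_cauchy[OF x d] by blast
  obtain M2 where M2: "\<And>m n. m \<ge> M2 \<Longrightarrow> n \<ge> M2 \<Longrightarrow> u (y m - y n) < d" using cs_cauchy[OF y d] by blast
  have "u (z m - z n) < e" if "m \<ge> max M1 M2" "n \<ge> max M1 M2" for m n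
  proof -
    have s: "u (x m - x n) + u (y m - y n) < 2 * d" using M1[of m n] M2[of m n] that by simp
    have s0: "0 \<le> u (x m - x n) + u (y m - y n)"
      by (intro add_nonneg_nonneg u_diff_nonneg cs_mem x y)
    have "u (z m - z n) \<le> \<bar>K\<bar> * (u (x m - x n) + u (y m - y n))"
      using K[of m n] mult_right_mono[OF abs_ge_self s0, of K] by linarith
    also have "\<dots> \<le> \<bar>K\<bar> * (2 * d)" using s by (intro mult_left_mono) auto
    also have "\<dots> < (\<bar>K\<bar> + 1) * (2 * d)" using d by (intro mult_strict_right_mono) auto
    also have "\<dots> = e" using abs_ge_zero[of K] by (simp add: d_def field_simps)
    finally show ?thesis .
  qed
  then show "\<exists>M. \<forall>m\<ge>M. \<forall>n\<ge>M. u (z m - z n) < e" by blast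
qed

lemma cs_const: "f \<in> star_polys X \<Longrightarrow> (\<lambda>_. f) \<in> cs"
  by (auto simp: cauchy_seqs_def)

lemma cs_add:
  assumes x: "x \<in> cs" and y: "y \<in> cs"
  shows "(\<lambda>n. x n + y n) \<in> cs"
proof (rule cs_dominated[OF x y, where K = 1])
  fix m n
  have eq: "x m + y m - (x n + y n) = (x m - x n) + (y m - y n)" by simp
  show "u (x m + y m - (x n + y n)) \<le> 1 * (u (x m - x n) + u (y m - y n))"
    unfolding eq mult_1 by (intro u_add star_polys_diff cs_mem x y)
qed (intro star_polys_add cs_mem x y)

lemma cs_scale:
  assumes x: "x \<in> cs"
  shows "(\<lambda>n. poly_scale c (x n)) \<in> cs"
proof (rule cs_dominated[OF x cs_const[OF star_polys_zero], where K = "cmod c"])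
  fix m n
  show "u (poly_scale c (x m) - poly_scale c (x n)) \<le> cmod c * (u (x m - x n) + u (0 - 0))"
    using u_scale_le[of "x m - x n" c] x by (simp add: cs_mem star_polys_diff poly_scale_diff)
qed (intro star_polys_scale cs_mem x)

lemma cs_uminus: "x \<in> cs \<Longrightarrow> (\<lambda>n. - x n) \<in> cs"
  using cs_scale[of x "-1"] by (simp add: poly_scale_neg1)

lemma cs_diff: "x \<in> cs \<Longrightarrow> y \<in> cs \<Longrightarrow> (\<lambda>n. x n - y n) \<in> cs"
  using cs_add[OF _ cs_uminus, of x y] by simp

lemma cs_adj:
  assumes x: "x \<in> cs"
  shows "(\<lambda>n. poly_adj (x n)) \<in> cs"
proof (rule cs_dominated[OF x cs_const[OF star_polys_zero], where K = 1])
  fix m n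
  show "u (poly_adj (x m) - poly_adj (x n)) \<le> 1 * (u (x m - x n) + u (0 - 0))"
    using u_adj_le[of "x m - x n"] x by (simp add: cs_mem star_polys_diff poly_adj_diff)
qed (intro star_polys_adj cs_mem x)

lemma cs_bounded:
  assumes x: "x \<in> cs"
  shows "\<exists>K>0. \<forall>n. u (x n) \<le> K"
proof -
  obtain M where M: "\<And>m n. m \<ge> M \<Longrightarrow> n \<ge> M \<Longrightarrow> u (x m - x n) < 1" using cs_cauchy[OF x, of 1] by auto
  define K where "K = (\<Sum>n\<le>M. u (x n)) + 1"
  have *: "0 \<le> u (x n)" for n by (intro u_nonneg cs_mem x)
  have s: "u (x n) \<le> (\<Sum>n\<le>M. u (x n))" if "n \<le> M" for n
    using that by (intro member_le_sum) (auto simp: *)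
  have "u (x n) \<le> K" for n
  proof (cases "n \<le> M")
    case True then show ?thesis using s[of n] by (simp add: K_def)
  next
    case False
    have "u (x n) \<le> u (x n - x M) + u (x M)"
      using u_add[of "x n - x M" "x M"] x by (simp add: cs_mem star_polys_diff)
    then show ?thesis using M[of n M] False s[of M] by (simp add: K_def)
  qed
  moreover have "K > 0" unfolding K_def using sum_nonneg[of "{..M}" "\<lambda>n. u (x n)"] * by simp
  ultimately show ?thesis by blast
qed

lemma u_mult_diff:
  assumes "f \<in> star_polys X" "f' \<in> star_polys X" "g \<in> star_polys X" "g' \<in> star_polys X"
  shows "u (f * g - f' * g') \<le> u f * u (g - g') + u (f - f') * u g'"
proof -
  have "f * g - f' * g' = f * (g - g') + (f - f') * g'" by (simp add: algebra_simps)
  also have "u \<dots> \<le> u (f * (g - g')) + u ((f - f') * g')"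
    using assms by (intro u_add star_polys_mult star_polys_diff)
  also have "\<dots> \<le> u f * u (g - g') + u (f - f') * u g'"
    using assms by (intro add_mono u_mult star_polys_diff)
  finally show ?thesis .
qed

lemma cs_mult:
  assumes x: "x \<in> cs" and y: "y \<in> cs"
  shows "(\<lambda>n. x n * y n) \<in> cs"
proof -
  obtain K where K: "K > 0" "\<And>n. u (x n) \<le> K" using cs_bounded[OF x] by blast
  obtain L where L: "L > 0" "\<And>n. u (y n) \<le> L" using cs_bounded[OF y] by blast
  show ?thesis
  proof (rule cs_dominated[OF x y, where K = "K + L"])
    fix m n
    have nn: "0 \<le> u (x m - x n)" "0 \<le> u (y m - y n)" by (intro u_diff_nonneg cs_mem x y)+
    have "u (x m * y m - x n * y n) \<le> u (x m) * u (y m - y n) + u (x m - x n) * u (y n)"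
      by (intro u_mult_diff cs_mem x y)
    also have "\<dots> \<le> K * u (y m - y n) + u (x m - x n) * L"
      using nn by (intro add_mono mult_mono K L) (auto intro: u_nonneg cs_mem x y less_imp_le K)
    also have "\<dots> \<le> (K + L) * (u (x m - x n) + u (y m - y n))"
      using nn K(1) L(1) by (simp add: algebra_simps)
    finally show "u (x m * y m - x n * y n) \<le> (K + L) * (u (x m - x n) + u (y m - y n))" .
  qed (intro star_polys_mult cs_mem x y)
qed

lemma cl_iff: "y \<in> cl x \<longleftrightarrow> y \<in> cs \<and> (\<lambda>n. u (x n - y n)) \<longlonglongrightarrow> 0"
  by (simp add: cauchy_class_def)

lemma cl_self: "x \<in> cs \<Longrightarrow> x \<in> cl x"
  by (simp add: cl_iff)

lemma null_trans:
  assumes "x \<in> cs" "y \<in> cs" "z \<in> cs"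
    and "(\<lambda>n. u (x n - y n)) \<longlonglongrightarrow> 0" "(\<lambda>n. u (y n - z n)) \<longlonglongrightarrow> 0"
  shows "(\<lambda>n. u (x n - z n)) \<longlonglongrightarrow> 0"
proof (rule tendsto_sandwich[OF _ _ tendsto_const])
  show "(\<lambda>n. u (x n - y n) + u (y n - z n)) \<longlonglongrightarrow> 0"
    using tendsto_add[OF assms(4,5)] by simp
qed (auto intro!: always_eventually u_diff_nonneg u_triangle cs_mem assms(1-3))

lemma null_sym:
  assumes "x \<in> cs" "y \<in> cs" "(\<lambda>n. u (x n - y n)) \<longlonglongrightarrow> 0"
  shows "(\<lambda>n. u (y n - x n)) \<longlonglongrightarrow> 0"
  using assms u_diff_commute[OF cs_mem cs_mem, of x y] by simp

lemma cl_eqI: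
  assumes "x \<in> cs" "y \<in> cs" "(\<lambda>n. u (x n - y n)) \<longlonglongrightarrow> 0"
  shows "cl x = cl y"
  using assms null_trans null_sym unfolding set_eq_iff cl_iff by meson

lemma cl_eq_iff: "x \<in> cs \<Longrightarrow> y \<in> cs \<Longrightarrow> cl x = cl y \<longleftrightarrow> (\<lambda>n. u (x n - y n)) \<longlonglongrightarrow> 0"
  using cl_eqI[of x y] cl_self[of y] by (auto simp: cl_iff)

lemma carrier_A: "carrier A = cl ` cs"
  by (simp add: universal_cstar_def)

lemma cl_carrier [simp, intro]: "x \<in> cs \<Longrightarrow> cl x \<in> carrier A"
  by (simp add: carrier_A)

lemma carrierE:
  assumes "a \<in> carrier A" obtains x where "x \<in> cs" "a = cl x"
  using assms by (auto simp: carrier_A)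

text \<open>\<open>universal_cstar\<close> defines its operations as unions over all
  representatives; the union collapses once each representative yields the same class.\<close>

lemma UN_cl: "x \<in> cs \<Longrightarrow> (\<And>x'. x' \<in> cl x \<Longrightarrow> F x' = B) \<Longrightarrow> (\<Union>x'\<in>cl x. F x') = B"
  by (rule SUP_eq_const) (auto dest: cl_self)

lemma null_dominated:
  assumes "x \<in> cs" "x' \<in> cs" "y \<in> cs" "y' \<in> cs" "z \<in> cs" "z' \<in> cs"
    and "(\<lambda>n. u (x n - x' n)) \<longlonglongrightarrow> 0" "(\<lambda>n. u (y n - y' n)) \<longlonglongrightarrow> 0"
    and K: "\<And>n. u (z n - z' n) \<le> K * (u (x n - x' n) + u (y n - y' n))"
  shows "cl z = cl z'"
proof (rule cl_eqI[OF assms(5,6)], rule tendsto_sandwich[OF _ _ tendsto_const])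
  show "(\<lambda>n. K * (u (x n - x' n) + u (y n - y' n))) \<longlonglongrightarrow> 0"
    using tendsto_mult[OF tendsto_const tendsto_add[OF assms(7,8)], of K] by simp
qed (auto intro!: always_eventually u_diff_nonneg cs_mem assms(5,6) K)

lemma cl_add_cong:
  assumes "x \<in> cs" "x' \<in> cl x" "y \<in> cs" "y' \<in> cl y"
  shows "cl (\<lambda>n. x' n + y' n) = cl (\<lambda>n. x n + y n)"
proof (rule sym, rule null_dominated[of x x' y y', where K = 1])
  fix n
  have eq: "x n + y n - (x' n + y' n) = (x n - x' n) + (y n - y' n)" by simp
  show "u (x n + y n - (x' n + y' n)) \<le> 1 * (u (x n - x' n) + u (y n - y' n))"
    unfolding eq mult_1 using assms by (intro u_add star_polys_diff cs_mem) (auto simp: cl_iff)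
qed (use assms in \<open>auto simp: cl_iff intro: cs_add\<close>)

lemma cl_mult_cong:
  assumes "x \<in> cs" "x' \<in> cl x" "y \<in> cs" "y' \<in> cl y"
  shows "cl (\<lambda>n. x' n * y' n) = cl (\<lambda>n. x n * y n)"
proof -
  have x': "x' \<in> cs" and y': "y' \<in> cs" using assms by (auto simp: cl_iff)
  obtain K where K: "K > 0" "\<And>n. u (x n) \<le> K" using cs_bounded[OF assms(1)] by blast
  obtain L where L: "L > 0" "\<And>n. u (y' n) \<le> L" using cs_bounded[OF y'] by blast
  show ?thesis
  proof (rule sym, rule null_dominated[of x x' y y', where K = "K + L"])
    fix n
    have nn: "0 \<le> u (x n - x' n)" "0 \<le> u (y n - y' n)" by (intro u_diff_nonneg cs_mem assms x' y')+
    have "u (x n * y n - x' n * y' n) \<le> u (x n) * u (y n - y' n) + u (x n - x' n) * u (y' n)"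
      by (intro u_mult_diff cs_mem assms x' y')
    also have "\<dots> \<le> K * u (y n - y' n) + u (x n - x' n) * L"
      using nn by (intro add_mono mult_mono K L) (auto intro: u_nonneg cs_mem y' less_imp_le K)
    also have "\<dots> \<le> (K + L) * (u (x n - x' n) + u (y n - y' n))"
      using nn K(1) L(1) by (simp add: algebra_simps)
    finally show "u (x n * y n - x' n * y' n) \<le> (K + L) * (u (x n - x' n) + u (y n - y' n))" .
  qed (use assms x' y' in \<open>auto simp: cl_iff intro: cs_mult\<close>)
qed

lemma cl_add:
  assumes "x \<in> cs" "y \<in> cs"
  shows "cl x \<oplus>\<^bsub>A\<^esub> cl y = cl (\<lambda>n. x n + y n)"
proof -
  have "(\<Union>x'\<in>cl x. \<Union>y'\<in>cl y. cl (\<lambda>n. x' n + y' n)) = cl (\<lambda>n. x n + y n)"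
    by (intro UN_cl assms cl_add_cong)
  then show ?thesis by (simp add: universal_cstar_def)
qed

lemma cl_mult:
  assumes "x \<in> cs" "y \<in> cs"
  shows "cl x \<otimes>\<^bsub>A\<^esub> cl y = cl (\<lambda>n. x n * y n)"
proof -
  have "(\<Union>x'\<in>cl x. \<Union>y'\<in>cl y. cl (\<lambda>n. x' n * y' n)) = cl (\<lambda>n. x n * y n)"
    by (intro UN_cl assms cl_mult_cong)
  then show ?thesis by (simp add: universal_cstar_def)
qed

lemma cl_scale:
  assumes x: "x \<in> cs"
  shows "c \<odot>\<^bsub>A\<^esub> cl x = cl (\<lambda>n. poly_scale c (x n))"
proof -
  have "cl (\<lambda>n. poly_scale c (x' n)) = cl (\<lambda>n. poly_scale c (x n))" if "x' \<in> cl x" for x'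
  proof (rule sym, rule null_dominated[of x x' x x, where K = "cmod c"])
    fix n
    show "u (poly_scale c (x n) - poly_scale c (x' n)) \<le> cmod c * (u (x n - x' n) + u (x n - x n))"
      using u_scale_le[of "x n - x' n" c] x that
      by (simp add: cs_mem star_polys_diff cl_iff poly_scale_diff)
  qed (use x that in \<open>auto simp: cl_iff intro: cs_scale\<close>)
  from UN_cl[OF x this] show ?thesis by (simp add: universal_cstar_def)
qed

lemma cl_invol:
  assumes x: "x \<in> cs"
  shows "invol A (cl x) = cl (\<lambda>n. poly_adj (x n))"
proof -
  have "cl (\<lambda>n. poly_adj (x' n)) = cl (\<lambda>n. poly_adj (x n))" if "x' \<in> cl x" for x'
  proof (rule sym, rule null_dominated[of x x' x x, where K = 1])
    fix n
    show "u (poly_adj (x n) - poly_adj (x' n)) \<le> 1 * (u (x n - x' n) + u (x n - x n))"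
      using u_adj_le[of "x n - x' n"] x that
      by (simp add: cs_mem star_polys_diff cl_iff poly_adj_diff)
  qed (use x that in \<open>auto simp: cl_iff intro: cs_adj\<close>)
  from UN_cl[OF x this] show ?thesis by (simp add: universal_cstar_def)
qed

lemma one_A: "\<one>\<^bsub>A\<^esub> = el 1"
  by (simp add: universal_cstar_def)

lemma zero_A: "\<zero>\<^bsub>A\<^esub> = el 0"
  by (simp add: universal_cstar_def)

text \<open>\<open>a_inv\<close> is a definite description and no ring structure has been set up, so
  the inverse is exhibited and its uniqueness checked directly.\<close>

lemma cl_a_inv:
  assumes x: "x \<in> cs"
  shows "\<ominus>\<^bsub>A\<^esub> cl x = cl (\<lambda>n. - x n)"
proof -
  have "(THE \<eta>. \<eta> \<in> carrier A \<and> cl x \<oplus>\<^bsub>A\<^esub> \<eta> = \<zero>\<^bsub>A\<^esub> \<and> \<eta> \<oplus>\<^bsub>A\<^esub> cl x = \<zero>\<^bsub>A\<^esub>) = cl (\<lambda>n. - x n)"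
  proof (rule the_equality)
    show "cl (\<lambda>n. - x n) \<in> carrier A \<and> cl x \<oplus>\<^bsub>A\<^esub> cl (\<lambda>n. - x n) = \<zero>\<^bsub>A\<^esub> \<and> cl (\<lambda>n. - x n) \<oplus>\<^bsub>A\<^esub> cl x = \<zero>\<^bsub>A\<^esub>"
      using x by (simp add: cl_add cs_uminus zero_A)
  next
    fix \<eta> assume \<eta>: "\<eta> \<in> carrier A \<and> cl x \<oplus>\<^bsub>A\<^esub> \<eta> = \<zero>\<^bsub>A\<^esub> \<and> \<eta> \<oplus>\<^bsub>A\<^esub> cl x = \<zero>\<^bsub>A\<^esub>"
    then obtain y where y: "y \<in> cs" "\<eta> = cl y" by (auto elim: carrierE)
    with \<eta> have "cl (\<lambda>n. y n + x n) = el 0" by (simp add: cl_add x zero_A)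
    then have "(\<lambda>n. u (y n - (- x n))) \<longlonglongrightarrow> 0"
      using cl_eq_iff[OF cs_add[OF y(1) x] cs_const[OF star_polys_zero]] by simp
    then show "\<eta> = cl (\<lambda>n. - x n)" unfolding y(2) by (rule cl_eqI[OF y(1) cs_uminus[OF x]])
  qed
  then show ?thesis by (simp add: a_inv_def m_inv_def)
qed

lemma cl_minus: "x \<in> cs \<Longrightarrow> y \<in> cs \<Longrightarrow> cl x \<ominus>\<^bsub>A\<^esub> cl y = cl (\<lambda>n. x n - y n)"
  by (simp add: a_minus_def cl_a_inv cl_add cs_uminus)

lemma u_convergent:
  assumes x: "x \<in> cs" shows "convergent (\<lambda>n. u (x n))"
proof -
  have "Cauchy (\<lambda>n. u (x n))"
    unfolding Cauchy_def
  proof (intro allI impI)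
    fix e :: real assume "e > 0"
    then obtain M where M: "\<And>m n. m \<ge> M \<Longrightarrow> n \<ge> M \<Longrightarrow> u (x m - x n) < e" using cs_cauchy[OF x] by blast
    have "dist (u (x m)) (u (x n)) < e" if "m \<ge> M" "n \<ge> M" for m n
      using M[OF that] u_diff_abs[OF cs_mem[OF x, of m] cs_mem[OF x, of n]] by (simp add: dist_real_def)
    then show "\<exists>M. \<forall>m\<ge>M. \<forall>n\<ge>M. dist (u (x m)) (u (x n)) < e" by blast
  qed
  then show ?thesis by (rule Cauchy_convergent)
qed

text \<open>\<open>cnorm\<close> looks at one chosen representative; the seminorms of equivalent
  sequences have the same limit.\<close>

lemma cnorm_cl:
  assumes x: "x \<in> cs" shows "(\<lambda>n. u (x n)) \<longlonglongrightarrow> cnorm A (cl x)"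
proof -
  define y where "y = (SOME y. y \<in> cl x)"
  have y: "y \<in> cl x" unfolding y_def by (rule someI[of _ x]) (rule cl_self[OF x])
  then have yc: "y \<in> cs" and n: "(\<lambda>n. u (x n - y n)) \<longlonglongrightarrow> 0" by (auto simp: cl_iff)
  have "cnorm A (cl x) = lim (\<lambda>n. u (y n))" by (simp add: universal_cstar_def y_def)
  then have "(\<lambda>n. u (y n)) \<longlonglongrightarrow> cnorm A (cl x)" using u_convergent[OF yc] by (simp add: convergent_LIMSEQ_iff)
  moreover have "(\<lambda>n. u (x n) - u (y n)) \<longlonglongrightarrow> 0"
    by (rule Lim_null_comparison[OF _ n]) (auto intro!: always_eventually u_diff_abs cs_mem x yc)
  ultimately have "(\<lambda>n. (u (x n) - u (y n)) + u (y n)) \<longlonglongrightarrow> 0 + cnorm A (cl x)" by (intro tendsto_add)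
  then show ?thesis by simp
qed

lemma cnorm_el: "f \<in> star_polys X \<Longrightarrow> cnorm A (el f) = u f"
  using cnorm_cl[OF cs_const, of f] LIMSEQ_unique[OF _ tendsto_const] by blast

lemma cnorm_nonneg: "a \<in> carrier A \<Longrightarrow> 0 \<le> cnorm A a"
  by (elim carrierE) (auto intro!: LIMSEQ_le_const[OF cnorm_cl] u_nonneg cs_mem)

lemma A_closed [simp, intro]:
  "a \<in> carrier A \<Longrightarrow> b \<in> carrier A \<Longrightarrow> a \<oplus>\<^bsub>A\<^esub> b \<in> carrier A"
  "a \<in> carrier A \<Longrightarrow> b \<in> carrier A \<Longrightarrow> a \<otimes>\<^bsub>A\<^esub> b \<in> carrier A"
  "a \<in> carrier A \<Longrightarrow> b \<in> carrier A \<Longrightarrow> a \<ominus>\<^bsub>A\<^esub> b \<in> carrier A"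
  "a \<in> carrier A \<Longrightarrow> c \<odot>\<^bsub>A\<^esub> a \<in> carrier A"
  "a \<in> carrier A \<Longrightarrow> invol A a \<in> carrier A"
  by (auto elim!: carrierE simp: cl_add cl_mult cl_minus cl_scale cl_invol
      intro!: cl_carrier cs_add cs_mult cs_diff cs_scale cs_adj)

lemma el_carrier [simp, intro]: "f \<in> star_polys X \<Longrightarrow> el f \<in> carrier A"
  by (simp add: cs_const)

lemma cnorm_triangle:
  assumes "a \<in> carrier A" "b \<in> carrier A"
  shows "cnorm A (a \<oplus>\<^bsub>A\<^esub> b) \<le> cnorm A a + cnorm A b"
proof -
  obtain x y where x: "x \<in> cs" "a = cl x" and y: "y \<in> cs" "b = cl y"
    using assms by (auto elim!: carrierE)
  show ?thesis unfolding x y cl_add[OF x(1) y(1)]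
    by (rule LIMSEQ_le[OF cnorm_cl[OF cs_add[OF x(1) y(1)]] tendsto_add[OF cnorm_cl[OF x(1)] cnorm_cl[OF y(1)]]])
       (auto intro!: u_add cs_mem x y)
qed

lemma cnorm_mult:
  assumes "a \<in> carrier A" "b \<in> carrier A"
  shows "cnorm A (a \<otimes>\<^bsub>A\<^esub> b) \<le> cnorm A a * cnorm A b"
proof -
  obtain x y where x: "x \<in> cs" "a = cl x" and y: "y \<in> cs" "b = cl y"
    using assms by (auto elim!: carrierE)
  show ?thesis unfolding x y cl_mult[OF x(1) y(1)]
    by (rule LIMSEQ_le[OF cnorm_cl[OF cs_mult[OF x(1) y(1)]] tendsto_mult[OF cnorm_cl[OF x(1)] cnorm_cl[OF y(1)]]])
       (auto intro!: u_mult cs_mem x y)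
qed

lemma cnorm_scale_le:
  assumes "a \<in> carrier A"
  shows "cnorm A (c \<odot>\<^bsub>A\<^esub> a) \<le> cmod c * cnorm A a"
proof -
  obtain x where x: "x \<in> cs" "a = cl x" using assms by (auto elim!: carrierE)
  show ?thesis unfolding x cl_scale[OF x(1)]
    by (rule LIMSEQ_le[OF cnorm_cl[OF cs_scale[OF x(1)]] tendsto_mult[OF tendsto_const cnorm_cl[OF x(1)]]])
       (auto intro!: u_scale_le cs_mem x)
qed

lemma cnorm_minus_commute:
  assumes "a \<in> carrier A" "b \<in> carrier A"
  shows "cnorm A (a \<ominus>\<^bsub>A\<^esub> b) = cnorm A (b \<ominus>\<^bsub>A\<^esub> a)"
proof -
  obtain x y where x: "x \<in> cs" "a = cl x" and y: "y \<in> cs" "b = cl y"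
    using assms by (auto elim!: carrierE)
  have eq: "(\<lambda>n. u (y n - x n)) = (\<lambda>n. u (x n - y n))"
    by (intro ext u_diff_commute cs_mem x y)
  show ?thesis unfolding x y cl_minus[OF x(1) y(1)] cl_minus[OF y(1) x(1)]
    by (rule LIMSEQ_unique[OF cnorm_cl[OF cs_diff[OF x(1) y(1)]]])
      (rule cnorm_cl[OF cs_diff[OF y(1) x(1)], unfolded eq])
qed

lemma el_approx:
  assumes x: "x \<in> cs"
  shows "(\<lambda>n. cnorm A (cl x \<ominus>\<^bsub>A\<^esub> el (x n))) \<longlonglongrightarrow> 0"
proof (rule LIMSEQ_I)
  fix e :: real assume e: "e > 0"
  then obtain M where M: "\<And>m n. m \<ge> M \<Longrightarrow> n \<ge> M \<Longrightarrow> u (x m - x n) < e / 2" using cs_cauchy[OF x, of "e/2"] by auto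
  have "norm (cnorm A (cl x \<ominus>\<^bsub>A\<^esub> el (x n)) - 0) < e" if n: "n \<ge> M" for n
  proof -
    have "(\<lambda>m. u (x m - x n)) \<longlonglongrightarrow> cnorm A (cl x \<ominus>\<^bsub>A\<^esub> el (x n))"
      using cnorm_cl[OF cs_diff[OF x cs_const[OF cs_mem[OF x, of n]]]]
      by (simp add: cl_minus x cs_const[OF cs_mem[OF x, of n]])
    then have "cnorm A (cl x \<ominus>\<^bsub>A\<^esub> el (x n)) \<le> e / 2"
      by (rule LIMSEQ_le_const2) (use M n in \<open>auto intro!: exI[of _ M] less_imp_le\<close>)
    moreover have "0 \<le> cnorm A (cl x \<ominus>\<^bsub>A\<^esub> el (x n))"
      by (intro cnorm_nonneg A_closed el_carrier cl_carrier x cs_mem)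
    ultimately show ?thesis using e by simp
  qed
  then show "\<exists>M. \<forall>n\<ge>M. norm (cnorm A (cl x \<ominus>\<^bsub>A\<^esub> el (x n)) - 0) < e" by blast
qed

lemma el_dense:
  assumes "a \<in> carrier A" "e > 0"
  obtains f where "f \<in> star_polys X" "cnorm A (a \<ominus>\<^bsub>A\<^esub> el f) < e"
proof -
  obtain x where x: "x \<in> cs" "a = cl x" using assms by (auto elim!: carrierE)
  have "eventually (\<lambda>n. cnorm A (a \<ominus>\<^bsub>A\<^esub> el (x n)) < e) sequentially"
    using el_approx[OF x(1)] assms(2) unfolding x(2) by (rule order_tendstoD)
  then show ?thesis using that cs_mem[OF x(1)] by (auto simp: eventually_sequentially)
qed

lemma el_ops:
  assumes "f \<in> star_polys X" "g \<in> star_polys X"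
  shows "el f \<oplus>\<^bsub>A\<^esub> el g = el (f + g)" "el f \<otimes>\<^bsub>A\<^esub> el g = el (f * g)"
    "el f \<ominus>\<^bsub>A\<^esub> el g = el (f - g)"
  using assms by (simp_all add: cl_add cl_mult cl_minus cs_const)

lemma el_unary_ops:
  assumes "f \<in> star_polys X"
  shows "c \<odot>\<^bsub>A\<^esub> el f = el (poly_scale c f)" "invol A (el f) = el (poly_adj f)"
  using assms by (simp_all add: cl_scale cl_invol cs_const)

lemma el_eqI:
  assumes "f \<in> star_polys X" "g \<in> star_polys X" "u (f - g) = 0"
  shows "el f = el g"
  by (rule cl_eqI) (use assms in \<open>auto intro: cs_const\<close>)

section \<open>States of the completion\<close>

lemma statesD:
  assumes "\<psi> \<in> states A"
  shows "a \<in> carrier A \<Longrightarrow> b \<in> carrier A \<Longrightarrow> \<psi> (a \<oplus>\<^bsub>A\<^esub> b) = \<psi> a + \<psi> b"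
    "a \<in> carrier A \<Longrightarrow> \<psi> (c \<odot>\<^bsub>A\<^esub> a) = c * \<psi> a"
    "a \<in> carrier A \<Longrightarrow> \<psi> (invol A a \<otimes>\<^bsub>A\<^esub> a) \<in> \<real>\<^sub>\<ge>\<^sub>0"
    "\<psi> \<one>\<^bsub>A\<^esub> = 1" "\<psi> \<in> extensional (carrier A)"
  using assms by (auto simp: states_def)

lemma state_cl_add:
  "\<psi> \<in> states A \<Longrightarrow> x \<in> cs \<Longrightarrow> y \<in> cs \<Longrightarrow> \<psi> (cl (\<lambda>n. x n + y n)) = \<psi> (cl x) + \<psi> (cl y)"
  using statesD(1)[of \<psi> "cl x" "cl y"] by (simp add: cl_add)

lemma state_cl_scale:
  "\<psi> \<in> states A \<Longrightarrow> x \<in> cs \<Longrightarrow> \<psi> (cl (\<lambda>n. poly_scale c (x n))) = c * \<psi> (cl x)"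
  using statesD(2)[of \<psi> "cl x" c] by (simp add: cl_scale)

lemma state_cl_diff:
  "\<psi> \<in> states A \<Longrightarrow> x \<in> cs \<Longrightarrow> y \<in> cs \<Longrightarrow> \<psi> (cl (\<lambda>n. x n - y n)) = \<psi> (cl x) - \<psi> (cl y)"
  using state_cl_add[of \<psi> x "\<lambda>n. - y n"] state_cl_scale[of \<psi> y "-1"]
  by (simp add: poly_scale_neg1 cs_uminus)

text \<open>The square root of \<open>1 - h\<close>, \<open>\<parallel>h\<parallel> < 1\<close>, is \<open>1 - y\<close> for the fixed point \<open>y\<close> of the contraction
  \<open>y \<mapsto> (h + y\<^sup>2)/2\<close>.\<close>

fun sqrt_iter :: "nat \<Rightarrow> 'g star_poly \<Rightarrow> 'g star_poly" where
  "sqrt_iter 0 h = 0"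
| "sqrt_iter (Suc k) h = poly_scale (1/2) (h + sqrt_iter k h * sqrt_iter k h)"

lemma sqrt_iter_mem: "h \<in> star_polys X \<Longrightarrow> sqrt_iter k h \<in> star_polys X"
  by (induction k) (auto intro: star_polys_intros)

lemma sqrt_iter_adj: "poly_adj h = h \<Longrightarrow> poly_adj (sqrt_iter k h) = sqrt_iter k h"
  by (induction k) (auto simp: poly_adj_scale poly_adj_add poly_adj_mult)

text \<open>The ball of radius r is invariant under y -> (h + y^2)/2, since (r + r^2)/2 is at most r
  when r < 1.\<close>

lemma sqrt_iter_bound:
  assumes h: "h \<in> star_polys X" "u h \<le> r" and r: "0 \<le> r" "r < 1"
  shows "u (sqrt_iter k h) \<le> r"
proof (induction k)
  case (Suc k)
  let ?y = "sqrt_iter k h"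
  have y: "?y \<in> star_polys X" by (intro sqrt_iter_mem h)
  have "u (sqrt_iter (Suc k) h) \<le> cmod (1/2) * u (h + ?y * ?y)"
    unfolding sqrt_iter.simps using y h by (intro u_scale_le star_polys_intros)
  also have "u (h + ?y * ?y) \<le> u h + u ?y * u ?y"
    using y h by (intro order_trans[OF u_add] add_left_mono u_mult star_polys_mult)
  also have "\<dots> \<le> r + r * 1"
    using Suc h r u_nonneg[OF y] by (intro add_mono mult_mono) auto
  finally show ?case by (simp add: norm_divide)
qed (use r in auto)

text \<open>From y^2 - y'^2 = y (y - y') + (y - y') y' the step is r-Lipschitz in y on the ball of
  radius r. The dependence on h is kept as well, because the iteration will run along a Cauchy
  sequence of h.\<close>

lemma sqrt_step_diff:
  assumes "h \<in> star_polys X" "h' \<in> star_polys X" "y \<in> star_polys X" "y' \<in> star_polys X"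
    and "u y \<le> r" "u y' \<le> r"
  shows "u (poly_scale (1/2) (h + y * y) - poly_scale (1/2) (h' + y' * y')) \<le> u (h - h') / 2 + r * u (y - y')"
proof -
  have nn: "0 \<le> u (y - y')" using assms by (intro u_diff_nonneg)
  have "u (poly_scale (1/2) (h + y * y) - poly_scale (1/2) (h' + y' * y'))
      = u (poly_scale (1/2) ((h - h') + (y * y - y' * y')))"
    by (simp add: algebra_simps flip: poly_scale_diff)
  also have "\<dots> \<le> cmod (1/2) * u ((h - h') + (y * y - y' * y'))"
    using assms by (intro u_scale_le star_polys_intros)
  also have "u ((h - h') + (y * y - y' * y')) \<le> u (h - h') + u (y * y - y' * y')"
    using assms by (intro u_add star_polys_intros)
  also have "u (y * y - y' * y') \<le> u y * u (y - y') + u (y - y') * u y'"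
    using assms by (intro u_mult_diff)
  also have "u y * u (y - y') \<le> r * u (y - y')" using assms nn by (intro mult_right_mono)
  also have "u (y - y') * u y' \<le> u (y - y') * r" using assms nn by (intro mult_left_mono)
  finally show ?thesis by (simp add: norm_divide field_simps)
qed

lemma sqrt_iter_Suc_diff:
  assumes h: "h \<in> star_polys X" "u h \<le> r" and r: "0 \<le> r" "r < 1"
  shows "u (sqrt_iter (Suc k) h - sqrt_iter k h) \<le> r ^ k"
proof (induction k)
  case 0
  have "u (poly_scale (1/2) h) \<le> cmod (1/2) * u h" by (intro u_scale_le h)
  then show ?case using h r by (simp add: norm_divide)
next
  case (Suc k)
  have "u (sqrt_iter (Suc (Suc k)) h - sqrt_iter (Suc k) h)
      \<le> u (h - h) / 2 + r * u (sqrt_iter (Suc k) h - sqrt_iter k h)"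
    using sqrt_step_diff[OF h(1) h(1) sqrt_iter_mem[OF h(1), of "Suc k"] sqrt_iter_mem[OF h(1), of k]
        sqrt_iter_bound[OF h r] sqrt_iter_bound[OF h r]]
    by (simp only: sqrt_iter.simps)
  also have "\<dots> \<le> r * r ^ k" using Suc r by (simp add: mult_left_mono)
  finally show ?case by simp
qed

lemma sqrt_iter_diff:
  assumes h: "h \<in> star_polys X" "u h \<le> r" and r: "0 \<le> r" "r < 1" and "m \<ge> k"
  shows "u (sqrt_iter m h - sqrt_iter k h) \<le> r ^ k / (1 - r)"
proof -
  have "u (sqrt_iter m h - sqrt_iter k h) \<le> (r ^ k - r ^ m) / (1 - r)"
    using \<open>m \<ge> k\<close>
  proof (induction m rule: dec_induct)
    case (step m)
    have "u (sqrt_iter (Suc m) h - sqrt_iter k h)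
        \<le> u (sqrt_iter (Suc m) h - sqrt_iter m h) + u (sqrt_iter m h - sqrt_iter k h)"
      by (intro u_triangle sqrt_iter_mem h)
    also have "\<dots> \<le> r ^ m + (r ^ k - r ^ m) / (1 - r)"
      using step by (intro add_mono sqrt_iter_Suc_diff h r) auto
    also have "\<dots> = (r ^ k - r ^ Suc m) / (1 - r)" using r by (simp add: field_simps)
    finally show ?case .
  qed simp
  also have "\<dots> \<le> r ^ k / (1 - r)" using r by (intro divide_right_mono) auto
  finally show ?thesis .
qed

lemma sqrt_iter_lipschitz:
  assumes h: "h \<in> star_polys X" "u h \<le> r" "h' \<in> star_polys X" "u h' \<le> r" and r: "0 \<le> r" "r < 1"
  shows "u (sqrt_iter k h - sqrt_iter k h') \<le> u (h - h') / (1 - r)"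
proof (induction k)
  case 0 then show ?case using r h by (simp add: u_diff_nonneg)
next
  case (Suc k)
  let ?d = "u (h - h')"
  have d: "0 \<le> ?d" by (intro u_diff_nonneg h)
  have "u (sqrt_iter (Suc k) h - sqrt_iter (Suc k) h') \<le> ?d / 2 + r * u (sqrt_iter k h - sqrt_iter k h')"
    unfolding sqrt_iter.simps by (rule sqrt_step_diff[OF h(1,3)]) (intro sqrt_iter_mem sqrt_iter_bound h r)+
  also have "\<dots> \<le> ?d + r * (?d / (1 - r))" using Suc r d by (intro add_mono mult_left_mono) auto
  also have "\<dots> = ?d / (1 - r)" using r by (simp add: field_simps)
  finally show ?case .
qed

text \<open>A diagonal sequence: the n-th iterate is taken for the n-th term of \<open>h\<close>.
  With y = 1 - z, the defect 1 - h - y^2 is 2 (z - (h + z^2)/2), up to sign twice an iteration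
  increment, and so at most 2 r^n.\<close>

lemma one_minus_square:
  assumes h: "h \<in> cs" "\<And>n. poly_adj (h n) = h n" "\<And>n. u (h n) \<le> r" and r: "0 \<le> r" "r < 1"
  obtains y where "y \<in> cs" "cl (\<lambda>n. 1 - h n) = invol A (cl y) \<otimes>\<^bsub>A\<^esub> cl y"
proof -
  define z where "z n = sqrt_iter n (h n)" for n
  have zm: "z n \<in> star_polys X" for n unfolding z_def by (intro sqrt_iter_mem cs_mem h)
  have zz: "u (z m - z n) \<le> r ^ n / (1 - r) + u (h m - h n) / (1 - r)" if "m \<ge> n" for m n
  proof -
    have "u (z m - z n) \<le> u (z m - sqrt_iter n (h m)) + u (sqrt_iter n (h m) - z n)"
      unfolding z_def by (intro u_triangle sqrt_iter_mem cs_mem h)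
    also have "\<dots> \<le> r ^ n / (1 - r) + u (h m - h n) / (1 - r)"
      unfolding z_def by (intro add_mono sqrt_iter_diff sqrt_iter_lipschitz cs_mem h r that)
    finally show ?thesis .
  qed
  have "z \<in> cs"
    unfolding cauchy_seqs_def
  proof (intro CollectI conjI allI impI zm)
    fix e :: real assume e: "e > 0"
    define d where "d = e * (1 - r) / 2"
    have d: "d > 0" using e r by (simp add: d_def)
    have "eventually (\<lambda>n. r ^ n < d) sequentially"
      using r d by (intro order_tendstoD(2)[OF LIMSEQ_realpow_zero])
    then obtain M1 where M1: "\<And>n. n \<ge> M1 \<Longrightarrow> r ^ n < d" by (auto simp: eventually_sequentially)
    obtain M2 where M2: "\<And>m n. m \<ge> M2 \<Longrightarrow> n \<ge> M2 \<Longrightarrow> u (h m - h n) < d" using cs_cauchy[OF h(1) d] by blast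
    have *: "u (z m - z n) < e" if "m \<ge> n" "n \<ge> max M1 M2" for m n
    proof -
      have "u (z m - z n) \<le> (r ^ n + u (h m - h n)) / (1 - r)" using zz[OF that(1)] by (simp add: add_divide_distrib)
      also have "\<dots> < (d + d) / (1 - r)" using M1[of n] M2[of m n] that r by (intro divide_strict_right_mono add_strict_mono) auto
      also have "\<dots> = e" using r by (simp add: d_def field_simps)
      finally show ?thesis .
    qed
    have "u (z m - z n) < e" if "m \<ge> max M1 M2" "n \<ge> max M1 M2" for m n
      using *[of n m] *[of m n] that u_diff_commute[OF zm zm, of m n] by (cases "m \<ge> n") auto
    then show "\<exists>M. \<forall>m\<ge>M. \<forall>n\<ge>M. u (z m - z n) < e" by blast
  qed
  define y where "y n = 1 - z n" for n
  have y: "y \<in> cs" unfolding y_def by (intro cs_diff cs_const star_polys_one \<open>z \<in> cs\<close>)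
  have ya: "poly_adj (y n) = y n" for n
    by (simp add: y_def poly_adj_diff z_def sqrt_iter_adj h)
  have "cl (\<lambda>n. 1 - h n) = cl (\<lambda>n. y n * y n)"
  proof (rule cl_eqI)
    show "(\<lambda>n. u (1 - h n - y n * y n)) \<longlonglongrightarrow> 0"
    proof (rule tendsto_sandwich[OF _ _ tendsto_const])
      show "(\<lambda>n. 2 * r ^ n) \<longlonglongrightarrow> 0"
        using tendsto_mult[OF tendsto_const LIMSEQ_realpow_zero, of r 2] r by simp
      have "u (1 - h n - y n * y n) \<le> 2 * r ^ n" for n
      proof -
        have "1 - h n - y n * y n = poly_scale 2 (z n - poly_scale (1/2) (h n + z n * z n))"
        proof -
          have "poly_scale 2 (z n - poly_scale (1/2) (h n + z n * z n)) = poly_scale (1 + 1) (z n) - (h n + z n * z n)"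
            by (simp add: poly_scale_diff poly_scale_scale)
          also have "\<dots> = z n + z n - (h n + z n * z n)" by (simp only: poly_scale_add_left poly_scale_1)
          finally show ?thesis by (simp add: y_def algebra_simps)
        qed
        also have "u \<dots> \<le> cmod 2 * u (z n - poly_scale (1/2) (h n + z n * z n))"
          by (intro u_scale_le star_polys_intros zm cs_mem h)
        also have "u (z n - poly_scale (1/2) (h n + z n * z n)) = u (sqrt_iter (Suc n) (h n) - sqrt_iter n (h n))"
          unfolding z_def sqrt_iter.simps by (intro u_diff_commute star_polys_intros sqrt_iter_mem cs_mem h)
        also have "\<dots> \<le> r ^ n" by (intro sqrt_iter_Suc_diff cs_mem h r)
        finally show ?thesis by simp
      qed
      then show "\<forall>\<^sub>F n in sequentially. u (1 - h n - y n * y n) \<le> 2 * r ^ n" by simp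
    qed (auto intro!: always_eventually u_nonneg[OF star_polys_diff[OF star_polys_diff[OF star_polys_one
          cs_mem[OF h(1)]] star_polys_mult[OF cs_mem[OF y] cs_mem[OF y]]]])
  qed (intro cs_diff cs_mult cs_const star_polys_one h y)+
  also have "\<dots> = invol A (cl y) \<otimes>\<^bsub>A\<^esub> cl y"
    by (simp add: cl_invol cl_mult cs_adj y ya)
  finally show ?thesis using that y by blast
qed

text \<open>Discarding initial terms turns a bound that holds eventually into one for all terms, as
  \<open>one_minus_square\<close> requires.\<close>

lemma cl_shift: "x \<in> cs \<Longrightarrow> (\<lambda>n. x (n + k)) \<in> cs \<and> cl (\<lambda>n. x (n + k)) = cl x"
proof (intro conjI)
  assume x: "x \<in> cs"
  show s: "(\<lambda>n. x (n + k)) \<in> cs"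
    unfolding cauchy_seqs_def
  proof (intro CollectI conjI allI impI cs_mem x)
    fix e :: real assume "e > 0"
    then obtain M where "\<forall>m\<ge>M. \<forall>n\<ge>M. u (x m - x n) < e" using cs_cauchy[OF x] by blast
    then show "\<exists>M. \<forall>m\<ge>M. \<forall>n\<ge>M. u (x (m + k) - x (n + k)) < e" by (meson trans_le_add1)
  qed
  show "cl (\<lambda>n. x (n + k)) = cl x"
  proof (rule cl_eqI[OF s x], rule LIMSEQ_I)
    fix e :: real assume "e > 0"
    then obtain M where M: "\<And>m n. m \<ge> M \<Longrightarrow> n \<ge> M \<Longrightarrow> u (x m - x n) < e" using cs_cauchy[OF x] by blast
    then show "\<exists>M. \<forall>n\<ge>M. norm (u (x (n + k) - x n) - 0) < e"
      by (intro exI[of _ M]) (auto simp: u_diff_nonneg cs_mem x)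
  qed
qed

text \<open>\<open>states\<close> asks only for nonnegative values on elements a* a, so boundedness
  has to be derived. For K above the norm of h, both 1 - h/K and 1 + h/K are of this form; hence the
  value at h is real and lies between -K and K.\<close>

lemma state_selfadjoint:
  assumes \<psi>: "\<psi> \<in> states A" and h: "h \<in> cs" "\<And>n. poly_adj (h n) = h n"
  shows "cmod (\<psi> (cl h)) \<le> cnorm A (cl h)"
proof (rule field_le_epsilon)
  fix e :: real assume e: "e > 0"
  define K where "K = cnorm A (cl h) + e"
  have K: "K > 0" using cnorm_nonneg[OF cl_carrier[OF h(1)]] e by (simp add: K_def)
  have "eventually (\<lambda>n. u (h n) < cnorm A (cl h) + e / 2) sequentially"
    using e by (intro order_tendstoD(2)[OF cnorm_cl[OF h(1)]]) auto
  then obtain M where M: "\<And>n. n \<ge> M \<Longrightarrow> u (h n) < cnorm A (cl h) + e / 2" by (auto simp: eventually_sequentially)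
  define h' where "h' n = h (n + M)" for n
  have h': "h' \<in> cs" "cl h' = cl h" using cl_shift[OF h(1), of M] by (auto simp: h'_def[abs_def])
  \<comment> \<open>Half of \<open>e\<close> for the terms against the whole of \<open>e\<close> in
    \<open>K\<close> keeps \<open>r\<close> strictly below 1.\<close>
  define r where "r = (cnorm A (cl h) + e / 2) / K"
  have r: "0 \<le> r" "r < 1" using cnorm_nonneg[OF cl_carrier[OF h(1)]] e K by (auto simp: r_def K_def)
  have *: "1 - of_real s * \<psi> (cl h) / of_real K \<in> \<real>\<^sub>\<ge>\<^sub>0" if s: "\<bar>s\<bar> = 1" for s :: real
  proof -
    define c where "c = complex_of_real (s / K)"
    define g where "g n = poly_scale c (h' n)" for n
    have g: "g \<in> cs" unfolding g_def by (intro cs_scale h')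
    have "u (g n) \<le> r" for n
    proof -
      have "u (g n) \<le> cmod c * u (h' n)" unfolding g_def by (intro u_scale_le cs_mem h')
      also have "cmod c = 1 / K" using s K by (simp add: c_def norm_divide)
      also have "1 / K * u (h' n) \<le> r" using M[of "n + M"] K by (simp add: h'_def r_def divide_right_mono)
      finally show ?thesis .
    qed
    moreover have "poly_adj (g n) = g n" for n by (simp add: g_def poly_adj_scale h'_def h c_def)
    ultimately obtain y where y: "y \<in> cs" "cl (\<lambda>n. 1 - g n) = invol A (cl y) \<otimes>\<^bsub>A\<^esub> cl y"
      using one_minus_square[OF g _ _ r] by blast
    have "\<psi> (cl (\<lambda>n. 1 - g n)) = 1 - c * \<psi> (cl h)"
      using state_cl_diff[OF \<psi> cs_const[OF star_polys_one] g] state_cl_scale[OF \<psi> h'(1), of c] statesD(4)[OF \<psi>]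
      by (simp add: one_A g_def[abs_def] h')
    moreover have "\<psi> (cl (\<lambda>n. 1 - g n)) \<in> \<real>\<^sub>\<ge>\<^sub>0" unfolding y(2) by (intro statesD(3)[OF \<psi>] cl_carrier y)
    ultimately show ?thesis by (simp add: c_def)
  qed
  have "Im (\<psi> (cl h)) = 0" "Re (\<psi> (cl h)) \<le> K" "- Re (\<psi> (cl h)) \<le> K"
    using *[of 1] *[of "-1"] K by (auto simp: complex_nonneg_Reals_iff field_simps Im_divide_of_real Re_divide_of_real)
  then have "cmod (\<psi> (cl h)) \<le> K" by (simp add: cmod_eq_Re)
  then show "cmod (\<psi> (cl h)) \<le> cnorm A (cl h) + e" by (simp add: K_def)
qed

text \<open>Polarization into two self-adjoint elements, for c = 1 and c = \<i>. It costs a factor 2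
  against the sharp bound, which is harmless for continuity and compactness.\<close>

lemma state_bound:
  assumes \<psi>: "\<psi> \<in> states A" and a: "a \<in> carrier A"
  shows "cmod (\<psi> a) \<le> 2 * cnorm A a"
proof -
  obtain x where x: "x \<in> cs" "a = cl x" using a by (auto elim!: carrierE)
  have aux: "cmod (\<psi> (cl (\<lambda>n. poly_scale c (x n) + poly_scale (cnj c) (poly_adj (x n))))) \<le> 2 * cmod c * cnorm A a" for c
  proof -
    define h where "h n = poly_scale c (x n) + poly_scale (cnj c) (poly_adj (x n))" for n
    have h: "h \<in> cs" unfolding h_def by (intro cs_add cs_scale cs_adj x)
    have "cmod (\<psi> (cl h)) \<le> cnorm A (cl h)"
      by (rule state_selfadjoint[OF \<psi> h]) (simp add: h_def poly_adj_add poly_adj_scale add.commute)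
    also have "\<dots> \<le> 2 * cmod c * cnorm A a"
    proof (rule LIMSEQ_le[OF cnorm_cl[OF h]])
      show "(\<lambda>n. 2 * cmod c * u (x n)) \<longlonglongrightarrow> 2 * cmod c * cnorm A a"
        unfolding x by (intro tendsto_intros cnorm_cl x)
      have "u (h n) \<le> 2 * cmod c * u (x n)" for n
      proof -
        have "u (h n) \<le> u (poly_scale c (x n)) + u (poly_scale (cnj c) (poly_adj (x n)))"
          unfolding h_def by (intro u_add star_polys_intros cs_mem x)
        also have "\<dots> \<le> cmod c * u (x n) + cmod (cnj c) * u (poly_adj (x n))"
          by (intro add_mono u_scale_le star_polys_intros cs_mem x)
        also have "\<dots> = 2 * cmod c * u (x n)" using u_adj[OF cs_mem[OF x(1)]] by simp
        finally show ?thesis .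
      qed
      then show "\<exists>N. \<forall>n\<ge>N. u (h n) \<le> 2 * cmod c * u (x n)" by blast
    qed
    finally show ?thesis unfolding h_def .
  qed
  have eq: "\<psi> (cl (\<lambda>n. poly_scale c (x n) + poly_scale (cnj c) (poly_adj (x n)))) =
      c * \<psi> a + cnj c * \<psi> (cl (\<lambda>n. poly_adj (x n)))" for c
    using state_cl_add[OF \<psi> cs_scale[OF x(1)] cs_scale[OF cs_adj[OF x(1)]], of c "cnj c"]
      state_cl_scale[OF \<psi> x(1), of c] state_cl_scale[OF \<psi> cs_adj[OF x(1)], of "cnj c"] by (simp add: x)
  have "2 * \<psi> a = (1 * \<psi> a + cnj 1 * \<psi> (cl (\<lambda>n. poly_adj (x n)))) - \<i> * (\<i> * \<psi> a + cnj \<i> * \<psi> (cl (\<lambda>n. poly_adj (x n))))"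
    by (simp add: algebra_simps)
  also have "cmod \<dots> \<le> 2 * cmod 1 * cnorm A a + cmod \<i> * (2 * cmod \<i> * cnorm A a)"
    unfolding eq[symmetric]
    by (rule order_trans[OF norm_triangle_ineq4]) (intro add_mono aux, simp only: norm_mult, intro mult_left_mono aux, simp)
  finally show ?thesis by (simp add: norm_mult)
qed

section \<open>States as functionals on words\<close>

definition word_val :: "((nat \<Rightarrow> 'g star_poly) set \<Rightarrow> complex) \<Rightarrow> 'g star_word \<Rightarrow> complex" where
  "word_val \<psi> w = (if w \<in> words_over X then \<psi> (el (wpoly w)) else 0)"

lemma state_el_add: "\<psi> \<in> states A \<Longrightarrow> f \<in> star_polys X \<Longrightarrow> g \<in> star_polys X \<Longrightarrow> \<psi> (el (f + g)) = \<psi> (el f) + \<psi> (el g)"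
  using state_cl_add[OF _ cs_const cs_const] by blast

lemma state_el_scale: "\<psi> \<in> states A \<Longrightarrow> f \<in> star_polys X \<Longrightarrow> \<psi> (el (poly_scale c f)) = c * \<psi> (el f)"
  using state_cl_scale[OF _ cs_const] by blast

lemma state_el_0: "\<psi> \<in> states A \<Longrightarrow> \<psi> (el 0) = 0"
  using state_el_scale[of \<psi> 0 0] by simp

lemma lin_word_val_mem:
  assumes "\<psi> \<in> states A"
  shows "f \<in> star_polys X \<Longrightarrow> lin (word_val \<psi>) f = \<psi> (el f)"
proof (induction rule: star_polys_induct)
  case (single w c)
  then show ?case using state_el_scale[OF assms, of "wpoly w" c] by (simp add: word_val_def star_polys_single)
qed (auto simp: assms state_el_add state_el_0 lin_add)

lemma lin_word_val:
  assumes "\<psi> \<in> states A"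
  shows "lin (word_val \<psi>) f = \<psi> (el (restrict_poly X f))"
  using lin_restrict_poly[of X "word_val \<psi>" f] lin_word_val_mem[OF assms restrict_poly_mem, of f]
  by (simp add: word_val_def)

lemma alg_state_word_val:
  assumes \<psi>: "\<psi> \<in> states A"
  shows "alg_state X R (word_val \<psi>)"
proof
  show "word_val \<psi> 0 = 1" using statesD(4)[OF \<psi>] by (simp add: word_val_def one_A)
next
  fix f :: "'g star_poly"
  let ?f = "restrict_poly X f"
  have "lin (word_val \<psi>) (poly_adj f * f) = \<psi> (invol A (el ?f) \<otimes>\<^bsub>A\<^esub> el ?f)"
    by (simp add: lin_word_val[OF \<psi>] restrict_poly_mult restrict_poly_adj el_ops el_unary_ops restrict_poly_mem star_polys_adj)
  also have "\<dots> \<in> \<real>\<^sub>\<ge>\<^sub>0" by (intro statesD(3)[OF \<psi>] el_carrier restrict_poly_mem)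
  finally show "lin (word_val \<psi>) (poly_adj f * f) \<in> \<real>\<^sub>\<ge>\<^sub>0" .
next
  fix r g h assume r: "r \<in> R"
  then have rm: "r \<in> star_polys X" using R_mem by auto
  let ?g = "restrict_poly X g" and ?h = "restrict_poly X h"
  have m: "?g * r * ?h \<in> star_polys X" by (intro star_polys_mult restrict_poly_mem rm)
  have "u (?g * r * ?h) \<le> u ?g * u r * u ?h"
    by (intro order_trans[OF u_mult] mult_right_mono u_mult u_nonneg star_polys_mult restrict_poly_mem rm)
  then have "u (?g * r * ?h - 0) = 0" using u_rel[OF r] u_nonneg[OF m] by simp
  then have "el (?g * r * ?h) = el 0" by (intro el_eqI m star_polys_zero)
  then show "lin (word_val \<psi>) (g * r * h) = 0"
    by (simp add: lin_word_val[OF \<psi>] restrict_poly_mult restrict_poly_id[OF rm] state_el_0[OF \<psi>])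
qed (simp add: word_val_def)

definition extend :: "('g star_word \<Rightarrow> complex) \<Rightarrow> (nat \<Rightarrow> 'g star_poly) set \<Rightarrow> complex" where
  "extend \<phi> = (\<lambda>\<xi>\<in>carrier A. lim (\<lambda>n. lin \<phi> ((SOME x. x \<in> \<xi>) n)))"

text \<open>By \<open>alg_state_le_u\<close> the values along a Cauchy sequence converge, and the
  limit does not depend on the representative that \<open>extend\<close> picks.\<close>

lemma extend_cl:
  assumes \<phi>: "alg_state X R \<phi>" and x: "x \<in> cs"
  shows "(\<lambda>n. lin \<phi> (x n)) \<longlonglongrightarrow> extend \<phi> (cl x)"
proof -
  have le: "cmod (lin \<phi> f - lin \<phi> g) \<le> u (f - g)" if "f \<in> star_polys X" "g \<in> star_polys X" for f g
    using alg_state_le_u[OF \<phi> star_polys_diff[OF that]] by (simp add: lin_diff)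
  have conv: "convergent (\<lambda>n. lin \<phi> (y n))" if y: "y \<in> cs" for y
  proof (rule Cauchy_convergent, unfold Cauchy_def, intro allI impI)
    fix e :: real assume "e > 0"
    then obtain M where M: "\<And>m n. m \<ge> M \<Longrightarrow> n \<ge> M \<Longrightarrow> u (y m - y n) < e" using cs_cauchy[OF y] by blast
    have "dist (lin \<phi> (y m)) (lin \<phi> (y n)) < e" if "m \<ge> M" "n \<ge> M" for m n
      using M[OF that] le[OF cs_mem[OF y, of m] cs_mem[OF y, of n]] by (simp add: dist_norm)
    then show "\<exists>M. \<forall>m\<ge>M. \<forall>n\<ge>M. dist (lin \<phi> (y m)) (lin \<phi> (y n)) < e" by blast
  qed
  define y where "y = (SOME y. y \<in> cl x)"
  have y: "y \<in> cl x" unfolding y_def by (rule someI[of _ x]) (rule cl_self[OF x])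
  then have yc: "y \<in> cs" and n: "(\<lambda>n. u (x n - y n)) \<longlonglongrightarrow> 0" by (auto simp: cl_iff)
  have "extend \<phi> (cl x) = lim (\<lambda>n. lin \<phi> (y n))" by (simp add: extend_def y_def x)
  then have "(\<lambda>n. lin \<phi> (y n)) \<longlonglongrightarrow> extend \<phi> (cl x)" using conv[OF yc] by (simp add: convergent_LIMSEQ_iff)
  moreover have "(\<lambda>n. lin \<phi> (x n) - lin \<phi> (y n)) \<longlonglongrightarrow> 0"
    by (rule Lim_null_comparison[OF _ n]) (auto intro!: always_eventually le cs_mem x yc)
  ultimately have "(\<lambda>n. (lin \<phi> (x n) - lin \<phi> (y n)) + lin \<phi> (y n)) \<longlonglongrightarrow> 0 + extend \<phi> (cl x)" by (intro tendsto_add)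
  then show ?thesis by simp
qed

lemma extend_el: "alg_state X R \<phi> \<Longrightarrow> f \<in> star_polys X \<Longrightarrow> extend \<phi> (el f) = lin \<phi> f"
  using extend_cl[OF _ cs_const] LIMSEQ_unique[OF _ tendsto_const] by blast

lemma extend_state:
  assumes \<phi>: "alg_state X R \<phi>"
  shows "extend \<phi> \<in> states A"
  unfolding states_def
proof (intro CollectI conjI ballI allI)
  interpret alg_state X R \<phi> by (rule \<phi>)
  show "extend \<phi> \<in> extensional (carrier A)" by (simp add: extend_def)
  show "extend \<phi> \<one>\<^bsub>A\<^esub> = 1" by (simp add: one_A extend_el[OF \<phi>] unit)
  fix a assume "a \<in> carrier A"
  then obtain x where x: "x \<in> cs" "a = cl x" by (auto elim!: carrierE)
  { fix c
    have "(\<lambda>n. lin \<phi> (poly_scale c (x n))) \<longlonglongrightarrow> c * extend \<phi> a"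
      unfolding lin_scale x by (intro tendsto_intros extend_cl[OF \<phi>] x)
    then show "extend \<phi> (c \<odot>\<^bsub>A\<^esub> a) = c * extend \<phi> a"
      unfolding x cl_scale[OF x(1)] using extend_cl[OF \<phi> cs_scale[OF x(1)]] LIMSEQ_unique by blast }
  { have "(\<lambda>n. lin \<phi> (poly_adj (x n) * x n)) \<longlonglongrightarrow> extend \<phi> (invol A a \<otimes>\<^bsub>A\<^esub> a)"
      unfolding x cl_invol[OF x(1)] cl_mult[OF cs_adj[OF x(1)] x(1)] by (intro extend_cl[OF \<phi>] cs_mult cs_adj x)
    moreover have "closed (\<real>\<^sub>\<ge>\<^sub>0 :: complex set)" by (rule closed_nonneg_Reals_complex)
    ultimately show "extend \<phi> (invol A a \<otimes>\<^bsub>A\<^esub> a) \<in> \<real>\<^sub>\<ge>\<^sub>0"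
      using pos_lin by (meson closed_sequentially) }
  fix b assume "b \<in> carrier A"
  then obtain y where y: "y \<in> cs" "b = cl y" by (auto elim!: carrierE)
  have "(\<lambda>n. lin \<phi> (x n + y n)) \<longlonglongrightarrow> extend \<phi> a + extend \<phi> b"
    unfolding lin_add x y by (intro tendsto_intros extend_cl[OF \<phi>] x y)
  then show "extend \<phi> (a \<oplus>\<^bsub>A\<^esub> b) = extend \<phi> a + extend \<phi> b"
    unfolding x y cl_add[OF x(1) y(1)] using extend_cl[OF \<phi> cs_add[OF x(1) y(1)]] LIMSEQ_unique by blast
qed

lemma state_diff:
  assumes "\<psi> \<in> states A" "a \<in> carrier A" "b \<in> carrier A"
  shows "\<psi> (a \<ominus>\<^bsub>A\<^esub> b) = \<psi> a - \<psi> b"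
  using assms(2,3) state_cl_diff[OF assms(1)] by (auto elim!: carrierE simp: cl_minus)

lemma state_lim:
  assumes \<psi>: "\<psi> \<in> states A" and x: "x \<in> cs"
  shows "(\<lambda>n. \<psi> (el (x n))) \<longlonglongrightarrow> \<psi> (cl x)"
proof -
  have "(\<lambda>n. \<psi> (cl x) - \<psi> (el (x n))) \<longlonglongrightarrow> 0"
  proof (rule Lim_null_comparison)
    show "(\<lambda>n. 2 * cnorm A (cl x \<ominus>\<^bsub>A\<^esub> el (x n))) \<longlonglongrightarrow> 0"
      using tendsto_mult[OF tendsto_const el_approx[OF x], of 2] by simp
    have "norm (\<psi> (cl x) - \<psi> (el (x n))) \<le> 2 * cnorm A (cl x \<ominus>\<^bsub>A\<^esub> el (x n))" for n
      using state_bound[OF \<psi>, of "cl x \<ominus>\<^bsub>A\<^esub> el (x n)"] x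
      by (simp add: state_diff[OF \<psi>] cs_mem cs_const)
    then show "\<forall>\<^sub>F n in sequentially. norm (\<psi> (cl x) - \<psi> (el (x n))) \<le> 2 * cnorm A (cl x \<ominus>\<^bsub>A\<^esub> el (x n))"
      by simp
  qed
  from tendsto_diff[OF tendsto_const[of "\<psi> (cl x)"] this] show ?thesis by simp
qed

text \<open>Together with \<open>word_val_extend\<close> this makes states of the completion and
  \<open>alg_state\<close> functionals correspond one to one; from here on states are handled
  through their values on words.\<close>

lemma extend_word_val:
  assumes \<psi>: "\<psi> \<in> states A"
  shows "extend (word_val \<psi>) = \<psi>"
proof (rule extensionalityI[of _ "carrier A"])
  fix a assume "a \<in> carrier A"
  then obtain x where x: "x \<in> cs" "a = cl x" by (auto elim!: carrierE)
  have "(\<lambda>n. lin (word_val \<psi>) (x n)) \<longlonglongrightarrow> \<psi> a"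
    using state_lim[OF \<psi> x(1)] by (simp add: lin_word_val_mem[OF \<psi>] cs_mem x)
  then show "extend (word_val \<psi>) a = \<psi> a"
    using extend_cl[OF alg_state_word_val[OF \<psi>] x(1)] LIMSEQ_unique x(2) by blast
qed (auto simp: extend_def statesD[OF \<psi>])

lemma word_val_extend:
  assumes \<phi>: "alg_state X R \<phi>"
  shows "word_val (extend \<phi>) = \<phi>"
  using alg_state.outside[OF \<phi>] extend_el[OF \<phi>]
  by (auto simp: word_val_def star_polys_single fun_eq_iff)

lemma tracialI:
  assumes \<psi>: "\<psi> \<in> states A" and tr: "\<And>v w. word_val \<psi> (v + w) = word_val \<psi> (w + v)"
  shows "\<psi> \<in> tracial_states A"
proof -
  have lin: "lin (word_val \<psi>) (f * g) = lin (word_val \<psi>) (g * f)" for f g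
  proof (induction f rule: star_poly_induct)
    case (single v c)
    show ?case
      by (induction g rule: star_poly_induct) (auto simp: mult_single lin_add distrib_left distrib_right tr)
  qed (auto simp: lin_add distrib_left distrib_right)
  have "\<psi> (a \<otimes>\<^bsub>A\<^esub> b) = \<psi> (b \<otimes>\<^bsub>A\<^esub> a)" if ab: "a \<in> carrier A" "b \<in> carrier A" for a b
  proof -
    obtain x y where x: "x \<in> cs" "a = cl x" and y: "y \<in> cs" "b = cl y"
      using ab by (auto elim!: carrierE)
    have "\<psi> (el (x n * y n)) = \<psi> (el (y n * x n))" for n
      using lin[of "x n" "y n"] x y by (simp add: lin_word_val_mem[OF \<psi>] star_polys_mult cs_mem)
    then show ?thesis
      using state_lim[OF \<psi> cs_mult[OF x(1) y(1)]] state_lim[OF \<psi> cs_mult[OF y(1) x(1)]] LIMSEQ_unique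
      by (simp add: x y cl_mult)
  qed
  then show ?thesis using \<psi> by (simp add: tracial_states_def)
qed

lemma tracialD:
  assumes \<psi>: "\<psi> \<in> tracial_states A"
  shows "word_val \<psi> (v + w) = word_val \<psi> (w + v)"
proof (cases "v \<in> words_over X \<and> w \<in> words_over X")
  case True
  then have "\<psi> (el (wpoly v) \<otimes>\<^bsub>A\<^esub> el (wpoly w)) = \<psi> (el (wpoly w) \<otimes>\<^bsub>A\<^esub> el (wpoly v))"
    using \<psi> by (simp add: tracial_states_def star_polys_single)
  then show ?thesis using True by (simp add: el_ops star_polys_single word_val_def wpoly_plus)
next
  case False
  then show ?thesis by (auto simp: word_val_def)
qed

section \<open>The weak* topology\<close>

lemma topspace_weak_star: "K \<subseteq> states A \<Longrightarrow> topspace (weak_star A K) = K"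
  by (auto simp: weak_star_def PiE_def dest: statesD)

text \<open>Evaluations at words suffice: a polynomial is a finite combination of words, and by
  \<open>state_bound\<close> evaluation at any element is a limit of evaluations at polynomials,
  uniformly over all states.\<close>

lemma continuous_map_weak_star:
  assumes K: "K \<subseteq> states A" and F: "\<And>z. z \<in> topspace Z \<Longrightarrow> F z \<in> K"
    and c: "\<And>w. w \<in> words_over X \<Longrightarrow> continuous_map Z euclidean (\<lambda>z. F z (el (wpoly w)))"
  shows "continuous_map Z (weak_star A K) F"
proof -
  have el: "continuous_map Z euclidean (\<lambda>z. F z (el f))" if "f \<in> star_polys X" for f
  proof -
    have "continuous_map Z euclidean (\<lambda>z. \<Sum>w\<in>Poly_Mapping.keys f. Poly_Mapping.lookup f w * F z (el (wpoly w)))"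
      using that by (intro continuous_map_sum continuous_map_cmult c) (auto simp: star_polys_iff)
    moreover have "F z (el f) = (\<Sum>w\<in>Poly_Mapping.keys f. Poly_Mapping.lookup f w * F z (el (wpoly w)))" if z: "z \<in> topspace Z" for z
    proof -
      have "F z \<in> states A" using F[OF z] K by auto
      then have "F z (el f) = (\<Sum>w\<in>Poly_Mapping.keys f. Poly_Mapping.lookup f w * word_val (F z) w)"
        using lin_word_val_mem[OF _ \<open>f \<in> star_polys X\<close>] by (simp add: lin_def)
      also have "\<dots> = (\<Sum>w\<in>Poly_Mapping.keys f. Poly_Mapping.lookup f w * F z (el (wpoly w)))"
        using \<open>f \<in> star_polys X\<close> by (intro sum.cong) (auto simp: word_val_def star_polys_iff)
      finally show ?thesis .
    qed
    ultimately show ?thesis by (rule continuous_map_eq[OF _ sym])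
  qed
  have "continuous_map Z euclidean (\<lambda>z. F z a)" if a: "a \<in> carrier A" for a
  proof (rule continuous_map_approx)
    fix e :: real assume "e > 0"
    then obtain f where f: "f \<in> star_polys X" "cnorm A (a \<ominus>\<^bsub>A\<^esub> el f) < e / 2" using el_dense[OF a, of "e/2"] by auto
    have "cmod (F z (el f) - F z a) < e" if z: "z \<in> topspace Z" for z
    proof -
      have s: "F z \<in> states A" using F[OF z] K by auto
      have "cmod (F z a - F z (el f)) \<le> 2 * cnorm A (a \<ominus>\<^bsub>A\<^esub> el f)"
        using state_bound[OF s, of "a \<ominus>\<^bsub>A\<^esub> el f"] a f by (simp add: state_diff[OF s] cs_const)
      then show ?thesis using f by (simp add: norm_minus_commute)
    qed
    then show "\<exists>g. continuous_map Z euclidean g \<and> (\<forall>z\<in>topspace Z. cmod (g z - F z a) < e)"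
      using el[OF f(1)] by blast
  qed
  moreover have "F ` topspace Z \<subseteq> extensional (carrier A)" using F K by (auto dest!: statesD(5) subsetD)
  ultimately show ?thesis using F
    by (auto simp: weak_star_def continuous_map_in_subtopology continuous_map_componentwise)
qed

lemma Hausdorff_weak_star: "Hausdorff_space (weak_star A K)"
  unfolding weak_star_def
  by (intro Hausdorff_space_subtopology) (simp add: Hausdorff_space_product_topology)

text \<open>The Banach-Alaoglu argument: \<open>state_bound\<close> places the traces in a product
  of discs, and each defining condition cuts out a closed subset.\<close>

lemma compact_tracial_states: "compact_space (weak_star A (tracial_states A))"
proof -
  let ?P = "product_topology (\<lambda>_. euclidean :: complex topology) (carrier A)"
  let ?B = "PiE (carrier A) (\<lambda>a. cball 0 (2 * cnorm A a))"
  have B: "compactin ?P ?B" by (simp add: compactin_PiE)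
  have ev: "continuous_map ?P euclidean (\<lambda>\<psi>. \<psi> a)" if "a \<in> carrier A" for a
    by (rule continuous_map_product_projection[OF that])
  have eq: "closedin ?P {\<psi> \<in> topspace ?P. f \<psi> = g \<psi>}"
    if "continuous_map ?P euclidean f" "continuous_map ?P euclidean g" for f g :: "_ \<Rightarrow> complex"
    by (rule closedin_continuous_maps_eq[OF _ that]) simp
  define C1 where "C1 = (\<Inter>a\<in>carrier A. \<Inter>b\<in>carrier A. {\<psi> \<in> topspace ?P. \<psi> (a \<oplus>\<^bsub>A\<^esub> b) = \<psi> a + \<psi> b})"
  define C2 where "C2 = (\<Inter>c\<in>UNIV. \<Inter>a\<in>carrier A. {\<psi> \<in> topspace ?P. \<psi> (c \<odot>\<^bsub>A\<^esub> a) = c * \<psi> a})"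
  define C3 where "C3 = (\<Inter>a\<in>carrier A. {\<psi> \<in> topspace ?P. \<psi> (invol A a \<otimes>\<^bsub>A\<^esub> a) \<in> \<real>\<^sub>\<ge>\<^sub>0})"
  define C4 where "C4 = {\<psi> \<in> topspace ?P. \<psi> \<one>\<^bsub>A\<^esub> = 1}"
  define C5 where "C5 = (\<Inter>a\<in>carrier A. \<Inter>b\<in>carrier A. {\<psi> \<in> topspace ?P. \<psi> (a \<otimes>\<^bsub>A\<^esub> b) = \<psi> (b \<otimes>\<^bsub>A\<^esub> a)})"
  have ne: "carrier A \<noteq> {}" using el_carrier[OF star_polys_one] by blast
  have one: "\<one>\<^bsub>A\<^esub> \<in> carrier A" by (simp add: one_A cs_const)
  have "closedin ?P C1" unfolding C1_def
    by (intro closedin_INT ne eq continuous_map_add ev A_closed)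
  moreover have "closedin ?P C2" unfolding C2_def
    by (intro closedin_INT ne eq continuous_map_cmult ev A_closed) auto
  moreover have "closedin ?P C3" unfolding C3_def
    by (intro closedin_INT ne closedin_continuous_map_preimage[OF ev] A_closed) (simp add: closed_nonneg_Reals_complex)+
  moreover have "closedin ?P C4" unfolding C4_def
    by (intro eq ev one) simp
  moreover have "closedin ?P C5" unfolding C5_def
    by (intro closedin_INT ne eq ev A_closed)
  ultimately have "compactin ?P (?B \<inter> (C1 \<inter> C2 \<inter> C3 \<inter> C4 \<inter> C5))"
    by (intro compact_Int_closedin B closedin_Int)
  moreover have "?B \<inter> (C1 \<inter> C2 \<inter> C3 \<inter> C4 \<inter> C5) = tracial_states A"
  proof (intro equalityI subsetI)
    fix \<psi> assume \<psi>: "\<psi> \<in> ?B \<inter> (C1 \<inter> C2 \<inter> C3 \<inter> C4 \<inter> C5)"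
    have "\<psi> \<in> extensional (carrier A)" using \<psi> by (auto simp: PiE_def)
    moreover have "\<forall>a\<in>carrier A. \<forall>b\<in>carrier A. \<psi> (a \<oplus>\<^bsub>A\<^esub> b) = \<psi> a + \<psi> b" using \<psi> unfolding C1_def by blast
    moreover have "\<forall>c. \<forall>a\<in>carrier A. \<psi> (c \<odot>\<^bsub>A\<^esub> a) = c * \<psi> a" using \<psi> unfolding C2_def by blast
    moreover have "\<forall>a\<in>carrier A. \<psi> (invol A a \<otimes>\<^bsub>A\<^esub> a) \<in> \<real>\<^sub>\<ge>\<^sub>0" using \<psi> unfolding C3_def by blast
    moreover have "\<psi> \<one>\<^bsub>A\<^esub> = 1" using \<psi> unfolding C4_def by blast
    moreover have "\<forall>a\<in>carrier A. \<forall>b\<in>carrier A. \<psi> (a \<otimes>\<^bsub>A\<^esub> b) = \<psi> (b \<otimes>\<^bsub>A\<^esub> a)" using \<psi> unfolding C5_def by blast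
    ultimately show "\<psi> \<in> tracial_states A" unfolding tracial_states_def states_def by blast
  next
    fix \<psi> assume "\<psi> \<in> tracial_states A"
    then have s: "\<psi> \<in> states A" and t: "\<And>a b. a \<in> carrier A \<Longrightarrow> b \<in> carrier A \<Longrightarrow> \<psi> (a \<otimes>\<^bsub>A\<^esub> b) = \<psi> (b \<otimes>\<^bsub>A\<^esub> a)"
      by (auto simp: tracial_states_def)
    have "\<psi> \<in> ?B" using state_bound[OF s] statesD(5)[OF s] by (auto simp: PiE_def)
    moreover have T: "\<psi> \<in> topspace ?P" using statesD(5)[OF s] by (simp add: PiE_def)
    moreover have "\<psi> \<in> C1" unfolding C1_def by (intro INT_I CollectI conjI T statesD(1)[OF s])
    moreover have "\<psi> \<in> C2" unfolding C2_def by (intro INT_I CollectI conjI T statesD(2)[OF s])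
    moreover have "\<psi> \<in> C3" unfolding C3_def by (intro INT_I CollectI conjI T statesD(3)[OF s])
    moreover have "\<psi> \<in> C4" unfolding C4_def by (intro CollectI conjI T statesD(4)[OF s])
    moreover have "\<psi> \<in> C5" unfolding C5_def by (intro INT_I CollectI conjI T t)
    ultimately show "\<psi> \<in> ?B \<inter> (C1 \<inter> C2 \<inter> C3 \<inter> C4 \<inter> C5)" by blast
  qed
  ultimately show ?thesis by (simp add: weak_star_def compact_space_subtopology)
qed

end


section \<open>The dynamics\<close>

fun letter_weight :: "('g \<Rightarrow> real) \<Rightarrow> 'g letter \<Rightarrow> real" where
  "letter_weight l (Gen g) = l g"
| "letter_weight l (Adj g) = - l g"

definition word_weight :: "('g \<Rightarrow> real) \<Rightarrow> 'g star_word \<Rightarrow> real" where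
  "word_weight l w = sum_list (map (letter_weight l) (letters w))"

lemma word_weight_0 [simp]: "word_weight l 0 = 0"
  by (simp add: word_weight_def zero_star_word_def)

lemma word_weight_plus [simp]: "word_weight l (v + w) = word_weight l v + word_weight l w"
  by (simp add: word_weight_def plus_star_word_def)

lemma word_weight_letter [simp]: "word_weight l (Word [x]) = letter_weight l x"
  by (simp add: word_weight_def)

lemma word_weight_adj [simp]: "word_weight l (word_adj w) = - word_weight l w"
proof -
  have "letter_weight l (letter_adj x) = - letter_weight l x" for x by (cases x) auto
  then have "sum_list (map (letter_weight l) (rev (map letter_adj xs))) = - sum_list (map (letter_weight l) xs)" for xs
    by (induction xs) auto
  then show ?thesis by (simp add: word_weight_def word_adj_def)
qed

definition weigh :: "('w \<Rightarrow> complex) \<Rightarrow> ('w \<Rightarrow>\<^sub>0 complex) \<Rightarrow> ('w \<Rightarrow>\<^sub>0 complex)" where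
  "weigh c f = (\<Sum>w\<in>Poly_Mapping.keys f. Poly_Mapping.single w (c w * Poly_Mapping.lookup f w))"

lemma lookup_weigh [simp]: "Poly_Mapping.lookup (weigh c f) w = c w * Poly_Mapping.lookup f w"
  by (simp add: weigh_def lookup_sum lookup_single when_def in_keys_iff if_distrib cong: if_cong)

lemma weigh_add: "weigh c (f + g) = weigh c f + weigh c g"
  by (rule poly_mapping_eqI) (simp add: lookup_add algebra_simps)

lemma weigh_zero [simp]: "weigh c 0 = 0"
  by (rule poly_mapping_eqI) simp

lemma weigh_diff: "weigh c (f - g) = weigh c f - weigh c g"
  by (rule poly_mapping_eqI) (simp add: lookup_minus algebra_simps)

lemma weigh_single [simp]: "weigh c (Poly_Mapping.single w d) = Poly_Mapping.single w (c w * d)"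
  by (rule poly_mapping_eqI) (simp add: lookup_single when_def)

lemma poly_scale_zero_right [simp]: "poly_scale c 0 = 0"
  by (simp add: poly_scale_def)

lemma lookup_poly_scale [simp]: "Poly_Mapping.lookup (poly_scale c f) w = c * Poly_Mapping.lookup f w"
  by (induction f rule: star_poly_induct)
    (auto simp: poly_scale_add lookup_add lookup_single when_def algebra_simps)

lemma weigh_scale: "weigh c (poly_scale d f) = poly_scale d (weigh c f)"
  by (rule poly_mapping_eqI) simp

lemma weigh_weigh: "weigh c (weigh d f) = weigh (\<lambda>w. c w * d w) f"
  by (rule poly_mapping_eqI) simp

lemma weigh_mem: "f \<in> star_polys X \<Longrightarrow> weigh c f \<in> star_polys X"
  by (auto simp: star_polys_iff in_keys_iff)

text \<open>With \<open>l\<close> the logarithm of the scale, real \<open>z\<close> gives the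
  dynamics on polynomials, and complex \<open>z\<close> its entire extension.\<close>

definition rot :: "('g \<Rightarrow> real) \<Rightarrow> complex \<Rightarrow> 'g star_poly \<Rightarrow> 'g star_poly" where
  "rot l z = weigh (\<lambda>w. exp (\<i> * z * word_weight l w))"

lemma rot_add: "rot l z (f + g) = rot l z f + rot l z g"
  and rot_diff: "rot l z (f - g) = rot l z f - rot l z g"
  and rot_zero [simp]: "rot l z 0 = 0"
  and rot_scale: "rot l z (poly_scale c f) = poly_scale c (rot l z f)"
  and rot_mem: "f \<in> star_polys X \<Longrightarrow> rot l z f \<in> star_polys X"
  by (simp_all add: rot_def weigh_add weigh_diff weigh_scale weigh_mem)

lemma rot_single [simp]:
  "rot l z (Poly_Mapping.single w c) = Poly_Mapping.single w (exp (\<i> * z * word_weight l w) * c)"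
  by (simp add: rot_def)

lemma rot_rot: "rot l z (rot l z' f) = rot l (z + z') f"
  by (simp add: rot_def weigh_weigh algebra_simps flip: exp_add)

lemma rot_0 [simp]: "rot l 0 f = f"
  by (rule poly_mapping_eqI) (simp add: rot_def)

lemma rot_mult: "rot l z (f * g) = rot l z f * rot l z g"
proof (induction f rule: star_poly_induct)
  case (single w c)
  show ?case
    by (induction g rule: star_poly_induct)
       (simp_all add: mult_single rot_add algebra_simps exp_add)
qed (simp_all add: rot_add algebra_simps)

lemma rot_adj: "rot l (of_real t) (poly_adj f) = poly_adj (rot l (of_real t) f)"
  by (rule poly_mapping_eqI) (simp add: rot_def lookup_poly_adj exp_cnj)

lemma rot_homogeneous:
  assumes "\<And>w. w \<in> Poly_Mapping.keys f \<Longrightarrow> word_weight l w = c"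
  shows "rot l z f = poly_scale (exp (\<i> * z * c)) f"
  by (rule poly_mapping_eqI) (use assms in \<open>auto simp: rot_def in_keys_iff\<close>)

text \<open>Bilinearity reduces this to words, on which \<open>rot\<close> at \<i> \<beta> is
  multiplication by \<open>exp (- \<beta> * word_weight l w)\<close>.\<close>

lemma lin_kms:
  fixes \<phi> :: "'g star_word \<Rightarrow> complex"
  assumes kms: "\<And>v w. \<phi> (w + v) = exp (- \<beta> * word_weight l w) * \<phi> (v + w)"
  shows "lin \<phi> (f * g) = lin \<phi> (g * rot l (\<i> * of_real \<beta>) f)"
proof (induction f rule: star_poly_induct)
  case (single w c)
  have "exp (\<i> * (\<i> * of_real \<beta>) * of_real (word_weight l w)) = complex_of_real (exp (- \<beta> * word_weight l w))"
    by (simp add: exp_of_real[symmetric] flip: mult.assoc)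
  then have rs: "rot l (\<i> * of_real \<beta>) (Poly_Mapping.single w c)
      = Poly_Mapping.single w (complex_of_real (exp (- \<beta> * word_weight l w)) * c)"
    by (simp only: rot_single)
  show ?case unfolding rs
  proof (induction g rule: star_poly_induct)
    case (single v d)
    show ?case unfolding mult_single lin_single kms[of w v] by (simp only: mult_ac)
  qed (simp_all add: lin_add distrib_left distrib_right)
qed (auto simp: lin_add distrib_left distrib_right rot_add)

text \<open>Homogeneity makes \<open>rot\<close> multiply each relation by a scalar, so that the
  dynamics descends to the universal algebra.\<close>

locale graded_presentation = isometric_presentation X R
  for X :: "'g set" and R :: "'g star_poly set" +
  fixes l :: "'g \<Rightarrow> real"
  assumes homogeneous: "r \<in> R \<Longrightarrow> \<exists>c. \<forall>w\<in>Poly_Mapping.keys r. word_weight l w = c"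
begin

text \<open>For real \<open>t\<close> an admissible seminorm composed with \<open>rot\<close> is
  again admissible, hence lies below the supremum.\<close>

lemma u_rot_le:
  assumes f: "f \<in> star_polys X"
  shows "u (rot l (of_real t) f) \<le> u f"
proof (rule u_least)
  fix p assume p: "p \<in> seminorms"
  have "(\<lambda>f. p (rot l (of_real t) f)) \<in> seminorms"
    unfolding seminorms_def cstar_seminorm_def
  proof (intro CollectI conjI ballI allI)
    fix r assume r: "r \<in> R"
    then obtain c where c: "\<forall>w\<in>Poly_Mapping.keys r. word_weight l w = c" using homogeneous by blast
    have "p (rot l (of_real t) r) = cmod (exp (\<i> * of_real t * c)) * p r"
      using seminormD(2)[OF p, of r "exp (\<i> * of_real t * c)"] rot_homogeneous[of r l c "of_real t"] r R_mem c by auto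
    then show "p (rot l (of_real t) r) = 0" using seminormD(6)[OF p r] by simp
  qed (use seminormD[OF p] in \<open>simp_all add: rot_add rot_mult rot_scale rot_adj rot_mem\<close>)
  from u_upper[OF this f] show "p (rot l (of_real t) f) \<le> u f" .
qed

lemma u_rot:
  assumes f: "f \<in> star_polys X"
  shows "u (rot l (of_real t) f) = u f"
  using u_rot_le[OF f, of t] u_rot_le[OF rot_mem[OF f], of "- t" l "of_real t"] by (simp add: rot_rot)

lemma cs_rot:
  assumes x: "x \<in> cs"
  shows "(\<lambda>n. rot l (of_real t) (x n)) \<in> cs"
proof (rule cs_dominated[OF x cs_const[OF star_polys_zero], where K = 1])
  fix m n
  show "u (rot l (of_real t) (x m) - rot l (of_real t) (x n)) \<le> 1 * (u (x m - x n) + u (0 - 0))"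
    using u_rot_le[of "x m - x n" t] x by (simp add: cs_mem star_polys_diff rot_diff)
qed (intro rot_mem cs_mem x)

definition dyn :: "real \<Rightarrow> (nat \<Rightarrow> 'g star_poly) set \<Rightarrow> (nat \<Rightarrow> 'g star_poly) set" where
  "dyn t = (\<lambda>\<xi>\<in>carrier A. cl (\<lambda>n. rot l (of_real t) ((SOME x. x \<in> \<xi>) n)))"

lemma dyn_cl:
  assumes x: "x \<in> cs"
  shows "dyn t (cl x) = cl (\<lambda>n. rot l (of_real t) (x n))"
proof -
  define y where "y = (SOME y. y \<in> cl x)"
  have "y \<in> cl x" unfolding y_def by (rule someI[of _ x]) (rule cl_self[OF x])
  then have y: "y \<in> cs" "(\<lambda>n. u (x n - y n)) \<longlonglongrightarrow> 0" by (auto simp: cl_iff)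
  have "cl (\<lambda>n. rot l (of_real t) (y n)) = cl (\<lambda>n. rot l (of_real t) (x n))"
    by (rule sym, rule cl_eqI[OF cs_rot[OF x] cs_rot[OF y(1)]])
       (use y in \<open>simp add: u_rot star_polys_diff cs_mem x flip: rot_diff\<close>)
  then show ?thesis by (simp add: dyn_def x y_def)
qed

lemma dyn_el: "f \<in> star_polys X \<Longrightarrow> dyn t (el f) = el (rot l (of_real t) f)"
  by (simp add: dyn_cl cs_const)

lemma dyn_carrier [simp, intro]: "a \<in> carrier A \<Longrightarrow> dyn t a \<in> carrier A"
  by (auto elim!: carrierE simp: dyn_cl intro!: cl_carrier cs_rot)

lemma dyn_add: "a \<in> carrier A \<Longrightarrow> b \<in> carrier A \<Longrightarrow> dyn t (a \<oplus>\<^bsub>A\<^esub> b) = dyn t a \<oplus>\<^bsub>A\<^esub> dyn t b"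
  by (auto elim!: carrierE simp: dyn_cl cl_add cs_add cs_rot rot_add)

lemma dyn_mult: "a \<in> carrier A \<Longrightarrow> b \<in> carrier A \<Longrightarrow> dyn t (a \<otimes>\<^bsub>A\<^esub> b) = dyn t a \<otimes>\<^bsub>A\<^esub> dyn t b"
  by (auto elim!: carrierE simp: dyn_cl cl_mult cs_mult cs_rot rot_mult)

lemma dyn_minus: "a \<in> carrier A \<Longrightarrow> b \<in> carrier A \<Longrightarrow> dyn t (a \<ominus>\<^bsub>A\<^esub> b) = dyn t a \<ominus>\<^bsub>A\<^esub> dyn t b"
  by (auto elim!: carrierE simp: dyn_cl cl_minus cs_diff cs_rot rot_diff)

lemma dyn_scale: "a \<in> carrier A \<Longrightarrow> dyn t (c \<odot>\<^bsub>A\<^esub> a) = c \<odot>\<^bsub>A\<^esub> dyn t a"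
  by (auto elim!: carrierE simp: dyn_cl cl_scale cs_scale cs_rot rot_scale)

lemma dyn_invol: "a \<in> carrier A \<Longrightarrow> dyn t (invol A a) = invol A (dyn t a)"
  by (auto elim!: carrierE simp: dyn_cl cl_invol cs_adj cs_rot rot_adj)

lemma dyn_dyn: "a \<in> carrier A \<Longrightarrow> dyn s (dyn t a) = dyn (s + t) a"
  by (auto elim!: carrierE simp: dyn_cl cs_rot rot_rot)

lemma dyn_0: "a \<in> carrier A \<Longrightarrow> dyn 0 a = a"
  by (auto elim!: carrierE simp: dyn_cl)

lemma cnorm_dyn: "a \<in> carrier A \<Longrightarrow> cnorm A (dyn t a) = cnorm A a"
proof (elim carrierE)
  fix x assume x: "x \<in> cs" "a = cl x"
  have "(\<lambda>n. u (rot l (of_real t) (x n))) = (\<lambda>n. u (x n))" by (intro ext u_rot cs_mem x)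
  then show ?thesis unfolding x dyn_cl[OF x(1)]
    using cnorm_cl[OF cs_rot[OF x(1)], of t] cnorm_cl[OF x(1)] by (simp add: LIMSEQ_unique)
qed

lemma star_automorphism_dyn: "star_automorphism A (dyn t)"
  unfolding star_automorphism_def
proof (intro conjI ballI allI)
  show "bij_betw (dyn t) (carrier A) (carrier A)"
    by (rule bij_betwI[where g = "dyn (- t)"]) (auto simp: dyn_dyn dyn_0)
qed (simp_all add: dyn_add dyn_mult dyn_scale dyn_invol cnorm_dyn, simp add: dyn_def)

lemma cnorm_minus_0:
  assumes "a \<in> carrier A" "b \<in> carrier A" "cnorm A (a \<ominus>\<^bsub>A\<^esub> b) = 0"
  shows "a = b"
proof -
  obtain x y where x: "x \<in> cs" "a = cl x" and y: "y \<in> cs" "b = cl y"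
    using assms by (auto elim!: carrierE)
  show ?thesis using assms(3) cnorm_cl[OF cs_diff[OF x(1) y(1)]] unfolding x y
    by (intro cl_eqI x y) (simp add: cl_minus x y)
qed

lemma minus_scale: "a \<in> carrier A \<Longrightarrow> b \<in> carrier A \<Longrightarrow> a \<ominus>\<^bsub>A\<^esub> b = a \<oplus>\<^bsub>A\<^esub> ((-1) \<odot>\<^bsub>A\<^esub> b)"
  by (auto elim!: carrierE simp: cl_minus cl_scale cl_add cs_scale cs_uminus poly_scale_neg1)

lemma cnorm_triangle3:
  assumes "a \<in> carrier A" "b \<in> carrier A" "c \<in> carrier A"
  shows "cnorm A (a \<ominus>\<^bsub>A\<^esub> c) \<le> cnorm A (a \<ominus>\<^bsub>A\<^esub> b) + cnorm A (b \<ominus>\<^bsub>A\<^esub> c)"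
proof -
  have "a \<ominus>\<^bsub>A\<^esub> c = (a \<ominus>\<^bsub>A\<^esub> b) \<oplus>\<^bsub>A\<^esub> (b \<ominus>\<^bsub>A\<^esub> c)"
    using assms by (auto elim!: carrierE simp: cl_minus cl_add cs_diff)
  then show ?thesis using cnorm_triangle[of "a \<ominus>\<^bsub>A\<^esub> b" "b \<ominus>\<^bsub>A\<^esub> c"] assms by simp
qed

lemma dyn_unique:
  assumes \<alpha>: "star_automorphism A \<alpha>"
    and gen: "\<And>x. x \<in> X \<Longrightarrow> \<alpha> (el (poly_gen x)) = exp (\<i> * of_real t * of_real (l x)) \<odot>\<^bsub>A\<^esub> el (poly_gen x)"
  shows "\<alpha> = dyn t"
proof -
  have cl\<alpha>: "\<alpha> a \<in> carrier A" if "a \<in> carrier A" for a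
    using \<alpha> that by (auto simp: star_automorphism_def bij_betw_def)
  have add: "\<alpha> (a \<oplus>\<^bsub>A\<^esub> b) = \<alpha> a \<oplus>\<^bsub>A\<^esub> \<alpha> b" and mult: "\<alpha> (a \<otimes>\<^bsub>A\<^esub> b) = \<alpha> a \<otimes>\<^bsub>A\<^esub> \<alpha> b"
    if "a \<in> carrier A" "b \<in> carrier A" for a b
    using \<alpha> that by (auto simp: star_automorphism_def)
  have scale: "\<alpha> (c \<odot>\<^bsub>A\<^esub> a) = c \<odot>\<^bsub>A\<^esub> \<alpha> a" and inv: "\<alpha> (invol A a) = invol A (\<alpha> a)" and nrm: "cnorm A (\<alpha> a) = cnorm A a"
    if "a \<in> carrier A" for a c
    using \<alpha> that by (auto simp: star_automorphism_def)
  \<comment> \<open>\<open>star_automorphism\<close> does not mention the unit. Surjectivity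
    supplies b with \<alpha>(b) = 1, and then \<alpha>(1) = \<alpha>(1) \<alpha>(b) = \<alpha>(b) =
    1.\<close>
  have one: "\<alpha> (el 1) = el 1"
  proof -
    have "el 1 \<in> \<alpha> ` carrier A" using \<alpha> by (auto simp: star_automorphism_def bij_betw_def)
    then obtain b where b: "b \<in> carrier A" "\<alpha> b = el 1" by auto
    have m1: "a \<otimes>\<^bsub>A\<^esub> el 1 = a" "el 1 \<otimes>\<^bsub>A\<^esub> a = a" if "a \<in> carrier A" for a
      using that by (auto elim!: carrierE simp: cl_mult cs_const)
    have "\<alpha> (el 1) = \<alpha> (el 1) \<otimes>\<^bsub>A\<^esub> \<alpha> b" using m1[OF cl\<alpha>[OF el_carrier[OF star_polys_one]]] b by simp
    also have "\<dots> = \<alpha> b" using mult[OF el_carrier[OF star_polys_one] b(1)] m1[OF b(1)] by simp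
    finally show ?thesis using b by simp
  qed
  have word: "w \<in> words_over X \<Longrightarrow> \<alpha> (el (wpoly w)) = el (rot l (of_real t) (wpoly w))" for w
  proof (induction w rule: star_word_induct)
    case zero then show ?case using one by (simp flip: single_one)
  next
    case (cons k w)
    then have k: "Word [k] \<in> words_over X" and w: "w \<in> words_over X" by auto
    have "\<alpha> (el (wpoly (Word [k]))) = el (rot l (of_real t) (wpoly (Word [k])))"
    proof (cases k)
      case (Gen x)
      with k have x: "x \<in> X" by simp
      show ?thesis using gen[OF x] el_unary_ops(1)[OF poly_gen_mem[OF x]] by (simp add: Gen poly_gen_def)
    next
      case (Adj x)
      with k have x: "x \<in> X" by simp
      have "el (wpoly (Word [k])) = invol A (el (poly_gen x))"
        by (simp add: el_unary_ops(2) poly_gen_mem x Adj adj_poly_gen)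
      then show ?thesis
        using inv[OF el_carrier[OF poly_gen_mem[OF x]]] gen[OF x] poly_gen_mem[OF x]
        by (simp add: el_unary_ops star_polys_scale poly_adj_scale adj_poly_gen Adj exp_cnj)
    qed
    then show ?case
      using cons.IH[OF w] mult[of "el (wpoly (Word [k]))" "el (wpoly w)"] k w
      by (simp only: wpoly_plus rot_mult el_ops(2)[symmetric] star_polys_single rot_mem el_carrier)
  qed
  have poly: "f \<in> star_polys X \<Longrightarrow> \<alpha> (el f) = dyn t (el f)" for f
  proof (induction rule: star_polys_induct)
    case zero
    have "\<alpha> (0 \<odot>\<^bsub>A\<^esub> el 0) = 0 \<odot>\<^bsub>A\<^esub> \<alpha> (el 0)" by (intro scale el_carrier star_polys_zero)
    moreover have "0 \<odot>\<^bsub>A\<^esub> a = el 0" if "a \<in> carrier A" for a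
      using that by (auto elim!: carrierE simp: cl_scale)
    ultimately show ?case using cl\<alpha>[OF el_carrier[OF star_polys_zero]] by (simp add: dyn_el cs_const)
  next
    case (single w c)
    have "el (Poly_Mapping.single w c) = c \<odot>\<^bsub>A\<^esub> el (wpoly w)"
      using single by (simp add: el_unary_ops star_polys_single)
    then show ?case using scale[of "el (wpoly w)" c] word[OF single] single
      by (simp add: dyn_scale dyn_el star_polys_single cs_const)
  next
    case (add f g)
    then show ?case using dyn_add[of "el f" "el g"] \<open>\<And>b a. \<lbrakk>a \<in> carrier A; b \<in> carrier A\<rbrakk> \<Longrightarrow> \<alpha> (a \<oplus>\<^bsub>A\<^esub> b) = \<alpha> a \<oplus>\<^bsub>A\<^esub> \<alpha> b\<close>[of "el f" "el g"]
      by (simp add: el_ops cs_const)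
  qed
  show ?thesis
  proof (rule extensionalityI[of _ "carrier A"])
    show "\<alpha> \<in> extensional (carrier A)" using \<alpha> by (simp add: star_automorphism_def)
    show "dyn t \<in> extensional (carrier A)" by (simp add: dyn_def)
    fix a assume a: "a \<in> carrier A"
    have "cnorm A (\<alpha> a \<ominus>\<^bsub>A\<^esub> dyn t a) \<le> 0"
    proof (rule field_le_epsilon)
      fix e :: real assume "e > 0"
      then obtain f where f: "f \<in> star_polys X" "cnorm A (a \<ominus>\<^bsub>A\<^esub> el f) < e / 2"
        using el_dense[OF a, of "e/2"] by auto
      have ef: "el f \<in> carrier A" by (intro el_carrier f)
      have "\<alpha> a \<ominus>\<^bsub>A\<^esub> \<alpha> (el f) = \<alpha> (a \<ominus>\<^bsub>A\<^esub> el f)"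
        using a ef by (simp add: minus_scale cl\<alpha> scale add)
      then have 1: "cnorm A (\<alpha> a \<ominus>\<^bsub>A\<^esub> \<alpha> (el f)) < e / 2" using f a ef nrm[of "a \<ominus>\<^bsub>A\<^esub> el f"] by simp
      have "dyn t (el f) \<ominus>\<^bsub>A\<^esub> dyn t a = dyn t (el f \<ominus>\<^bsub>A\<^esub> a)"
        using a ef by (simp add: dyn_minus)
      then have 2: "cnorm A (dyn t (el f) \<ominus>\<^bsub>A\<^esub> dyn t a) < e / 2"
        using f a ef cnorm_dyn[of "el f \<ominus>\<^bsub>A\<^esub> a"] cnorm_minus_commute[OF a ef] by simp
      have "cnorm A (\<alpha> a \<ominus>\<^bsub>A\<^esub> dyn t a) \<le> cnorm A (\<alpha> a \<ominus>\<^bsub>A\<^esub> \<alpha> (el f)) + cnorm A (\<alpha> (el f) \<ominus>\<^bsub>A\<^esub> dyn t a)"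
        using a ef by (intro cnorm_triangle3 cl\<alpha> dyn_carrier)
      then show "cnorm A (\<alpha> a \<ominus>\<^bsub>A\<^esub> dyn t a) \<le> 0 + e" using 1 2 unfolding poly[OF f(1)] by simp
    qed
    then show "\<alpha> a = dyn t a"
      using a by (intro cnorm_minus_0 cl\<alpha> dyn_carrier antisym cnorm_nonneg A_closed)
  qed
qed

lemma the_dyn:
  "(THE \<alpha>. star_automorphism A \<alpha> \<and>
      (\<forall>x\<in>X. \<alpha> (el (poly_gen x)) = exp (\<i> * of_real t * of_real (l x)) \<odot>\<^bsub>A\<^esub> el (poly_gen x))) = dyn t"
proof (rule the_equality)
  show "star_automorphism A (dyn t) \<and>
      (\<forall>x\<in>X. dyn t (el (poly_gen x)) = exp (\<i> * of_real t * of_real (l x)) \<odot>\<^bsub>A\<^esub> el (poly_gen x))"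
    by (simp add: star_automorphism_dyn dyn_el poly_gen_mem el_unary_ops) (simp add: poly_gen_def)
qed (auto intro: dyn_unique)

end

section \<open>KMS states\<close>

text \<open>If an entire function is close to constants on two horizontal lines and bounded in between,
  comparing the increments of a primitive along both lines shows that the constants are close.\<close>

lemma strip_mean_values:
  assumes g: "g holomorphic_on UNIV"
    and c0: "\<And>t. cmod (g (of_real t) - c0) \<le> e0"
    and c1: "\<And>t. cmod (g (of_real t + \<i> * of_real b) - c1) \<le> e1"
    and K: "\<And>t y. y \<in> closed_segment 0 b \<Longrightarrow> cmod (g (of_real t + \<i> * of_real y)) \<le> K"
  shows "cmod (c0 - c1) \<le> e0 + e1"
proof -
  obtain P where P: "\<And>z. (P has_field_derivative g z) (at z)"
    using holomorphic_convex_primitive'[OF _ _ g] by auto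
  have hor: "cmod (P (of_real R + \<i> * of_real y) - P (of_real (- R) + \<i> * of_real y) - of_real (2 * R) * c) \<le> 2 * R * e"
    if e: "\<And>t. cmod (g (of_real t + \<i> * of_real y) - c) \<le> e" and "R > 0" for R y c e
  proof -
    let ?S = "{z. Im z = y}"
    have "norm ((\<lambda>z. P z - c * z) (of_real R + \<i> * of_real y) - (\<lambda>z. P z - c * z) (of_real (- R) + \<i> * of_real y))
        \<le> e * norm ((of_real R + \<i> * of_real y) - (of_real (- R) + \<i> * of_real y) :: complex)"
    proof (rule field_differentiable_bound[where S = ?S and f' = "\<lambda>z. g z - c"])
      show "convex ?S"
        unfolding convex_alt by (auto simp: algebra_simps)
      show "((\<lambda>z. P z - c * z) has_field_derivative g z - c) (at z within ?S)" for z
        by (auto intro!: derivative_eq_intros has_field_derivative_at_within[OF P])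
      show "norm (g z - c) \<le> e" if "z \<in> ?S" for z
      proof -
        have "z = of_real (Re z) + \<i> * of_real y" using that complex_eq[of z] by simp
        then show ?thesis using e[of "Re z"] by metis
      qed
    qed auto
    also have "norm ((of_real R + \<i> * of_real y) - (of_real (- R) + \<i> * of_real y) :: complex) = 2 * R"
    proof -
      have "(of_real R + \<i> * of_real y) - (of_real (- R) + \<i> * of_real y) = complex_of_real (2 * R)" by simp
      then show ?thesis using \<open>R > 0\<close> by (simp only: norm_of_real)
    qed
    finally show ?thesis by (simp add: algebra_simps)
  qed
  have ver: "cmod (P (of_real t + \<i> * of_real b) - P (of_real t)) \<le> K * \<bar>b\<bar>" for t
  proof -
    let ?S = "closed_segment (of_real t) (of_real t + \<i> * of_real b) :: complex set"
    have "norm (P (of_real t + \<i> * of_real b) - P (of_real t))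
        \<le> K * norm ((of_real t + \<i> * of_real b) - (of_real t) :: complex)"
    proof (rule field_differentiable_bound[where S = ?S and f' = g])
      show "norm (g z) \<le> K" if "z \<in> ?S" for z
      proof -
        have "\<exists>s. 0 \<le> s \<and> s \<le> 1 \<and> z = (1 - s) *\<^sub>R of_real t + s *\<^sub>R (of_real t + \<i> * of_real b)"
          using that by (simp only: in_segment)
        then obtain s where s: "0 \<le> s" "s \<le> 1" "z = (1 - s) *\<^sub>R of_real t + s *\<^sub>R (of_real t + \<i> * of_real b)"
          by metis
        have "z = of_real t + \<i> * of_real (s * b)" unfolding s(3) by (simp add: scaleR_conv_of_real algebra_simps)
        moreover have "s * b \<in> closed_segment 0 b" using s by (auto simp: closed_segment_def intro!: exI[of _ s])
        ultimately show ?thesis using K[of "s * b" t] by (simp only:)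
      qed
    qed (auto intro: has_field_derivative_at_within[OF P])
    then show ?thesis by (simp add: norm_mult)
  qed
  show ?thesis
  proof (rule field_le_epsilon)
    fix e :: real assume e: "e > 0"
    have K0: "K \<ge> 0" using order_trans[OF norm_ge_zero K[of 0 0]] by simp
    \<comment> \<open>The two vertical sides contribute at most \<open>K * \<bar>b\<bar>\<close>
      each; this \<open>R\<close> makes that at most \<open>R * e\<close>, negligible against the
      horizontal length \<open>2 * R\<close>.\<close>
    define R where "R = (K * \<bar>b\<bar> + 1) / e"
    have R: "R > 0" using e K0 by (simp add: R_def add_nonneg_pos)
    have "of_real (2 * R) * (c0 - c1) =
       (P (of_real R + \<i> * of_real b) - P (of_real (- R) + \<i> * of_real b) - of_real (2 * R) * c1)
       - (P (of_real R + \<i> * of_real 0) - P (of_real (- R) + \<i> * of_real 0) - of_real (2 * R) * c0)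
       - (P (of_real R + \<i> * of_real b) - P (of_real R)) + (P (of_real (- R) + \<i> * of_real b) - P (of_real (- R)))"
      by (simp add: algebra_simps)
    also have "cmod \<dots> \<le> 2 * R * e1 + 2 * R * e0 + K * \<bar>b\<bar> + K * \<bar>b\<bar>"
    proof -
      have tri: "cmod (a - b - c + d) \<le> cmod a + cmod b + cmod c + cmod d" for a b c d
        by norm
      show ?thesis
        by (rule order_trans[OF tri], intro add_mono hor ver R c1) (use c0 in simp)
    qed
    finally have "cmod (of_real (2 * R) * (c0 - c1)) \<le> 2 * R * e1 + 2 * R * e0 + K * \<bar>b\<bar> + K * \<bar>b\<bar>" .
    moreover have "cmod (of_real (2 * R) * (c0 - c1)) = 2 * R * cmod (c0 - c1)" using R by (simp add: norm_mult)
    ultimately have "2 * R * cmod (c0 - c1) \<le> 2 * (R * (e0 + e1) + K * \<bar>b\<bar>)"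
      by (simp add: algebra_simps)
    also have "K * \<bar>b\<bar> \<le> R * e" using e by (simp add: R_def)
    finally have "R * cmod (c0 - c1) \<le> R * (e0 + e1 + e)" by (simp add: algebra_simps)
    then show "cmod (c0 - c1) \<le> e0 + e1 + e" using R by simp
  qed
qed

lemma entire_eq_on_reals:
  assumes "f holomorphic_on UNIV" "g holomorphic_on UNIV"
    and eq: "\<And>t. f (complex_of_real t) = g (complex_of_real t)"
  shows "f z = g z"
proof -
  have "f z - g z = 0"
  proof (rule analytic_continuation[of "\<lambda>z. f z - g z" UNIV \<real> 0])
    show "(0::complex) islimpt \<real>"
      unfolding islimpt_approachable
    proof (intro allI impI)
      fix e :: real assume "e > 0"
      then show "\<exists>x'\<in>\<real>. x' \<noteq> 0 \<and> dist x' (0::complex) < e"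
        by (intro bexI[of _ "complex_of_real (e/2)"]) (auto simp: dist_norm norm_divide)
    qed
  qed (use assms in \<open>auto intro!: holomorphic_intros elim!: Reals_cases\<close>)
  then show ?thesis by simp
qed

context graded_presentation
begin

text \<open>An entire extension takes values in the algebra; composed with such a functional it
  becomes a scalar entire function.\<close>

definition bounded_lin :: "((nat \<Rightarrow> 'g star_poly) set \<Rightarrow> complex) \<Rightarrow> bool" where
  "bounded_lin \<Lambda> \<longleftrightarrow>
     (\<forall>a\<in>carrier A. \<forall>b\<in>carrier A. \<Lambda> (a \<ominus>\<^bsub>A\<^esub> b) = \<Lambda> a - \<Lambda> b) \<and>
     (\<forall>c. \<forall>a\<in>carrier A. \<Lambda> (c \<odot>\<^bsub>A\<^esub> a) = c * \<Lambda> a) \<and>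
     (\<exists>K. \<forall>a\<in>carrier A. cmod (\<Lambda> a) \<le> K * cnorm A a)"

lemma minus_mult:
  assumes "a \<in> carrier A" "b \<in> carrier A" "v \<in> carrier A"
  shows "v \<otimes>\<^bsub>A\<^esub> (a \<ominus>\<^bsub>A\<^esub> b) = v \<otimes>\<^bsub>A\<^esub> a \<ominus>\<^bsub>A\<^esub> v \<otimes>\<^bsub>A\<^esub> b"
    "(a \<ominus>\<^bsub>A\<^esub> b) \<otimes>\<^bsub>A\<^esub> v = a \<otimes>\<^bsub>A\<^esub> v \<ominus>\<^bsub>A\<^esub> b \<otimes>\<^bsub>A\<^esub> v"
  using assms by (auto elim!: carrierE simp: cl_mult cl_minus cs_diff cs_mult algebra_simps)

lemma scale_mult:
  assumes "a \<in> carrier A" "v \<in> carrier A"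
  shows "v \<otimes>\<^bsub>A\<^esub> (c \<odot>\<^bsub>A\<^esub> a) = c \<odot>\<^bsub>A\<^esub> (v \<otimes>\<^bsub>A\<^esub> a)" "(c \<odot>\<^bsub>A\<^esub> a) \<otimes>\<^bsub>A\<^esub> v = c \<odot>\<^bsub>A\<^esub> (a \<otimes>\<^bsub>A\<^esub> v)"
  using assms by (auto elim!: carrierE simp: cl_mult cl_scale cs_scale cs_mult poly_scale_mult_left poly_scale_mult_right)

lemma state_mult_bound:
  assumes \<psi>: "\<psi> \<in> states A" and "a \<in> carrier A" "v \<in> carrier A"
  shows "cmod (\<psi> (v \<otimes>\<^bsub>A\<^esub> a)) \<le> 2 * cnorm A v * cnorm A a" "cmod (\<psi> (a \<otimes>\<^bsub>A\<^esub> v)) \<le> 2 * cnorm A v * cnorm A a"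
  using state_bound[OF \<psi>, of "v \<otimes>\<^bsub>A\<^esub> a"] state_bound[OF \<psi>, of "a \<otimes>\<^bsub>A\<^esub> v"] cnorm_mult[of v a] cnorm_mult[of a v] assms
  by (auto simp: mult.commute)

lemma bounded_lin_state:
  assumes \<psi>: "\<psi> \<in> states A" and v: "v \<in> carrier A"
  shows "bounded_lin (\<lambda>a. \<psi> (v \<otimes>\<^bsub>A\<^esub> dyn t a))"
  unfolding bounded_lin_def
proof (intro conjI ballI allI exI[of _ "2 * cnorm A v"])
  fix a assume a: "a \<in> carrier A"
  show "cmod (\<psi> (v \<otimes>\<^bsub>A\<^esub> dyn t a)) \<le> 2 * cnorm A v * cnorm A a"
    using state_mult_bound(1)[OF \<psi> dyn_carrier[OF a] v] by (simp add: cnorm_dyn a)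
qed (simp_all add: dyn_minus dyn_scale minus_mult scale_mult v state_diff[OF \<psi>] statesD(2)[OF \<psi>])

lemma entire_functional:
  assumes F: "entire_extension A \<sigma> a F" and \<Lambda>: "bounded_lin \<Lambda>"
  shows "(\<lambda>z. \<Lambda> (F z)) holomorphic_on UNIV"
proof -
  obtain K where K: "\<And>a. a \<in> carrier A \<Longrightarrow> cmod (\<Lambda> a) \<le> K * cnorm A a"
    using \<Lambda> unfolding bounded_lin_def by blast
  have "\<exists>d. ((\<lambda>z. \<Lambda> (F z)) has_field_derivative d) (at z)" for z
  proof -
    have Fc: "F z \<in> carrier A" for z using F by (simp add: entire_extension_def)
    obtain d where d: "d \<in> carrier A"
      and lim: "((\<lambda>h. cnorm A ((1 / h) \<odot>\<^bsub>A\<^esub> (F (z + h) \<ominus>\<^bsub>A\<^esub> F z) \<ominus>\<^bsub>A\<^esub> d)) \<longlongrightarrow> 0) (at 0)"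
      using F unfolding entire_extension_def by blast
    have "((\<lambda>h. (\<Lambda> (F (z + h)) - \<Lambda> (F z)) / h - \<Lambda> d) \<longlongrightarrow> 0) (at 0)"
    proof (rule Lim_null_comparison)
      show "((\<lambda>h. K * cnorm A ((1 / h) \<odot>\<^bsub>A\<^esub> (F (z + h) \<ominus>\<^bsub>A\<^esub> F z) \<ominus>\<^bsub>A\<^esub> d)) \<longlongrightarrow> 0) (at 0)"
        using tendsto_mult[OF tendsto_const lim, of K] by simp
      have "norm ((\<Lambda> (F (z + h)) - \<Lambda> (F z)) / h - \<Lambda> d) \<le> K * cnorm A ((1 / h) \<odot>\<^bsub>A\<^esub> (F (z + h) \<ominus>\<^bsub>A\<^esub> F z) \<ominus>\<^bsub>A\<^esub> d)" for h
        using K[of "(1 / h) \<odot>\<^bsub>A\<^esub> (F (z + h) \<ominus>\<^bsub>A\<^esub> F z) \<ominus>\<^bsub>A\<^esub> d"] \<Lambda> Fc d by (simp add: bounded_lin_def)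
      then show "\<forall>\<^sub>F h in at 0. norm ((\<Lambda> (F (z + h)) - \<Lambda> (F z)) / h - \<Lambda> d) \<le> K * cnorm A ((1 / h) \<odot>\<^bsub>A\<^esub> (F (z + h) \<ominus>\<^bsub>A\<^esub> F z) \<ominus>\<^bsub>A\<^esub> d)"
        by simp
    qed
    then have "((\<lambda>h. (\<Lambda> (F (z + h)) - \<Lambda> (F z)) / h) \<longlongrightarrow> \<Lambda> d) (at 0)" by (simp add: LIM_zero_iff)
    then show ?thesis by (auto simp: DERIV_def)
  qed
  then show ?thesis by (auto simp: holomorphic_on_def field_differentiable_def)
qed

text \<open>Supplies the bound inside the strip: norm differentiability gives continuity on the
  compact vertical segment, and the isometric dynamics carries the bound to other real
  parts.\<close>

lemma entire_norm_bounded: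
  assumes F: "entire_extension A \<sigma> a F"
  shows "\<exists>K. \<forall>y\<in>closed_segment 0 b. cnorm A (F (\<i> * of_real y)) \<le> K"
proof -
  have Fc: "F z \<in> carrier A" for z using F by (simp add: entire_extension_def)
  have "isCont (\<lambda>z. cnorm A (F z)) z" for z
  proof -
    obtain d where d: "d \<in> carrier A"
      and lim: "((\<lambda>h. cnorm A ((1 / h) \<odot>\<^bsub>A\<^esub> (F (z + h) \<ominus>\<^bsub>A\<^esub> F z) \<ominus>\<^bsub>A\<^esub> d)) \<longlongrightarrow> 0) (at 0)"
      using F unfolding entire_extension_def by blast
    let ?q = "\<lambda>h. (1 / h) \<odot>\<^bsub>A\<^esub> (F (z + h) \<ominus>\<^bsub>A\<^esub> F z) \<ominus>\<^bsub>A\<^esub> d"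
    have "((\<lambda>h. cnorm A (F (z + h)) - cnorm A (F z)) \<longlongrightarrow> 0) (at 0)"
    proof (rule Lim_null_comparison)
      show "((\<lambda>h. cmod h * (cnorm A (?q h) + cnorm A d)) \<longlongrightarrow> 0) (at 0)"
      proof -
        have "((\<lambda>h. cmod h * (cnorm A (?q h) + cnorm A d)) \<longlongrightarrow> cmod 0 * (0 + cnorm A d)) (at 0)"
          by (intro tendsto_intros lim)
        then show ?thesis by simp
      qed
      have "\<bar>cnorm A (F (z + h)) - cnorm A (F z)\<bar> \<le> cmod h * (cnorm A (?q h) + cnorm A d)" if h: "h \<noteq> 0" for h
      proof -
        have rev: "\<bar>cnorm A a - cnorm A b\<bar> \<le> cnorm A (a \<ominus>\<^bsub>A\<^esub> b)" if "a \<in> carrier A" "b \<in> carrier A" for a b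
        proof -
          have "a = (a \<ominus>\<^bsub>A\<^esub> b) \<oplus>\<^bsub>A\<^esub> b" "b = (b \<ominus>\<^bsub>A\<^esub> a) \<oplus>\<^bsub>A\<^esub> a"
            using that by (auto elim!: carrierE simp: cl_minus cl_add cs_diff)
          then show ?thesis
            using cnorm_triangle[of "a \<ominus>\<^bsub>A\<^esub> b" b] cnorm_triangle[of "b \<ominus>\<^bsub>A\<^esub> a" a] cnorm_minus_commute[OF that] that by simp
        qed
        have dec: "a \<ominus>\<^bsub>A\<^esub> b = (h \<odot>\<^bsub>A\<^esub> ((1 / h) \<odot>\<^bsub>A\<^esub> (a \<ominus>\<^bsub>A\<^esub> b) \<ominus>\<^bsub>A\<^esub> d)) \<oplus>\<^bsub>A\<^esub> (h \<odot>\<^bsub>A\<^esub> d)"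
          if "a \<in> carrier A" "b \<in> carrier A" for a b
          using that d h by (auto elim!: carrierE simp: cl_minus cl_add cl_scale cs_diff cs_scale poly_scale_diff poly_scale_scale)
        have "cnorm A (F (z + h) \<ominus>\<^bsub>A\<^esub> F z) \<le> cnorm A (h \<odot>\<^bsub>A\<^esub> ?q h) + cnorm A (h \<odot>\<^bsub>A\<^esub> d)"
          by (subst dec[OF Fc Fc]) (intro cnorm_triangle A_closed Fc d)
        also have "\<dots> \<le> cmod h * cnorm A (?q h) + cmod h * cnorm A d"
          by (intro add_mono cnorm_scale_le A_closed Fc d)
        finally show ?thesis using rev[OF Fc Fc, of "z + h" z] by (simp add: distrib_left)
      qed
      then show "\<forall>\<^sub>F h in at 0. norm (cnorm A (F (z + h)) - cnorm A (F z)) \<le> cmod h * (cnorm A (?q h) + cnorm A d)"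
        by (auto simp: eventually_at intro!: exI[of _ 1])
    qed
    then show ?thesis by (simp add: isCont_iff LIM_zero_iff)
  qed
  then have "continuous_on UNIV (\<lambda>z. cnorm A (F z))" by (simp add: continuous_at_imp_continuous_on)
  then have "continuous_on (closed_segment 0 b) (\<lambda>y. cnorm A (F (\<i> * of_real y)))"
    by (rule continuous_on_compose2) (auto intro!: continuous_intros)
  then have "compact ((\<lambda>y. cnorm A (F (\<i> * of_real y))) ` closed_segment 0 b)"
    by (intro compact_continuous_image) auto
  then have "bdd_above ((\<lambda>y. cnorm A (F (\<i> * of_real y))) ` closed_segment 0 b)"
    by (intro bounded_imp_bdd_above compact_imp_bounded)
  then show ?thesis by (auto simp: bdd_above_def)
qed

text \<open>The dense subspace \<open>D\<close> may contain no word at all, so the word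
  \<open>W\<close> is approximated by some a in \<open>D\<close> with entire extension F. Freed from
  its oscillation, \<psi>(V F(z)) is nearly \<psi>(V W) on the real line, and nearly
  \<open>exp (\<beta> * L)\<close> times \<psi>(W V) on the line with imaginary part \<beta>;
  \<open>strip_mean_values\<close> then compares the two constants.\<close>

lemma kms_word:
  assumes kms: "\<psi> \<in> kms_states A dyn \<beta>"
  shows "word_val \<psi> (w + v) = exp (- \<beta> * word_weight l w) * word_val \<psi> (v + w)"
proof (cases "w \<in> words_over X \<and> v \<in> words_over X")
  case False then show ?thesis by (auto simp: word_val_def)
next
  case True
  have \<psi>: "\<psi> \<in> states A" using kms by (simp add: kms_states_def)
  obtain D where D: "dense_subspace A D" and Dinv: "\<And>t a. a \<in> D \<Longrightarrow> dyn t a \<in> D"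
    and DF: "\<And>a. a \<in> D \<Longrightarrow> \<exists>F. entire_extension A dyn a F \<and> (\<forall>b\<in>D. \<psi> (a \<otimes>\<^bsub>A\<^esub> b) = \<psi> (b \<otimes>\<^bsub>A\<^esub> F (\<i> * of_real \<beta>)))"
    using kms unfolding kms_states_def by blast
  have Dc: "a \<in> carrier A" if "a \<in> D" for a using D that by (auto simp: dense_subspace_def)
  have dense: "\<exists>b\<in>D. cnorm A (a \<ominus>\<^bsub>A\<^esub> b) < e" if "a \<in> carrier A" "e > 0" for a e
    using D that by (auto simp: dense_subspace_def)
  \<comment> \<open>By continuity the second variable may run over the whole algebra. The first
    stays in \<open>D\<close>, whose elements have entire extensions.\<close>
  have DF': "\<exists>F. entire_extension A dyn a F \<and> (\<forall>b\<in>carrier A. \<psi> (a \<otimes>\<^bsub>A\<^esub> b) = \<psi> (b \<otimes>\<^bsub>A\<^esub> F (\<i> * of_real \<beta>)))" if a: "a \<in> D" for a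
  proof -
    obtain F where F: "entire_extension A dyn a F" and FD: "\<And>b. b \<in> D \<Longrightarrow> \<psi> (a \<otimes>\<^bsub>A\<^esub> b) = \<psi> (b \<otimes>\<^bsub>A\<^esub> F (\<i> * of_real \<beta>))"
      using DF[OF a] by blast
    let ?G = "F (\<i> * of_real \<beta>)"
    have G: "?G \<in> carrier A" using F by (simp add: entire_extension_def)
    have "\<psi> (a \<otimes>\<^bsub>A\<^esub> b) = \<psi> (b \<otimes>\<^bsub>A\<^esub> ?G)" if b: "b \<in> carrier A" for b
    proof -
      define C where "C = 2 * cnorm A a + 2 * cnorm A ?G"
      have C: "C \<ge> 0" using cnorm_nonneg[OF Dc[OF a]] cnorm_nonneg[OF G] by (simp add: C_def)
      have "cmod (\<psi> (a \<otimes>\<^bsub>A\<^esub> b) - \<psi> (b \<otimes>\<^bsub>A\<^esub> ?G)) \<le> 0"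
      proof (rule field_le_epsilon)
        fix e :: real assume e: "e > 0"
        then obtain b' where b': "b' \<in> D" "cnorm A (b \<ominus>\<^bsub>A\<^esub> b') < e / (C + 1)"
          using dense[OF b, of "e / (C + 1)"] C by auto
        have bb: "b \<ominus>\<^bsub>A\<^esub> b' \<in> carrier A" by (intro A_closed b Dc b')
        have "\<psi> (a \<otimes>\<^bsub>A\<^esub> b) - \<psi> (b \<otimes>\<^bsub>A\<^esub> ?G) = \<psi> (a \<otimes>\<^bsub>A\<^esub> (b \<ominus>\<^bsub>A\<^esub> b')) - \<psi> ((b \<ominus>\<^bsub>A\<^esub> b') \<otimes>\<^bsub>A\<^esub> ?G)"
          using FD[OF b'(1)] by (simp add: minus_mult state_diff[OF \<psi>] Dc[OF a] Dc[OF b'(1)] b G)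
        also have "cmod \<dots> \<le> 2 * cnorm A a * cnorm A (b \<ominus>\<^bsub>A\<^esub> b') + 2 * cnorm A ?G * cnorm A (b \<ominus>\<^bsub>A\<^esub> b')"
          by (rule order_trans[OF norm_triangle_ineq4]) (intro add_mono state_mult_bound \<psi> bb Dc a G)
        also have "\<dots> = C * cnorm A (b \<ominus>\<^bsub>A\<^esub> b')" by (simp add: C_def algebra_simps)
        also have "\<dots> \<le> (C + 1) * (e / (C + 1))" using b'(2) C cnorm_nonneg[OF bb] by (intro mult_mono) auto
        also have "\<dots> = e" using C by simp
        finally show "cmod (\<psi> (a \<otimes>\<^bsub>A\<^esub> b) - \<psi> (b \<otimes>\<^bsub>A\<^esub> ?G)) \<le> 0 + e" by simp
      qed
      then show ?thesis by simp
    qed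
    then show ?thesis using F by blast
  qed
  define W where "W = el (wpoly w)"
  define V where "V = el (wpoly v)"
  define L where "L = word_weight l w"
  have W: "W \<in> carrier A" and V: "V \<in> carrier A" using True by (auto simp: W_def V_def star_polys_single intro!: el_carrier)
  have dW: "dyn t W = exp (\<i> * of_real t * of_real L) \<odot>\<^bsub>A\<^esub> W" for t
    using True by (simp add: W_def dyn_el star_polys_single el_unary_ops L_def)
  define M where "M = 2 * cnorm A V"
  have M: "M \<ge> 0" using cnorm_nonneg[OF V] by (simp add: M_def)
  have main: "cmod (\<psi> (V \<otimes>\<^bsub>A\<^esub> W) - exp (\<beta> * L) * \<psi> (W \<otimes>\<^bsub>A\<^esub> V)) \<le> M * e + exp (\<beta> * L) * (M * e)" if e: "e > 0" for e
  proof -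
    obtain a where a: "a \<in> D" "cnorm A (W \<ominus>\<^bsub>A\<^esub> a) < e" using dense[OF W e] by blast
    then have ac: "a \<in> carrier A" and aW: "cnorm A (a \<ominus>\<^bsub>A\<^esub> W) < e" using cnorm_minus_commute[OF W Dc[OF a(1)]] by (auto simp: Dc)
    obtain F where F: "entire_extension A dyn a F" using DF'[OF a(1)] by blast
    have Fc: "F z \<in> carrier A" for z using F by (simp add: entire_extension_def)
    have Fr: "F (of_real t) = dyn t a" for t using F by (simp add: entire_extension_def)
    define f where "f z = \<psi> (V \<otimes>\<^bsub>A\<^esub> F z)" for z
    have hol: "(\<lambda>z. \<psi> (V \<otimes>\<^bsub>A\<^esub> dyn t (F z))) holomorphic_on UNIV" for t
      by (rule entire_functional[OF F bounded_lin_state[OF \<psi> V]])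
    have f: "f holomorphic_on UNIV" using hol[of 0] by (simp add: f_def[abs_def] dyn_0 Fc)
    have f_shift_hol: "(\<lambda>z. f (z + of_real t)) holomorphic_on UNIV" for t
    proof -
      have "(f \<circ> (\<lambda>z. z + of_real t)) holomorphic_on UNIV"
        by (rule holomorphic_on_compose_gen[OF _ f]) (auto intro!: holomorphic_intros)
      then show ?thesis by (simp add: o_def)
    qed
    have shift: "f (z + of_real t) = \<psi> (V \<otimes>\<^bsub>A\<^esub> dyn t (F z))" for z t
      by (rule entire_eq_on_reals[OF f_shift_hol hol])
         (simp add: f_def Fr dyn_dyn ac add.commute flip: of_real_add)
    \<comment> \<open>Invariance of \<open>D\<close> makes the KMS identity available for
      \<open>dyn t a\<close>. Tested against \<open>V\<close>, its extension agrees with z -> F(z +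
      t), because the two agree on the reals.\<close>
    have top: "f (of_real t + \<i> * of_real \<beta>) = \<psi> (dyn t a \<otimes>\<^bsub>A\<^esub> V)" for t
    proof -
      obtain G where G: "entire_extension A dyn (dyn t a) G"
        and GV: "\<psi> (dyn t a \<otimes>\<^bsub>A\<^esub> V) = \<psi> (V \<otimes>\<^bsub>A\<^esub> G (\<i> * of_real \<beta>))"
        using DF'[OF Dinv[OF a(1)]] V by blast
      have Gc: "G z \<in> carrier A" for z using G by (simp add: entire_extension_def)
      have "(\<lambda>z. \<psi> (V \<otimes>\<^bsub>A\<^esub> dyn 0 (G z))) holomorphic_on UNIV"
        by (rule entire_functional[OF G bounded_lin_state[OF \<psi> V]])
      then have Gh: "(\<lambda>z. \<psi> (V \<otimes>\<^bsub>A\<^esub> G z)) holomorphic_on UNIV" by (simp add: dyn_0 Gc)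
      have Gr: "G (of_real s) = dyn s (dyn t a)" for s using G by (simp add: entire_extension_def)
      have "f (\<i> * of_real \<beta> + of_real t) = \<psi> (V \<otimes>\<^bsub>A\<^esub> G (\<i> * of_real \<beta>))"
        by (rule entire_eq_on_reals[OF f_shift_hol Gh])
           (simp add: f_def Fr Gr dyn_dyn ac flip: of_real_add)
      then show ?thesis using GV by (simp add: add.commute)
    qed
    obtain K where K: "\<And>y. y \<in> closed_segment 0 \<beta> \<Longrightarrow> cnorm A (F (\<i> * of_real y)) \<le> K"
      using entire_norm_bounded[OF F] by blast
    \<comment> \<open>Removes the factor exp(\<i> t L) by which the dynamics acts on
      \<open>W\<close>, so that \<open>g\<close> is nearly constant on both lines.\<close>
    define g where "g z = exp (- \<i> * of_real L * z) * f z" for z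
    show ?thesis
    proof (rule strip_mean_values[of g])
      show "g holomorphic_on UNIV" unfolding g_def by (intro holomorphic_intros f)
    next
      fix t :: real
      have "exp (- \<i> * of_real L * of_real t) * exp (\<i> * of_real t * of_real L) = (1::complex)"
        by (simp add: mult_exp_exp)
      then have ee: "exp (- \<i> * of_real L * of_real t) * (y - exp (\<i> * of_real t * of_real L) * c)
          = exp (- \<i> * of_real L * of_real t) * y - c" for y c :: complex
        by (simp only: right_diff_distrib mult.assoc[symmetric] mult_1)
      have "g (of_real t) - \<psi> (V \<otimes>\<^bsub>A\<^esub> W) = exp (- \<i> * of_real L * of_real t) * (f (of_real t) - exp (\<i> * of_real t * of_real L) * \<psi> (V \<otimes>\<^bsub>A\<^esub> W))"
        unfolding ee g_def ..
      also have "f (of_real t) - exp (\<i> * of_real t * of_real L) * \<psi> (V \<otimes>\<^bsub>A\<^esub> W) = \<psi> (V \<otimes>\<^bsub>A\<^esub> dyn t (a \<ominus>\<^bsub>A\<^esub> W))"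
        by (simp add: f_def Fr dyn_minus dW ac W V minus_mult scale_mult state_diff[OF \<psi>] statesD(2)[OF \<psi>])
      also have "cmod (exp (- \<i> * of_real L * of_real t) * \<psi> (V \<otimes>\<^bsub>A\<^esub> dyn t (a \<ominus>\<^bsub>A\<^esub> W))) \<le> 1 * (M * cnorm A (dyn t (a \<ominus>\<^bsub>A\<^esub> W)))"
        unfolding norm_mult M_def by (intro mult_mono state_mult_bound \<psi> V dyn_carrier A_closed ac W) auto
      also have "\<dots> \<le> M * e" using aW M by (simp add: cnorm_dyn ac W mult_left_mono)
      finally show "cmod (g (of_real t) - \<psi> (V \<otimes>\<^bsub>A\<^esub> W)) \<le> M * e" .
      have ex: "exp (- \<i> * of_real L * (of_real t + \<i> * of_real \<beta>)) = of_real (exp (\<beta> * L)) * exp (- \<i> * of_real L * of_real t)"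
      proof -
        have "- \<i> * of_real L * (of_real t + \<i> * of_real \<beta>) = complex_of_real (\<beta> * L) + - \<i> * of_real L * of_real t"
          by (simp add: algebra_simps)
        then show ?thesis by (simp only: exp_add exp_of_real)
      qed
      have "g (of_real t + \<i> * of_real \<beta>) - of_real (exp (\<beta> * L)) * \<psi> (W \<otimes>\<^bsub>A\<^esub> V)
          = of_real (exp (\<beta> * L)) * (exp (- \<i> * of_real L * of_real t) * (f (of_real t + \<i> * of_real \<beta>) - exp (\<i> * of_real t * of_real L) * \<psi> (W \<otimes>\<^bsub>A\<^esub> V)))"
        unfolding ee g_def ex by (simp only: right_diff_distrib mult.assoc)
      also have "f (of_real t + \<i> * of_real \<beta>) - exp (\<i> * of_real t * of_real L) * \<psi> (W \<otimes>\<^bsub>A\<^esub> V) = \<psi> (dyn t (a \<ominus>\<^bsub>A\<^esub> W) \<otimes>\<^bsub>A\<^esub> V)"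
        by (simp add: top dyn_minus dW ac W V minus_mult scale_mult state_diff[OF \<psi>] statesD(2)[OF \<psi>])
      also have "cmod (of_real (exp (\<beta> * L)) * (exp (- \<i> * of_real L * of_real t) * \<psi> (dyn t (a \<ominus>\<^bsub>A\<^esub> W) \<otimes>\<^bsub>A\<^esub> V)))
          \<le> exp (\<beta> * L) * (1 * (M * cnorm A (dyn t (a \<ominus>\<^bsub>A\<^esub> W))))"
        unfolding norm_mult M_def by (intro mult_mono state_mult_bound \<psi> V dyn_carrier A_closed ac W) (auto intro: cnorm_nonneg V)
      also have "\<dots> \<le> exp (\<beta> * L) * (M * e)" using aW M by (simp add: cnorm_dyn ac W mult_left_mono)
      finally show "cmod (g (of_real t + \<i> * of_real \<beta>) - of_real (exp (\<beta> * L)) * \<psi> (W \<otimes>\<^bsub>A\<^esub> V)) \<le> exp (\<beta> * L) * (M * e)" .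
    next
      fix t y :: real assume y: "y \<in> closed_segment 0 \<beta>"
      have yb: "\<bar>y\<bar> \<le> \<bar>\<beta>\<bar>" using y by (auto simp: closed_segment_def abs_mult mult_left_le_one_le)
      have "cmod (g (of_real t + \<i> * of_real y)) = exp (L * y) * cmod (f (\<i> * of_real y + of_real t))"
        by (simp add: g_def norm_mult add.commute)
      also have "\<dots> \<le> exp (\<bar>L\<bar> * \<bar>\<beta>\<bar>) * (M * K)"
      proof (rule mult_mono)
        have "L * y \<le> \<bar>L\<bar> * \<bar>y\<bar>" by (metis abs_ge_self abs_mult)
        also have "\<dots> \<le> \<bar>L\<bar> * \<bar>\<beta>\<bar>" using yb by (intro mult_left_mono) auto
        finally show "exp (L * y) \<le> exp (\<bar>L\<bar> * \<bar>\<beta>\<bar>)" by simp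
        have "cmod (f (\<i> * of_real y + of_real t)) \<le> M * cnorm A (dyn t (F (\<i> * of_real y)))"
          unfolding shift M_def by (intro state_mult_bound \<psi> V dyn_carrier Fc)
        also have "\<dots> \<le> M * K" using K[OF y] M by (simp add: cnorm_dyn Fc mult_left_mono)
        finally show "cmod (f (\<i> * of_real y + of_real t)) \<le> M * K" .
      qed auto
      finally show "cmod (g (of_real t + \<i> * of_real y)) \<le> exp (\<bar>L\<bar> * \<bar>\<beta>\<bar>) * (M * K)" .
    qed
  qed
  have "cmod (\<psi> (V \<otimes>\<^bsub>A\<^esub> W) - exp (\<beta> * L) * \<psi> (W \<otimes>\<^bsub>A\<^esub> V)) \<le> 0"
  proof (rule field_le_epsilon)
    fix e :: real assume e: "e > 0"
    define C where "C = M * (1 + exp (\<beta> * L))"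
    have C: "C \<ge> 0" using M by (simp add: C_def add_nonneg_nonneg)
    have "cmod (\<psi> (V \<otimes>\<^bsub>A\<^esub> W) - exp (\<beta> * L) * \<psi> (W \<otimes>\<^bsub>A\<^esub> V)) \<le> C * (e / (C + 1))"
    proof -
      have eq: "M * d + exp (\<beta> * L) * (M * d) = C * d" for d by (simp add: C_def algebra_simps)
      have "0 < e / (C + 1)" using e C by simp
      from main[OF this] show ?thesis unfolding eq .
    qed
    also have "\<dots> \<le> e" using e C by (simp add: field_simps)
    finally show "cmod (\<psi> (V \<otimes>\<^bsub>A\<^esub> W) - exp (\<beta> * L) * \<psi> (W \<otimes>\<^bsub>A\<^esub> V)) \<le> 0 + e" by simp
  qed
  then have "\<psi> (V \<otimes>\<^bsub>A\<^esub> W) = exp (\<beta> * L) * \<psi> (W \<otimes>\<^bsub>A\<^esub> V)" by simp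
  then have "\<psi> (W \<otimes>\<^bsub>A\<^esub> V) = exp (- \<beta> * L) * \<psi> (V \<otimes>\<^bsub>A\<^esub> W)"
    by (simp add: exp_of_real flip: exp_add mult.assoc of_real_mult)
  then show ?thesis using True
    by (simp add: word_val_def W_def V_def L_def el_ops star_polys_single wpoly_plus)
qed

text \<open>Words have seminorm at most 1. This l1 bound reduces norm derivatives of a polynomial to
  derivatives of finitely many coefficients.\<close>

lemma u_le_sum:
  assumes f: "f \<in> star_polys X" and A: "finite B" "Poly_Mapping.keys f \<subseteq> B"
  shows "u f \<le> (\<Sum>w\<in>B. cmod (Poly_Mapping.lookup f w))"
proof -
  have "u f \<le> (\<Sum>w\<in>Poly_Mapping.keys f. cmod (Poly_Mapping.lookup f w))"
  proof -
    have "u (\<Sum>w\<in>C. Poly_Mapping.single w (Poly_Mapping.lookup f w)) \<le> (\<Sum>w\<in>C. cmod (Poly_Mapping.lookup f w))"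
      if "finite C" "C \<subseteq> Poly_Mapping.keys f" for C
      using that
    proof (induction C rule: finite_induct)
      case (insert w C)
      then have wm: "w \<in> words_over X" using f by (auto simp: star_polys_iff)
      have "u (Poly_Mapping.single w (Poly_Mapping.lookup f w)) \<le> cmod (Poly_Mapping.lookup f w) * u (wpoly w)"
        using u_scale_le[OF star_polys_single[OF wm], of "Poly_Mapping.lookup f w" 1] by simp
      also have "u (wpoly w) \<le> 1" by (rule u_least) (rule seminorm_word[OF _ wm])
      finally have 1: "u (Poly_Mapping.single w (Poly_Mapping.lookup f w)) \<le> cmod (Poly_Mapping.lookup f w)"
        by (simp add: mult_left_mono)
      have "u (\<Sum>w\<in>insert w C. Poly_Mapping.single w (Poly_Mapping.lookup f w))
          \<le> u (Poly_Mapping.single w (Poly_Mapping.lookup f w)) + u (\<Sum>w\<in>C. Poly_Mapping.single w (Poly_Mapping.lookup f w))"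
        using insert f wm by (simp, intro u_add star_polys_sum star_polys_single) (auto simp: star_polys_iff)
      then show ?case using 1 insert by simp
    qed simp
    from this[of "Poly_Mapping.keys f"] show ?thesis by (simp flip: star_poly_expand)
  qed
  also have "\<dots> \<le> (\<Sum>w\<in>B. cmod (Poly_Mapping.lookup f w))" using A by (intro sum_mono2) auto
  finally show ?thesis .
qed

lemma entire_extension_el:
  assumes f: "f \<in> star_polys X"
  shows "entire_extension A dyn (el f) (\<lambda>z. el (rot l z f))"
  unfolding entire_extension_def
proof (intro conjI allI)
  show "el (rot l z f) \<in> carrier A" for z by (intro el_carrier rot_mem f)
  show "el (rot l (of_real t) f) = dyn t (el f)" for t by (simp add: dyn_el f)
next
  fix z
  define d where "d = weigh (\<lambda>w. \<i> * word_weight l w * exp (\<i> * z * word_weight l w)) f"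
  have d: "d \<in> star_polys X" unfolding d_def by (intro weigh_mem f)
  define E where "E h w = (exp (\<i> * (z + h) * word_weight l w) - exp (\<i> * z * word_weight l w)) / h
      - \<i> * word_weight l w * exp (\<i> * z * word_weight l w)" for h w
  have q: "(1 / h) \<odot>\<^bsub>A\<^esub> (el (rot l (z + h) f) \<ominus>\<^bsub>A\<^esub> el (rot l z f)) \<ominus>\<^bsub>A\<^esub> el d
      = el (poly_scale (1 / h) (rot l (z + h) f - rot l z f) - d)" for h
    using d f by (simp add: el_ops el_unary_ops rot_mem star_polys_intros)
  have pm: "poly_scale (1 / h) (rot l (z + h) f - rot l z f) - d \<in> star_polys X" for h
    by (intro star_polys_intros rot_mem f d)
  have lk: "Poly_Mapping.lookup (poly_scale (1 / h) (rot l (z + h) f - rot l z f) - d) w = E h w * Poly_Mapping.lookup f w" for h w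
    by (simp add: E_def d_def rot_def lookup_minus algebra_simps diff_divide_distrib)
  have "((\<lambda>h. cnorm A ((1 / h) \<odot>\<^bsub>A\<^esub> (el (rot l (z + h) f) \<ominus>\<^bsub>A\<^esub> el (rot l z f)) \<ominus>\<^bsub>A\<^esub> el d)) \<longlongrightarrow> 0) (at 0)"
  proof (rule tendsto_sandwich[OF _ _ tendsto_const])
    show "\<forall>\<^sub>F h in at 0. cnorm A ((1 / h) \<odot>\<^bsub>A\<^esub> (el (rot l (z + h) f) \<ominus>\<^bsub>A\<^esub> el (rot l z f)) \<ominus>\<^bsub>A\<^esub> el d)
        \<le> (\<Sum>w\<in>Poly_Mapping.keys f. cmod (E h w * Poly_Mapping.lookup f w))"
    proof (intro always_eventually allI)
      fix h
      have "Poly_Mapping.keys (poly_scale (1 / h) (rot l (z + h) f - rot l z f) - d) \<subseteq> Poly_Mapping.keys f"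
        by (auto simp: in_keys_iff lk)
      from u_le_sum[OF pm _ this]
      show "cnorm A ((1 / h) \<odot>\<^bsub>A\<^esub> (el (rot l (z + h) f) \<ominus>\<^bsub>A\<^esub> el (rot l z f)) \<ominus>\<^bsub>A\<^esub> el d)
        \<le> (\<Sum>w\<in>Poly_Mapping.keys f. cmod (E h w * Poly_Mapping.lookup f w))"
        unfolding q cnorm_el[OF pm] lk by simp
    qed
    have E0: "((\<lambda>h. E h w) \<longlongrightarrow> 0) (at 0)" for w
    proof -
      have "((\<lambda>z. exp (\<i> * z * word_weight l w)) has_field_derivative \<i> * word_weight l w * exp (\<i> * z * word_weight l w)) (at z)"
        by (auto intro!: derivative_eq_intros)
      then show ?thesis unfolding E_def by (simp add: DERIV_def LIM_zero_iff)
    qed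
    have "((\<lambda>h. \<Sum>w\<in>Poly_Mapping.keys f. cmod (E h w * Poly_Mapping.lookup f w)) \<longlongrightarrow> (\<Sum>w\<in>Poly_Mapping.keys f. cmod (0 * Poly_Mapping.lookup f w))) (at 0)"
      by (intro tendsto_sum tendsto_norm tendsto_mult E0 tendsto_const)
    then show "((\<lambda>h. \<Sum>w\<in>Poly_Mapping.keys f. cmod (E h w * Poly_Mapping.lookup f w)) \<longlongrightarrow> 0) (at 0)" by simp
  qed (auto intro!: always_eventually cnorm_nonneg A_closed el_carrier rot_mem f d)
  then show "\<exists>d\<in>carrier A. ((\<lambda>h. cnorm A ((1 / h) \<odot>\<^bsub>A\<^esub> (el (rot l (z + h) f) \<ominus>\<^bsub>A\<^esub> el (rot l z f)) \<ominus>\<^bsub>A\<^esub> d)) \<longlongrightarrow> 0) (at 0)"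
    using el_carrier[OF d] by blast
qed

lemma kms_statesI:
  assumes \<psi>: "\<psi> \<in> states A"
    and kms: "\<And>v w. word_val \<psi> (w + v) = exp (- \<beta> * word_weight l w) * word_val \<psi> (v + w)"
  shows "\<psi> \<in> kms_states A dyn \<beta>"
proof -
  note lin = lin_kms[where \<phi> = "word_val \<psi>" and l = l and \<beta> = \<beta>, OF kms]
  have "\<exists>D. dense_subspace A D \<and> (\<forall>t. \<forall>a\<in>D. dyn t a \<in> D) \<and>
          (\<forall>a\<in>D. \<exists>F. entire_extension A dyn a F \<and>
             (\<forall>b\<in>D. \<psi> (a \<otimes>\<^bsub>A\<^esub> b) = \<psi> (b \<otimes>\<^bsub>A\<^esub> F (\<i> * complex_of_real \<beta>))))"
  proof (intro exI[of _ "el ` star_polys X"] conjI allI ballI)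
    show "dense_subspace A (el ` star_polys X)"
      unfolding dense_subspace_def
      by (auto simp: zero_A el_ops el_unary_ops star_polys_intros elim: el_dense intro!: el_carrier imageI)
    show "dyn t a \<in> el ` star_polys X" if "a \<in> el ` star_polys X" for t a
      using that by (auto simp: dyn_el rot_mem)
    fix a assume "a \<in> el ` star_polys X"
    then obtain f where f: "f \<in> star_polys X" "a = el f" by auto
    show "\<exists>F. entire_extension A dyn a F \<and>
             (\<forall>b\<in>el ` star_polys X. \<psi> (a \<otimes>\<^bsub>A\<^esub> b) = \<psi> (b \<otimes>\<^bsub>A\<^esub> F (\<i> * complex_of_real \<beta>)))"
    proof (intro exI conjI ballI)
      show "entire_extension A dyn a (\<lambda>z. el (rot l z f))" unfolding f(2) by (rule entire_extension_el[OF f(1)])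
      fix b assume "b \<in> el ` star_polys X"
      then obtain g where g: "g \<in> star_polys X" "b = el g" by auto
      show "\<psi> (a \<otimes>\<^bsub>A\<^esub> b) = \<psi> (b \<otimes>\<^bsub>A\<^esub> el (rot l (\<i> * complex_of_real \<beta>) f))"
        using lin[of f g] f g by (simp add: el_ops rot_mem lin_word_val_mem[OF \<psi>] star_polys_mult)
    qed
  qed
  then show ?thesis using \<psi> by (simp add: kms_states_def)
qed

end


section \<open>Characters of groups\<close>

text \<open>Normalized positive definite functions constant on conjugacy classes: these are the
  characters of the overview, the restrictions to a group of the tracial states on its
  C*-algebra.\<close>

definition group_char :: "('g, 'm) monoid_scheme \<Rightarrow> ('g \<Rightarrow> complex) \<Rightarrow> bool" where
  "group_char G \<kappa> \<longleftrightarrow>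
     \<kappa> \<one>\<^bsub>G\<^esub> = 1 \<and>
     (\<forall>g\<in>carrier G. \<forall>h\<in>carrier G. \<kappa> (g \<otimes>\<^bsub>G\<^esub> h) = \<kappa> (h \<otimes>\<^bsub>G\<^esub> g)) \<and>
     (\<forall>B a. finite B \<longrightarrow> B \<subseteq> carrier G \<longrightarrow>
        (\<Sum>g\<in>B. \<Sum>h\<in>B. cnj (a g) * a h * \<kappa> (inv\<^bsub>G\<^esub> g \<otimes>\<^bsub>G\<^esub> h)) \<in> \<real>\<^sub>\<ge>\<^sub>0)"

lemma nonneg_Reals_sum:
  fixes f :: "'a \<Rightarrow> 'b::real_algebra_1"
  shows "(\<And>i. i \<in> I \<Longrightarrow> f i \<in> \<real>\<^sub>\<ge>\<^sub>0) \<Longrightarrow> sum f I \<in> \<real>\<^sub>\<ge>\<^sub>0"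
  by (induction I rule: infinite_finite_induct) (auto intro: nonneg_Reals_add_I)

text \<open>Families with repetitions reduce to sets by adding up the coefficients that belong to
  the same group element.\<close>

lemma group_char_family:
  assumes \<kappa>: "group_char G \<kappa>" and I: "finite I" and h: "\<And>i. i \<in> I \<Longrightarrow> h i \<in> carrier G"
  shows "(\<Sum>i\<in>I. \<Sum>j\<in>I. cnj (f i) * f j * \<kappa> (inv\<^bsub>G\<^esub> (h i) \<otimes>\<^bsub>G\<^esub> h j)) \<in> \<real>\<^sub>\<ge>\<^sub>0"
proof -
  define a where "a g = (\<Sum>i\<in>{i\<in>I. h i = g}. f i)" for g
  let ?X = "\<lambda>g g'. \<kappa> (inv\<^bsub>G\<^esub> g \<otimes>\<^bsub>G\<^esub> g')"
  have "(\<Sum>i\<in>I. \<Sum>j\<in>I. cnj (f i) * f j * ?X (h i) (h j))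
      = (\<Sum>i\<in>I. \<Sum>g'\<in>h ` I. \<Sum>j\<in>{j\<in>I. h j = g'}. cnj (f i) * f j * ?X (h i) (h j))"
    by (intro sum.cong refl sum.image_gen I)
  also have "\<dots> = (\<Sum>g\<in>h ` I. \<Sum>i\<in>{i\<in>I. h i = g}. \<Sum>g'\<in>h ` I. \<Sum>j\<in>{j\<in>I. h j = g'}. cnj (f i) * f j * ?X (h i) (h j))"
    by (intro sum.image_gen I)
  also have "\<dots> = (\<Sum>g\<in>h ` I. \<Sum>i\<in>{i\<in>I. h i = g}. \<Sum>g'\<in>h ` I. cnj (f i) * a g' * ?X g g')"
    by (intro sum.cong refl) (simp add: a_def sum_distrib_left sum_distrib_right)
  also have "\<dots> = (\<Sum>g\<in>h ` I. \<Sum>g'\<in>h ` I. cnj (a g) * a g' * ?X g g')"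
    by (intro sum.cong refl, subst sum.swap) (simp add: a_def sum_distrib_right)
  also have "\<dots> \<in> \<real>\<^sub>\<ge>\<^sub>0"
    using \<kappa> I h unfolding group_char_def by blast
  finally show ?thesis .
qed

lemma (in group) group_char_norm:
  assumes \<kappa>: "group_char G \<kappa>" and g: "g \<in> carrier G"
  shows "cmod (\<kappa> g) \<le> 1"
proof -
  define b where "b = \<kappa> (inv g)"
  have pos: "cnj x * x + cnj x * y * \<kappa> g + (cnj y * x * b + cnj y * y) \<in> \<real>\<^sub>\<ge>\<^sub>0" for x y
  proof -
    \<comment> \<open>The points 1 and g, indexed by \<open>bool\<close> so that they may
      coincide.\<close>
    let ?h = "\<lambda>i::bool. if i then g else \<one>" and ?f = "\<lambda>i::bool. if i then y else x"
    have "(\<Sum>i\<in>UNIV. \<Sum>j\<in>UNIV. cnj (?f i) * ?f j * \<kappa> (inv (?h i) \<otimes> ?h j)) \<in> \<real>\<^sub>\<ge>\<^sub>0"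
      by (rule group_char_family[OF \<kappa>]) (use g in auto)
    then show ?thesis using g \<kappa> by (simp add: UNIV_bool b_def group_char_def)
  qed
  have "Im (\<kappa> g + b) = 0" "Im (\<kappa> g * \<i> - \<i> * b) = 0"
    using pos[of 1 1] pos[of 1 \<i>] by (auto simp: complex_nonneg_Reals_iff mult.commute)
  then have b: "b = cnj (\<kappa> g)" by (simp add: complex_eq_iff)
  \<comment> \<open>With these coefficients the two-point form is 1 minus the squared modulus of
    \<open>\<kappa> g\<close>.\<close>
  have "0 \<le> Re (cnj (\<kappa> g) * \<kappa> g - cnj (\<kappa> g) * \<kappa> g + (1 - \<kappa> g * b))"
    using pos[of "- \<kappa> g" 1] by (simp add: complex_nonneg_Reals_iff algebra_simps)
  then have "(cmod (\<kappa> g))\<^sup>2 \<le> 1" unfolding b cmod_power2 by (simp add: power2_eq_square)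
  then show ?thesis by (simp add: abs_square_le_1)
qed

section \<open>States from group-valued cocycles\<close>

text \<open>The letters act by partial bijections of \<open>C \<times> G\<close> that commute with right multiplication on \<open>G\<close>;
  a character \<open>\<kappa>\<close> of \<open>G\<close> and a weight \<open>W\<close> on \<open>C\<close> define the state
  \<open>w \<mapsto> \<Sum>c. W c \<cdot> \<langle>w \<delta>\<^sub>c, \<delta>\<^sub>c\<rangle>\<close> of the representation of words induced from \<open>\<kappa>\<close>.\<close>

locale cocycle_rep = group G for G (structure) +
  fixes X :: "'x set" and C :: "'c set" and mv :: "'x \<Rightarrow> 'c \<Rightarrow> 'c" and th :: "'x \<Rightarrow> 'c \<Rightarrow> 'a"
    and W :: "'c \<Rightarrow> real" and l :: "'x \<Rightarrow> real" and \<beta> :: real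
  assumes mv: "x \<in> X \<Longrightarrow> c \<in> C \<Longrightarrow> mv x c \<in> C"
    and inj: "x \<in> X \<Longrightarrow> inj_on (mv x) C"
    and th: "x \<in> X \<Longrightarrow> c \<in> C \<Longrightarrow> th x c \<in> carrier G"
    and W_nonneg: "c \<in> C \<Longrightarrow> 0 \<le> W c"
    and W_sum: "(W has_sum 1) C"
    and W_mv: "x \<in> X \<Longrightarrow> c \<in> C \<Longrightarrow> W (mv x c) = exp (- \<beta> * l x) * W c"
begin

fun lact :: "'x letter \<Rightarrow> 'c \<times> 'a \<Rightarrow> ('c \<times> 'a) option" where
  "lact (Gen x) p = (if x \<in> X then Some (mv x (fst p), th x (fst p) \<otimes> snd p) else None)"
| "lact (Adj x) p = (if x \<in> X \<and> fst p \<in> mv x ` C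
     then Some (inv_into C (mv x) (fst p), inv (th x (inv_into C (mv x) (fst p))) \<otimes> snd p) else None)"

primrec lsact :: "'x letter list \<Rightarrow> 'c \<times> 'a \<Rightarrow> ('c \<times> 'a) option" where
  "lsact [] p = Some p"
| "lsact (k # ks) p = Option.bind (lsact ks p) (lact k)"

definition wact :: "'x star_word \<Rightarrow> 'c \<times> 'a \<Rightarrow> ('c \<times> 'a) option" where
  "wact w = lsact (letters w)"

lemma lsact_append: "lsact (ks @ ms) p = Option.bind (lsact ms p) (lsact ks)"
  by (induction ks) (auto simp: bind_assoc split: bind_split)

lemma wact_0 [simp]: "wact 0 p = Some p"
  by (simp add: wact_def zero_star_word_def)

lemma wact_plus: "wact (v + w) p = Option.bind (wact w p) (wact v)"
  by (simp add: wact_def plus_star_word_def lsact_append)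

lemma wact_letter [simp]: "wact (Word [k]) p = lact k p"
  by (simp add: wact_def)

abbreviation D :: "('c \<times> 'a) set" where "D \<equiv> C \<times> carrier G"

lemma inv_mv: "x \<in> X \<Longrightarrow> c \<in> C \<Longrightarrow> inv_into C (mv x) (mv x c) = c"
  by (simp add: inj)

lemma lact_closed: "p \<in> D \<Longrightarrow> lact k p = Some q \<Longrightarrow> q \<in> D"
  by (cases k) (auto split: if_splits simp: mv th inv_mv)

lemma lact_adj1: "p \<in> D \<Longrightarrow> lact k p = Some q \<Longrightarrow> lact (letter_adj k) q = Some p"
  by (cases k) (auto split: if_splits simp: mv th inv_mv m_assoc[symmetric] inj_on_eq_iff[OF inj])

lemma lact_right:
  assumes "p \<in> D" "lact k p = Some q" "g \<in> carrier G"
  shows "lact k (fst p, snd p \<otimes> g) = Some (fst q, snd q \<otimes> g)"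
  using assms by (cases k) (auto split: if_splits simp: th inv_mv m_assoc)

lemma lact_W: "p \<in> D \<Longrightarrow> lact k p = Some q \<Longrightarrow> W (fst q) = exp (- \<beta> * letter_weight l k) * W (fst p)"
  by (cases k) (auto split: if_splits simp: W_mv inv_mv simp flip: exp_add mult.assoc)

lemma wact_closed: "p \<in> D \<Longrightarrow> wact w p = Some q \<Longrightarrow> q \<in> D"
proof (induction w arbitrary: q rule: star_word_induct)
  case (cons k w)
  then obtain r where "wact w p = Some r" "lact k r = Some q" by (auto simp: wact_plus bind_eq_Some_conv)
  then show ?case using cons lact_closed by blast
qed simp

lemma wact_adj1: "p \<in> D \<Longrightarrow> wact w p = Some q \<Longrightarrow> wact (word_adj w) q = Some p"
proof (induction w arbitrary: q rule: star_word_induct)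
  case (cons k w)
  then obtain r where r: "wact w p = Some r" "lact k r = Some q" by (auto simp: wact_plus bind_eq_Some_conv)
  have "word_adj (Word [k]) = Word [letter_adj k]" by (simp add: word_adj_def)
  then show ?case using r cons lact_adj1[OF wact_closed[OF cons.prems(1) r(1)] r(2)]
    by (simp add: word_adj_plus wact_plus)
qed simp

lemma wact_adj: "p \<in> D \<Longrightarrow> q \<in> D \<Longrightarrow> wact (word_adj w) q = Some p \<longleftrightarrow> wact w p = Some q"
  using wact_adj1[of p w q] wact_adj1[of q "word_adj w" p] by auto

lemma wact_right:
  "p \<in> D \<Longrightarrow> wact w p = Some q \<Longrightarrow> g \<in> carrier G \<Longrightarrow> wact w (fst p, snd p \<otimes> g) = Some (fst q, snd q \<otimes> g)"
proof (induction w arbitrary: q rule: star_word_induct)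
  case (cons k w)
  then obtain r where r: "wact w p = Some r" "lact k r = Some q" by (auto simp: wact_plus bind_eq_Some_conv)
  show ?case using cons.IH[OF cons.prems(1) r(1) cons.prems(3)]
      lact_right[OF wact_closed[OF cons.prems(1) r(1)] r(2) cons.prems(3)]
    by (simp add: wact_plus)
qed simp

lemma wact_W: "p \<in> D \<Longrightarrow> wact w p = Some q \<Longrightarrow> W (fst q) = exp (- \<beta> * word_weight l w) * W (fst p)"
proof (induction w arbitrary: q rule: star_word_induct)
  case (cons k w)
  then obtain r where r: "wact w p = Some r" "lact k r = Some q" by (auto simp: wact_plus bind_eq_Some_conv)
  have "exp (- \<beta> * word_weight l (Word [k] + w)) = exp (- \<beta> * letter_weight l k) * exp (- \<beta> * word_weight l w)"
    by (simp add: algebra_simps flip: exp_add)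
  then show ?case using cons.IH[OF cons.prems(1) r(1)] lact_W[OF wact_closed[OF cons.prems(1) r(1)] r(2)]
    by (simp only: mult.assoc)
qed simp

lemma wact_outside: "w \<notin> words_over X \<Longrightarrow> wact w p = None"
proof (induction w rule: star_word_induct)
  case (cons k w)
  show ?case
  proof (cases "w \<in> words_over X")
    case True
    with cons.prems have "Word [k] \<notin> words_over X" by simp
    then have "lact k q = None" for q by (cases k) auto
    then show ?thesis by (simp add: wact_plus Option.bind_eq_None_conv)
  qed (simp add: wact_plus cons.IH)
qed simp

definition omega :: "('a \<Rightarrow> complex) \<Rightarrow> 'c \<Rightarrow> 'x star_word \<Rightarrow> complex" where
  "omega \<kappa> c w = (case wact w (c, \<one>) of None \<Rightarrow> 0 | Some (d, g) \<Rightarrow> if d = c then \<kappa> g else 0)"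

definition state :: "('a \<Rightarrow> complex) \<Rightarrow> 'x star_word \<Rightarrow> complex" where
  "state \<kappa> w = (\<Sum>\<^sub>\<infinity>c\<in>C. of_real (W c) * omega \<kappa> c w)"

lemma omega_eqI: "wact w (c, \<one>) = Some (c, g) \<Longrightarrow> omega \<kappa> c w = \<kappa> g"
  by (simp add: omega_def)

lemma omega_eq_0: "(\<And>g. wact w (c, \<one>) \<noteq> Some (c, g)) \<Longrightarrow> omega \<kappa> c w = 0"
  by (auto simp: omega_def split: option.splits)

lemma omega_norm: "group_char G \<kappa> \<Longrightarrow> c \<in> C \<Longrightarrow> cmod (omega \<kappa> c w) \<le> 1"
  using wact_closed[of "(c, \<one>)" w]
  by (auto simp: omega_def group_char_norm split: option.splits)

lemma W_omega_norm:
  "group_char G \<kappa> \<Longrightarrow> c \<in> C \<Longrightarrow> norm (of_real (W c) * omega \<kappa> c w) \<le> W c"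
  using omega_norm[of \<kappa> c w] W_nonneg[of c] by (simp add: norm_mult mult_left_le)

lemma W_summable: "W summable_on C"
  using W_sum by (auto simp: summable_on_def)

lemma omega_summable: "group_char G \<kappa> \<Longrightarrow> (\<lambda>c. of_real (W c) * omega \<kappa> c w) summable_on C"
  by (rule abs_summable_summable, rule summable_on_comparison_test[OF W_summable])
     (auto intro: W_omega_norm)

lemma state_has_sum:
  assumes \<kappa>: "group_char G \<kappa>"
  shows "((\<lambda>c. of_real (W c) * lin (omega \<kappa> c) f) has_sum lin (state \<kappa>) f) C"
proof (induction f rule: star_poly_induct)
  case (single w d)
  have "((\<lambda>c. of_real (W c) * omega \<kappa> c w) has_sum state \<kappa> w) C"
    unfolding state_def by (rule has_sum_infsum[OF omega_summable[OF \<kappa>]])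
  from has_sum_cmult_right[OF this, of d] show ?case by (simp add: mult_ac)
qed (auto simp: lin_add distrib_left intro: has_sum_add)

lemma lin_adj_mult:
  "lin \<phi> (poly_adj f * f) = (\<Sum>v\<in>Poly_Mapping.keys f. \<Sum>w\<in>Poly_Mapping.keys f.
     cnj (Poly_Mapping.lookup f v) * Poly_Mapping.lookup f w * \<phi> (word_adj v + w))"
proof -
  let ?K = "Poly_Mapping.keys f" and ?f = "Poly_Mapping.lookup f"
  have "poly_adj f = (\<Sum>v\<in>?K. Poly_Mapping.single (word_adj v) (cnj (?f v)))"
    using arg_cong[OF star_poly_expand[of f], of poly_adj] by (simp add: poly_adj_sum)
  from arg_cong2[OF this star_poly_expand[of f], of "(*)"]
  have "poly_adj f * f = (\<Sum>v\<in>?K. \<Sum>w\<in>?K. Poly_Mapping.single (word_adj v + w) (cnj (?f v) * ?f w))"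
    unfolding sum_product mult_single .
  then show ?thesis by (simp add: lin_sum)
qed

text \<open>By right equivariance, if v takes (c, 1) to (e, g), then it takes (c, inv g h) to (e,
  h). So the adjoint of v brings the image (e, h) of (c, 1) under w back to (c, inv g h). This is
  the shape in which positive definiteness of \<kappa> becomes positivity of
  \<open>omega\<close>.\<close>

lemma omega_adj_plus:
  assumes c: "c \<in> C"
  shows "omega \<kappa> c (word_adj v + w) =
    (case (wact v (c, \<one>), wact w (c, \<one>)) of
       (Some (d, g), Some (e, h)) \<Rightarrow> if d = e then \<kappa> (inv g \<otimes> h) else 0 | _ \<Rightarrow> 0)"
proof (cases "wact w (c, \<one>)")
  case None then show ?thesis by (auto simp: omega_def wact_plus split: option.splits)
next
  case (Some p)
  obtain e h where p: "p = (e, h)" by (cases p)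
  have eh: "(e, h) \<in> D" using wact_closed[of "(c, \<one>)" w] c Some p by auto
  show ?thesis
  proof (cases "\<exists>g. wact v (c, \<one>) = Some (e, g)")
    case True
    then obtain g where g: "wact v (c, \<one>) = Some (e, g)" by blast
    have gG: "(e, g) \<in> D" using wact_closed[OF _ g] c by auto
    have k: "inv g \<otimes> h \<in> carrier G" using gG eh by auto
    have "wact v (c, \<one> \<otimes> (inv g \<otimes> h)) = Some (e, g \<otimes> (inv g \<otimes> h))"
      using wact_right[OF _ g k] c by auto
    then have "wact v (c, inv g \<otimes> h) = Some (e, h)" using gG eh by (simp add: m_assoc[symmetric])
    then have "wact (word_adj v) (e, h) = Some (c, inv g \<otimes> h)" using wact_adj1[of "(c, inv g \<otimes> h)" v] c k by auto
    then show ?thesis using Some p g by (auto simp: omega_def wact_plus)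
  next
    case False
    have "wact (word_adj v) (e, h) \<noteq> Some (c, k)" for k
    proof
      assume k: "wact (word_adj v) (e, h) = Some (c, k)"
      then have ck: "(c, k) \<in> D" using wact_closed[OF eh] by auto
      have "wact v (c, k) = Some (e, h)" using wact_adj[OF ck eh] k by simp
      from wact_right[OF ck this, of "inv k"] ck have "wact v (c, \<one>) = Some (e, h \<otimes> inv k)" by auto
      then show False using False by blast
    qed
    then have "omega \<kappa> c (word_adj v + w) = 0" using Some p by (intro omega_eq_0) (simp add: wact_plus)
    then show ?thesis using Some p False by (auto split: option.splits)
  qed
qed

lemma omega_pos:
  assumes \<kappa>: "group_char G \<kappa>" and c: "c \<in> C"
  shows "lin (omega \<kappa> c) (poly_adj f * f) \<in> \<real>\<^sub>\<ge>\<^sub>0"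
proof -
  let ?K = "Poly_Mapping.keys f" and ?f = "Poly_Mapping.lookup f"
  define V where "V = {v \<in> ?K. wact v (c, \<one>) \<noteq> None}"
  define d where "d v = fst (the (wact v (c, \<one>)))" for v
  define h where "h v = snd (the (wact v (c, \<one>)))" for v
  have V: "finite V" "V \<subseteq> ?K" by (auto simp: V_def)
  have wv: "wact v (c, \<one>) = Some (d v, h v)" if "v \<in> V" for v using that by (auto simp: V_def d_def h_def)
  have hG: "h v \<in> carrier G" if "v \<in> V" for v using wact_closed[OF _ wv[OF that]] c by auto
  let ?t = "\<lambda>v w. cnj (?f v) * ?f w * \<kappa> (inv (h v) \<otimes> h w)"
  have "lin (omega \<kappa> c) (poly_adj f * f) = (\<Sum>v\<in>?K. \<Sum>w\<in>?K. cnj (?f v) * ?f w * omega \<kappa> c (word_adj v + w))"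
    by (rule lin_adj_mult)
  also have "\<dots> = (\<Sum>v\<in>V. \<Sum>w\<in>?K. cnj (?f v) * ?f w * omega \<kappa> c (word_adj v + w))"
    using V by (intro sum.mono_neutral_right) (auto simp: omega_adj_plus[OF c] V_def split: option.splits intro!: sum.neutral)
  also have "\<dots> = (\<Sum>v\<in>V. \<Sum>w\<in>V. cnj (?f v) * ?f w * omega \<kappa> c (word_adj v + w))"
    using V by (intro sum.cong refl sum.mono_neutral_right) (auto simp: omega_adj_plus[OF c] V_def split: option.splits)
  also have "\<dots> = (\<Sum>v\<in>V. \<Sum>w\<in>V. if d v = d w then ?t v w else 0)"
    by (intro sum.cong refl) (auto simp: omega_adj_plus[OF c] wv)
  \<comment> \<open>Vectors sent to different classes are orthogonal; within one class the group
    components form a family for \<open>group_char_family\<close>.\<close>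
  also have "\<dots> = (\<Sum>e\<in>d ` V. \<Sum>v\<in>{v\<in>V. d v = e}. \<Sum>w\<in>V. if d v = d w then ?t v w else 0)"
    by (rule sum.image_gen[OF V(1)])
  also have "\<dots> = (\<Sum>e\<in>d ` V. \<Sum>v\<in>{v\<in>V. d v = e}. \<Sum>w\<in>{v\<in>V. d v = e}. ?t v w)"
    using V by (intro sum.cong refl sum.mono_neutral_cong_right) auto
  also have "\<dots> \<in> \<real>\<^sub>\<ge>\<^sub>0"
    using V by (intro nonneg_Reals_sum group_char_family[OF \<kappa>]) (auto simp: hG)
  finally show ?thesis .
qed

lemma state_pos:
  assumes \<kappa>: "group_char G \<kappa>"
  shows "lin (state \<kappa>) (poly_adj f * f) \<in> \<real>\<^sub>\<ge>\<^sub>0"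
proof -
  note hs = state_has_sum[OF \<kappa>, of "poly_adj f * f"]
  have o: "0 \<le> Re (lin (omega \<kappa> c) (poly_adj f * f))" "Im (lin (omega \<kappa> c) (poly_adj f * f)) = 0" if "c \<in> C" for c
    using omega_pos[OF \<kappa> that, of f] by (auto simp: complex_nonneg_Reals_iff)
  have "0 \<le> Re (lin (state \<kappa>) (poly_adj f * f))"
    by (rule has_sum_nonneg[OF has_sum_Re[OF hs]]) (auto simp: o W_nonneg)
  moreover have "Im (lin (state \<kappa>) (poly_adj f * f)) = 0"
    by (rule has_sum_unique[OF has_sum_Im[OF hs] has_sum_0]) (simp add: o)
  ultimately show ?thesis by (simp add: complex_nonneg_Reals_iff)
qed

lemma state_unit: "group_char G \<kappa> \<Longrightarrow> state \<kappa> 0 = 1"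
proof -
  assume \<kappa>: "group_char G \<kappa>"
  have "omega \<kappa> c 0 = 1" for c using \<kappa> by (simp add: omega_def group_char_def)
  then have "state \<kappa> 0 = (\<Sum>\<^sub>\<infinity>c\<in>C. of_real (W c))" by (simp add: state_def)
  also have "\<dots> = of_real 1" by (intro infsumI has_sum_of_real W_sum)
  also have "\<dots> = 1" by simp
  finally show ?thesis .
qed

lemma state_mult_wpoly:
  assumes "\<And>p. p \<in> D \<Longrightarrow> wact w1 p = wact w2 p"
  shows "lin (state \<kappa>) (g * wpoly w1 * h) = lin (state \<kappa>) (g * wpoly w2 * h)"
proof -
  have eq: "state \<kappa> (v + w1 + u) = state \<kappa> (v + w2 + u)" for v u
  proof -
    have "wact (v + w1 + u) (c, \<one>) = wact (v + w2 + u) (c, \<one>)" if "c \<in> C" for c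
      using wact_closed[of "(c, \<one>)" u] that assms by (auto simp: wact_plus bind_assoc split: bind_split)
    then show ?thesis unfolding state_def omega_def by (intro infsum_cong) simp
  qed
  show ?thesis
  proof (induction g rule: star_poly_induct)
    case (single v a)
    show ?case
      by (induction h rule: star_poly_induct) (auto simp: mult_single lin_add distrib_left eq)
  qed (auto simp: lin_add distrib_right)
qed

lemma state_rel:
  assumes "\<And>p. p \<in> D \<Longrightarrow> wact w1 p = wact w2 p"
  shows "lin (state \<kappa>) (g * (wpoly w1 - wpoly w2) * h) = 0"
  using state_mult_wpoly[OF assms, of \<kappa> g h] by (simp add: algebra_simps lin_diff)

lemma state_rel_0:
  assumes "\<And>p. p \<in> D \<Longrightarrow> wact w1 p = None"
  shows "lin (state \<kappa>) (g * wpoly w1 * h) = 0"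
proof -
  have eq: "state \<kappa> (v + w1 + u) = 0" for v u
  proof -
    have "wact (v + w1 + u) (c, \<one>) = None" if "c \<in> C" for c
      using wact_closed[of "(c, \<one>)" u] that assms by (auto simp: wact_plus Option.bind_eq_None_conv split: bind_split)
    then have "omega \<kappa> c (v + w1 + u) = 0" if "c \<in> C" for c using that by (simp add: omega_def)
    then show ?thesis unfolding state_def by (intro infsum_0) simp
  qed
  show ?thesis
  proof (induction g rule: star_poly_induct)
    case (single v a)
    show ?case
      by (induction h rule: star_poly_induct) (auto simp: mult_single lin_add distrib_left eq)
  qed (auto simp: lin_add distrib_right)
qed

text \<open>Cyclic reindexing: a loop at c that passes through d between v and w is also a loop at d
  for v + w. Its group element changes by a conjugation, and the weights of c and d differ by the
  exponential factor.\<close>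

lemma state_kms:
  assumes \<kappa>: "group_char G \<kappa>"
  shows "state \<kappa> (w + v) = exp (- \<beta> * word_weight l w) * state \<kappa> (v + w)"
proof -
  have comm: "\<kappa> (g \<otimes> h) = \<kappa> (h \<otimes> g)" if "g \<in> carrier G" "h \<in> carrier G" for g h
    using \<kappa> that by (simp add: group_char_def)
  define B where "B v w = {c\<in>C. \<exists>g. wact (w + v) (c, \<one>) = Some (c, g)}" for v w
  define f where "f v c = fst (the (wact v (c, \<one>)))" for v c
  have key: "f v c \<in> B w v \<and> f w (f v c) = c \<and> W c = exp (- \<beta> * word_weight l w) * W (f v c)
      \<and> omega \<kappa> c (w + v) = omega \<kappa> (f v c) (v + w)" if c: "c \<in> B v w" for v w c
  proof -
    from c obtain h where cC: "c \<in> C" and h: "wact (w + v) (c, \<one>) = Some (c, h)" by (auto simp: B_def)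
    then obtain d g where dg: "wact v (c, \<one>) = Some (d, g)" and w: "wact w (d, g) = Some (c, h)"
      by (auto simp: wact_plus bind_eq_Some_conv)
    have d: "(d, g) \<in> D" using wact_closed[OF _ dg] cC by auto
    have ch: "(c, h) \<in> D" using wact_closed[OF d w] .
    have w1: "wact w (d, \<one>) = Some (c, h \<otimes> inv g)" using wact_right[OF d w, of "inv g"] d by auto
    have k: "h \<otimes> inv g \<in> carrier G" using d ch by auto
    have v1: "wact v (c, h \<otimes> inv g) = Some (d, g \<otimes> (h \<otimes> inv g))" using wact_right[OF _ dg k] cC k by auto
    have vw: "wact (v + w) (d, \<one>) = Some (d, g \<otimes> (h \<otimes> inv g))" by (simp add: wact_plus w1 v1)
    have f: "f v c = d" "f w d = c" by (simp_all add: f_def dg w1)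
    have "\<kappa> h = \<kappa> (g \<otimes> (h \<otimes> inv g))"
      using comm[of g "h \<otimes> inv g"] d ch by (simp add: m_assoc)
    then show ?thesis
      using d vw h f wact_W[OF d w] by (auto simp: B_def omega_eqI)
  qed
  have bij: "bij_betw (f v) (B v w) (B w v)"
    by (rule bij_betwI[where g = "f w"]) (use key in blast)+
  have red: "state \<kappa> (w + v) = (\<Sum>\<^sub>\<infinity>c\<in>B v w. of_real (W c) * omega \<kappa> c (w + v))" for v w
    unfolding state_def by (rule infsum_cong_neutral) (auto simp: B_def intro!: omega_eq_0)
  have "state \<kappa> (w + v) = (\<Sum>\<^sub>\<infinity>c\<in>B v w. of_real (exp (- \<beta> * word_weight l w)) * (of_real (W (f v c)) * omega \<kappa> (f v c) (v + w)))"
    unfolding red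
  proof (rule infsum_cong)
    fix c assume "c \<in> B v w"
    then have k: "W c = exp (- \<beta> * word_weight l w) * W (f v c)" "omega \<kappa> c (w + v) = omega \<kappa> (f v c) (v + w)"
      using key by blast+
    show "of_real (W c) * omega \<kappa> c (w + v)
        = of_real (exp (- \<beta> * word_weight l w)) * (of_real (W (f v c)) * omega \<kappa> (f v c) (v + w))"
      unfolding k(2) by (subst k(1)) (simp only: of_real_mult mult.assoc)
  qed
  also have "\<dots> = of_real (exp (- \<beta> * word_weight l w)) * (\<Sum>\<^sub>\<infinity>c\<in>B v w. of_real (W (f v c)) * omega \<kappa> (f v c) (v + w))"
    by (rule infsum_cmult_right')
  also have "(\<Sum>\<^sub>\<infinity>c\<in>B v w. of_real (W (f v c)) * omega \<kappa> (f v c) (v + w)) = state \<kappa> (v + w)"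
    unfolding red by (rule infsum_reindex_bij_betw[OF bij])
  finally show ?thesis .
qed

lemma alg_state_state:
  assumes \<kappa>: "group_char G \<kappa>"
    and R: "\<And>r. r \<in> R \<Longrightarrow> (\<exists>w1 w2. r = wpoly w1 - wpoly w2 \<and> (\<forall>p\<in>D. wact w1 p = wact w2 p)) \<or>
        (\<exists>w. r = wpoly w \<and> (\<forall>p\<in>D. wact w p = None))"
  shows "alg_state X R (state \<kappa>)"
proof
  fix w assume "w \<notin> words_over X"
  then show "state \<kappa> w = 0" by (simp add: state_def omega_def wact_outside)
next
  fix r g h assume "r \<in> R"
  from R[OF this] show "lin (state \<kappa>) (g * r * h) = 0"
  proof (elim disjE exE conjE)
    fix w1 w2 assume r: "r = wpoly w1 - wpoly w2" and p: "\<forall>p\<in>D. wact w1 p = wact w2 p"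
    show ?thesis unfolding r by (rule state_rel) (rule bspec[OF p])
  next
    fix w assume r: "r = wpoly w" and p: "\<forall>p\<in>D. wact w p = None"
    show ?thesis unfolding r by (rule state_rel_0) (rule bspec[OF p])
  qed
qed (auto simp: state_unit state_pos \<kappa>)

text \<open>\<open>omega\<close> is bounded by 1, so cutting the sum off at a finite set of classes
  costs at most the remaining weight, uniformly in the character.\<close>

lemma continuous_map_state:
  assumes \<kappa>: "\<And>z. z \<in> topspace Z \<Longrightarrow> group_char G (\<kappa> z)"
    and cont: "\<And>g. g \<in> carrier G \<Longrightarrow> continuous_map Z euclidean (\<lambda>z. \<kappa> z g)"
  shows "continuous_map Z euclidean (\<lambda>z. state (\<kappa> z) w)"
proof (rule continuous_map_approx)
  fix e :: real assume e: "e > 0"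
  obtain F where F: "finite F" "F \<subseteq> C" and Fe: "dist (sum W F) 1 \<le> e / 2"
    using has_sum_finite_approximation[OF W_sum, of "e/2"] e by auto
  have rest: "(W has_sum (1 - sum W F)) (C - F)"
    by (rule has_sum_Diff[OF W_sum has_sum_finite[OF F(1)] F(2)])
  have om: "continuous_map Z euclidean (\<lambda>z. omega (\<kappa> z) c w)" if "c \<in> C" for c
  proof (cases "\<exists>g. wact w (c, \<one>) = Some (c, g)")
    case True
    then obtain g where g: "wact w (c, \<one>) = Some (c, g)" by blast
    then have "g \<in> carrier G" using wact_closed[OF _ g] that by auto
    then show ?thesis using cont by (simp add: omega_eqI[OF g])
  next
    case False
    then show ?thesis by (simp add: omega_eq_0)
  qed
  have "continuous_map Z euclidean (\<lambda>z. \<Sum>c\<in>F. of_real (W c) * omega (\<kappa> z) c w)"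
    using F by (intro continuous_map_sum continuous_map_cmult om) auto
  moreover have "cmod ((\<Sum>c\<in>F. of_real (W c) * omega (\<kappa> z) c w) - state (\<kappa> z) w) < e" if z: "z \<in> topspace Z" for z
  proof -
    let ?g = "\<lambda>c. of_real (W c) * omega (\<kappa> z) c w"
    have hs: "(?g has_sum (state (\<kappa> z) w - sum ?g F)) (C - F)"
      unfolding state_def
      by (rule has_sum_Diff[OF has_sum_infsum[OF omega_summable[OF \<kappa>[OF z]]] has_sum_finite[OF F(1)] F(2)])
    have "cmod (state (\<kappa> z) w - sum ?g F) \<le> 1 - sum W F"
      by (rule norm_infsum_le[OF hs rest]) (auto intro: W_omega_norm \<kappa> z)
    then show ?thesis using Fe e unfolding dist_real_def by (subst norm_minus_commute) linarith
  qed
  ultimately show "\<exists>f. continuous_map Z euclidean f \<and> (\<forall>z\<in>topspace Z. cmod (f z - state (\<kappa> z) w) < e)"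
    by blast
qed

lemma state_affine:
  assumes "group_char G \<kappa>" "group_char G \<kappa>'" and "\<And>g. g \<in> carrier G \<Longrightarrow> \<kappa>'' g = a * \<kappa> g + b * \<kappa>' g"
  shows "state \<kappa>'' w = a * state \<kappa> w + b * state \<kappa>' w"
proof -
  have "omega \<kappa>'' c w = a * omega \<kappa> c w + b * omega \<kappa>' c w" if "c \<in> C" for c
    using wact_closed[of "(c, \<one>)" w] that assms(3) by (auto simp: omega_def split: option.splits)
  then have "state \<kappa>'' w = (\<Sum>\<^sub>\<infinity>c\<in>C. a * (of_real (W c) * omega \<kappa> c w) + b * (of_real (W c) * omega \<kappa>' c w))"
    unfolding state_def by (intro infsum_cong) (simp add: algebra_simps)
  also have "\<dots> = a * state \<kappa> w + b * state \<kappa>' w"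
    unfolding state_def
    by (subst infsum_add) (auto intro!: summable_on_cmult_right omega_summable assms simp: infsum_cmult_right')
  finally show ?thesis .
qed

end


section \<open>The maximal group image\<close>

locale directed_monoid = right_lcm_semigroup T for T (structure) +
  assumes directed: "\<lbrakk>a \<in> carrier T; b \<in> carrier T\<rbrakk> \<Longrightarrow> \<exists>c\<in>carrier T. \<exists>d\<in>carrier T. a \<otimes> c = b \<otimes> d"
begin

abbreviation frac :: "'a \<Rightarrow> 'a \<Rightarrow> 'a \<rightharpoonup> 'a" where
  "frac s t \<equiv> left_mult T s \<circ>\<^sub>m partial_inv (left_mult T t)"

abbreviation Ih :: "('a \<rightharpoonup> 'a) monoid" where "Ih \<equiv> left_inverse_hull T"

abbreviation G :: "('a \<rightharpoonup> 'a) set monoid" where "G \<equiv> max_group_image Ih"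

definition cls :: "'a \<Rightarrow> 'a \<Rightarrow> ('a \<rightharpoonup> 'a) set" where
  "cls s t = group_congruence Ih `` {frac s t}"

text \<open>Equality of the fractions s/t and s'/t' in the sense of Ore: they have a common
  expansion.\<close>

definition fr :: "'a \<Rightarrow> 'a \<Rightarrow> 'a \<Rightarrow> 'a \<Rightarrow> bool" where
  "fr s t s' t' \<longleftrightarrow> (\<exists>a\<in>carrier T. \<exists>b\<in>carrier T. s \<otimes> a = s' \<otimes> b \<and> t \<otimes> a = t' \<otimes> b)"

lemma cancel_iff:
  "s \<in> carrier T \<Longrightarrow> t \<in> carrier T \<Longrightarrow> u \<in> carrier T \<Longrightarrow> s \<otimes> t = s \<otimes> u \<longleftrightarrow> t = u"
  using left_cancel by blast

lemma left_mult_Some: "left_mult T s x = Some y \<longleftrightarrow> x \<in> carrier T \<and> y = s \<otimes> x"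
  by (auto simp: left_mult_def)

lemma partial_inv_left_mult:
  assumes t: "t \<in> carrier T"
  shows "partial_inv (left_mult T t) y = Some x \<longleftrightarrow> x \<in> carrier T \<and> y = t \<otimes> x"
proof (cases "y \<in> ran (left_mult T t)")
  case True
  then obtain x' where x': "x' \<in> carrier T" "y = t \<otimes> x'" by (auto simp: ran_def left_mult_Some)
  have "(THE x. left_mult T t x = Some y) = x'"
    by (rule the_equality) (use x' t cancel_iff in \<open>auto simp: left_mult_Some\<close>)
  then show ?thesis using True x' t cancel_iff by (auto simp: partial_inv_def)
next
  case False
  then show ?thesis by (auto simp: partial_inv_def ran_def left_mult_Some)
qed

lemma frac_Some:
  "t \<in> carrier T \<Longrightarrow> frac s t y = Some z \<longleftrightarrow> (\<exists>x\<in>carrier T. y = t \<otimes> x \<and> z = s \<otimes> x)"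
  by (auto simp: map_comp_Some_iff partial_inv_left_mult left_mult_Some)

lemma carrier_Ih: "carrier Ih = {frac s t | s t. s \<in> carrier T \<and> t \<in> carrier T}"
  by (simp add: left_inverse_hull_def)

lemma mult_Ih: "x \<otimes>\<^bsub>Ih\<^esub> y = x \<circ>\<^sub>m y"
  by (simp add: left_inverse_hull_def)

lemma partial_map_eqI:
  assumes "\<And>y z. f y = Some z \<longleftrightarrow> g y = Some z"
  shows "f = g"
  using assms by (metis ext not_None_eq)

text \<open>Products of partial bijections need a least common multiple, not just any, for the
  domains to match. In the group image any common multiple will do, see
  \<open>cls_prod_indep\<close>.\<close>

lemma lcm_mult:
  assumes "s \<in> carrier T" "t \<in> carrier T"
  obtains a b where "a \<in> carrier T" "b \<in> carrier T" "s \<otimes> a = t \<otimes> b"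
    "\<And>c d. c \<in> carrier T \<Longrightarrow> d \<in> carrier T \<Longrightarrow> s \<otimes> c = t \<otimes> d \<Longrightarrow> \<exists>e\<in>carrier T. c = a \<otimes> e \<and> d = b \<otimes> e"
proof -
  have "(s <# carrier T) \<inter> (t <# carrier T) \<noteq> {}"
    using directed[OF assms] by (auto simp: l_coset_def)
  then obtain r where r: "r \<in> carrier T" "(s <# carrier T) \<inter> (t <# carrier T) = r <# carrier T"
    using right_lcm[OF assms] by blast
  have "r \<in> r <# carrier T" using r(1) by (auto simp: l_coset_def intro!: bexI[of _ \<one>])
  then obtain a b where ab: "a \<in> carrier T" "b \<in> carrier T" "r = s \<otimes> a" "r = t \<otimes> b"
    unfolding r(2)[symmetric] by (auto simp: l_coset_def)
  show ?thesis
  proof (rule that[OF ab(1,2)])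
    show "s \<otimes> a = t \<otimes> b" using ab by simp
    fix c d assume cd: "c \<in> carrier T" "d \<in> carrier T" "s \<otimes> c = t \<otimes> d"
    have "s \<otimes> c \<in> s <# carrier T" using cd(1) by (auto simp: l_coset_def)
    moreover have "s \<otimes> c \<in> t <# carrier T" unfolding cd(3) using cd(2) by (auto simp: l_coset_def)
    ultimately have "s \<otimes> c \<in> r <# carrier T" unfolding r(2)[symmetric] by blast
    then obtain e where e: "e \<in> carrier T" "s \<otimes> c = r \<otimes> e" by (auto simp: l_coset_def)
    have "s \<otimes> c = s \<otimes> (a \<otimes> e)" using e ab assms by (metis m_assoc)
    then have 1: "c = a \<otimes> e" using left_cancel[OF assms(1) cd(1)] ab e by simp
    have "t \<otimes> d = t \<otimes> (b \<otimes> e)" using e ab assms cd by (metis m_assoc)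
    then have "d = b \<otimes> e" using left_cancel[OF assms(2) cd(2)] ab e by simp
    then show "\<exists>e\<in>carrier T. c = a \<otimes> e \<and> d = b \<otimes> e" using 1 e by blast
  qed
qed

lemma frac_frac:
  assumes "s \<in> carrier T" "t \<in> carrier T" "s' \<in> carrier T" "t' \<in> carrier T"
  obtains a b where "a \<in> carrier T" "b \<in> carrier T" "t \<otimes> a = s' \<otimes> b" "frac s t \<circ>\<^sub>m frac s' t' = frac (s \<otimes> a) (t' \<otimes> b)"
proof -
  obtain a b where ab: "a \<in> carrier T" "b \<in> carrier T" "t \<otimes> a = s' \<otimes> b"
    and u: "\<And>c d. c \<in> carrier T \<Longrightarrow> d \<in> carrier T \<Longrightarrow> t \<otimes> c = s' \<otimes> d \<Longrightarrow> \<exists>e\<in>carrier T. c = a \<otimes> e \<and> d = b \<otimes> e"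
    using lcm_mult[OF assms(2,3)] by metis
  have "frac s t \<circ>\<^sub>m frac s' t' = frac (s \<otimes> a) (t' \<otimes> b)"
  proof (rule partial_map_eqI)
    fix y z
    have "(frac s t \<circ>\<^sub>m frac s' t') y = Some z \<longleftrightarrow>
      (\<exists>d\<in>carrier T. \<exists>c\<in>carrier T. y = t' \<otimes> d \<and> s' \<otimes> d = t \<otimes> c \<and> z = s \<otimes> c)"
      unfolding map_comp_Some_iff[of "frac s t"] frac_Some[OF assms(2)] frac_Some[OF assms(4)] by blast
    also have "\<dots> \<longleftrightarrow> (\<exists>e\<in>carrier T. y = t' \<otimes> (b \<otimes> e) \<and> z = s \<otimes> (a \<otimes> e))"
    proof
      assume "\<exists>d\<in>carrier T. \<exists>c\<in>carrier T. y = t' \<otimes> d \<and> s' \<otimes> d = t \<otimes> c \<and> z = s \<otimes> c"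
      then show "\<exists>e\<in>carrier T. y = t' \<otimes> (b \<otimes> e) \<and> z = s \<otimes> (a \<otimes> e)" using u by metis
    next
      assume "\<exists>e\<in>carrier T. y = t' \<otimes> (b \<otimes> e) \<and> z = s \<otimes> (a \<otimes> e)"
      then obtain e where e: "e \<in> carrier T" "y = t' \<otimes> (b \<otimes> e)" "z = s \<otimes> (a \<otimes> e)" by blast
      have "s' \<otimes> (b \<otimes> e) = t \<otimes> (a \<otimes> e)" using ab e(1) assms by (metis m_assoc)
      then show "\<exists>d\<in>carrier T. \<exists>c\<in>carrier T. y = t' \<otimes> d \<and> s' \<otimes> d = t \<otimes> c \<and> z = s \<otimes> c"
        using e ab by blast
    qed
    also have "\<dots> \<longleftrightarrow> frac (s \<otimes> a) (t' \<otimes> b) y = Some z"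
      using ab assms by (simp add: frac_Some m_assoc)
    finally show "(frac s t \<circ>\<^sub>m frac s' t') y = Some z \<longleftrightarrow> frac (s \<otimes> a) (t' \<otimes> b) y = Some z" .
  qed
  then show ?thesis using that ab by blast
qed

lemma frac_carrier: "s \<in> carrier T \<Longrightarrow> t \<in> carrier T \<Longrightarrow> frac s t \<in> carrier Ih"
  by (auto simp: carrier_Ih)

text \<open>An idempotent of the hull is the identity on a right ideal, and by directedness any two
  such ideals meet. So congruent fractions agree at some \<open>t \<otimes> a\<close>, which
  exhibits the common expansion.\<close>

lemma congruence_frac:
  assumes "s \<in> carrier T" "t \<in> carrier T" "s' \<in> carrier T" "t' \<in> carrier T"
  shows "(frac s t, frac s' t') \<in> group_congruence Ih \<longleftrightarrow> fr s t s' t'"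
proof
  assume "(frac s t, frac s' t') \<in> group_congruence Ih"
  then obtain q where q: "q \<in> carrier Ih" "q \<circ>\<^sub>m q = q" "frac s t \<circ>\<^sub>m q = frac s' t' \<circ>\<^sub>m q"
    unfolding group_congruence_def mem_Collect_eq prod.case mult_Ih by blast
  from q(1) obtain u v where uv: "u \<in> carrier T" "v \<in> carrier T" and quv: "q = frac u v"
    unfolding carrier_Ih by blast
  note idem = q(2)[unfolded quv] and eq = q(3)[unfolded quv]
  obtain x0 x1 where x0: "x0 \<in> carrier T" "x1 \<in> carrier T" "u \<otimes> x0 = v \<otimes> x1" using directed[OF uv] by blast
  have "frac u v (v \<otimes> x0) = Some (u \<otimes> x0)" using uv x0 by (auto simp: frac_Some)
  moreover have "frac u v (u \<otimes> x0) = Some (u \<otimes> x1)" using uv x0 by (auto simp: frac_Some)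
  ultimately have "(frac u v \<circ>\<^sub>m frac u v) (v \<otimes> x0) = Some (u \<otimes> x1)" by (simp add: map_comp_simps)
  then have "u \<otimes> x1 = u \<otimes> x0" unfolding idem using \<open>frac u v (v \<otimes> x0) = Some (u \<otimes> x0)\<close> by simp
  then have "x1 = x0" using left_cancel uv x0 by blast
  \<comment> \<open>Idempotence makes \<open>frac u v\<close> fix \<open>v \<otimes> x0\<close>, and
    with it the right ideal generated by this element.\<close>
  with x0 have m: "u \<otimes> x0 = v \<otimes> x0" by simp
  obtain z a where z: "z \<in> carrier T" "a \<in> carrier T" "(v \<otimes> x0) \<otimes> z = t \<otimes> a"
    using directed[of "v \<otimes> x0" t] uv x0 assms by auto
  have "u \<otimes> (x0 \<otimes> z) = t \<otimes> a" "v \<otimes> (x0 \<otimes> z) = t \<otimes> a"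
    using z m uv x0 by (metis m_assoc)+
  then have f: "frac u v (t \<otimes> a) = Some (t \<otimes> a)"
    unfolding frac_Some[OF uv(2)] using x0 z by (intro bexI[of _ "x0 \<otimes> z"]) auto
  have "frac s t (t \<otimes> a) = Some (s \<otimes> a)" using assms z by (auto simp: frac_Some)
  then have "(frac s' t' \<circ>\<^sub>m frac u v) (t \<otimes> a) = Some (s \<otimes> a)"
    unfolding eq[symmetric] using f by (simp add: map_comp_simps)
  then have "frac s' t' (t \<otimes> a) = Some (s \<otimes> a)" using f by (simp add: map_comp_simps)
  then obtain b where "b \<in> carrier T" "t \<otimes> a = t' \<otimes> b" "s \<otimes> a = s' \<otimes> b" using assms by (auto simp: frac_Some)
  then show "fr s t s' t'" using z(2) unfolding fr_def by blast
next
  assume "fr s t s' t'"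
  then obtain a b where ab: "a \<in> carrier T" "b \<in> carrier T" "s \<otimes> a = s' \<otimes> b" "t \<otimes> a = t' \<otimes> b"
    unfolding fr_def by blast
  \<comment> \<open>The identity on the right ideal of \<open>t \<otimes> a\<close>, where both
    fractions are defined and agree.\<close>
  define p where "p = frac (t \<otimes> a) (t \<otimes> a)"
  have p: "p y = Some z \<longleftrightarrow> (\<exists>x\<in>carrier T. y = t \<otimes> a \<otimes> x) \<and> z = y" for y z
    unfolding p_def using assms ab by (auto simp: frac_Some)
  have pI: "p \<in> carrier Ih" unfolding p_def using assms ab by (intro frac_carrier) auto
  have 1: "p \<circ>\<^sub>m p = p"
    by (rule partial_map_eqI) (auto simp: map_comp_Some_iff p)
  have 2: "frac s t \<circ>\<^sub>m p = frac s' t' \<circ>\<^sub>m p"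
  proof (rule partial_map_eqI)
    fix y z
    have 1: "frac s t (t \<otimes> a \<otimes> x) = Some (s \<otimes> a \<otimes> x)" if "x \<in> carrier T" for x
      unfolding frac_Some[OF assms(2)] using assms ab(1) that by (intro bexI[of _ "a \<otimes> x"]) (auto simp: m_assoc)
    have 2: "frac s' t' (t \<otimes> a \<otimes> x) = Some (s \<otimes> a \<otimes> x)" if "x \<in> carrier T" for x
    proof -
      have "t \<otimes> a \<otimes> x = t' \<otimes> (b \<otimes> x)" "s \<otimes> a \<otimes> x = s' \<otimes> (b \<otimes> x)"
        unfolding ab(3,4) using assms ab that by (simp_all add: m_assoc)
      then show ?thesis unfolding frac_Some[OF assms(4)] using ab that by (intro bexI[of _ "b \<otimes> x"]) auto
    qed
    show "(frac s t \<circ>\<^sub>m p) y = Some z \<longleftrightarrow> (frac s' t' \<circ>\<^sub>m p) y = Some z"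
      unfolding map_comp_Some_iff[of _ p] p using 1 2 by auto
  qed
  show "(frac s t, frac s' t') \<in> group_congruence Ih"
    unfolding group_congruence_def mem_Collect_eq prod.case mult_Ih
    by (intro conjI bexI[OF _ pI] frac_carrier assms 1 2)
qed

lemma fr_refl: "fr s t s t"
  unfolding fr_def by (intro bexI[of _ \<one>]) auto

lemma fr_sym: "fr s t s' t' \<Longrightarrow> fr s' t' s t"
  unfolding fr_def by metis

lemma fr_trans:
  assumes c: "s \<in> carrier T" "t \<in> carrier T" "s' \<in> carrier T" "t' \<in> carrier T" "s'' \<in> carrier T" "t'' \<in> carrier T"
    and "fr s t s' t'" "fr s' t' s'' t''"
  shows "fr s t s'' t''"
proof -
  obtain a b where ab: "a \<in> carrier T" "b \<in> carrier T" "s \<otimes> a = s' \<otimes> b" "t \<otimes> a = t' \<otimes> b"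
    using assms(7) unfolding fr_def by blast
  obtain d e where de: "d \<in> carrier T" "e \<in> carrier T" "s' \<otimes> d = s'' \<otimes> e" "t' \<otimes> d = t'' \<otimes> e"
    using assms(8) unfolding fr_def by blast
  obtain x y where xy: "x \<in> carrier T" "y \<in> carrier T" "b \<otimes> x = d \<otimes> y" using directed ab de by blast
  have "s \<otimes> (a \<otimes> x) = s'' \<otimes> (e \<otimes> y)" "t \<otimes> (a \<otimes> x) = t'' \<otimes> (e \<otimes> y)"
    using ab de xy c by (metis m_assoc)+
  then show ?thesis unfolding fr_def using ab de xy by (meson m_closed)
qed

lemma cls_eq:
  assumes "s \<in> carrier T" "t \<in> carrier T" "s' \<in> carrier T" "t' \<in> carrier T"
  shows "cls s t = cls s' t' \<longleftrightarrow> fr s t s' t'"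
proof
  assume "cls s t = cls s' t'"
  moreover have "frac s' t' \<in> cls s' t'" using assms by (auto simp: cls_def congruence_frac fr_refl)
  ultimately have "frac s' t' \<in> cls s t" by simp
  then show "fr s t s' t'" using assms by (simp add: cls_def congruence_frac)
next
  assume fr: "fr s t s' t'"
  have *: "(frac s t, x) \<in> group_congruence Ih \<longleftrightarrow> (frac s' t', x) \<in> group_congruence Ih" for x
  proof (cases "x \<in> carrier Ih")
    case True
    then obtain u v where uv: "u \<in> carrier T" "v \<in> carrier T" "x = frac u v" by (auto simp: carrier_Ih)
    show ?thesis unfolding uv(3) congruence_frac[OF assms(1,2) uv(1,2)] congruence_frac[OF assms(3,4) uv(1,2)]
      using fr_trans[OF assms(3,4,1,2) uv(1,2)] fr_trans[OF assms(1,2,3,4) uv(1,2)] fr fr_sym[OF fr] by blast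
  qed (auto simp: group_congruence_def)
  show "cls s t = cls s' t'" unfolding cls_def Image_singleton by (rule Collect_cong) (rule *)
qed

lemma cls_mem:
  assumes "s \<in> carrier T" "t \<in> carrier T" "x \<in> cls s t"
  obtains s' t' where "s' \<in> carrier T" "t' \<in> carrier T" "x = frac s' t'" "fr s t s' t'"
proof -
  have "x \<in> carrier Ih" using assms(3) by (auto simp: cls_def group_congruence_def)
  then obtain s' t' where st: "s' \<in> carrier T" "t' \<in> carrier T" "x = frac s' t'" unfolding carrier_Ih by blast
  show ?thesis by (rule that[OF st]) (use assms st in \<open>simp add: cls_def congruence_frac\<close>)
qed

lemma carrier_G: "carrier G = {cls s t | s t. s \<in> carrier T \<and> t \<in> carrier T}"
proof -
  have q: "carrier G = carrier Ih // group_congruence Ih" by (simp add: max_group_image_def)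
  show ?thesis
  proof (intro equalityI subsetI)
    fix g assume "g \<in> carrier G"
    then obtain x where x: "g = group_congruence Ih `` {x}" "x \<in> carrier Ih" unfolding q by (rule quotientE)
    from x(2) obtain s t where "s \<in> carrier T" "t \<in> carrier T" "x = frac s t" unfolding carrier_Ih by blast
    with x(1) show "g \<in> {cls s t | s t. s \<in> carrier T \<and> t \<in> carrier T}" unfolding cls_def by blast
  next
    fix g assume "g \<in> {cls s t | s t. s \<in> carrier T \<and> t \<in> carrier T}"
    then obtain s t where "s \<in> carrier T" "t \<in> carrier T" "g = group_congruence Ih `` {frac s t}"
      unfolding cls_def by blast
    then show "g \<in> carrier G" unfolding q using quotientI[OF frac_carrier] by blast
  qed
qed

lemma cls_carrier [simp, intro]: "s \<in> carrier T \<Longrightarrow> t \<in> carrier T \<Longrightarrow> cls s t \<in> carrier G"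
  by (auto simp: carrier_G)

lemma cls_cancel:
  assumes "s \<in> carrier T" "t \<in> carrier T" "a \<in> carrier T"
  shows "cls (s \<otimes> a) (t \<otimes> a) = cls s t"
proof -
  have "fr (s \<otimes> a) (t \<otimes> a) s t"
    unfolding fr_def by (rule bexI[of _ \<one>], rule bexI[of _ a]) (use assms in simp_all)
  then show ?thesis using assms by (simp add: cls_eq)
qed

text \<open>Two choices of a common multiple can be extended to a common one by directedness, and
  left cancellation identifies the second factors.\<close>

lemma cls_prod_indep:
  assumes c: "s \<in> carrier T" "t \<in> carrier T" "s' \<in> carrier T" "t' \<in> carrier T"
    and ab: "a \<in> carrier T" "b \<in> carrier T" "t \<otimes> a = s' \<otimes> b"
    and de: "d \<in> carrier T" "e \<in> carrier T" "t \<otimes> d = s' \<otimes> e"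
  shows "cls (s \<otimes> a) (t' \<otimes> b) = cls (s \<otimes> d) (t' \<otimes> e)"
proof -
  obtain x y where xy: "x \<in> carrier T" "y \<in> carrier T" "a \<otimes> x = d \<otimes> y" using directed ab de by blast
  have "s' \<otimes> (b \<otimes> x) = s' \<otimes> (e \<otimes> y)" using ab de xy c by (metis m_assoc)
  then have "b \<otimes> x = e \<otimes> y" using left_cancel[of s' "b \<otimes> x" "e \<otimes> y"] ab de xy c by simp
  then have "fr (s \<otimes> a) (t' \<otimes> b) (s \<otimes> d) (t' \<otimes> e)"
    unfolding fr_def using ab de xy c by (intro bexI[of _ x] bexI[of _ y]) (simp_all add: m_assoc)
  then show ?thesis using ab de c by (subst cls_eq) auto
qed

lemma cls_prod_cong:
  assumes c: "s \<in> carrier T" "t \<in> carrier T" "s' \<in> carrier T" "t' \<in> carrier T"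
    and c1: "s1 \<in> carrier T" "t1 \<in> carrier T" "s1' \<in> carrier T" "t1' \<in> carrier T"
    and fr: "fr s t s1 t1" "fr s' t' s1' t1'"
    and ab: "a \<in> carrier T" "b \<in> carrier T" "t \<otimes> a = s' \<otimes> b"
    and de: "d \<in> carrier T" "e \<in> carrier T" "t1 \<otimes> d = s1' \<otimes> e"
  shows "cls (s \<otimes> a) (t' \<otimes> b) = cls (s1 \<otimes> d) (t1' \<otimes> e)"
proof -
  obtain f g where fg: "f \<in> carrier T" "g \<in> carrier T" "s \<otimes> f = s1 \<otimes> g" "t \<otimes> f = t1 \<otimes> g"
    using fr(1) unfolding fr_def by blast
  obtain f' g' where fg': "f' \<in> carrier T" "g' \<in> carrier T" "s' \<otimes> f' = s1' \<otimes> g'" "t' \<otimes> f' = t1' \<otimes> g'"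
    using fr(2) unfolding fr_def by blast
  obtain x y where xy: "x \<in> carrier T" "y \<in> carrier T" "(t \<otimes> f) \<otimes> x = (s' \<otimes> f') \<otimes> y"
    using directed[OF m_closed[OF c(2) fg(1)] m_closed[OF c(3) fg'(1)]] by blast
  have "cls (s \<otimes> a) (t' \<otimes> b) = cls (s \<otimes> (f \<otimes> x)) (t' \<otimes> (f' \<otimes> y))"
    using xy fg(1) fg'(1) c by (intro cls_prod_indep[OF c ab]) (auto simp: m_assoc)
  also have "\<dots> = cls (s1 \<otimes> (g \<otimes> x)) (t1' \<otimes> (g' \<otimes> y))"
    using xy fg fg' c c1 by (metis m_assoc)
  also have "\<dots> = cls (s1 \<otimes> d) (t1' \<otimes> e)"
  proof (rule cls_prod_indep[OF c1 _ _ _ de])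
    show "t1 \<otimes> (g \<otimes> x) = s1' \<otimes> (g' \<otimes> y)" using xy fg fg' c c1 by (metis m_assoc)
  qed (use xy fg fg' in auto)
  finally show ?thesis .
qed

lemma cls_mult:
  assumes c: "s \<in> carrier T" "t \<in> carrier T" "s' \<in> carrier T" "t' \<in> carrier T"
    and ab: "a \<in> carrier T" "b \<in> carrier T" "t \<otimes> a = s' \<otimes> b"
  shows "cls s t \<otimes>\<^bsub>G\<^esub> cls s' t' = cls (s \<otimes> a) (t' \<otimes> b)"
proof -
  have "group_congruence Ih `` {x \<circ>\<^sub>m y} = cls (s \<otimes> a) (t' \<otimes> b)" if x: "x \<in> cls s t" and y: "y \<in> cls s' t'" for x y
  proof -
    obtain s1 t1 where 1: "s1 \<in> carrier T" "t1 \<in> carrier T" "x = frac s1 t1" "fr s t s1 t1" using cls_mem[OF c(1,2) x] .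
    obtain s1' t1' where 2: "s1' \<in> carrier T" "t1' \<in> carrier T" "y = frac s1' t1'" "fr s' t' s1' t1'" using cls_mem[OF c(3,4) y] .
    obtain d e where de: "d \<in> carrier T" "e \<in> carrier T" "t1 \<otimes> d = s1' \<otimes> e" "x \<circ>\<^sub>m y = frac (s1 \<otimes> d) (t1' \<otimes> e)"
      using frac_frac[OF 1(1,2) 2(1,2)] 1(3) 2(3) by metis
    then have "group_congruence Ih `` {x \<circ>\<^sub>m y} = cls (s1 \<otimes> d) (t1' \<otimes> e)" by (simp add: cls_def)
    then show ?thesis using cls_prod_cong[OF c 1(1,2) 2(1,2) 1(4) 2(4) ab de(1-3)] by simp
  qed
  moreover have "frac s t \<in> cls s t" "frac s' t' \<in> cls s' t'" using c by (auto simp: cls_def congruence_frac fr_refl)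
  ultimately have "(\<Union>x\<in>cls s t. \<Union>y\<in>cls s' t'. group_congruence Ih `` {x \<circ>\<^sub>m y}) = cls (s \<otimes> a) (t' \<otimes> b)"
    by (intro SUP_eq_const) auto
  then show ?thesis by (simp add: max_group_image_def mult_Ih)
qed

lemma cls_mult_mid:
  "p \<in> carrier T \<Longrightarrow> q \<in> carrier T \<Longrightarrow> r \<in> carrier T \<Longrightarrow> cls p q \<otimes>\<^bsub>G\<^esub> cls q r = cls p r"
  using cls_mult[of p q q r \<one> \<one>] by simp

lemma one_G: "\<one>\<^bsub>G\<^esub> = cls \<one> \<one>"
proof -
  have "left_mult T \<one> = frac \<one> \<one>"
    by (rule partial_map_eqI) (auto simp: frac_Some left_mult_Some)
  then show ?thesis by (simp add: max_group_image_def left_inverse_hull_def cls_def)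
qed

lemma cls_same: "t \<in> carrier T \<Longrightarrow> cls t t = \<one>\<^bsub>G\<^esub>"
  using cls_cancel[of \<one> \<one> t] by (simp add: one_G)

text \<open>In this form products are read off from \<open>cls_mult_mid\<close>, as (p/q)(q/r) =
  p/r, which reduces the group laws to bookkeeping.\<close>

lemma common_denominators:
  assumes "g \<in> carrier G" "h \<in> carrier G"
  obtains p q r where "p \<in> carrier T" "q \<in> carrier T" "r \<in> carrier T" "g = cls p q" "h = cls q r"
proof -
  obtain s t where st: "s \<in> carrier T" "t \<in> carrier T" "g = cls s t" using assms by (auto simp: carrier_G)
  obtain s' t' where st': "s' \<in> carrier T" "t' \<in> carrier T" "h = cls s' t'" using assms by (auto simp: carrier_G)
  obtain a b where ab: "a \<in> carrier T" "b \<in> carrier T" "t \<otimes> a = s' \<otimes> b" using directed st st' by blast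
  have "g = cls (s \<otimes> a) (t \<otimes> a)" using cls_cancel[OF st(1,2) ab(1)] st(3) by simp
  moreover have "h = cls (t \<otimes> a) (t' \<otimes> b)" using cls_cancel[OF st'(1,2) ab(2)] st'(3) ab(3) by simp
  ultimately show ?thesis using st st' ab by (intro that[of "s \<otimes> a" "t \<otimes> a" "t' \<otimes> b"]) auto
qed

lemma group_G: "group G"
proof (rule groupI)
  fix g h assume g: "g \<in> carrier G" and h: "h \<in> carrier G"
  obtain p q r where pqr: "p \<in> carrier T" "q \<in> carrier T" "r \<in> carrier T" "g = cls p q" "h = cls q r"
    using common_denominators[OF g h] .
  then show "g \<otimes>\<^bsub>G\<^esub> h \<in> carrier G" by (simp add: cls_mult_mid)
  fix k assume k: "k \<in> carrier G"
  then obtain s t where st: "s \<in> carrier T" "t \<in> carrier T" "k = cls s t" by (auto simp: carrier_G)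
  obtain a b where ab: "a \<in> carrier T" "b \<in> carrier T" "r \<otimes> a = s \<otimes> b" using directed pqr st by blast
  have "g = cls (p \<otimes> a) (q \<otimes> a)" "h = cls (q \<otimes> a) (r \<otimes> a)" "k = cls (r \<otimes> a) (t \<otimes> b)"
    using cls_cancel[OF pqr(1,2) ab(1)] cls_cancel[OF pqr(2,3) ab(1)] cls_cancel[OF st(1,2) ab(2)] pqr(4,5) st(3) ab(3)
    by simp_all
  then show "g \<otimes>\<^bsub>G\<^esub> h \<otimes>\<^bsub>G\<^esub> k = g \<otimes>\<^bsub>G\<^esub> (h \<otimes>\<^bsub>G\<^esub> k)"
    using pqr(1-3) st(1,2) ab(1,2) by (simp add: cls_mult_mid)
next
  show "\<one>\<^bsub>G\<^esub> \<in> carrier G" by (simp add: one_G)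
  fix g assume "g \<in> carrier G"
  then obtain s t where st: "s \<in> carrier T" "t \<in> carrier T" "g = cls s t" by (auto simp: carrier_G)
  show "\<one>\<^bsub>G\<^esub> \<otimes>\<^bsub>G\<^esub> g = g" using st cls_same[of s] cls_mult_mid[of s s t] by simp
  show "\<exists>h\<in>carrier G. h \<otimes>\<^bsub>G\<^esub> g = \<one>\<^bsub>G\<^esub>"
    using st by (intro bexI[of _ "cls t s"]) (auto simp: cls_mult_mid cls_same)
qed

sublocale G: group G by (rule group_G)

lemma inv_cls: "s \<in> carrier T \<Longrightarrow> t \<in> carrier T \<Longrightarrow> inv\<^bsub>G\<^esub> (cls s t) = cls t s"
  by (intro G.inv_equality) (auto simp: cls_mult_mid cls_same)

definition j :: "'a \<Rightarrow> ('a \<rightharpoonup> 'a) set" where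
  "j t = cls t \<one>"

lemma j_carrier [simp, intro]: "t \<in> carrier T \<Longrightarrow> j t \<in> carrier G"
  by (simp add: j_def)

lemma j_mult: "s \<in> carrier T \<Longrightarrow> t \<in> carrier T \<Longrightarrow> j (s \<otimes> t) = j s \<otimes>\<^bsub>G\<^esub> j t"
  using cls_mult[of s \<one> t \<one> t \<one>] by (simp add: j_def)

lemma j_one: "j \<one> = \<one>\<^bsub>G\<^esub>"
  by (simp add: j_def one_G)

lemma cls_j: "s \<in> carrier T \<Longrightarrow> t \<in> carrier T \<Longrightarrow> cls s t = j s \<otimes>\<^bsub>G\<^esub> inv\<^bsub>G\<^esub> (j t)"
  by (simp add: j_def inv_cls cls_mult_mid)

end

section \<open>Presentations of semigroup and group algebras\<close>

text \<open>Every relation is a difference of two words or a single word; this is the form that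
  \<open>alg_state_state\<close> accepts.\<close>

lemma semigroup_relations_cases:
  assumes "r \<in> semigroup_relations S"
  obtains (isom) s where "s \<in> carrier S" "r = wpoly (Word [Adj s, Gen s]) - wpoly 0"
  | (one) "r = wpoly (Word [Gen \<one>\<^bsub>S\<^esub>]) - wpoly 0"
  | (mult) s t where "s \<in> carrier S" "t \<in> carrier S"
      "r = wpoly (Word [Gen s, Gen t]) - wpoly (Word [Gen (s \<otimes>\<^bsub>S\<^esub> t)])"
  | (lcm) s t q where "s \<in> carrier S" "t \<in> carrier S" "q \<in> carrier S"
      "(s <#\<^bsub>S\<^esub> carrier S) \<inter> (t <#\<^bsub>S\<^esub> carrier S) = q <#\<^bsub>S\<^esub> carrier S"
      "r = wpoly (Word [Gen s, Adj s] + Word [Gen t, Adj t]) - wpoly (Word [Gen q, Adj q])"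
  | (disj) s t where "s \<in> carrier S" "t \<in> carrier S"
      "(s <#\<^bsub>S\<^esub> carrier S) \<inter> (t <#\<^bsub>S\<^esub> carrier S) = {}"
      "r = wpoly (Word [Gen s, Adj s] + Word [Gen t, Adj t])"
proof -
  have 1: "poly_adj (poly_gen s) * poly_gen s - 1 = wpoly (Word [Adj s, Gen s]) - wpoly 0" for s :: 'a
    by (simp add: adj_poly_gen) (simp add: poly_gen_def mult_single plus_star_word_def)
  have 2: "range_proj s = wpoly (Word [Gen s, Adj s])" for s :: 'a
    by (simp add: range_proj_def adj_poly_gen) (simp add: poly_gen_def mult_single plus_star_word_def)
  have 3: "poly_gen s * poly_gen t - poly_gen q = wpoly (Word [Gen s, Gen t]) - wpoly (Word [Gen q])" for s t q :: 'a
    by (simp add: poly_gen_def mult_single plus_star_word_def)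
  have 4: "poly_gen q - 1 = wpoly (Word [Gen q]) - wpoly 0" for q :: 'a
    by (simp add: poly_gen_def)
  from assms show ?thesis
    unfolding semigroup_relations_def Un_iff mem_Collect_eq 1 2 3 4 singleton_iff wpoly_plus[symmetric]
    using that by blast
qed

lemma group_relations_cases:
  assumes "r \<in> group_relations G"
  obtains (left) g where "g \<in> carrier G" "r = wpoly (Word [Adj g, Gen g]) - wpoly 0"
  | (right) g where "g \<in> carrier G" "r = wpoly (Word [Gen g, Adj g]) - wpoly 0"
  | (mult) g h where "g \<in> carrier G" "h \<in> carrier G"
      "r = wpoly (Word [Gen g, Gen h]) - wpoly (Word [Gen (g \<otimes>\<^bsub>G\<^esub> h)])"
proof -
  have 1: "poly_adj (poly_gen s) * poly_gen s - 1 = wpoly (Word [Adj s, Gen s]) - wpoly 0" for s :: 'a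
    by (simp add: adj_poly_gen) (simp add: poly_gen_def mult_single plus_star_word_def)
  have 2: "poly_gen s * poly_adj (poly_gen s) - 1 = wpoly (Word [Gen s, Adj s]) - wpoly 0" for s :: 'a
    by (simp add: adj_poly_gen) (simp add: poly_gen_def mult_single plus_star_word_def)
  have 3: "poly_gen s * poly_gen t - poly_gen q = wpoly (Word [Gen s, Gen t]) - wpoly (Word [Gen q])" for s t q :: 'a
    by (simp add: poly_gen_def mult_single plus_star_word_def)
  from assms show ?thesis
    unfolding group_relations_def Un_iff mem_Collect_eq 1 2 3
    using that by blast
qed

lemma words_over_Word [simp]: "Word (k # k' # ks) \<in> words_over X \<longleftrightarrow> Word [k] \<in> words_over X \<and> Word (k' # ks) \<in> words_over X"
  by (auto simp: words_over_def)

lemma (in monoid) isometric_semigroup: "isometric_presentation (carrier G) (semigroup_relations G)"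
proof
  show "semigroup_relations G \<subseteq> star_polys (carrier G)"
  proof
    fix r assume "r \<in> semigroup_relations G"
    then show "r \<in> star_polys (carrier G)"
      by (cases rule: semigroup_relations_cases) (auto intro!: star_polys_diff star_polys_single)
  qed
qed (auto simp: semigroup_relations_def)

lemma (in group) isometric_group: "isometric_presentation (carrier G) (group_relations G)"
proof
  show "group_relations G \<subseteq> star_polys (carrier G)"
  proof
    fix r assume "r \<in> group_relations G"
    then show "r \<in> star_polys (carrier G)"
      by (cases rule: group_relations_cases) (auto intro!: star_polys_diff star_polys_single)
  qed
qed (auto simp: group_relations_def)

context cocycle_rep
begin

lemma wact_isom: "x \<in> X \<Longrightarrow> p \<in> D \<Longrightarrow> wact (Word [Adj x, Gen x]) p = Some p"
  by (cases p) (simp add: wact_def th imageI inv_mv flip: m_assoc)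

lemma wact_proj:
  assumes x: "x \<in> X" and p: "p \<in> D"
  shows "wact (Word [Gen x, Adj x]) p = (if fst p \<in> mv x ` C then Some p else None)"
proof (cases "fst p \<in> mv x ` C")
  case True
  then obtain c where c: "c \<in> C" "fst p = mv x c" by blast
  show ?thesis using p x c by (cases p) (simp add: wact_def inv_mv th flip: m_assoc)
next
  case False
  then show ?thesis by (simp add: wact_def)
qed

lemma wact_mult:
  "x \<in> X \<Longrightarrow> y \<in> X \<Longrightarrow> wact (Word [Gen x, Gen y]) p = Some (mv x (mv y (fst p)), th x (mv y (fst p)) \<otimes> (th y (fst p) \<otimes> snd p))"
  by (simp add: wact_def)

lemma wact_proj2:
  "x \<in> X \<Longrightarrow> y \<in> X \<Longrightarrow> p \<in> D \<Longrightarrow> wact (Word [Gen x, Adj x] + Word [Gen y, Adj y]) p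
     = (if fst p \<in> mv x ` C \<inter> mv y ` C then Some p else None)"
  by (simp add: wact_plus wact_proj)

end

context directed_monoid
begin

text \<open>A single class of weight 1 and a trivial grading: the induced states are then traces on
  the algebra of \<open>T\<close>, with t acting as left multiplication by its image
  \<open>j t\<close>.\<close>

sublocale B: cocycle_rep G "carrier T" "{()}" "\<lambda>_ _. ()" "\<lambda>s _. j s" "\<lambda>_. 1" "\<lambda>_. 0" 0
  by standard (use has_sum_finite[of "{()}" "\<lambda>_. 1::real"] in auto)

lemma B_mult_aux: "s \<in> carrier T \<Longrightarrow> t \<in> carrier T \<Longrightarrow> g \<in> carrier G \<Longrightarrow>
    j s \<otimes>\<^bsub>G\<^esub> (j t \<otimes>\<^bsub>G\<^esub> g) = j (s \<otimes> t) \<otimes>\<^bsub>G\<^esub> g"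
  by (simp add: j_mult G.m_assoc)

lemma alg_state_B:
  assumes "group_char G \<kappa>"
  shows "alg_state (carrier T) (semigroup_relations T) (B.state \<kappa>)"
proof (rule B.alg_state_state[OF assms])
  fix r assume "r \<in> semigroup_relations T"
  then show "(\<exists>w1 w2. r = wpoly w1 - wpoly w2 \<and> (\<forall>p\<in>B.D. B.wact w1 p = B.wact w2 p)) \<or>
        (\<exists>w. r = wpoly w \<and> (\<forall>p\<in>B.D. B.wact w p = None))"
  proof (cases rule: semigroup_relations_cases)
    case (isom s)
    show ?thesis by (intro disjI1 exI conjI, rule isom(2)) (simp add: B.wact_isom isom(1))
  next
    case one
    show ?thesis by (intro disjI1 exI conjI, rule one) (auto simp: j_one)
  next
    case (mult s t)
    show ?thesis by (intro disjI1 exI conjI, rule mult(3)) (use mult in \<open>auto simp: B.wact_mult B_mult_aux\<close>)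
  next
    case (lcm s t q)
    show ?thesis by (intro disjI1 exI conjI, rule lcm(5)) (use lcm(1-3) in \<open>simp add: B.wact_proj2 B.wact_proj\<close>)
  next
    case (disj s t)
    then show ?thesis using directed[OF disj(1,2)] by (auto simp: l_coset_def)
  qed
qed

text \<open>The same for the group algebra, where each group element acts by its own left
  multiplication.\<close>

sublocale Cg: cocycle_rep G "carrier G" "{()}" "\<lambda>_ _. ()" "\<lambda>g _. g" "\<lambda>_. 1" "\<lambda>_. 0" 0
  by standard (use has_sum_finite[of "{()}" "\<lambda>_. 1::real"] in auto)

lemma alg_state_C:
  assumes "group_char G \<kappa>"
  shows "alg_state (carrier G) (group_relations G) (Cg.state \<kappa>)"
proof (rule Cg.alg_state_state[OF assms])
  fix r assume "r \<in> group_relations G"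
  then show "(\<exists>w1 w2. r = wpoly w1 - wpoly w2 \<and> (\<forall>p\<in>Cg.D. Cg.wact w1 p = Cg.wact w2 p)) \<or>
        (\<exists>w. r = wpoly w \<and> (\<forall>p\<in>Cg.D. Cg.wact w p = None))"
  proof (cases rule: group_relations_cases)
    case (left g)
    show ?thesis by (intro disjI1 exI conjI, rule left(2)) (simp add: Cg.wact_isom left(1))
  next
    case (right g)
    show ?thesis by (intro disjI1 exI conjI, rule right(2)) (simp add: Cg.wact_proj right(1))
  next
    case (mult g h)
    show ?thesis by (intro disjI1 exI conjI, rule mult(3)) (use mult in \<open>auto simp: Cg.wact_mult G.m_assoc\<close>)
  qed
qed

end

section \<open>The semigroup acting on classes\<close>

locale scaled_semigroup = right_lcm_semigroup S for S (structure) +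
  fixes N :: "'a \<Rightarrow> real"
  assumes scale: "scale S N"
    and ker_directed: "\<lbrakk>a \<in> carrier S; N a = 1; b \<in> carrier S; N b = 1\<rbrakk> \<Longrightarrow>
      \<exists>c\<in>carrier S. \<exists>d\<in>carrier S. N c = 1 \<and> N d = 1 \<and> a \<otimes> c = b \<otimes> d"
begin

abbreviation T :: "('a, 'b) monoid_scheme" where "T \<equiv> scale_ker S N"

lemma N_mult: "s \<in> carrier S \<Longrightarrow> t \<in> carrier S \<Longrightarrow> N (s \<otimes> t) = N s * N t"
  and N_ge1: "s \<in> carrier S \<Longrightarrow> 1 \<le> N s"
  using scale by (auto simp: scale_def)

lemma N_pos: "s \<in> carrier S \<Longrightarrow> 0 < N s"
  using N_ge1 by fastforce

lemma N_one: "N \<one> = 1"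
  using N_mult[of \<one> \<one>] N_pos[of \<one>] by simp

lemma carrier_T: "t \<in> carrier T \<longleftrightarrow> t \<in> carrier S \<and> N t = 1"
  by (simp add: scale_ker_def)

lemma T_ops [simp]: "s \<otimes>\<^bsub>T\<^esub> t = s \<otimes> t" "\<one>\<^bsub>T\<^esub> = \<one>"
  by (simp_all add: scale_ker_def)

lemma T_S: "t \<in> carrier T \<Longrightarrow> t \<in> carrier S"
  by (simp add: carrier_T)

lemma N_mult_1: "s \<in> carrier S \<Longrightarrow> t \<in> carrier S \<Longrightarrow> N s * N t = 1 \<Longrightarrow> N s = 1 \<and> N t = 1"
  using N_ge1[of s] N_ge1[of t] mult_mono[of 1 "N s" 1 "N t"] mult_left_mono[of 1 "N t" "N s"]
    mult_right_mono[of 1 "N s" "N t"] by auto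

text \<open>The right LCM r in \<open>S\<close> of two kernel elements divides a kernel element, and
  all scales are at least 1, so r lies in the kernel. Right ideals of the kernel are those of
  \<open>S\<close> cut down to scale 1.\<close>

lemma directed_T: "directed_monoid T"
proof
  fix a b assume ab: "a \<in> carrier T" "b \<in> carrier T"
  show dir: "\<exists>c\<in>carrier T. \<exists>d\<in>carrier T. a \<otimes>\<^bsub>T\<^esub> c = b \<otimes>\<^bsub>T\<^esub> d"
  proof -
    obtain c d where "c \<in> carrier S" "d \<in> carrier S" "N c = 1" "N d = 1" "a \<otimes> c = b \<otimes> d"
      using ker_directed[of a b] ab unfolding carrier_T by blast
    then have "c \<in> carrier T" "d \<in> carrier T" "a \<otimes>\<^bsub>T\<^esub> c = b \<otimes>\<^bsub>T\<^esub> d" by (simp_all add: carrier_T)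
    then show ?thesis by blast
  qed
  then obtain c d where cd: "c \<in> carrier T" "d \<in> carrier T" "a \<otimes> c = b \<otimes> d" by auto
  have "a \<otimes> c \<in> a <# carrier S" using T_S[OF cd(1)] by (auto simp: l_coset_def)
  moreover have "a \<otimes> c \<in> b <# carrier S" unfolding cd(3) using T_S[OF cd(2)] by (auto simp: l_coset_def)
  ultimately have acd: "a \<otimes> c \<in> (a <# carrier S) \<inter> (b <# carrier S)" by blast
  then obtain r where r: "r \<in> carrier S" "(a <# carrier S) \<inter> (b <# carrier S) = r <# carrier S"
    using right_lcm[of a b] ab by (auto simp: T_S)
  obtain e where e: "e \<in> carrier S" "a \<otimes> c = r \<otimes> e"
    using acd unfolding r(2) by (auto simp: l_coset_def)
  have "N r * N e = 1" using e r ab cd N_mult[of a c] N_mult[of r e] by (simp add: carrier_T)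
  then have rT: "r \<in> carrier T" using N_mult_1[OF r(1) e(1)] r by (simp add: carrier_T)
  have sub: "x \<in> s <#\<^bsub>T\<^esub> carrier T \<longleftrightarrow> x \<in> s <# carrier S \<and> N x = 1" if "s \<in> carrier T" for s x
    using that N_mult[of s] by (auto simp: carrier_T l_coset_def)
  have "(a <#\<^bsub>T\<^esub> carrier T) \<inter> (b <#\<^bsub>T\<^esub> carrier T) = r <#\<^bsub>T\<^esub> carrier T"
    using sub[OF ab(1)] sub[OF ab(2)] sub[OF rT] r(2) by blast
  then show "(a <#\<^bsub>T\<^esub> carrier T) \<inter> (b <#\<^bsub>T\<^esub> carrier T) = {} \<or>
       (\<exists>r\<in>carrier T. (a <#\<^bsub>T\<^esub> carrier T) \<inter> (b <#\<^bsub>T\<^esub> carrier T) = r <#\<^bsub>T\<^esub> carrier T)"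
    using rT by blast
qed (auto simp: carrier_T N_mult N_one m_assoc intro: left_cancel)

sublocale K: directed_monoid T by (rule directed_T)

abbreviation sim :: "'a \<Rightarrow> 'a \<Rightarrow> bool" where
  "sim x y \<equiv> (x, y) \<in> scale_rel S N"

lemma sim_iff: "sim x y \<longleftrightarrow> x \<in> carrier S \<and> y \<in> carrier S \<and> (\<exists>a\<in>carrier T. \<exists>b\<in>carrier T. x \<otimes> a = y \<otimes> b)"
  by (simp add: scale_rel_def)

lemma sim_refl: "x \<in> carrier S \<Longrightarrow> sim x x"
  unfolding sim_iff using K.one_closed by blast

lemma sim_sym: "sim x y \<Longrightarrow> sim y x"
  unfolding sim_iff by metis

lemma sim_trans:
  assumes "sim x y" "sim y z" shows "sim x z"
proof -
  obtain a b where ab: "a \<in> carrier T" "b \<in> carrier T" "x \<otimes> a = y \<otimes> b" using assms by (auto simp: sim_iff)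
  obtain c d where cd: "c \<in> carrier T" "d \<in> carrier T" "y \<otimes> c = z \<otimes> d" using assms by (auto simp: sim_iff)
  have S: "x \<in> carrier S" "y \<in> carrier S" "z \<in> carrier S" using assms by (auto simp: sim_iff)
  obtain e f where ef: "e \<in> carrier T" "f \<in> carrier T" "b \<otimes> e = c \<otimes> f" using K.directed[OF ab(2) cd(1)] by auto
  have "x \<otimes> (a \<otimes> e) = z \<otimes> (d \<otimes> f)" using ab cd ef S by (metis m_assoc T_S)
  moreover have "a \<otimes> e \<in> carrier T" "d \<otimes> f \<in> carrier T" using ab cd ef K.m_closed by auto
  ultimately show ?thesis unfolding sim_iff using S by blast
qed

lemma equiv_sim: "equiv (carrier S) (scale_rel S N)"
  by (rule equivI) (auto simp: refl_on_def sym_def trans_def sim_refl intro: sim_sym sim_trans, auto simp: sim_iff)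

lemma class_eq: "x \<in> carrier S \<Longrightarrow> y \<in> carrier S \<Longrightarrow> scale_class S N x = scale_class S N y \<longleftrightarrow> sim x y"
  using eq_equiv_class_iff[OF equiv_sim] by blast

lemma sim_N: "sim x y \<Longrightarrow> N x = N y"
proof -
  assume "sim x y"
  then obtain a b where "a \<in> carrier T" "b \<in> carrier T" "x \<otimes> a = y \<otimes> b" "x \<in> carrier S" "y \<in> carrier S" by (auto simp: sim_iff)
  then show ?thesis using N_mult[of x a] N_mult[of y b] by (simp add: carrier_T)
qed

lemma sim_mult: "s \<in> carrier S \<Longrightarrow> sim x y \<Longrightarrow> sim (s \<otimes> x) (s \<otimes> y)"
proof -
  assume s: "s \<in> carrier S" and "sim x y"
  then obtain a b where ab: "a \<in> carrier T" "b \<in> carrier T" "x \<otimes> a = y \<otimes> b" "x \<in> carrier S" "y \<in> carrier S"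
    by (auto simp: sim_iff)
  then have "s \<otimes> x \<otimes> a = s \<otimes> y \<otimes> b" using s by (simp add: m_assoc T_S)
  then show "sim (s \<otimes> x) (s \<otimes> y)" unfolding sim_iff using s ab by blast
qed

lemma sim_cancel: "s \<in> carrier S \<Longrightarrow> x \<in> carrier S \<Longrightarrow> y \<in> carrier S \<Longrightarrow> sim (s \<otimes> x) (s \<otimes> y) \<Longrightarrow> sim x y"
  unfolding sim_iff by (metis m_assoc T_S left_cancel m_closed)

lemma sim_T: "x \<in> carrier S \<Longrightarrow> a \<in> carrier T \<Longrightarrow> sim x (x \<otimes> a)"
proof -
  assume xa: "x \<in> carrier S" "a \<in> carrier T"
  have "x \<otimes> a = x \<otimes> a \<otimes> \<one>" "\<one> \<in> carrier T" using xa K.one_closed by (simp_all add: T_S)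
  then show "sim x (x \<otimes> a)" unfolding sim_iff using xa T_S by blast
qed

lemma in_l_coset: "s \<in> carrier S \<Longrightarrow> x \<in> carrier S \<Longrightarrow> a \<in> carrier T \<Longrightarrow> s \<otimes> x \<otimes> a \<in> s <# carrier S"
  by (auto simp: l_coset_def T_S m_assoc)

text \<open>For equivalent x and y this plays the part of x^(-1) y in the group: y a = x b makes it
  the fraction b/a. \<open>tr_eq\<close> shows that the choice of a, b is immaterial.\<close>

definition tr :: "'a \<Rightarrow> 'a \<Rightarrow> ('a \<rightharpoonup> 'a) set" where
  "tr x y = (SOME g. \<exists>a\<in>carrier T. \<exists>b\<in>carrier T. y \<otimes> a = x \<otimes> b \<and> g = K.cls b a)"

lemma tr_eq:
  assumes xy: "x \<in> carrier S" "y \<in> carrier S" and ab: "a \<in> carrier T" "b \<in> carrier T" "y \<otimes> a = x \<otimes> b"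
  shows "tr x y = K.cls b a"
proof -
  have "\<exists>a\<in>carrier T. \<exists>b\<in>carrier T. y \<otimes> a = x \<otimes> b \<and> tr x y = K.cls b a"
    unfolding tr_def by (rule someI_ex) (use ab in blast)
  then obtain c d where cd: "c \<in> carrier T" "d \<in> carrier T" "y \<otimes> c = x \<otimes> d" "tr x y = K.cls d c" by blast
  obtain e f where ef: "e \<in> carrier T" "f \<in> carrier T" "a \<otimes> e = c \<otimes> f" using K.directed[OF ab(1) cd(1)] by auto
  have "x \<otimes> (b \<otimes> e) = x \<otimes> (d \<otimes> f)" using ab cd ef xy by (metis m_assoc T_S)
  then have "b \<otimes> e = d \<otimes> f" using left_cancel[of x "b \<otimes> e" "d \<otimes> f"] xy ab cd ef T_S by auto
  then have "K.cls b a = K.cls d c"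
    using ab cd ef by (subst K.cls_eq) (auto simp: K.fr_def)
  then show ?thesis using cd by simp
qed

lemma sim_common:
  assumes "sim x y"
  obtains a b where "a \<in> carrier T" "b \<in> carrier T" "y \<otimes> a = x \<otimes> b" "tr x y = K.cls b a"
  using assms tr_eq by (auto simp: sim_iff)

lemma tr_carrier: "sim x y \<Longrightarrow> tr x y \<in> carrier K.G"
  by (erule sim_common) auto

lemma tr_trans:
  assumes "sim x y" "sim y z"
  shows "tr x y \<otimes>\<^bsub>K.G\<^esub> tr y z = tr x z"
proof -
  have S: "x \<in> carrier S" "y \<in> carrier S" "z \<in> carrier S" using assms by (auto simp: sim_iff)
  obtain a b where ab: "a \<in> carrier T" "b \<in> carrier T" "y \<otimes> a = x \<otimes> b" "tr x y = K.cls b a" using sim_common[OF assms(1)] .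
  obtain c d where cd: "c \<in> carrier T" "d \<in> carrier T" "z \<otimes> c = y \<otimes> d" "tr y z = K.cls d c" using sim_common[OF assms(2)] .
  obtain e f where ef: "e \<in> carrier T" "f \<in> carrier T" "a \<otimes> e = d \<otimes> f" using K.directed[OF ab(1) cd(2)] by auto
  have cl: "a \<otimes> e \<in> carrier T" "b \<otimes> e \<in> carrier T" "c \<otimes> f \<in> carrier T" "d \<otimes> f \<in> carrier T"
    using ab cd ef K.m_closed by auto
  have "z \<otimes> (c \<otimes> f) = x \<otimes> (b \<otimes> e)" using ab cd ef S by (metis m_assoc T_S)
  then have "tr x z = K.cls (b \<otimes> e) (c \<otimes> f)" by (intro tr_eq S cl)
  moreover have "tr x y = K.cls (b \<otimes> e) (a \<otimes> e)" using ab ef K.cls_cancel[of b a e] by simp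
  moreover have "tr y z = K.cls (a \<otimes> e) (c \<otimes> f)" using cd ef K.cls_cancel[of d c f] by simp
  ultimately show ?thesis using K.cls_mult_mid cl by simp
qed

lemma tr_mult_left: "s \<in> carrier S \<Longrightarrow> sim x y \<Longrightarrow> tr (s \<otimes> x) (s \<otimes> y) = tr x y"
proof -
  assume s: "s \<in> carrier S" and xy: "sim x y"
  obtain a b where ab: "a \<in> carrier T" "b \<in> carrier T" "y \<otimes> a = x \<otimes> b" "tr x y = K.cls b a" using sim_common[OF xy] .
  have S: "x \<in> carrier S" "y \<in> carrier S" using xy by (auto simp: sim_iff)
  have "s \<otimes> y \<otimes> a = s \<otimes> x \<otimes> b" using s S ab by (simp add: m_assoc T_S)
  then show ?thesis unfolding ab(4) using s S ab(1,2) by (intro tr_eq m_closed)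
qed

lemma tr_T: "x \<in> carrier S \<Longrightarrow> a \<in> carrier T \<Longrightarrow> tr x (x \<otimes> a) = K.j a"
  unfolding K.j_def using K.one_closed by (intro tr_eq) (simp_all add: T_S)

lemma tr_refl: "x \<in> carrier S \<Longrightarrow> tr x x = \<one>\<^bsub>K.G\<^esub>"
  using tr_T[of x \<one>] K.one_closed K.j_one by simp

abbreviation C :: "'a set set" where "C \<equiv> scale_classes S N"

definition rep :: "'a set \<Rightarrow> 'a" where "rep c = (SOME s. s \<in> c)"

abbreviation cof :: "'a \<Rightarrow> 'a set" where "cof \<equiv> scale_class S N"

lemma class_in: "x \<in> carrier S \<Longrightarrow> cof x \<in> C"
  by (simp add: quotientI)

lemma rep_sim: "x \<in> carrier S \<Longrightarrow> sim x (rep (cof x))"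
proof -
  assume "x \<in> carrier S"
  then have "x \<in> cof x" by (simp add: sim_refl)
  then have "rep (cof x) \<in> cof x" unfolding rep_def by (rule someI)
  then show ?thesis by simp
qed

lemma C_E:
  assumes "c \<in> C" obtains x where "x \<in> carrier S" "c = cof x"
  using assms by (auto simp: quotient_def)

lemma rep_carrier: "c \<in> C \<Longrightarrow> rep c \<in> carrier S"
  using rep_sim by (auto elim!: C_E simp: sim_iff)

lemma class_rep: "c \<in> C \<Longrightarrow> cof (rep c) = c"
proof (erule C_E)
  fix x assume x: "x \<in> carrier S" "c = cof x"
  then show "cof (rep c) = c" using class_eq[OF rep_carrier[OF class_in[OF x(1)]] x(1)] sim_sym[OF rep_sim[OF x(1)]] by simp
qed

lemma class_member: "c \<in> C \<Longrightarrow> x \<in> c \<Longrightarrow> x \<in> carrier S \<and> cof x = c"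
proof (erule C_E)
  fix y assume y: "y \<in> carrier S" "c = cof y" and "x \<in> c"
  then have yx: "sim y x" by simp
  then have x: "x \<in> carrier S" by (simp add: sim_iff)
  then show "x \<in> carrier S \<and> cof x = c" using class_eq[OF x y(1)] sim_sym[OF yx] y by simp
qed

definition mv :: "'a \<Rightarrow> 'a set \<Rightarrow> 'a set" where "mv s c = cof (s \<otimes> rep c)"

text \<open>The cocycle of the action: the group element by which \<open>s \<otimes> rep c\<close>
  differs from the representative of its own class.\<close>

definition th :: "'a \<Rightarrow> 'a set \<Rightarrow> ('a \<rightharpoonup> 'a) set" where "th s c = tr (rep (mv s c)) (s \<otimes> rep c)"

lemma mv_class: "s \<in> carrier S \<Longrightarrow> x \<in> carrier S \<Longrightarrow> mv s (cof x) = cof (s \<otimes> x)"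
  unfolding mv_def using rep_sim[of x] rep_carrier[OF class_in, of x]
  by (subst class_eq) (auto intro!: sim_mult sim_sym[OF rep_sim])

lemma mv_C: "s \<in> carrier S \<Longrightarrow> c \<in> C \<Longrightarrow> mv s c \<in> C"
  by (simp add: mv_def class_in rep_carrier)

lemma mv_inj: "s \<in> carrier S \<Longrightarrow> inj_on (mv s) C"
proof (rule inj_onI)
  fix c d assume s: "s \<in> carrier S" and cd: "c \<in> C" "d \<in> C" "mv s c = mv s d"
  then have "sim (s \<otimes> rep c) (s \<otimes> rep d)" by (simp add: mv_def class_eq rep_carrier)
  then have "sim (rep c) (rep d)" using sim_cancel s cd rep_carrier by blast
  then have "cof (rep c) = cof (rep d)" using cd by (simp add: class_eq rep_carrier)
  then show "c = d" using cd by (simp add: class_rep)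
qed

lemma th_sim: "s \<in> carrier S \<Longrightarrow> c \<in> C \<Longrightarrow> sim (rep (mv s c)) (s \<otimes> rep c)"
  unfolding mv_def by (rule sim_sym[OF rep_sim]) (simp add: rep_carrier)

lemma th_carrier: "s \<in> carrier S \<Longrightarrow> c \<in> C \<Longrightarrow> th s c \<in> carrier K.G"
  unfolding th_def by (intro tr_carrier th_sim)

lemma mv_one: "c \<in> C \<Longrightarrow> mv \<one> c = c"
  by (simp add: mv_def rep_carrier class_rep)

lemma th_one: "c \<in> C \<Longrightarrow> th \<one> c = \<one>\<^bsub>K.G\<^esub>"
  by (simp add: th_def mv_one rep_carrier tr_refl)

lemma mv_mult: "s \<in> carrier S \<Longrightarrow> t \<in> carrier S \<Longrightarrow> c \<in> C \<Longrightarrow> mv s (mv t c) = mv (s \<otimes> t) c"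
  unfolding mv_def[of t] by (subst mv_class) (auto simp: rep_carrier mv_def m_assoc)

lemma th_mult:
  assumes "s \<in> carrier S" "t \<in> carrier S" "c \<in> C"
  shows "th s (mv t c) \<otimes>\<^bsub>K.G\<^esub> th t c = th (s \<otimes> t) c"
proof -
  have "th t c = tr (s \<otimes> rep (mv t c)) (s \<otimes> (t \<otimes> rep c))"
    unfolding th_def[of t] using assms by (intro tr_mult_left[symmetric] th_sim)
  then have "th s (mv t c) \<otimes>\<^bsub>K.G\<^esub> th t c = tr (rep (mv s (mv t c))) (s \<otimes> (t \<otimes> rep c))"
    unfolding th_def[of s] using assms by (simp add: tr_trans[OF th_sim sim_mult[OF _ th_sim]] mv_C)
  then show ?thesis using assms by (simp add: th_def mv_mult m_assoc rep_carrier)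
qed

lemma mv_image: "s \<in> carrier S \<Longrightarrow> c \<in> mv s ` C \<longleftrightarrow> (\<exists>x\<in>carrier S. c = cof (s \<otimes> x))"
proof -
  assume s: "s \<in> carrier S"
  have "c = cof (s \<otimes> x) \<Longrightarrow> x \<in> carrier S \<Longrightarrow> c \<in> mv s ` C" for x
    using mv_class[OF s, of x] class_in[of x] by blast
  then show ?thesis unfolding mv_def using rep_carrier by blast
qed

lemma class_scale_rep: "class_scale N c = N (rep c)"
  by (simp add: class_scale_def rep_def)

lemma class_scale_class: "x \<in> carrier S \<Longrightarrow> class_scale N (cof x) = N x"
  using sim_N[OF rep_sim] by (simp add: class_scale_rep)

lemma class_scale_mv: "s \<in> carrier S \<Longrightarrow> c \<in> C \<Longrightarrow> class_scale N (mv s c) = N s * class_scale N c"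
  unfolding mv_def by (simp only: class_scale_class m_closed rep_carrier N_mult class_scale_rep[of c])

end

section \<open>The weights and the induced functional\<close>

locale scaled_setting = scaled_semigroup +
  fixes \<beta> :: real
  assumes summable: "(\<lambda>c. class_scale N c powr (- \<beta>)) summable_on C"
begin

abbreviation \<zeta> :: real where "\<zeta> \<equiv> scale_zeta S N \<beta>"

lemma zeta_pos: "0 < \<zeta>"
proof -
  have "(\<Sum>c\<in>{cof \<one>}. class_scale N c powr (- \<beta>)) \<le> \<zeta>"
    unfolding scale_zeta_def by (rule finite_sum_le_infsum[OF summable]) (auto intro: class_in)
  then show ?thesis by (simp add: class_scale_class N_one)
qed

definition wt :: "'a set \<Rightarrow> real" where "wt c = class_scale N c powr (- \<beta>) / \<zeta>"

sublocale A: cocycle_rep K.G "carrier S" C mv th wt "\<lambda>s. ln (N s)" \<beta>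
proof
  have "((\<lambda>c. class_scale N c powr (- \<beta>)) has_sum \<zeta>) C"
    unfolding scale_zeta_def by (rule has_sum_infsum[OF summable])
  from has_sum_cmult_left[OF this, of "1 / \<zeta>"] show "(wt has_sum 1) C"
    using zeta_pos by (simp add: wt_def[abs_def])
  fix c assume c: "c \<in> C"
  show "0 \<le> wt c" using zeta_pos by (simp add: wt_def)
  fix s assume s: "s \<in> carrier S"
  show "wt (mv s c) = exp (- \<beta> * ln (N s)) * wt c"
  proof -
    have p: "0 < class_scale N c" using N_pos[OF rep_carrier[OF c]] by (simp add: class_scale_rep)
    have "(N s * class_scale N c) powr (- \<beta>) = exp (- \<beta> * ln (N s)) * class_scale N c powr (- \<beta>)"
      using p N_pos[OF s] by (simp add: powr_mult) (simp add: powr_def)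
    then show ?thesis by (simp only: wt_def class_scale_mv[OF s c] times_divide_eq_right)
  qed
qed (auto simp: mv_C mv_inj th_carrier)

lemma alg_state_A:
  assumes "group_char K.G \<kappa>"
  shows "alg_state (carrier S) (semigroup_relations S) (A.state \<kappa>)"
proof (rule A.alg_state_state[OF assms])
  fix r assume "r \<in> semigroup_relations S"
  then show "(\<exists>w1 w2. r = wpoly w1 - wpoly w2 \<and> (\<forall>p\<in>A.D. A.wact w1 p = A.wact w2 p)) \<or>
        (\<exists>w. r = wpoly w \<and> (\<forall>p\<in>A.D. A.wact w p = None))"
  proof (cases rule: semigroup_relations_cases)
    case (isom s)
    show ?thesis by (intro disjI1 exI conjI, rule isom(2)) (simp add: A.wact_isom isom(1))
  next
    case one
    show ?thesis by (intro disjI1 exI conjI, rule one) (auto simp: mv_one th_one)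
  next
    case (mult s t)
    have "th s (mv t c) \<otimes>\<^bsub>K.G\<^esub> (th t c \<otimes>\<^bsub>K.G\<^esub> g) = th (s \<otimes> t) c \<otimes>\<^bsub>K.G\<^esub> g"
      if "c \<in> C" "g \<in> carrier K.G" for c g
      using that mult th_mult[of s t c] by (simp add: th_carrier mv_C flip: K.G.m_assoc)
    then show ?thesis
      by (intro disjI1 exI conjI, rule_tac mult(3)) (use mult in \<open>auto simp: A.wact_mult mv_mult\<close>)
  next
    case (lcm s t q)
    \<comment> \<open>The range of \<open>mv s\<close> consists of the classes meeting the ideal of
      s. Equivalent elements become equal after right multiplication by kernel elements, which stays
      inside both ideals, so intersections of ranges follow those of ideals.\<close>
    have "mv s ` C \<inter> mv t ` C = mv q ` C"
    proof (intro equalityI subsetI)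
      fix c assume "c \<in> mv s ` C \<inter> mv t ` C"
      then obtain x y where x: "x \<in> carrier S" "c = cof (s \<otimes> x)" and y: "y \<in> carrier S" "c = cof (t \<otimes> y)"
        using lcm by (auto simp: mv_image)
      then have "sim (s \<otimes> x) (t \<otimes> y)" using class_eq[of "s \<otimes> x" "t \<otimes> y"] lcm by simp
      then obtain a b where ab: "a \<in> carrier T" "b \<in> carrier T" "s \<otimes> x \<otimes> a = t \<otimes> y \<otimes> b" by (auto simp: sim_iff)
      have "s \<otimes> x \<otimes> a \<in> s <# carrier S" "t \<otimes> y \<otimes> b \<in> t <# carrier S"
        using x(1) y(1) ab(1,2) lcm(1,2) by (auto intro: in_l_coset)
      then have "s \<otimes> x \<otimes> a \<in> q <# carrier S" using lcm(4) ab(3) by auto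
      then obtain z where z: "z \<in> carrier S" "s \<otimes> x \<otimes> a = q \<otimes> z" by (auto simp: l_coset_def)
      have "c = cof (q \<otimes> z)"
        using x z sim_T[of "s \<otimes> x" a] ab lcm class_eq[of "s \<otimes> x" "q \<otimes> z"] by auto
      then show "c \<in> mv q ` C" using lcm z by (auto simp: mv_image)
    next
      fix c assume "c \<in> mv q ` C"
      then obtain z where z: "z \<in> carrier S" "c = cof (q \<otimes> z)" using lcm by (auto simp: mv_image)
      have "q \<otimes> z \<in> (s <# carrier S) \<inter> (t <# carrier S)" unfolding lcm(4) using z by (auto simp: l_coset_def)
      then obtain x y where "x \<in> carrier S" "q \<otimes> z = s \<otimes> x" "y \<in> carrier S" "q \<otimes> z = t \<otimes> y"
        unfolding l_coset_def by blast
      then have "c = cof (s \<otimes> x)" "c = cof (t \<otimes> y)" "x \<in> carrier S" "y \<in> carrier S" using z(2) by auto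
      then show "c \<in> mv s ` C \<inter> mv t ` C" unfolding Int_iff mv_image[OF lcm(1)] mv_image[OF lcm(2)] by blast
    qed
    then show ?thesis
      by (intro disjI1 exI conjI, rule_tac lcm(5)) (use lcm(1-3) in \<open>simp add: A.wact_proj2 A.wact_proj\<close>)
  next
    case (disj s t)
    have "mv s ` C \<inter> mv t ` C = {}"
    proof (rule ccontr)
      assume "mv s ` C \<inter> mv t ` C \<noteq> {}"
      then obtain c where "c \<in> mv s ` C" "c \<in> mv t ` C" by blast
      then obtain x y where "x \<in> carrier S" "y \<in> carrier S" "cof (s \<otimes> x) = cof (t \<otimes> y)"
        unfolding mv_image[OF disj(1)] mv_image[OF disj(2)] by metis
      then have "sim (s \<otimes> x) (t \<otimes> y)" and xy: "x \<in> carrier S" "y \<in> carrier S" using class_eq[of "s \<otimes> x" "t \<otimes> y"] disj by auto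
      then obtain a b where ab: "a \<in> carrier T" "b \<in> carrier T" "s \<otimes> x \<otimes> a = t \<otimes> y \<otimes> b" by (auto simp: sim_iff)
      have "s \<otimes> x \<otimes> a \<in> s <# carrier S" "t \<otimes> y \<otimes> b \<in> t <# carrier S"
        using xy ab(1,2) disj(1,2) by (auto intro: in_l_coset)
      then show False using disj(3) ab(3) by auto
    qed
    then show ?thesis
      by (intro disjI2 exI conjI, rule_tac disj(4)) (use disj(1,2) in \<open>simp add: A.wact_proj2\<close>)
  qed
qed

sublocale pres: graded_presentation "carrier S" "semigroup_relations S" "\<lambda>s. ln (N s)"
proof -
  interpret isometric_presentation "carrier S" "semigroup_relations S" by (rule isometric_semigroup)
  show "graded_presentation (carrier S) (semigroup_relations S) (\<lambda>s. ln (N s))"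
  proof
    fix r assume "r \<in> semigroup_relations S"
    then show "\<exists>c. \<forall>w\<in>Poly_Mapping.keys r. word_weight (\<lambda>s. ln (N s)) w = c"
    proof (cases rule: semigroup_relations_cases)
      case (isom s)
      show ?thesis unfolding isom(2) using keys_diff[of "wpoly (Word [Adj s, Gen s])" "wpoly 0"]
        by (intro exI[of _ 0]) (auto simp: word_weight_def zero_star_word_def)
    next
      case one
      show ?thesis unfolding one using keys_diff[of "wpoly (Word [Gen \<one>])" "wpoly 0"]
        by (intro exI[of _ 0]) (auto simp: N_one)
    next
      case (mult s t)
      show ?thesis
      proof (intro exI[of _ "ln (N s) + ln (N t)"] ballI)
        fix w assume "w \<in> Poly_Mapping.keys r"
        then have "w = Word [Gen s, Gen t] \<or> w = Word [Gen (s \<otimes> t)]"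
          unfolding mult(3) using keys_diff[of "wpoly (Word [Gen s, Gen t])" "wpoly (Word [Gen (s \<otimes> t)])"] by auto
        then show "word_weight (\<lambda>s. ln (N s)) w = ln (N s) + ln (N t)"
          using mult(1,2) N_pos[of s] N_pos[of t] by (auto simp: word_weight_def N_mult ln_mult)
      qed
    next
      case (lcm s t q)
      show ?thesis unfolding lcm(5)
        using keys_diff[of "wpoly (Word [Gen s, Adj s] + Word [Gen t, Adj t])" "wpoly (Word [Gen q, Adj q])"]
        by (intro exI[of _ 0]) (auto simp: word_weight_def plus_star_word_def)
    next
      case (disj s t)
      show ?thesis unfolding disj(4)
        by (intro exI[of _ 0]) (auto simp: word_weight_def plus_star_word_def)
    qed
  qed
qed

end


section \<open>Computing modulo a KMS functional\<close>

lemma (in group) group_char_cong: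
  assumes \<kappa>: "group_char G \<kappa>" and eq: "\<And>g. g \<in> carrier G \<Longrightarrow> \<kappa>' g = \<kappa> g"
  shows "group_char G \<kappa>'"
  unfolding group_char_def
proof (intro conjI ballI allI impI)
  fix B :: "'a set" and a :: "'a \<Rightarrow> complex" assume B: "finite B" "B \<subseteq> carrier G"
  have "(\<Sum>g\<in>B. \<Sum>h\<in>B. cnj (a g) * a h * \<kappa>' (inv g \<otimes> h)) = (\<Sum>g\<in>B. \<Sum>h\<in>B. cnj (a g) * a h * \<kappa> (inv g \<otimes> h))"
    using B by (intro sum.cong refl) (auto simp: eq subset_iff)
  then show "(\<Sum>g\<in>B. \<Sum>h\<in>B. cnj (a g) * a h * \<kappa>' (inv g \<otimes> h)) \<in> \<real>\<^sub>\<ge>\<^sub>0"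
    using \<kappa> B unfolding group_char_def by simp
qed (use \<kappa> eq in \<open>auto simp: group_char_def\<close>)

locale kms_functional = bounded_alg_state X R \<phi>
  for X :: "'x set" and R :: "'x star_poly set" and \<phi> :: "'x star_word \<Rightarrow> complex" +
  fixes l :: "'x \<Rightarrow> real" and \<beta> :: real
  assumes kms: "\<phi> (w + v) = exp (- \<beta> * word_weight l w) * \<phi> (v + w)"
begin

text \<open>\<open>f - g\<close> lies in the largest two-sided ideal on which \<open>\<phi>\<close>
  vanishes. This is the sense of computing modulo \<open>\<phi>\<close>.\<close>

definition eqv :: "'x star_poly \<Rightarrow> 'x star_poly \<Rightarrow> bool" (infix \<open>\<doteq>\<close> 50) where
  "f \<doteq> g \<longleftrightarrow> (\<forall>h k. lin \<phi> (h * f * k) = lin \<phi> (h * g * k))"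

lemma eqv_refl [simp, intro]: "f \<doteq> f"
  by (simp add: eqv_def)

lemma eqv_sym: "f \<doteq> g \<Longrightarrow> g \<doteq> f"
  by (simp add: eqv_def)

lemma eqv_trans [trans]: "f \<doteq> g \<Longrightarrow> g \<doteq> h \<Longrightarrow> f \<doteq> h"
  by (simp add: eqv_def)

lemma eqv_add: "f \<doteq> f' \<Longrightarrow> g \<doteq> g' \<Longrightarrow> f + g \<doteq> f' + g'"
  by (simp add: eqv_def distrib_left distrib_right lin_add)

lemma eqv_diff: "f \<doteq> f' \<Longrightarrow> g \<doteq> g' \<Longrightarrow> f - g \<doteq> f' - g'"
  by (simp add: eqv_def left_diff_distrib right_diff_distrib lin_diff)

lemma eqv_mult_left: "f \<doteq> g \<Longrightarrow> h * f \<doteq> h * g"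
  unfolding eqv_def by (metis mult.assoc)

lemma eqv_mult_right: "f \<doteq> g \<Longrightarrow> f * k \<doteq> g * k"
  unfolding eqv_def by (metis mult.assoc)

lemma eqv_mult: "f \<doteq> f' \<Longrightarrow> g \<doteq> g' \<Longrightarrow> f * g \<doteq> f' * g'"
  using eqv_mult_left eqv_mult_right eqv_trans by blast

lemma eqv_mid: "f \<doteq> g \<Longrightarrow> h * f * k \<doteq> h * g * k"
  by (intro eqv_mult_left eqv_mult_right)

lemma eqv_adj: "f \<doteq> g \<Longrightarrow> poly_adj f \<doteq> poly_adj g"
proof -
  assume fg: "f \<doteq> g"
  have "lin \<phi> (h * poly_adj f * k) = cnj (lin \<phi> (poly_adj k * f * poly_adj h))" for f h k
    using lin_adj[of "poly_adj k * f * poly_adj h"] by (simp add: poly_adj_mult mult.assoc)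
  then show ?thesis using fg by (simp add: eqv_def)
qed

lemma eqv_lin: "f \<doteq> g \<Longrightarrow> lin \<phi> f = lin \<phi> g"
  unfolding eqv_def by (metis mult_1_left mult_1_right)

lemma eqv_nrm: "f \<doteq> g \<Longrightarrow> nrm f = nrm g"
  unfolding nrm_def using eqv_lin[OF eqv_mult[OF eqv_adj]] by metis

lemma eqv_rel: "f - g \<in> R \<Longrightarrow> f \<doteq> g"
  using rel by (fastforce simp: eqv_def left_diff_distrib right_diff_distrib lin_diff)

lemma eqv_rel_0: "f \<in> R \<Longrightarrow> f \<doteq> 0"
  using rel by (auto simp: eqv_def)

lemma eqv_diff_0: "f - g \<doteq> 0 \<longleftrightarrow> f \<doteq> g"
  by (auto simp: eqv_def left_diff_distrib right_diff_distrib lin_diff)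

lemma lin_word_mult: "lin \<phi> (wpoly w * f) = exp (- \<beta> * word_weight l w) * lin \<phi> (f * wpoly w)"
proof (induction f rule: star_poly_induct)
  case (single v c)
  show ?case using kms[of w v] by (simp add: mult_single)
qed (simp_all add: distrib_left distrib_right lin_add)

text \<open>For a general state the null vectors form only a left ideal. The KMS identity moves a
  right factor to the left, which makes the ideal two-sided.\<close>

lemma null_eqv:
  assumes "nrm f = 0" shows "f \<doteq> 0"
proof -
  have "lin \<phi> (h * f * k) = 0" for h k
  proof -
    \<comment> \<open>Chosen so that moving \<open>k'\<close> to the back by the KMS identity turns
      it into \<open>k\<close>.\<close>
    define k' where "k' = rot l (- \<i> * of_real \<beta>) k"
    have "lin \<phi> (h * f * k) = lin \<phi> (h * f * rot l (\<i> * of_real \<beta>) k')" by (simp add: k'_def rot_rot)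
    also have "\<dots> = lin \<phi> (k' * (h * f))" by (rule lin_kms[OF kms, symmetric])
    finally have "cmod (lin \<phi> (h * f * k)) \<le> 0"
      using lin_le_nrm[of "k' * h" f] assms by (simp add: mult.assoc)
    then show ?thesis by simp
  qed
  then show ?thesis by (simp add: eqv_def)
qed

abbreviation V :: "'x \<Rightarrow> 'x star_poly" where "V \<equiv> poly_gen"
abbreviation U :: "'x \<Rightarrow> 'x star_poly" where "U x \<equiv> poly_adj (poly_gen x)"

lemma isom_eqv: "x \<in> X \<Longrightarrow> U x * V x \<doteq> 1"
  by (rule eqv_rel) (rule isom)

lemma lin_V_mult: "lin \<phi> (V x * f) = exp (- \<beta> * l x) * lin \<phi> (f * V x)"
  using lin_word_mult[of "Word [Gen x]" f] by (simp add: poly_gen_def)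

lemma lin_U_mult: "lin \<phi> (U x * f) = exp (\<beta> * l x) * lin \<phi> (f * U x)"
  using lin_word_mult[of "Word [Adj x]" f] by (simp add: adj_poly_gen)

text \<open>Modulo \<open>\<phi>\<close>, 1 - V U is a projection. Its value is 1 - \<phi>(U V) = 0
  because a letter of weight 0 moves cyclically for free, so it is null.\<close>

lemma unitary_eqv:
  assumes x: "x \<in> X" and l: "l x = 0"
  shows "V x * U x \<doteq> 1"
proof -
  define f where "f = 1 - V x * U x"
  have "poly_adj f * f = 1 - V x * U x - V x * U x + V x * (U x * V x) * U x"
    by (simp add: f_def poly_adj_mult poly_adj_diff algebra_simps)
  also have "\<dots> \<doteq> 1 - V x * U x - V x * U x + V x * 1 * U x"
    by (intro eqv_add eqv_refl eqv_mid isom_eqv x)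
  finally have "lin \<phi> (poly_adj f * f) = lin \<phi> (1 - V x * U x)" by (auto dest: eqv_lin)
  also have "\<dots> = 1 - lin \<phi> (V x * U x)" by (simp add: lin_diff unit)
  also have "lin \<phi> (V x * U x) = lin \<phi> (U x * V x)" using lin_V_mult[of x "U x"] by (simp add: l)
  also have "\<dots> = 1" using eqv_lin[OF isom_eqv[OF x]] by (simp add: unit)
  finally have "nrm f = 0" by (simp add: nrm_def)
  from null_eqv[OF this] have "1 \<doteq> V x * U x" unfolding f_def eqv_diff_0 .
  then show ?thesis by (rule eqv_sym)
qed

end

section \<open>Fractions modulo a KMS functional\<close>

lemma (in directed_monoid) carrier_GE:
  assumes "g \<in> carrier G"
  obtains q p where "q \<in> carrier T" "p \<in> carrier T" "g = cls q p"
  using assms unfolding carrier_G by blast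

definition (in directed_monoid) rep_frac :: "('a \<rightharpoonup> 'a) set \<Rightarrow> 'a \<times> 'a" where
  "rep_frac g = (SOME qp. fst qp \<in> carrier T \<and> snd qp \<in> carrier T \<and> g = cls (fst qp) (snd qp))"

lemma (in directed_monoid) rep_fracE:
  assumes "g \<in> carrier G"
  obtains s t where "rep_frac g = (s, t)" "s \<in> carrier T" "t \<in> carrier T" "g = cls s t"
proof -
  obtain q p where "q \<in> carrier T" "p \<in> carrier T" "g = cls q p" using carrier_GE[OF assms] .
  then have "\<exists>qp. fst qp \<in> carrier T \<and> snd qp \<in> carrier T \<and> g = cls (fst qp) (snd qp)"
    by (intro exI[of _ "(q, p)"]) simp
  from someI_ex[OF this] have "fst (rep_frac g) \<in> carrier T \<and> snd (rep_frac g) \<in> carrier T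
      \<and> g = cls (fst (rep_frac g)) (snd (rep_frac g))" unfolding rep_frac_def .
  then show ?thesis using that[of "fst (rep_frac g)" "snd (rep_frac g)"] by simp
qed

text \<open>Made for two instances: a trace on the algebra of \<open>T\<close> itself, with
  \<open>X\<close> the carrier of \<open>T\<close>, and a KMS functional on a larger semigroup, of
  which \<open>T\<close> is the kernel of the scale.\<close>

locale T_functional = directed_monoid T + kms_functional X R \<phi> l \<beta>
  for T :: "('x, 'm) monoid_scheme" (structure) and X :: "'x set" and R :: "'x star_poly set"
    and \<phi> :: "'x star_word \<Rightarrow> complex" and l :: "'x \<Rightarrow> real" and \<beta> :: real +
  assumes T_X: "carrier T \<subseteq> X" and l_T: "t \<in> carrier T \<Longrightarrow> l t = 0"
    and T_mult: "\<lbrakk>s \<in> carrier T; t \<in> carrier T\<rbrakk> \<Longrightarrow> V s * V t \<doteq> V (s \<otimes> t)"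
    and T_one: "V \<one> \<doteq> 1"
begin

lemma UV: "a \<in> carrier T \<Longrightarrow> U a * V a \<doteq> 1"
  using T_X by (intro isom_eqv) auto

lemma VU: "a \<in> carrier T \<Longrightarrow> V a * U a \<doteq> 1"
  using T_X l_T by (intro unitary_eqv) auto

lemma U_mult: "s \<in> carrier T \<Longrightarrow> t \<in> carrier T \<Longrightarrow> U t * U s \<doteq> U (s \<otimes> t)"
  using eqv_adj[OF T_mult[of s t]] by (simp add: poly_adj_mult)

lemma frac_cancel:
  assumes "q \<in> carrier T" "p \<in> carrier T" "a \<in> carrier T"
  shows "V q * U p \<doteq> V (q \<otimes> a) * U (p \<otimes> a)"
proof -
  have "V q * U p = V q * 1 * U p" by simp
  also have "\<dots> \<doteq> V q * (V a * U a) * U p" by (intro eqv_mid eqv_sym[OF VU] assms)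
  also have "\<dots> = (V q * V a) * (U a * U p)" by (simp add: mult.assoc)
  also have "\<dots> \<doteq> V (q \<otimes> a) * U (p \<otimes> a)" by (intro eqv_mult T_mult U_mult assms)
  finally show ?thesis .
qed

lemma frac_cong:
  assumes "q \<in> carrier T" "p \<in> carrier T" "q' \<in> carrier T" "p' \<in> carrier T" "cls q p = cls q' p'"
  shows "V q * U p \<doteq> V q' * U p'"
proof -
  obtain a b where ab: "a \<in> carrier T" "b \<in> carrier T" "q \<otimes> a = q' \<otimes> b" "p \<otimes> a = p' \<otimes> b"
    using assms by (auto simp: cls_eq fr_def)
  have "V q * U p \<doteq> V (q \<otimes> a) * U (p \<otimes> a)" by (intro frac_cancel assms ab)
  also have "\<dots> \<doteq> V q' * U p'" unfolding ab(3,4) by (rule eqv_sym) (intro frac_cancel assms ab)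
  finally show ?thesis .
qed

lemma UV_swap:
  assumes "p \<in> carrier T" "q \<in> carrier T" "a \<in> carrier T" "b \<in> carrier T" "p \<otimes> a = q \<otimes> b"
  shows "U p * V q \<doteq> V a * U b"
proof -
  have "U p * V q = (U p * V q) * 1" by simp
  also have "\<dots> \<doteq> (U p * V q) * (V b * U b)" by (intro eqv_mult_left eqv_sym[OF VU] assms)
  also have "\<dots> = U p * (V q * V b) * U b" by (simp add: mult.assoc)
  also have "\<dots> \<doteq> U p * V (q \<otimes> b) * U b" by (intro eqv_mid T_mult assms)
  also have "\<dots> \<doteq> U p * (V p * V a) * U b" unfolding assms(5)[symmetric] by (intro eqv_mid eqv_sym[OF T_mult] assms)
  also have "\<dots> = (U p * V p) * (V a * U b)" by (simp add: mult.assoc)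
  also have "\<dots> \<doteq> 1 * (V a * U b)" by (intro eqv_mult_right UV assms)
  finally show ?thesis by simp
qed

lemma frac_mult:
  assumes c: "q \<in> carrier T" "p \<in> carrier T" "q' \<in> carrier T" "p' \<in> carrier T"
  obtains s t where "s \<in> carrier T" "t \<in> carrier T" "cls q p \<otimes>\<^bsub>G\<^esub> cls q' p' = cls s t"
    "(V q * U p) * (V q' * U p') \<doteq> V s * U t"
proof -
  obtain a b where ab: "a \<in> carrier T" "b \<in> carrier T" "p \<otimes> a = q' \<otimes> b" using directed c by blast
  have "(V q * U p) * (V q' * U p') = V q * (U p * V q') * U p'" by (simp add: mult.assoc)
  also have "\<dots> \<doteq> V q * (V a * U b) * U p'" by (intro eqv_mid UV_swap c ab)
  also have "\<dots> = (V q * V a) * (U b * U p')" by (simp add: mult.assoc)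
  also have "\<dots> \<doteq> V (q \<otimes> a) * U (p' \<otimes> b)" by (intro eqv_mult T_mult U_mult c ab)
  finally show ?thesis using c ab cls_mult[OF c ab] by (intro that[of "q \<otimes> a" "p' \<otimes> b"]) auto
qed

lemma frac_one: "V \<one> * U \<one> \<doteq> 1"
  by (rule VU) simp

text \<open>\<open>\<psi>\<close> may differ from \<open>\<phi>\<close> and need not be normalized,
  as for the corner of a KMS functional; hence the division by its value at the empty word.\<close>

definition chr :: "('x star_word \<Rightarrow> complex) \<Rightarrow> ('x \<rightharpoonup> 'x) set \<Rightarrow> complex" where
  "chr \<psi> g = (let (q, p) = rep_frac g in lin \<psi> (V q * U p) / \<psi> 0)"

lemma chr_eq:
  assumes resp: "\<And>f g. f \<doteq> g \<Longrightarrow> lin \<psi> f = lin \<psi> g"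
    and qp: "q \<in> carrier T" "p \<in> carrier T"
  shows "chr \<psi> (cls q p) = lin \<psi> (V q * U p) / \<psi> 0"
proof -
  obtain s t where r: "rep_frac (cls q p) = (s, t)" "s \<in> carrier T" "t \<in> carrier T" "cls q p = cls s t"
    using rep_fracE[OF cls_carrier[OF qp]] .
  have "lin \<psi> (V q * U p) = lin \<psi> (V s * U t)" by (intro resp frac_cong qp r)
  then show ?thesis by (simp add: chr_def r(1))
qed

lemma group_char_chr:
  assumes resp: "\<And>f g. f \<doteq> g \<Longrightarrow> lin \<psi> f = lin \<psi> g"
    and pos: "\<And>f. lin \<psi> (poly_adj f * f) \<in> \<real>\<^sub>\<ge>\<^sub>0"
    and tr: "\<And>a f. a \<in> carrier T \<Longrightarrow> lin \<psi> (V a * f) = lin \<psi> (f * V a)"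
    and nz: "\<psi> 0 \<noteq> 0"
  shows "group_char G (chr \<psi>)"
  unfolding group_char_def
proof (intro conjI ballI allI impI)
  have eq: "chr \<psi> (cls q p) = lin \<psi> (V q * U p) / \<psi> 0" if "q \<in> carrier T" "p \<in> carrier T" for q p
    by (rule chr_eq) (use resp that in auto)
  have p0: "\<psi> 0 \<in> \<real>\<^sub>\<ge>\<^sub>0" using pos[of 1] by simp
  show "chr \<psi> \<one>\<^bsub>G\<^esub> = 1"
    using resp[OF frac_one] nz by (simp add: one_G eq)
  \<comment> \<open>The trace property for adjoints is bought by inserting \<open>U a * V a\<close>
    at the end and moving \<open>V a\<close> around.\<close>
  have trU: "lin \<psi> (U a * f) = lin \<psi> (f * U a)" if a: "a \<in> carrier T" for a f
  proof -
    have "lin \<psi> (U a * f) = lin \<psi> (U a * f * (U a * V a))"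
      by (intro resp) (use eqv_mult_left[OF eqv_sym[OF UV[OF a]], of "U a * f"] in simp)
    also have "\<dots> = lin \<psi> (V a * (U a * f * U a))" using tr[OF a, of "U a * f * U a"] by (simp add: mult.assoc)
    also have "\<dots> = lin \<psi> (f * U a)"
      by (intro resp) (use eqv_mult_right[OF VU[OF a], of "f * U a"] in \<open>simp add: mult.assoc\<close>)
    finally show ?thesis .
  qed
  fix g h assume g: "g \<in> carrier G" and h: "h \<in> carrier G"
  obtain q p where qp: "q \<in> carrier T" "p \<in> carrier T" "g = cls q p" using carrier_GE[OF g] .
  obtain q' p' where qp': "q' \<in> carrier T" "p' \<in> carrier T" "h = cls q' p'" using carrier_GE[OF h] .
  obtain s t where st: "s \<in> carrier T" "t \<in> carrier T" "g \<otimes>\<^bsub>G\<^esub> h = cls s t" "(V q * U p) * (V q' * U p') \<doteq> V s * U t"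
    using frac_mult[OF qp(1,2) qp'(1,2)] qp qp' by metis
  obtain s' t' where st': "s' \<in> carrier T" "t' \<in> carrier T" "h \<otimes>\<^bsub>G\<^esub> g = cls s' t'" "(V q' * U p') * (V q * U p) \<doteq> V s' * U t'"
    using frac_mult[OF qp'(1,2) qp(1,2)] qp qp' by metis
  have "lin \<psi> ((V q * U p) * (V q' * U p')) = lin \<psi> ((V q' * U p') * (V q * U p))"
    using tr[OF qp(1), of "U p * (V q' * U p')"] trU[OF qp(2), of "V q' * U p' * V q"] by (simp add: mult.assoc)
  then show "chr \<psi> (g \<otimes>\<^bsub>G\<^esub> h) = chr \<psi> (h \<otimes>\<^bsub>G\<^esub> g)"
    using resp[OF st(4)] resp[OF st'(4)] by (simp add: st st' eq)
next
  have eq: "chr \<psi> (cls q p) = lin \<psi> (V q * U p) / \<psi> 0" if "q \<in> carrier T" "p \<in> carrier T" for q p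
    by (rule chr_eq) (use resp that in auto)
  have p0: "\<psi> 0 \<in> \<real>\<^sub>\<ge>\<^sub>0" using pos[of 1] by simp
  fix B :: "('x \<rightharpoonup> 'x) set set" and a :: "('x \<rightharpoonup> 'x) set \<Rightarrow> complex"
  assume B: "finite B" "B \<subseteq> carrier G"
  have "\<forall>g\<in>B. \<exists>q p. q \<in> carrier T \<and> p \<in> carrier T \<and> g = cls q p" using B by (meson carrier_GE subsetD)
  then obtain q p where qp: "\<And>g. g \<in> B \<Longrightarrow> q g \<in> carrier T \<and> p g \<in> carrier T \<and> g = cls (q g) (p g)" by metis
  \<comment> \<open>Its square under \<open>\<psi>\<close> is the quadratic form of
    \<open>chr \<psi>\<close>, up to the factor \<open>\<psi> 0\<close>.\<close>
  define f where "f = (\<Sum>g\<in>B. poly_scale (a g) (V (q g) * U (p g)))"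
  have tm: "lin \<psi> (poly_adj (V (q g) * U (p g)) * (V (q h) * U (p h))) = \<psi> 0 * chr \<psi> (inv\<^bsub>G\<^esub> g \<otimes>\<^bsub>G\<^esub> h)"
    if g: "g \<in> B" and h: "h \<in> B" for g h
  proof -
    have gq: "q g \<in> carrier T" "p g \<in> carrier T" "g = cls (q g) (p g)" using qp[OF g] by auto
    have hq: "q h \<in> carrier T" "p h \<in> carrier T" "h = cls (q h) (p h)" using qp[OF h] by auto
    have ig: "inv\<^bsub>G\<^esub> g = cls (p g) (q g)" using inv_cls[OF gq(1,2)] gq(3) by simp
    obtain s t where st: "s \<in> carrier T" "t \<in> carrier T" "cls (p g) (q g) \<otimes>\<^bsub>G\<^esub> cls (q h) (p h) = cls s t"
        "(V (p g) * U (q g)) * (V (q h) * U (p h)) \<doteq> V s * U t"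
      using frac_mult[OF gq(2,1) hq(1,2)] .
    have "inv\<^bsub>G\<^esub> g \<otimes>\<^bsub>G\<^esub> h = cls s t" using st(3) ig hq(3) by simp
    moreover have "lin \<psi> (poly_adj (V (q g) * U (p g)) * (V (q h) * U (p h))) = lin \<psi> (V s * U t)"
      using resp[OF st(4)] by (simp add: poly_adj_mult)
    ultimately show ?thesis using eq[OF st(1,2)] nz by simp
  qed
  have "lin \<psi> (poly_adj f * f) = (\<Sum>g\<in>B. \<Sum>h\<in>B. cnj (a g) * a h * lin \<psi> (poly_adj (V (q g) * U (p g)) * (V (q h) * U (p h))))"
    by (simp add: f_def poly_adj_sum sum_product lin_sum poly_adj_scale poly_scale_mult_left poly_scale_mult_right mult_ac)
  also have "\<dots> = \<psi> 0 * (\<Sum>g\<in>B. \<Sum>h\<in>B. cnj (a g) * a h * chr \<psi> (inv\<^bsub>G\<^esub> g \<otimes>\<^bsub>G\<^esub> h))"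
    by (simp add: tm sum_distrib_left mult_ac cong: sum.cong)
  finally have *: "\<psi> 0 * (\<Sum>g\<in>B. \<Sum>h\<in>B. cnj (a g) * a h * chr \<psi> (inv\<^bsub>G\<^esub> g \<otimes>\<^bsub>G\<^esub> h)) \<in> \<real>\<^sub>\<ge>\<^sub>0"
    using pos[of f] by simp
  have "inverse (\<psi> 0) * (\<psi> 0 * (\<Sum>g\<in>B. \<Sum>h\<in>B. cnj (a g) * a h * chr \<psi> (inv\<^bsub>G\<^esub> g \<otimes>\<^bsub>G\<^esub> h))) \<in> \<real>\<^sub>\<ge>\<^sub>0"
    by (intro nonneg_Reals_mult_I * nonneg_Reals_inverse_I p0)
  then show "(\<Sum>g\<in>B. \<Sum>h\<in>B. cnj (a g) * a h * chr \<psi> (inv\<^bsub>G\<^esub> g \<otimes>\<^bsub>G\<^esub> h)) \<in> \<real>\<^sub>\<ge>\<^sub>0"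
    using nz by (simp flip: mult.assoc)
qed

text \<open>The reduction of a word to a fraction is carried out next to its action on the one-point
  system \<open>B\<close>, which tells the group element of that fraction.\<close>

lemma word_frac:
  assumes "w \<in> words_over (carrier T)"
  shows "\<exists>q\<in>carrier T. \<exists>p\<in>carrier T. wpoly w \<doteq> V q * U p \<and> B.wact w ((), \<one>\<^bsub>G\<^esub>) = Some ((), cls q p)"
  using assms
proof (induction w rule: star_word_induct)
  case zero
  then show ?case using eqv_sym[OF frac_one] by (intro bexI[of _ \<one>]) (auto simp: one_G)
next
  case (cons k w)
  then obtain q p where qp: "q \<in> carrier T" "p \<in> carrier T" "wpoly w \<doteq> V q * U p" "B.wact w ((), \<one>\<^bsub>G\<^esub>) = Some ((), cls q p)"
    by auto
  have "\<exists>a\<in>carrier T. \<exists>b\<in>carrier T. wpoly (Word [k]) \<doteq> V a * U b \<and> B.lact k ((), cls q p) = Some ((), cls a b \<otimes>\<^bsub>G\<^esub> cls q p)"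
  proof (cases k)
    case (Gen a)
    with cons.prems have a: "a \<in> carrier T" by simp
    have "V a = V a * 1" by simp
    also have "\<dots> \<doteq> V a * U \<one>" using eqv_adj[OF T_one] by (intro eqv_mult_left) (auto intro: eqv_sym)
    finally have f: "V a \<doteq> V a * U \<one>" .
    show ?thesis
      by (rule rev_bexI[OF a], rule rev_bexI[OF one_closed]) (use f in \<open>simp add: a Gen poly_gen_def flip: j_def\<close>)
  next
    case (Adj a)
    with cons.prems have a: "a \<in> carrier T" by simp
    have "U a = 1 * U a" by simp
    also have "\<dots> \<doteq> V \<one> * U a" using T_one by (intro eqv_mult_right) (auto intro: eqv_sym)
    finally have f: "U a \<doteq> V \<one> * U a" .
    have "cls \<one> a = inv\<^bsub>G\<^esub> (j a)" using a by (simp add: j_def inv_cls)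
    with f show ?thesis
      by - (rule rev_bexI[OF one_closed], rule rev_bexI[OF a], use f in \<open>simp add: a Adj adj_poly_gen\<close>)
  qed
  then obtain a b where ab: "a \<in> carrier T" "b \<in> carrier T" "wpoly (Word [k]) \<doteq> V a * U b"
    "B.lact k ((), cls q p) = Some ((), cls a b \<otimes>\<^bsub>G\<^esub> cls q p)" by blast
  obtain s t where st: "s \<in> carrier T" "t \<in> carrier T" "cls a b \<otimes>\<^bsub>G\<^esub> cls q p = cls s t"
    "(V a * U b) * (V q * U p) \<doteq> V s * U t" using frac_mult[OF ab(1,2) qp(1,2)] .
  have "wpoly (Word [k] + w) \<doteq> (V a * U b) * (V q * U p)" unfolding wpoly_plus by (intro eqv_mult ab qp)
  also note st(4)
  finally show ?case using st ab(4) qp(4) by (auto simp: B.wact_plus)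
qed

lemma state_chr:
  assumes resp: "\<And>f g. f \<doteq> g \<Longrightarrow> lin \<psi> f = lin \<psi> g" and nz: "\<psi> 0 \<noteq> 0"
    and w: "w \<in> words_over (carrier T)"
  shows "\<psi> w = \<psi> 0 * B.state (chr \<psi>) w"
proof -
  obtain q p where qp: "q \<in> carrier T" "p \<in> carrier T" "wpoly w \<doteq> V q * U p" "B.wact w ((), \<one>\<^bsub>G\<^esub>) = Some ((), cls q p)"
    using word_frac[OF w] by blast
  have "\<psi> w = lin \<psi> (V q * U p)" using resp[OF qp(3)] by simp
  also have "chr \<psi> (cls q p) = lin \<psi> (V q * U p) / \<psi> 0"
    by (rule chr_eq) (use resp qp in auto)
  then have "lin \<psi> (V q * U p) = \<psi> 0 * chr \<psi> (cls q p)" using nz by simp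
  also have "chr \<psi> (cls q p) = B.state (chr \<psi>) w"
    by (simp add: B.state_def B.omega_eqI[OF qp(4)])
  finally show ?thesis .
qed

end

section \<open>Tracial states and characters of the group\<close>

context directed_monoid
begin

lemma B_state_frac:
  "q \<in> carrier T \<Longrightarrow> p \<in> carrier T \<Longrightarrow> B.state \<kappa> (Word [Gen q, Adj p]) = \<kappa> (cls q p)"
proof -
  assume qp: "q \<in> carrier T" "p \<in> carrier T"
  have "B.wact (Word [Gen q, Adj p]) ((), \<one>\<^bsub>G\<^esub>) = Some ((), cls q p)"
    using qp by (simp add: B.wact_def cls_j)
  then show ?thesis by (simp add: B.state_def B.omega_eqI)
qed

sublocale presB: isometric_presentation "carrier T" "semigroup_relations T"
  by (rule isometric_semigroup)

sublocale presC: isometric_presentation "carrier G" "group_relations G"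
  by (rule G.isometric_group)

lemma T_functional_trace:
  assumes \<tau>: "\<tau> \<in> tracial_states presB.A"
  shows "T_functional T (carrier T) (semigroup_relations T) (presB.word_val \<tau>) (\<lambda>_. 0) 0"
proof -
  have st: "\<tau> \<in> states presB.A" using \<tau> by (simp add: tracial_states_def)
  interpret alg_state "carrier T" "semigroup_relations T" "presB.word_val \<tau>" by (rule presB.alg_state_word_val[OF st])
  interpret F: kms_functional "carrier T" "semigroup_relations T" "presB.word_val \<tau>" "\<lambda>_. 0" 0
    by unfold_locales (use presB.tracialD[OF \<tau>] in simp)
  show ?thesis
  proof
    show "F.eqv (poly_gen s * poly_gen t) (poly_gen (s \<otimes> t))" if "s \<in> carrier T" "t \<in> carrier T" for s t
      by (rule F.eqv_rel) (use that in \<open>auto simp: semigroup_relations_def\<close>)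
    show "F.eqv (poly_gen \<one>) 1"
      by (rule F.eqv_rel) (auto simp: semigroup_relations_def)
  qed auto
qed

text \<open>Each value is \<open>\<tau>\<close> at one fixed element of the algebra, which makes it
  affine and weak* continuous in \<open>\<tau>\<close>. For traces it agrees with \<open>chr\<close>
  on the group.\<close>

definition chrB :: "((nat \<Rightarrow> 'a star_poly) set \<Rightarrow> complex) \<Rightarrow> ('a \<rightharpoonup> 'a) set \<Rightarrow> complex" where
  "chrB \<tau> g = (let (q, p) = rep_frac g in \<tau> (presB.el (wpoly (Word [Gen q, Adj p]))))"

lemma chrB:
  assumes \<tau>: "\<tau> \<in> tracial_states presB.A"
  shows "group_char G (chrB \<tau>)" "presB.word_val \<tau> = B.state (chrB \<tau>)"
proof -
  have st: "\<tau> \<in> states presB.A" using \<tau> by (simp add: tracial_states_def)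
  interpret F: T_functional T "carrier T" "semigroup_relations T" "presB.word_val \<tau>" "\<lambda>_. 0" 0
    by (rule T_functional_trace[OF \<tau>])
  have eq: "chrB \<tau> g = F.chr (presB.word_val \<tau>) g" if g: "g \<in> carrier G" for g
  proof -
    obtain s t where r: "rep_frac g = (s, t)" "s \<in> carrier T" "t \<in> carrier T" "g = cls s t"
      using rep_fracE[OF g] .
    have VU: "poly_gen s * poly_adj (poly_gen t) = wpoly (Word [Gen s, Adj t])"
      by (simp add: adj_poly_gen) (simp add: poly_gen_def mult_single plus_star_word_def)
    have "F.chr (presB.word_val \<tau>) g = presB.word_val \<tau> (Word [Gen s, Adj t])"
      by (simp add: F.chr_def r(1) VU F.unit)
    also have "\<dots> = chrB \<tau> g" using r(2,3) by (simp add: chrB_def r(1) presB.word_val_def)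
    finally show ?thesis by simp
  qed
  have gc: "group_char G (F.chr (presB.word_val \<tau>))"
    by (rule F.group_char_chr[OF F.eqv_lin F.pos_lin]) (auto simp: F.lin_V_mult F.unit)
  show gcB: "group_char G (chrB \<tau>)" by (rule G.group_char_cong[OF gc eq])
  show "presB.word_val \<tau> = B.state (chrB \<tau>)"
  proof
    fix w show "presB.word_val \<tau> w = B.state (chrB \<tau>) w"
    proof (cases "w \<in> words_over (carrier T)")
      case True
      obtain q p where qp: "q \<in> carrier T" "p \<in> carrier T" "B.wact w ((), \<one>\<^bsub>G\<^esub>) = Some ((), cls q p)"
        using F.word_frac[OF True] by blast
      have "presB.word_val \<tau> w = B.state (F.chr (presB.word_val \<tau>)) w"
        using F.state_chr[OF F.eqv_lin _ True] by (simp add: F.unit)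
      also have "\<dots> = B.state (chrB \<tau>) w"
        using qp by (simp add: B.state_def B.omega_eqI[OF qp(3)] eq)
      finally show ?thesis .
    next
      case False
      then show ?thesis using alg_state.outside[OF alg_state_B[OF gcB]] by (simp add: presB.word_val_def)
    qed
  qed
qed

lemma extend_B_tracial:
  assumes "group_char G \<kappa>"
  shows "presB.extend (B.state \<kappa>) \<in> tracial_states presB.A"
  using assms alg_state_B[OF assms] B.state_kms[OF assms]
  by (intro presB.tracialI presB.extend_state) (auto simp: presB.word_val_extend)

lemma chrB_extend:
  assumes \<kappa>: "group_char G \<kappa>" and g: "g \<in> carrier G"
  shows "chrB (presB.extend (B.state \<kappa>)) g = \<kappa> g"
proof -
  obtain s t where r: "rep_frac g = (s, t)" "s \<in> carrier T" "t \<in> carrier T" "g = cls s t"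
    using rep_fracE[OF g] .
  show ?thesis unfolding chrB_def r(1)
    using r(2-) by (simp add: presB.extend_el[OF alg_state_B[OF \<kappa>]] star_polys_single B_state_frac)
qed

definition chrC :: "((nat \<Rightarrow> ('a \<rightharpoonup> 'a) set star_poly) set \<Rightarrow> complex) \<Rightarrow> ('a \<rightharpoonup> 'a) set \<Rightarrow> complex" where
  "chrC \<tau> g = \<tau> (presC.el (poly_gen g))"

lemma chrC:
  assumes \<tau>: "\<tau> \<in> tracial_states presC.A"
  shows "group_char G (chrC \<tau>)" "presC.word_val \<tau> = Cg.state (chrC \<tau>)"
proof -
  have st: "\<tau> \<in> states presC.A" using \<tau> by (simp add: tracial_states_def)
  interpret alg_state "carrier G" "group_relations G" "presC.word_val \<tau>" by (rule presC.alg_state_word_val[OF st])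
  interpret F: kms_functional "carrier G" "group_relations G" "presC.word_val \<tau>" "\<lambda>_. 0" 0
    by unfold_locales (use presC.tracialD[OF \<tau>] in simp)
  have chr: "chrC \<tau> g = lin (presC.word_val \<tau>) (poly_gen g)" if "g \<in> carrier G" for g
    using that by (simp add: chrC_def poly_gen_def presC.word_val_def)
  have m: "F.eqv (poly_gen g * poly_gen h) (poly_gen (g \<otimes>\<^bsub>G\<^esub> h))" if "g \<in> carrier G" "h \<in> carrier G" for g h
    by (rule F.eqv_rel) (use that in \<open>auto simp: group_relations_def\<close>)
  have VU: "F.eqv (poly_gen g * poly_adj (poly_gen g)) 1" if "g \<in> carrier G" for g
    by (rule F.eqv_rel) (use that in \<open>auto simp: group_relations_def\<close>)
  \<comment> \<open>\<open>group_relations\<close> contains no relation for the unit; that its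
    generator acts as 1 follows from its being an idempotent isometry.\<close>
  have one: "F.eqv (poly_gen \<one>\<^bsub>G\<^esub>) 1"
  proof -
    have "F.eqv (1 * poly_gen \<one>\<^bsub>G\<^esub>) (poly_adj (poly_gen \<one>\<^bsub>G\<^esub>) * poly_gen \<one>\<^bsub>G\<^esub> * poly_gen \<one>\<^bsub>G\<^esub>)"
      by (intro F.eqv_mult_right F.eqv_sym[OF F.isom_eqv]) simp
    also have "\<dots> = poly_adj (poly_gen \<one>\<^bsub>G\<^esub>) * (poly_gen \<one>\<^bsub>G\<^esub> * poly_gen \<one>\<^bsub>G\<^esub>)" by (simp add: mult.assoc)
    also have "F.eqv \<dots> (poly_adj (poly_gen \<one>\<^bsub>G\<^esub>) * poly_gen \<one>\<^bsub>G\<^esub>)"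
      using m[of "\<one>\<^bsub>G\<^esub>" "\<one>\<^bsub>G\<^esub>"] by (intro F.eqv_mult_left) simp
    also have "F.eqv \<dots> 1" by (intro F.isom_eqv) simp
    finally show ?thesis by simp
  qed
  have adj: "F.eqv (poly_adj (poly_gen g)) (poly_gen (inv\<^bsub>G\<^esub> g))" if g: "g \<in> carrier G" for g
  proof -
    have "F.eqv (poly_adj (poly_gen g) * 1) (poly_adj (poly_gen g) * (poly_gen g * poly_gen (inv\<^bsub>G\<^esub> g)))"
      using m[of g "inv\<^bsub>G\<^esub> g"] one g by (intro F.eqv_mult_left) (auto intro: F.eqv_sym F.eqv_trans)
    also have "\<dots> = poly_adj (poly_gen g) * poly_gen g * poly_gen (inv\<^bsub>G\<^esub> g)" by (simp add: mult.assoc)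
    also have "F.eqv \<dots> (1 * poly_gen (inv\<^bsub>G\<^esub> g))" by (intro F.eqv_mult_right F.isom_eqv g)
    finally show ?thesis by simp
  qed
  show gc: "group_char G (chrC \<tau>)"
    unfolding group_char_def
  proof (intro conjI ballI allI impI)
    show "chrC \<tau> \<one>\<^bsub>G\<^esub> = 1" using F.eqv_lin[OF one] by (simp add: chr unit)
    fix g h assume gh: "g \<in> carrier G" "h \<in> carrier G"
    show "chrC \<tau> (g \<otimes>\<^bsub>G\<^esub> h) = chrC \<tau> (h \<otimes>\<^bsub>G\<^esub> g)"
      using F.eqv_lin[OF m[OF gh]] F.eqv_lin[OF m[OF gh(2,1)]] F.lin_V_mult[of g "poly_gen h"] gh by (simp add: chr)
  next
    fix B :: "('a \<rightharpoonup> 'a) set set" and a :: "('a \<rightharpoonup> 'a) set \<Rightarrow> complex"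
    assume B: "finite B" "B \<subseteq> carrier G"
    define f where "f = (\<Sum>g\<in>B. poly_scale (a g) (poly_gen g))"
    have tm: "lin (presC.word_val \<tau>) (poly_adj (poly_gen g) * poly_gen h) = chrC \<tau> (inv\<^bsub>G\<^esub> g \<otimes>\<^bsub>G\<^esub> h)"
      if "g \<in> B" "h \<in> B" for g h
    proof -
      have gh: "g \<in> carrier G" "h \<in> carrier G" using that B by auto
      have "F.eqv (poly_adj (poly_gen g) * poly_gen h) (poly_gen (inv\<^bsub>G\<^esub> g \<otimes>\<^bsub>G\<^esub> h))"
        using F.eqv_mult_right[OF adj[OF gh(1)], of "poly_gen h"] m[of "inv\<^bsub>G\<^esub> g" h] gh by (auto intro: F.eqv_trans)
      then show ?thesis using gh F.eqv_lin by (simp add: chr)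
    qed
    have "(\<Sum>g\<in>B. \<Sum>h\<in>B. cnj (a g) * a h * chrC \<tau> (inv\<^bsub>G\<^esub> g \<otimes>\<^bsub>G\<^esub> h)) = lin (presC.word_val \<tau>) (poly_adj f * f)"
      by (simp add: f_def poly_adj_sum sum_product lin_sum poly_adj_scale poly_scale_mult_left poly_scale_mult_right mult_ac tm cong: sum.cong)
    then show "(\<Sum>g\<in>B. \<Sum>h\<in>B. cnj (a g) * a h * chrC \<tau> (inv\<^bsub>G\<^esub> g \<otimes>\<^bsub>G\<^esub> h)) \<in> \<real>\<^sub>\<ge>\<^sub>0"
      using pos_lin[of f] by simp
  qed
  have wf: "\<exists>g\<in>carrier G. F.eqv (wpoly w) (poly_gen g) \<and> Cg.wact w ((), \<one>\<^bsub>G\<^esub>) = Some ((), g)"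
    if "w \<in> words_over (carrier G)" for w
    using that
  proof (induction w rule: star_word_induct)
    case zero
    then show ?case using F.eqv_sym[OF one] by (intro bexI[of _ "\<one>\<^bsub>G\<^esub>"]) auto
  next
    case (cons k w)
    then obtain g where g: "g \<in> carrier G" "F.eqv (wpoly w) (poly_gen g)" "Cg.wact w ((), \<one>\<^bsub>G\<^esub>) = Some ((), g)" by auto
    have "\<exists>h\<in>carrier G. F.eqv (wpoly (Word [k])) (poly_gen h) \<and> Cg.lact k ((), g) = Some ((), h \<otimes>\<^bsub>G\<^esub> g)"
    proof (cases k)
      case (Gen h) then show ?thesis using cons.prems by (intro bexI[of _ h]) (auto simp: poly_gen_def)
    next
      case (Adj h) then show ?thesis using cons.prems adj[of h] by (intro bexI[of _ "inv\<^bsub>G\<^esub> h"]) (auto simp: adj_poly_gen)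
    qed
    then obtain h where h: "h \<in> carrier G" "F.eqv (wpoly (Word [k])) (poly_gen h)" "Cg.lact k ((), g) = Some ((), h \<otimes>\<^bsub>G\<^esub> g)" by blast
    have "F.eqv (wpoly (Word [k] + w)) (poly_gen h * poly_gen g)" unfolding wpoly_plus by (intro F.eqv_mult h g)
    also have "F.eqv \<dots> (poly_gen (h \<otimes>\<^bsub>G\<^esub> g))" by (intro m h g)
    finally show ?case using h g by (intro bexI[of _ "h \<otimes>\<^bsub>G\<^esub> g"]) (auto simp: Cg.wact_plus)
  qed
  show "presC.word_val \<tau> = Cg.state (chrC \<tau>)"
  proof
    fix w show "presC.word_val \<tau> w = Cg.state (chrC \<tau>) w"
    proof (cases "w \<in> words_over (carrier G)")
      case True
      then obtain g where g: "g \<in> carrier G" "F.eqv (wpoly w) (poly_gen g)" "Cg.wact w ((), \<one>\<^bsub>G\<^esub>) = Some ((), g)" using wf by blast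
      show ?thesis using F.eqv_lin[OF g(2)] by (simp add: chr g(1) Cg.state_def Cg.omega_eqI[OF g(3)])
    next
      case False
      then show ?thesis using alg_state.outside[OF alg_state_C[OF gc]] by (simp add: presC.word_val_def)
    qed
  qed
qed

lemma extend_C_tracial:
  assumes "group_char G \<kappa>"
  shows "presC.extend (Cg.state \<kappa>) \<in> tracial_states presC.A"
  using assms alg_state_C[OF assms] Cg.state_kms[OF assms]
  by (intro presC.tracialI presC.extend_state) (auto simp: presC.word_val_extend)

lemma chrC_extend:
  assumes \<kappa>: "group_char G \<kappa>" and g: "g \<in> carrier G"
  shows "chrC (presC.extend (Cg.state \<kappa>)) g = \<kappa> g"
proof -
  have "Cg.wact (Word [Gen g]) ((), \<one>\<^bsub>G\<^esub>) = Some ((), g)" using g by simp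
  then have "Cg.state \<kappa> (Word [Gen g]) = \<kappa> g" by (simp add: Cg.state_def Cg.omega_eqI)
  then show ?thesis using g
    by (simp add: chrC_def presC.extend_el[OF alg_state_C[OF \<kappa>]] poly_gen_mem) (simp add: poly_gen_def)
qed

end


section \<open>Dominated convergence for infinite sums\<close>

lemma infsum_dominated_convergence:
  fixes f :: "nat \<Rightarrow> 'a \<Rightarrow> complex"
  assumes g: "g summable_on C" and dom: "\<And>n c. c \<in> C \<Longrightarrow> cmod (f n c) \<le> g c"
    and lim: "\<And>c. c \<in> C \<Longrightarrow> (\<lambda>n. f n c) \<longlonglongrightarrow> h c"
  shows "(\<lambda>n. \<Sum>\<^sub>\<infinity>c\<in>C. f n c) \<longlonglongrightarrow> (\<Sum>\<^sub>\<infinity>c\<in>C. h c)"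
proof -
  have domh: "cmod (h c) \<le> g c" if "c \<in> C" for c
    by (rule LIMSEQ_le_const2[OF tendsto_norm[OF lim[OF that]]]) (use dom[OF that] in auto)
  have fs: "f n summable_on C" for n
    by (rule abs_summable_summable, rule summable_on_comparison_test[OF g]) (auto intro: dom)
  have hs: "h summable_on C"
    by (rule abs_summable_summable, rule summable_on_comparison_test[OF g]) (auto intro: domh)
  show ?thesis
  proof (rule LIMSEQ_I)
    fix e :: real assume e: "e > 0"
    obtain F where F: "finite F" "F \<subseteq> C" and Fe: "dist (sum g F) (infsum g C) \<le> e / 4"
      using infsum_finite_approximation[OF g, of "e/4"] e by auto
    have rest: "(g has_sum (infsum g C - sum g F)) (C - F)"
      by (rule has_sum_Diff[OF has_sum_infsum[OF g] has_sum_finite[OF F(1)] F(2)])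
    have r: "infsum g C - sum g F \<le> e / 4" using Fe by (simp add: dist_real_def abs_if split: if_splits)
    have fr: "cmod (infsum (f n) C - sum (f n) F) \<le> e / 4" for n
      using norm_infsum_le[OF has_sum_Diff[OF has_sum_infsum[OF fs] has_sum_finite[OF F(1)] F(2)] rest] dom r
      by (meson DiffD1 order_trans)
    have hr: "cmod (infsum h C - sum h F) \<le> e / 4"
      using norm_infsum_le[OF has_sum_Diff[OF has_sum_infsum[OF hs] has_sum_finite[OF F(1)] F(2)] rest] domh r
      by (meson DiffD1 order_trans)
    have "(\<lambda>n. sum (f n) F) \<longlonglongrightarrow> sum h F" using F by (intro tendsto_sum lim) auto
    then obtain M where M: "\<And>n. n \<ge> M \<Longrightarrow> cmod (sum (f n) F - sum h F) < e / 4"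
      using LIMSEQ_D[of "\<lambda>n. sum (f n) F" "sum h F" "e/4"] e by auto
    have "cmod (infsum (f n) C - infsum h C) < e" if n: "n \<ge> M" for n
    proof -
      have "infsum (f n) C - infsum h C = (infsum (f n) C - sum (f n) F) + (sum (f n) F - sum h F) - (infsum h C - sum h F)" by simp
      also have "cmod \<dots> \<le> e / 4 + e / 4 + e / 4"
        by (intro order_trans[OF norm_triangle_ineq4] order_trans[OF norm_triangle_ineq] add_mono fr hr less_imp_le[OF M[OF n]])
      finally show ?thesis using e by simp
    qed
    then show "\<exists>M. \<forall>n\<ge>M. cmod (infsum (f n) C - infsum h C) < e" by blast
  qed
qed

section \<open>KMS functionals are induced from the kernel\<close>

context kms_functional
begin

definition proj :: "'x star_poly \<Rightarrow> bool" where
  "proj e \<longleftrightarrow> poly_adj e \<doteq> e \<and> e * e \<doteq> e"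

lemma proj_nrm: "proj e \<Longrightarrow> lin \<phi> e = complex_of_real ((nrm e)\<^sup>2)"
  unfolding proj_def lin_eq_nrm[symmetric]
  by (rule eqv_lin) (meson eqv_mult_right eqv_sym eqv_trans)

lemma proj_contract: "proj e \<Longrightarrow> nrm (e * g) \<le> nrm g"
proof (cases "nrm (e * g) = 0")
  case False
  assume e: "proj e"
  have "poly_adj g * poly_adj e * e * g \<doteq> poly_adj g * e * e * g"
    using e unfolding proj_def by (metis eqv_mid eqv_mult_right)
  also have "\<dots> = poly_adj g * (e * e) * g" by (simp add: mult.assoc)
  also have "\<dots> \<doteq> poly_adj g * e * g" using e unfolding proj_def by (metis eqv_mid)
  finally have "lin \<phi> (poly_adj (e * g) * (e * g)) = lin \<phi> (poly_adj g * (e * g))"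
    using eqv_lin by (simp add: poly_adj_mult mult.assoc)
  then have "complex_of_real ((nrm (e * g))\<^sup>2) = lin \<phi> (poly_adj g * (e * g))" by (simp only: lin_eq_nrm)
  then have "(nrm (e * g))\<^sup>2 = cmod (lin \<phi> (poly_adj g * (e * g)))"
    by (metis abs_of_nonneg norm_of_real zero_le_power2)
  also have "\<dots> \<le> nrm g * nrm (e * g)" by (rule Cauchy_Schwarz)
  finally show ?thesis using False by (simp add: power2_eq_square less_le)
qed simp

lemma proj_le_one: "proj e \<Longrightarrow> nrm (poly_adj e) \<le> 1"
  using proj_contract[of e 1] eqv_nrm[of "poly_adj e" e] by (simp add: proj_def nrm_one)

lemma proj_bound: "proj e \<Longrightarrow> cmod (lin \<phi> (e * f)) \<le> nrm f"
  using lin_le_nrm[of e f] proj_le_one[of e] mult_right_mono[of "nrm (poly_adj e)" 1 "nrm f"] by simp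

text \<open>The difference of nested projections is a projection modulo \<open>\<phi>\<close>, and
  Cauchy-Schwarz is applied to it. Monotone convergence of the values thereby controls everything
  else.\<close>

lemma proj_diff_bound:
  assumes e: "proj e" "proj e'" "e * e' \<doteq> e'" "e' * e \<doteq> e'"
  shows "(cmod (lin \<phi> (e * f) - lin \<phi> (e' * f)))\<^sup>2 \<le> (Re (lin \<phi> e) - Re (lin \<phi> e')) * (nrm f)\<^sup>2"
    and "Re (lin \<phi> e') \<le> Re (lin \<phi> e)"
proof -
  let ?d = "e - e'"
  have adj: "poly_adj ?d \<doteq> ?d" using e unfolding poly_adj_diff proj_def by (intro eqv_diff) auto
  have "?d * ?d = (e * e - e * e') - (e' * e - e' * e')" by (simp add: algebra_simps)
  also have "\<dots> \<doteq> (e - e') - (e' - e')" using e unfolding proj_def by (intro eqv_diff) auto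
  finally have "proj ?d" using adj by (simp add: proj_def)
  from proj_nrm[OF this] have d: "(nrm ?d)\<^sup>2 = Re (lin \<phi> e) - Re (lin \<phi> e')" by (simp add: lin_diff complex_eq_iff)
  have "cmod (lin \<phi> (?d * f)) \<le> nrm ?d * nrm f"
    using lin_le_nrm[of ?d f] eqv_nrm[OF adj] by simp
  then have "(cmod (lin \<phi> (?d * f)))\<^sup>2 \<le> (nrm ?d * nrm f)\<^sup>2" by (intro power_mono) auto
  then show "(cmod (lin \<phi> (e * f) - lin \<phi> (e' * f)))\<^sup>2 \<le> (Re (lin \<phi> e) - Re (lin \<phi> e')) * (nrm f)\<^sup>2"
    by (simp add: power_mult_distrib d left_diff_distrib lin_diff)
  show "Re (lin \<phi> e') \<le> Re (lin \<phi> e)" using zero_le_power2[of "nrm ?d"] unfolding d by simp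
qed

abbreviation P :: "'x \<Rightarrow> 'x star_poly" where "P s \<equiv> V s * U s"

primrec Q :: "'x list \<Rightarrow> 'x star_poly" where
  "Q [] = 1"
| "Q (s # L) = (1 - P s) * Q L"

lemma Q_append: "Q (L @ M) = Q L * Q M"
  by (induction L) (simp_all add: mult.assoc)

lemma P_idem: "s \<in> X \<Longrightarrow> P s * P s \<doteq> P s"
proof -
  assume s: "s \<in> X"
  have "P s * P s = V s * (U s * V s) * U s" by (simp add: mult.assoc)
  also have "\<dots> \<doteq> V s * 1 * U s" by (intro eqv_mid isom_eqv s)
  finally show ?thesis by simp
qed

lemma lin_P: "s \<in> X \<Longrightarrow> lin \<phi> (P s) = exp (- \<beta> * l s)"
  using lin_V_mult[of s "U s"] eqv_lin[OF isom_eqv[of s]] by (simp add: unit)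

text \<open>Range projections have weight 0 and so lie in the centralizer: the factors from moving
  \<open>V s\<close> and \<open>U s\<close> cancel.\<close>

lemma lin_P_mult: "lin \<phi> (P s * f) = lin \<phi> (f * P s)"
proof -
  have "lin \<phi> (P s * f) = exp (- \<beta> * l s) * (exp (\<beta> * l s) * lin \<phi> (f * P s))"
    using lin_V_mult[of s "U s * f"] lin_U_mult[of s "f * V s"] by (simp add: mult.assoc)
  then show ?thesis by (simp add: exp_minus field_simps)
qed

lemma lin_Q_mult: "lin \<phi> (Q L * f) = lin \<phi> (f * Q L)"
proof (induction L arbitrary: f)
  case (Cons s L)
  have "lin \<phi> (Q (s # L) * f) = lin \<phi> (Q L * f) - lin \<phi> (P s * (Q L * f))"
    by (simp add: left_diff_distrib lin_diff mult.assoc)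
  also have "lin \<phi> (P s * (Q L * f)) = lin \<phi> (Q L * (f * P s))" unfolding lin_P_mult by (simp add: mult.assoc)
  also have "lin \<phi> (Q L * f) - lin \<phi> (Q L * (f * P s)) = lin \<phi> (f * Q (s # L))"
    unfolding Cons.IH by (simp add: algebra_simps lin_diff)
  finally show ?case .
qed simp

end

locale S_functional = scaled_setting S N \<beta> +
  kms_functional "carrier S" "semigroup_relations S" \<phi> "\<lambda>s. ln (N s)" \<beta>
  for S :: "('a, 'b) monoid_scheme" (structure) and N :: "'a \<Rightarrow> real" and \<beta> :: real
    and \<phi> :: "'a star_word \<Rightarrow> complex" +
  assumes countable_S: "countable (carrier S)"
    and nontrivial: "\<exists>s\<in>carrier S. N s \<noteq> 1"
    and \<beta>_nz: "\<beta> \<noteq> 0"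
begin

lemma V_mult: "s \<in> carrier S \<Longrightarrow> t \<in> carrier S \<Longrightarrow> V s * V t \<doteq> V (s \<otimes> t)"
  by (rule eqv_rel) (auto simp: semigroup_relations_def)

lemma V_one: "V \<one> \<doteq> 1"
  by (rule eqv_rel) (auto simp: semigroup_relations_def)

lemma UU_mult: "s \<in> carrier S \<Longrightarrow> t \<in> carrier S \<Longrightarrow> U t * U s \<doteq> U (s \<otimes> t)"
  using eqv_adj[OF V_mult[of s t]] by (simp add: poly_adj_mult)

sublocale F: T_functional T "carrier S" "semigroup_relations S" \<phi> "\<lambda>s. ln (N s)" \<beta>
proof
  show "carrier T \<subseteq> carrier S" using T_S by blast
qed (auto simp: carrier_T V_mult V_one)

lemma P_lcm:
  assumes "s \<in> carrier S" "t \<in> carrier S" "r \<in> carrier S"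
    "(s <# carrier S) \<inter> (t <# carrier S) = r <# carrier S"
  shows "P s * P t \<doteq> P r"
  using eqv_rel[of "P s * P t" "P r"] assms unfolding semigroup_relations_def range_proj_def by blast

lemma P_disj:
  assumes "s \<in> carrier S" "t \<in> carrier S" "(s <# carrier S) \<inter> (t <# carrier S) = {}"
  shows "P s * P t \<doteq> 0"
  using eqv_rel_0[of "P s * P t"] assms unfolding semigroup_relations_def range_proj_def by blast

lemma lcm_cases:
  assumes "s \<in> carrier S" "t \<in> carrier S"
  obtains (disj) "(s <# carrier S) \<inter> (t <# carrier S) = {}"
  | (lcm) z z' where "z \<in> carrier S" "z' \<in> carrier S" "s \<otimes> z = t \<otimes> z'"
      "(s <# carrier S) \<inter> (t <# carrier S) = (s \<otimes> z) <# carrier S"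
proof (cases "(s <# carrier S) \<inter> (t <# carrier S) = {}")
  case False
  then obtain r where r: "r \<in> carrier S" "(s <# carrier S) \<inter> (t <# carrier S) = r <# carrier S"
    using right_lcm[OF assms] by blast
  have "r \<in> r <# carrier S" using r(1) unfolding l_coset_def by (auto intro!: bexI[of _ \<one>])
  then have "r \<in> s <# carrier S" "r \<in> t <# carrier S" using r(2) by auto
  then obtain z z' where "z \<in> carrier S" "z' \<in> carrier S" "r = s \<otimes> z" "r = t \<otimes> z'"
    unfolding l_coset_def by blast
  then show ?thesis using lcm[of z z'] r by simp
qed (rule disj)

lemma P_comm: "s \<in> carrier S \<Longrightarrow> t \<in> carrier S \<Longrightarrow> P s * P t \<doteq> P t * P s"
proof -
  assume st: "s \<in> carrier S" "t \<in> carrier S"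
  have i: "(t <# carrier S) \<inter> (s <# carrier S) = (s <# carrier S) \<inter> (t <# carrier S)" by blast
  show ?thesis using st
  proof (cases rule: lcm_cases)
    case disj
    show ?thesis
      by (rule eqv_trans[OF P_disj[OF st disj] eqv_sym[OF P_disj[OF st(2,1) trans[OF i disj]]]])
  next
    case (lcm z z')
    have sz: "s \<otimes> z \<in> carrier S" using st lcm by simp
    show ?thesis
      by (rule eqv_trans[OF P_lcm[OF st sz lcm(4)] eqv_sym[OF P_lcm[OF st(2,1) sz trans[OF i lcm(4)]]]])
  qed
qed

lemma P_conj: "s \<in> carrier S \<Longrightarrow> t \<in> carrier S \<Longrightarrow> V s * P t * U s \<doteq> P (s \<otimes> t)"
  using eqv_mult[OF V_mult UU_mult, of s t s t] by (simp add: mult.assoc)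

lemma P_T: "a \<in> carrier T \<Longrightarrow> P a \<doteq> 1"
  by (rule F.VU)

lemma P_mult_T: "s \<in> carrier S \<Longrightarrow> a \<in> carrier T \<Longrightarrow> P (s \<otimes> a) \<doteq> P s"
proof -
  assume s: "s \<in> carrier S" and a: "a \<in> carrier T"
  have "P (s \<otimes> a) \<doteq> V s * P a * U s" using P_conj[OF s T_S[OF a]] by (rule eqv_sym)
  also have "\<dots> \<doteq> V s * 1 * U s" by (intro eqv_mid P_T a)
  finally show ?thesis by simp
qed

lemma P_sim: "sim x y \<Longrightarrow> P x \<doteq> P y"
proof -
  assume "sim x y"
  then obtain a b where ab: "a \<in> carrier T" "b \<in> carrier T" "x \<otimes> a = y \<otimes> b" "x \<in> carrier S" "y \<in> carrier S"
    by (auto simp: sim_iff)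
  have "P x \<doteq> P (x \<otimes> a)" using P_mult_T[OF ab(4,1)] by (rule eqv_sym)
  also have "\<dots> \<doteq> P y" unfolding ab(3) by (rule P_mult_T[OF ab(5,2)])
  finally show ?thesis .
qed

lemma P_not_0: "s \<in> carrier S \<Longrightarrow> \<not> P s \<doteq> 0"
proof
  assume "s \<in> carrier S" "P s \<doteq> 0"
  then show False using eqv_lin[of "P s" 0] lin_P[of s] by simp
qed

text \<open>The value of \<open>\<phi>\<close> at \<open>P s\<close> is N(s)^(-\<beta>), which
  determines N(s) since \<beta> is nonzero.\<close>

lemma P_eqv_N: "s \<in> carrier S \<Longrightarrow> t \<in> carrier S \<Longrightarrow> P s \<doteq> P t \<Longrightarrow> N s = N t"
  using eqv_lin[of "P s" "P t"] \<beta>_nz N_pos[of s] N_pos[of t] by (simp add: lin_P)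

lemma E_comm: "s \<in> carrier S \<Longrightarrow> t \<in> carrier S \<Longrightarrow> (1 - P s) * (1 - P t) \<doteq> (1 - P t) * (1 - P s)"
proof -
  assume st: "s \<in> carrier S" "t \<in> carrier S"
  have "(1 - P s) * (1 - P t) = 1 - P t - P s + P s * P t" by (simp add: algebra_simps)
  also have "\<dots> \<doteq> 1 - P t - P s + P t * P s" by (intro eqv_add eqv_refl P_comm st)
  also have "\<dots> = (1 - P t) * (1 - P s)" by (simp add: algebra_simps)
  finally show ?thesis .
qed

lemma E_idem: "s \<in> carrier S \<Longrightarrow> (1 - P s) * (1 - P s) \<doteq> 1 - P s"
proof -
  assume s: "s \<in> carrier S"
  have "(1 - P s) * (1 - P s) = 1 - P s - P s + P s * P s" by (simp add: algebra_simps)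
  also have "\<dots> \<doteq> 1 - P s - P s + P s" by (intro eqv_add eqv_refl P_idem s)
  finally show ?thesis by simp
qed

lemma E_Q: "s \<in> carrier S \<Longrightarrow> set L \<subseteq> carrier S \<Longrightarrow> (1 - P s) * Q L \<doteq> Q L * (1 - P s)"
proof (induction L)
  case (Cons t L)
  then have t: "t \<in> carrier S" by simp
  have "(1 - P s) * Q (t # L) = ((1 - P s) * (1 - P t)) * Q L" by (simp add: mult.assoc)
  also have "\<dots> \<doteq> ((1 - P t) * (1 - P s)) * Q L" by (intro eqv_mult_right E_comm t Cons)
  also have "\<dots> = (1 - P t) * ((1 - P s) * Q L)" by (simp add: mult.assoc)
  also have "\<dots> \<doteq> (1 - P t) * (Q L * (1 - P s))" using Cons by (intro eqv_mult_left) auto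
  finally show ?case by (simp add: mult.assoc)
qed simp

lemma Q_absorb_mem: "set L \<subseteq> carrier S \<Longrightarrow> s \<in> set L \<Longrightarrow> (1 - P s) * Q L \<doteq> Q L"
proof (induction L)
  case (Cons t L)
  show ?case
  proof (cases "s = t")
    case True
    have "(1 - P s) * Q (t # L) = ((1 - P s) * (1 - P s)) * Q L" by (simp add: True mult.assoc)
    also have "\<dots> \<doteq> (1 - P s) * Q L" using Cons True by (intro eqv_mult_right E_idem) auto
    finally show ?thesis by (simp add: True)
  next
    case False
    then have s: "s \<in> set L" "s \<in> carrier S" "t \<in> carrier S" using Cons by auto
    have "(1 - P s) * Q (t # L) = ((1 - P s) * (1 - P t)) * Q L" by (simp add: mult.assoc)
    also have "\<dots> \<doteq> ((1 - P t) * (1 - P s)) * Q L" by (intro eqv_mult_right E_comm s)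
    also have "\<dots> = (1 - P t) * ((1 - P s) * Q L)" by (simp add: mult.assoc)
    also have "\<dots> \<doteq> (1 - P t) * Q L" using Cons s by (intro eqv_mult_left) auto
    finally show ?thesis by simp
  qed
qed simp

lemma Q_absorb: "(\<And>s. s \<in> set L \<Longrightarrow> (1 - P s) * f \<doteq> f) \<Longrightarrow> Q L * f \<doteq> f"
proof (induction L)
  case (Cons t L)
  have "Q (t # L) * f = (1 - P t) * (Q L * f)" by (simp add: mult.assoc)
  also have "\<dots> \<doteq> (1 - P t) * f" using Cons by (intro eqv_mult_left) auto
  also have "\<dots> \<doteq> f" using Cons by simp
  finally show ?case .
qed simp

lemma Q_subset: "set M \<subseteq> carrier S \<Longrightarrow> set L \<subseteq> set M \<Longrightarrow> Q L * Q M \<doteq> Q M"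
  by (rule Q_absorb) (auto intro: Q_absorb_mem)

lemma Q_Q: "set L \<subseteq> carrier S \<Longrightarrow> set M \<subseteq> carrier S \<Longrightarrow> Q L * Q M \<doteq> Q M * Q L"
proof (induction L)
  case (Cons t L)
  have "Q (t # L) * Q M = (1 - P t) * (Q L * Q M)" by (simp add: mult.assoc)
  also have "\<dots> \<doteq> (1 - P t) * (Q M * Q L)" using Cons by (intro eqv_mult_left) auto
  also have "\<dots> = ((1 - P t) * Q M) * Q L" by (simp add: mult.assoc)
  also have "\<dots> \<doteq> (Q M * (1 - P t)) * Q L" using Cons by (intro eqv_mult_right E_Q) auto
  finally show ?case by (simp add: mult.assoc)
qed simp

lemma Q_proj: "set L \<subseteq> carrier S \<Longrightarrow> proj (Q L)"
  unfolding proj_def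
proof (intro conjI)
  assume L: "set L \<subseteq> carrier S"
  show "Q L * Q L \<doteq> Q L" by (intro Q_subset L order_refl)
  show "poly_adj (Q L) \<doteq> Q L" using L
  proof (induction L)
    case (Cons t L)
    have "poly_adj (Q (t # L)) = poly_adj (Q L) * (1 - P t)" by (simp add: poly_adj_mult poly_adj_diff)
    also have "\<dots> \<doteq> Q L * (1 - P t)" using Cons by (intro eqv_mult_right) auto
    also have "\<dots> \<doteq> (1 - P t) * Q L" using Cons by (intro eqv_sym[OF E_Q]) auto
    finally show ?case by simp
  qed simp
qed

section \<open>The corner functional\<close>

definition Kc :: "'a set" where "Kc = carrier S - carrier T"

lemma Kc_iff: "s \<in> Kc \<longleftrightarrow> s \<in> carrier S \<and> N s \<noteq> 1"
  by (auto simp: Kc_def carrier_T)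

lemma Kc_S: "s \<in> Kc \<Longrightarrow> s \<in> carrier S"
  by (simp add: Kc_iff)

lemma Kc_mult: "s \<in> Kc \<Longrightarrow> t \<in> carrier S \<Longrightarrow> t \<otimes> s \<in> Kc"
  using N_mult[of t s] N_mult_1[of t s] by (auto simp: Kc_iff)

lemma Kc_ne: "Kc \<noteq> {}"
  using nontrivial by (auto simp: Kc_iff)

text \<open>Initial segments of an enumeration of \<open>Kc\<close>. The projections
  \<open>Q (en n)\<close> decrease, but their limit need not exist in the algebra; only the limits
  of their values under \<open>\<phi>\<close> are taken.\<close>

definition en :: "nat \<Rightarrow> 'a list" where "en n = map (from_nat_into Kc) [0..<n]"

lemma en_Kc: "set (en n) \<subseteq> Kc"
  using from_nat_into[OF Kc_ne] by (auto simp: en_def)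

lemma en_S: "set (en n) \<subseteq> carrier S"
  using en_Kc Kc_S by blast

lemma en_mono: "m \<le> n \<Longrightarrow> set (en m) \<subseteq> set (en n)"
  by (auto simp: en_def)

lemma en_eventually: "s \<in> Kc \<Longrightarrow> \<forall>\<^sub>F n in sequentially. s \<in> set (en n)"
proof -
  assume s: "s \<in> Kc"
  have "countable Kc" using countable_S by (auto simp: Kc_def intro: countable_subset)
  then obtain k where k: "from_nat_into Kc k = s" using from_nat_into_surj[OF _ s] by blast
  show ?thesis unfolding eventually_sequentially
    by (intro exI[of _ "Suc k"]) (auto simp: en_def k[symmetric])
qed

lemma en_eventually_list: "set M \<subseteq> Kc \<Longrightarrow> \<forall>\<^sub>F n in sequentially. set M \<subseteq> set (en n)"
  unfolding subset_eq[of "set M" "set (en _)"] using en_eventually by (intro eventually_ball_finite) auto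

lemma Q_decreasing:
  assumes "set M \<subseteq> carrier S" "Q L * Q M \<doteq> Q M" "set L \<subseteq> carrier S"
  shows "(cmod (lin \<phi> (Q L * f) - lin \<phi> (Q M * f)))\<^sup>2 \<le> (Re (lin \<phi> (Q L)) - Re (lin \<phi> (Q M))) * (nrm f)\<^sup>2"
    "Re (lin \<phi> (Q M)) \<le> Re (lin \<phi> (Q L))"
proof -
  have "Q M * Q L \<doteq> Q M" using Q_Q[OF assms(1,3)] assms(2) eqv_trans by blast
  note b = proj_diff_bound[OF Q_proj[OF assms(3)] Q_proj[OF assms(1)] assms(2) this]
  show "(cmod (lin \<phi> (Q L * f) - lin \<phi> (Q M * f)))\<^sup>2 \<le> (Re (lin \<phi> (Q L)) - Re (lin \<phi> (Q M))) * (nrm f)\<^sup>2"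
    "Re (lin \<phi> (Q M)) \<le> Re (lin \<phi> (Q L))" using b by auto
qed

definition q :: "nat \<Rightarrow> real" where "q n = Re (lin \<phi> (Q (en n)))"

definition q0 :: real where "q0 = lim q"

lemma q_lim: "q \<longlonglongrightarrow> q0" and q_ge: "q0 \<le> q n"
proof -
  have dec: "decseq q" unfolding decseq_def q_def
    by (intro allI impI Q_decreasing(2) Q_subset en_S en_mono)
  have "0 \<le> q n" for n unfolding q_def using proj_nrm[OF Q_proj[OF en_S]] by simp
  then obtain L where L: "q \<longlonglongrightarrow> L" "\<And>n. L \<le> q n" using decseq_convergent[OF dec, of 0] by metis
  then have "q0 = L" unfolding q0_def by (simp add: limI)
  then show "q \<longlonglongrightarrow> q0" "q0 \<le> q n" using L by auto
qed

text \<open>Any finite list in \<open>Kc\<close> is eventually contained in \<open>en n\<close>, so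
  \<open>q0\<close> is a lower bound for all finite products and not only for those of the
  enumeration.\<close>

lemma q_le_Q:
  assumes M: "set M \<subseteq> Kc" shows "q0 \<le> Re (lin \<phi> (Q M))"
proof -
  obtain n where n: "set M \<subseteq> set (en n)" using en_eventually_list[OF M] by (auto simp: eventually_sequentially)
  have "q n \<le> Re (lin \<phi> (Q M))" unfolding q_def
    using M Kc_S by (intro Q_decreasing(2) Q_subset en_S n) auto
  then show ?thesis using q_ge[of n] by simp
qed

text \<open>The compression of \<open>\<phi>\<close> to the corner, left unnormalized: its value at
  1 turns out to be 1/\<zeta>.\<close>

definition \<psi> :: "'a star_word \<Rightarrow> complex" where
  "\<psi> w = lim (\<lambda>n. lin \<phi> (Q (en n) * wpoly w))"

text \<open>Once \<open>q k\<close> is within \<open>d\<close> of the infimum, any product over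
  \<open>Kc\<close> below \<open>Q (en k)\<close> has almost the same value, and
  \<open>proj_diff_bound\<close> applies. This yields both the existence of the limit and its
  independence of the exhaustion.\<close>

lemma Q_close:
  assumes M: "set M \<subseteq> Kc" and abs: "\<And>s. s \<in> set (en k) \<Longrightarrow> (1 - P s) * Q M \<doteq> Q M" and k: "q k \<le> q0 + d"
  shows "(cmod (lin \<phi> (Q (en k) * f) - lin \<phi> (Q M * f)))\<^sup>2 \<le> d * (nrm f)\<^sup>2"
proof -
  have MS: "set M \<subseteq> carrier S" using M Kc_S by blast
  have "Q (en k) * Q M \<doteq> Q M" by (rule Q_absorb) (rule abs)
  from Q_decreasing(1)[OF MS this en_S]
  have "(cmod (lin \<phi> (Q (en k) * f) - lin \<phi> (Q M * f)))\<^sup>2 \<le> (q k - Re (lin \<phi> (Q M))) * (nrm f)\<^sup>2"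
    by (simp add: q_def)
  also have "\<dots> \<le> d * (nrm f)\<^sup>2" using k q_le_Q[OF M] by (intro mult_right_mono) auto
  finally show ?thesis .
qed

lemma q_small: "d > 0 \<Longrightarrow> \<exists>k. q k \<le> q0 + d"
  using order_tendstoD(2)[OF q_lim, of "q0 + d"] by (auto simp: eventually_sequentially intro: less_imp_le)

lemma Q_en_absorb: "n \<ge> k \<Longrightarrow> s \<in> set (en k) \<Longrightarrow> (1 - P s) * Q (en n) \<doteq> Q (en n)"
  using en_mono by (intro Q_absorb_mem en_S) blast

text \<open>The form in which \<open>Q_close\<close> is used: \<open>d\<close> is prescribed from
  \<open>e\<close>, and the + 1 keeps the quotient meaningful for y = 0.\<close>

lemma close_sqrt:
  assumes "x\<^sup>2 \<le> d * y\<^sup>2" "0 \<le> y" "d = (e / (y + 1))\<^sup>2" "e > 0"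
  shows "x \<le> (e::real)"
proof -
  have "x\<^sup>2 \<le> (e / (y + 1) * y)\<^sup>2" using assms by (simp only: power_mult_distrib)
  then have "x \<le> e / (y + 1) * y" by (rule power2_le_imp_le) (use assms in auto)
  also have "\<dots> \<le> e" using assms by (simp add: field_simps)
  finally show ?thesis .
qed

lemma \<psi>_word: "(\<lambda>n. lin \<phi> (Q (en n) * wpoly w)) \<longlonglongrightarrow> \<psi> w"
proof -
  let ?f = "\<lambda>n. lin \<phi> (Q (en n) * wpoly w)"
  have "Cauchy ?f"
    unfolding Cauchy_def
  proof (intro allI impI)
    fix e :: real assume e: "e > 0"
    define d where "d = (e / 3 / (nrm (wpoly w) + 1))\<^sup>2"
    have "0 < nrm (wpoly w) + 1" using nrm_nonneg[of "wpoly w"] by linarith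
    then have "d > 0" using e unfolding d_def by (intro zero_less_power divide_pos_pos) auto
    then obtain k where k: "q k \<le> q0 + d" using q_small by blast
    have c: "cmod (?f k - ?f n) \<le> e / 3" if "n \<ge> k" for n
      by (rule close_sqrt[OF Q_close[OF en_Kc Q_en_absorb[OF that] k] nrm_nonneg d_def]) (use e in auto)
    have "dist (?f m) (?f n) < e" if "m \<ge> k" "n \<ge> k" for m n
    proof -
      have "?f m - ?f n = (?f k - ?f n) - (?f k - ?f m)" by simp
      then have "dist (?f m) (?f n) \<le> e / 3 + e / 3" unfolding dist_norm
        using norm_triangle_ineq4[of "?f k - ?f n" "?f k - ?f m"] c[OF that(1)] c[OF that(2)] by simp
      then show ?thesis using e by simp
    qed
    then show "\<exists>M. \<forall>m\<ge>M. \<forall>n\<ge>M. dist (?f m) (?f n) < e" by blast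
  qed
  then show ?thesis unfolding \<psi>_def by (simp add: Cauchy_convergent_iff convergent_LIMSEQ_iff)
qed

lemma \<psi>_lim: "(\<lambda>n. lin \<phi> (Q (en n) * f)) \<longlonglongrightarrow> lin \<psi> f"
proof (induction f rule: star_poly_induct)
  case (single w c)
  have eq: "lin \<phi> (Q (en n) * Poly_Mapping.single w c) = c * lin \<phi> (Q (en n) * wpoly w)" for n
    using poly_scale_mult_right[of "Q (en n)" c "wpoly w"] by simp
  show ?case unfolding eq lin_single by (intro tendsto_intros \<psi>_word)
qed (auto simp: distrib_left lin_add intro: tendsto_add)

text \<open>Another exhaustion gives the same functional. It is applied to lists translated by a
  kernel element in \<open>\<psi>_trace\<close>, and to the lists \<open>Ms\<close> in
  \<open>phi_sum\<close>.\<close>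

lemma \<psi>_lim_gen:
  assumes M: "\<And>n. set (M n) \<subseteq> Kc"
    and abs: "\<And>s. s \<in> Kc \<Longrightarrow> \<forall>\<^sub>F n in sequentially. (1 - P s) * Q (M n) \<doteq> Q (M n)"
  shows "(\<lambda>n. lin \<phi> (Q (M n) * f)) \<longlonglongrightarrow> lin \<psi> f"
proof (rule LIMSEQ_I)
  fix e :: real assume e: "e > 0"
  define d where "d = (e / 3 / (nrm f + 1))\<^sup>2"
  have "0 < nrm f + 1" using nrm_nonneg[of f] by linarith
  then have "d > 0" using e unfolding d_def by (intro zero_less_power divide_pos_pos) auto
  then obtain k where k: "q k \<le> q0 + d" using q_small by blast
  have "cmod (lin \<phi> (Q (en k) * f) - lin \<phi> (Q (en n) * f)) \<le> e / 3" if "n \<ge> k" for n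
    by (rule close_sqrt[OF Q_close[OF en_Kc Q_en_absorb[OF that] k] nrm_nonneg d_def]) (use e in auto)
  then have 1: "cmod (lin \<phi> (Q (en k) * f) - lin \<psi> f) \<le> e / 3"
    by (intro LIMSEQ_le_const2[OF tendsto_norm[OF tendsto_diff[OF tendsto_const \<psi>_lim]]]) blast
  have "\<forall>\<^sub>F n in sequentially. \<forall>s\<in>set (en k). (1 - P s) * Q (M n) \<doteq> Q (M n)"
    using en_Kc abs by (intro eventually_ball_finite) auto
  then obtain n0 where n0: "\<And>n s. n \<ge> n0 \<Longrightarrow> s \<in> set (en k) \<Longrightarrow> (1 - P s) * Q (M n) \<doteq> Q (M n)"
    by (auto simp: eventually_sequentially)
  have "cmod (lin \<phi> (Q (M n) * f) - lin \<psi> f) < e" if n: "n \<ge> n0" for n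
  proof -
    have 2: "cmod (lin \<phi> (Q (en k) * f) - lin \<phi> (Q (M n) * f)) \<le> e / 3"
      by (rule close_sqrt[OF Q_close[OF M n0[OF n] k] nrm_nonneg d_def]) (use e in auto)
    have "lin \<phi> (Q (M n) * f) - lin \<psi> f = (lin \<phi> (Q (en k) * f) - lin \<psi> f) - (lin \<phi> (Q (en k) * f) - lin \<phi> (Q (M n) * f))" by simp
    then have "cmod (lin \<phi> (Q (M n) * f) - lin \<psi> f) \<le> e / 3 + e / 3"
      using norm_triangle_ineq4[of "lin \<phi> (Q (en k) * f) - lin \<psi> f" "lin \<phi> (Q (en k) * f) - lin \<phi> (Q (M n) * f)"] 1 2 by simp
    then show ?thesis using e by simp
  qed
  then show "\<exists>n0. \<forall>n\<ge>n0. cmod (lin \<phi> (Q (M n) * f) - lin \<psi> f) < e" by blast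
qed

lemma \<psi>_eqv: "f \<doteq> g \<Longrightarrow> lin \<psi> f = lin \<psi> g"
proof -
  assume "f \<doteq> g"
  then have "lin \<phi> (Q (en n) * f) = lin \<phi> (Q (en n) * g)" for n by (intro eqv_lin eqv_mult_left)
  then show ?thesis using \<psi>_lim[of f] \<psi>_lim[of g] LIMSEQ_unique by simp
qed

text \<open>\<open>Q (en n)\<close> is a projection in the centralizer, so it can be split and half
  of it moved around: the value becomes that of a square, of f times the projection.\<close>

lemma \<psi>_pos: "lin \<psi> (poly_adj f * f) \<in> \<real>\<^sub>\<ge>\<^sub>0"
proof -
  have "lin \<phi> (Q (en n) * (poly_adj f * f)) \<in> \<real>\<^sub>\<ge>\<^sub>0" for n
  proof -
    let ?Q = "Q (en n)"
    have p: "proj ?Q" by (rule Q_proj[OF en_S])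
    have "lin \<phi> (?Q * (poly_adj f * f)) = lin \<phi> (?Q * ?Q * (poly_adj f * f))"
      using p by (intro eqv_lin eqv_mult_right) (auto simp: proj_def intro: eqv_sym)
    also have "\<dots> = lin \<phi> (?Q * (poly_adj f * f) * ?Q)" using lin_Q_mult[of "en n" "?Q * (poly_adj f * f)"] by (simp add: mult.assoc)
    also have "\<dots> = lin \<phi> (poly_adj ?Q * (poly_adj f * f) * ?Q)"
      using p by (intro eqv_lin eqv_mult_right) (auto simp: proj_def intro: eqv_sym)
    also have "\<dots> = lin \<phi> (poly_adj (f * ?Q) * (f * ?Q))" by (simp add: poly_adj_mult mult.assoc)
    finally show ?thesis using pos_lin by simp
  qed
  then show ?thesis using closed_sequentially[OF closed_nonneg_Reals_complex _ \<psi>_lim] by blast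
qed

text \<open>For large n the product contains the factor 1 - P s, which annihilates
  \<open>V s\<close> from the left.\<close>

lemma \<psi>_V: "s \<in> Kc \<Longrightarrow> lin \<psi> (V s * f) = 0"
proof -
  assume s: "s \<in> Kc"
  have "\<forall>\<^sub>F n in sequentially. lin \<phi> (Q (en n) * (V s * f)) = 0"
    using en_eventually[OF s]
  proof eventually_elim
    case (elim n)
    have "Q (en n) * (V s * f) = Q (en n) * V s * f" by (simp add: mult.assoc)
    also have "\<dots> \<doteq> ((1 - P s) * Q (en n)) * V s * f"
      by (intro eqv_mult_right eqv_sym[OF Q_absorb_mem[OF en_S elim]])
    also have "\<dots> \<doteq> (Q (en n) * (1 - P s)) * V s * f" by (intro eqv_mult_right E_Q en_S Kc_S s)
    also have "\<dots> = Q (en n) * (V s - V s * (U s * V s)) * f" by (simp add: algebra_simps)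
    also have "\<dots> \<doteq> Q (en n) * (V s - V s * 1) * f"
      by (intro eqv_mid eqv_diff eqv_refl eqv_mult_left isom_eqv Kc_S s)
    finally show ?case using eqv_lin by fastforce
  qed
  then have "(\<lambda>n. lin \<phi> (Q (en n) * (V s * f))) \<longlonglongrightarrow> 0" by (rule tendsto_eventually)
  then show ?thesis using \<psi>_lim LIMSEQ_unique by blast
qed

text \<open>The KMS identity brings \<open>U s\<close> to the front, where it meets the factor 1 - P
  s and vanishes.\<close>

lemma \<psi>_U: "s \<in> Kc \<Longrightarrow> lin \<psi> (f * U s) = 0"
proof -
  assume s: "s \<in> Kc"
  have "\<forall>\<^sub>F n in sequentially. lin \<phi> (Q (en n) * (f * U s)) = 0"
    using en_eventually[OF s]
  proof eventually_elim
    case (elim n)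
    have "U s * (Q (en n) * f) = U s * Q (en n) * f" by (simp add: mult.assoc)
    also have "\<dots> \<doteq> U s * ((1 - P s) * Q (en n)) * f" by (intro eqv_mid eqv_sym[OF Q_absorb_mem[OF en_S elim]])
    also have "\<dots> = (U s - (U s * V s) * U s) * (Q (en n) * f)" by (simp add: algebra_simps)
    also have "\<dots> \<doteq> (U s - 1 * U s) * (Q (en n) * f)"
      by (intro eqv_mult_right eqv_diff eqv_refl isom_eqv Kc_S s)
    finally have "lin \<phi> (U s * (Q (en n) * f)) = 0" using eqv_lin by fastforce
    then show ?case using lin_U_mult[of s "Q (en n) * f"] by (simp add: mult.assoc)
  qed
  then have "(\<lambda>n. lin \<phi> (Q (en n) * (f * U s))) \<longlonglongrightarrow> 0" by (rule tendsto_eventually)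
  then show ?thesis using \<psi>_lim LIMSEQ_unique by blast
qed

text \<open>As N(a) = 1, \<open>V a\<close> moves cyclically for free, and it carries
  \<open>Q (en n)\<close> to the product over the list translated by a. What remains is that the
  translated lists again exhaust \<open>Kc\<close>, up to equality of range projections modulo
  \<open>\<phi>\<close>.\<close>

lemma \<psi>_trace: "a \<in> carrier T \<Longrightarrow> lin \<psi> (V a * f) = lin \<psi> (f * V a)"
proof -
  assume a: "a \<in> carrier T"
  then have aS: "a \<in> carrier S" by (rule T_S)
  let ?M = "\<lambda>n. map ((\<otimes>) a) (en n)"
  have VP: "V a * (1 - P s) \<doteq> (1 - P (a \<otimes> s)) * V a" if s: "s \<in> carrier S" for s
  proof -
    have "V a * (1 - P s) = V a - V a * P s * 1" by (simp add: algebra_simps)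
    also have "\<dots> \<doteq> V a - V a * P s * (U a * V a)" by (intro eqv_diff eqv_refl eqv_mult_left eqv_sym[OF F.UV[OF a]])
    also have "\<dots> = V a - (V a * P s * U a) * V a" by (simp add: mult.assoc)
    also have "\<dots> \<doteq> V a - P (a \<otimes> s) * V a" by (intro eqv_diff eqv_refl eqv_mult_right P_conj aS s)
    finally show ?thesis by (simp add: algebra_simps)
  qed
  have VQ: "set L \<subseteq> carrier S \<Longrightarrow> V a * Q L \<doteq> Q (map ((\<otimes>) a) L) * V a" for L
  proof (induction L)
    case (Cons s L)
    have "V a * Q (s # L) = (V a * (1 - P s)) * Q L" by (simp add: mult.assoc)
    also have "\<dots> \<doteq> ((1 - P (a \<otimes> s)) * V a) * Q L" using Cons by (intro eqv_mult_right VP) auto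
    also have "\<dots> = (1 - P (a \<otimes> s)) * (V a * Q L)" by (simp add: mult.assoc)
    also have "\<dots> \<doteq> (1 - P (a \<otimes> s)) * (Q (map ((\<otimes>) a) L) * V a)" using Cons by (intro eqv_mult_left) auto
    finally show ?case by (simp add: mult.assoc)
  qed simp
  have eq: "lin \<phi> (Q (en n) * (f * V a)) = lin \<phi> (Q (?M n) * (V a * f))" for n
  proof -
    have "lin \<phi> (Q (en n) * (f * V a)) = lin \<phi> (V a * (Q (en n) * f))"
      using lin_V_mult[of a "Q (en n) * f"] a by (simp add: mult.assoc carrier_T)
    also have "V a * (Q (en n) * f) = V a * Q (en n) * f" by (simp add: mult.assoc)
    also have "lin \<phi> \<dots> = lin \<phi> (Q (?M n) * V a * f)" by (intro eqv_lin eqv_mult_right VQ en_S)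
    finally show ?thesis by (simp add: mult.assoc)
  qed
  have "(\<lambda>n. lin \<phi> (Q (?M n) * (V a * f))) \<longlonglongrightarrow> lin \<psi> (V a * f)"
  proof (rule \<psi>_lim_gen)
    show Mn: "set (?M n) \<subseteq> Kc" for n using en_Kc[of n] Kc_mult[OF _ aS] by auto
    fix s assume s: "s \<in> Kc"
    \<comment> \<open>The right LCM of a and s is a s', and P a acts as 1, so its projection is that
      of s. Disjoint ideals would make P s vanish, and equal values of \<open>\<phi>\<close> keep s'
      out of the kernel.\<close>
    obtain s' where s': "s' \<in> Kc" "P (a \<otimes> s') \<doteq> P s"
      using aS Kc_S[OF s]
    proof (cases rule: lcm_cases)
      case disj
      have "P s = 1 * P s" by simp
      also have "\<dots> \<doteq> P a * P s" by (intro eqv_mult_right eqv_sym[OF P_T[OF a]])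
      also have "\<dots> \<doteq> 0" by (rule P_disj[OF aS Kc_S[OF s] disj])
      finally show ?thesis using P_not_0[OF Kc_S[OF s]] by blast
    next
      case (lcm z z')
      have "a \<otimes> z \<in> carrier S" using aS lcm(1) by simp
      from P_lcm[OF aS Kc_S[OF s] this lcm(4)] have "P (a \<otimes> z) \<doteq> P a * P s" by (rule eqv_sym)
      also have "\<dots> \<doteq> 1 * P s" by (intro eqv_mult_right P_T a)
      finally have 1: "P (a \<otimes> z) \<doteq> P s" by simp
      have "N (a \<otimes> z) = N s" by (rule P_eqv_N[OF _ _ 1]) (use aS lcm Kc_S[OF s] in auto)
      then have "z \<in> Kc" using s a lcm N_mult[OF aS lcm(1)] by (auto simp: Kc_iff carrier_T)
      then show ?thesis using that 1 by blast
    qed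
    show "\<forall>\<^sub>F n in sequentially. (1 - P s) * Q (?M n) \<doteq> Q (?M n)"
      using en_eventually[OF s'(1)]
    proof eventually_elim
      case (elim n)
      have "(1 - P s) * Q (?M n) \<doteq> (1 - P (a \<otimes> s')) * Q (?M n)"
        by (intro eqv_mult_right eqv_diff eqv_refl eqv_sym[OF s'(2)])
      also have "\<dots> \<doteq> Q (?M n)"
        by (rule Q_absorb_mem) (use elim Mn[of n] Kc_S in auto)
      finally show ?case .
    qed
  qed
  then have "(\<lambda>n. lin \<phi> (Q (en n) * (f * V a))) \<longlonglongrightarrow> lin \<psi> (V a * f)" by (simp only: eq)
  then show ?thesis using \<psi>_lim[of "f * V a"] LIMSEQ_unique by blast
qed

end


section \<open>Reconstruction of a KMS functional from its corner\<close>

text \<open>For \<open>c\<close> absent from the list the result is empty, so the tails are defined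
  for every class.\<close>

primrec after :: "'c \<Rightarrow> 'c list \<Rightarrow> 'c list" where
  "after c [] = []"
| "after c (d # L) = (if c = d then L else after c L)"

lemma after_subset: "set (after c L) \<subseteq> set L"
  by (induction L) auto

lemma after_distinct: "distinct L \<Longrightarrow> c \<notin> set (after c L)"
  by (induction L) auto

lemma after_sorted: "sorted (map k L) \<Longrightarrow> d \<in> set (after c L) \<Longrightarrow> k c \<le> k d"
  by (induction L) (auto split: if_splits)

lemma after_mem: "sorted (map k L) \<Longrightarrow> c \<in> set L \<Longrightarrow> d \<in> set L \<Longrightarrow> k c < k d \<Longrightarrow> d \<in> set (after c L)"
  by (induction L) auto

context S_functional
begin

lemma P_rep: "x \<in> carrier S \<Longrightarrow> P (rep (cof x)) \<doteq> P x"
  by (intro P_sim sim_sym[OF rep_sim])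

text \<open>Peeling off the first factor at each step: 1 minus the product of all 1 - P_i is the sum
  of P_i times the product of the factors after i.\<close>

lemma lin_Q_telescope:
  "distinct L \<Longrightarrow> lin \<phi> ((1 - Q (map rep L)) * f) = (\<Sum>c\<in>set L. lin \<phi> (P (rep c) * Q (map rep (after c L)) * f))"
proof (induction L)
  case (Cons d L)
  let ?t = "\<lambda>M c. lin \<phi> (P (rep c) * Q (map rep (after c M)) * f)"
  have "(1 - Q (map rep (d # L))) * f = (1 - Q (map rep L)) * f + P (rep d) * Q (map rep L) * f"
    by (simp add: left_diff_distrib mult.assoc)
  then have "lin \<phi> ((1 - Q (map rep (d # L))) * f) = (\<Sum>c\<in>set L. ?t L c) + ?t (d # L) d"
    using Cons by (simp add: lin_add)
  also have "(\<Sum>c\<in>set L. ?t L c) = (\<Sum>c\<in>set L. ?t (d # L) c)" using Cons.prems by (intro sum.cong) auto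
  finally show ?case using Cons.prems by simp
qed simp

text \<open>The classes are listed by increasing scale, so that the range projection of a class lies
  under none of the projections of the classes listed after it.\<close>

definition hs :: "nat \<Rightarrow> 'a set list" where
  "hs n = sort_key (\<lambda>c. N (rep c)) (remdups (cof \<one> # map (from_nat_into C) [0..<n]))"

lemma C_ne: "C \<noteq> {}"
  using class_in[of \<one>] by auto

lemma countable_C: "countable C"
proof -
  have "C = cof ` carrier S" by (auto simp: quotient_def)
  then show ?thesis using countable_S by simp
qed

lemma hs_C: "set (hs n) \<subseteq> C"
  using from_nat_into[OF C_ne] class_in[of \<one>] by (auto simp: hs_def)

lemma hs_distinct: "distinct (hs n)"
  by (simp add: hs_def)

lemma hs_sorted: "sorted (map (\<lambda>c. N (rep c)) (hs n))"
  by (simp add: hs_def)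

lemma hs_one: "cof \<one> \<in> set (hs n)"
  by (simp add: hs_def)

lemma hs_eventually: "c \<in> C \<Longrightarrow> \<forall>\<^sub>F n in sequentially. c \<in> set (hs n)"
proof -
  assume "c \<in> C"
  then obtain k where k: "from_nat_into C k = c" using from_nat_into_surj[OF countable_C] by blast
  show ?thesis unfolding eventually_sequentially
    by (intro exI[of _ "Suc k"]) (auto simp: hs_def k[symmetric])
qed

text \<open>The list contains the class of 1, whose factor vanishes because its range projection is
  1 modulo \<open>\<phi>\<close>. Hence the telescoped blocks add up to 1.\<close>

lemma Q_hs: "Q (map rep (hs n)) \<doteq> 0"
proof -
  let ?r = "rep (cof \<one>)"
  have "P ?r \<doteq> P \<one>" by (rule P_rep) simp
  also have "\<dots> \<doteq> 1" using K.one_closed by (intro P_T) simp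
  finally have r: "P ?r \<doteq> 1" .
  have S: "set (map rep (hs n)) \<subseteq> carrier S" using hs_C rep_carrier by (auto simp: subset_iff)
  have "Q (map rep (hs n)) \<doteq> (1 - P ?r) * Q (map rep (hs n))"
    by (rule eqv_sym[OF Q_absorb_mem[OF S]]) (use hs_one in simp)
  also have "\<dots> \<doteq> (1 - 1) * Q (map rep (hs n))" by (intro eqv_mult_right eqv_diff eqv_refl r)
  finally show ?thesis by simp
qed

lemma U_P_disj:
  assumes "x \<in> carrier S" "y \<in> carrier S" "(x <# carrier S) \<inter> (y <# carrier S) = {}"
  shows "U x * P y \<doteq> 0"
proof -
  have "U x * P y = 1 * (U x * P y)" by simp
  also have "\<dots> \<doteq> (U x * V x) * (U x * P y)" by (intro eqv_mult_right eqv_sym[OF isom_eqv] assms)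
  also have "\<dots> = U x * (P x * P y)" by (simp add: mult.assoc)
  also have "\<dots> \<doteq> U x * 0" by (intro eqv_mult_left P_disj assms)
  finally show ?thesis by simp
qed

lemma U_P_mult:
  assumes "x \<in> carrier S" "z \<in> carrier S"
  shows "U x * P (x \<otimes> z) \<doteq> P z * U x"
proof -
  have "U x * P (x \<otimes> z) \<doteq> U x * (V x * P z * U x)" by (intro eqv_mult_left eqv_sym[OF P_conj] assms)
  also have "\<dots> = (U x * V x) * (P z * U x)" by (simp add: mult.assoc)
  also have "\<dots> \<doteq> 1 * (P z * U x)" by (intro eqv_mult_right isom_eqv assms)
  finally show ?thesis by simp
qed

lemma U_P_lcm:
  assumes "x \<in> carrier S" "y \<in> carrier S" "z \<in> carrier S"
    "(x <# carrier S) \<inter> (y <# carrier S) = (x \<otimes> z) <# carrier S"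
  shows "U x * P y \<doteq> U x * P (x \<otimes> z)"
proof -
  have "U x * P y = 1 * (U x * P y)" by simp
  also have "\<dots> \<doteq> (U x * V x) * (U x * P y)" by (intro eqv_mult_right eqv_sym[OF isom_eqv] assms)
  also have "\<dots> = U x * (P x * P y)" by (simp add: mult.assoc)
  also have "\<dots> \<doteq> U x * P (x \<otimes> z)" using assms by (intro eqv_mult_left P_lcm) auto
  finally show ?thesis .
qed

text \<open>Here the increasing order of scales is used. Moving U x past 1 - P y yields 1 - P z,
  where x z is the right LCM, or nothing if the ideals are disjoint. If z were in the kernel, N(x)
  \<le> N(y) would force its partner z' into the kernel as well, making x and y equivalent.\<close>

lemma conj_step:
  assumes xy: "x \<in> carrier S" "y \<in> carrier S" and N: "N x \<le> N y" and ns: "\<not> sim x y"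
  obtains M where "set M \<subseteq> Kc" "U x * (1 - P y) \<doteq> Q M * U x"
  using xy
proof (cases rule: lcm_cases)
  case disj
  have "U x * (1 - P y) = U x - U x * P y" by (simp add: right_diff_distrib)
  also have "\<dots> \<doteq> U x - 0" by (intro eqv_diff eqv_refl U_P_disj xy disj)
  finally show ?thesis by (intro that[of "[]"]) auto
next
  case (lcm z z')
  have "z \<in> Kc"
  proof (rule ccontr)
    assume "z \<notin> Kc"
    then have z: "N z = 1" using lcm(1) by (simp add: Kc_iff)
    then have "N x = N y * N z'" using N_mult[OF xy(1) lcm(1)] N_mult[OF xy(2) lcm(2)] lcm(3) by simp
    then have "N y * N z' \<le> N y * 1" using N by simp
    then have "N z' \<le> 1" using N_pos[OF xy(2)] by simp
    then have "N z' = 1" using N_ge1[OF lcm(2)] by simp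
    then have "z \<in> carrier T" "z' \<in> carrier T" using z lcm(1,2) by (auto simp: carrier_T)
    then have "sim x y" unfolding sim_iff using xy lcm(3) by blast
    with ns show False ..
  qed
  moreover have "U x * (1 - P y) \<doteq> Q [z] * U x"
  proof -
    have "U x * (1 - P y) = U x - U x * P y" by (simp add: right_diff_distrib)
    also have "\<dots> \<doteq> U x - U x * P (x \<otimes> z)" by (intro eqv_diff eqv_refl U_P_lcm xy lcm)
    also have "\<dots> \<doteq> U x - P z * U x" by (intro eqv_diff eqv_refl U_P_mult xy lcm)
    finally show ?thesis by (simp add: left_diff_distrib)
  qed
  ultimately show ?thesis by (intro that[of "[z]"]) auto
qed

lemma conj_list:
  assumes x: "x \<in> carrier S" and L: "\<And>y. y \<in> set L \<Longrightarrow> y \<in> carrier S \<and> N x \<le> N y \<and> \<not> sim x y"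
  shows "\<exists>M. set M \<subseteq> Kc \<and> U x * Q L \<doteq> Q M * U x"
  using L
proof (induction L)
  case Nil
  show ?case by (rule exI[of _ "[]"]) simp
next
  case (Cons y L)
  then obtain M where M: "set M \<subseteq> Kc" "U x * Q L \<doteq> Q M * U x" by auto
  have y: "y \<in> carrier S" "N x \<le> N y" "\<not> sim x y" using Cons.prems[of y] by auto
  obtain M' where M': "set M' \<subseteq> Kc" "U x * (1 - P y) \<doteq> Q M' * U x" using conj_step[OF x y] .
  have "U x * Q (y # L) = (U x * (1 - P y)) * Q L" by (simp add: mult.assoc)
  also have "\<dots> \<doteq> (Q M' * U x) * Q L" by (intro eqv_mult_right M')
  also have "\<dots> = Q M' * (U x * Q L)" by (simp add: mult.assoc)
  also have "\<dots> \<doteq> Q M' * (Q M * U x)" by (intro eqv_mult_left M)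
  also have "\<dots> = Q (M' @ M) * U x" by (simp add: Q_append mult.assoc)
  finally have "U x * Q (y # L) \<doteq> Q (M' @ M) * U x" .
  then show ?case using M(1) M'(1) by (intro exI[of _ "M' @ M"]) auto
qed

text \<open>Modulo \<open>\<phi>\<close>, Q M is Q L conjugated by the isometry of x; the factor of
  r in L is thereby seen as the factor of s, since r and x s have the same range projection.\<close>

lemma conj_absorb:
  assumes x: "x \<in> carrier S" and M: "U x * Q L \<doteq> Q M * U x" and L: "set L \<subseteq> carrier S"
    and s: "s \<in> carrier S" and r: "r \<in> set L" "P r \<doteq> P (x \<otimes> s)"
  shows "(1 - P s) * Q M \<doteq> Q M"
proof -
  have "Q M = Q M * 1" by simp
  also have "\<dots> \<doteq> Q M * (U x * V x)" by (intro eqv_mult_left eqv_sym[OF isom_eqv] x)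
  also have "\<dots> = (Q M * U x) * V x" by (simp add: mult.assoc)
  also have "\<dots> \<doteq> (U x * Q L) * V x" by (intro eqv_mult_right eqv_sym[OF M])
  finally have 1: "Q M \<doteq> (U x * Q L) * V x" .
  have "(1 - P s) * Q M \<doteq> (1 - P s) * ((U x * Q L) * V x)" by (intro eqv_mult_left 1)
  also have "\<dots> = (U x - P s * U x) * (Q L * V x)" by (simp add: left_diff_distrib mult.assoc)
  also have "\<dots> \<doteq> (U x - U x * P r) * (Q L * V x)"
    by (intro eqv_mult_right eqv_diff eqv_refl eqv_sym[OF eqv_trans[OF eqv_mult_left[OF r(2)] U_P_mult[OF x s]]])
  also have "\<dots> = U x * ((1 - P r) * Q L) * V x" by (simp add: left_diff_distrib right_diff_distrib mult.assoc)
  also have "\<dots> \<doteq> U x * Q L * V x" by (intro eqv_mid Q_absorb_mem L r)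
  also have "\<dots> \<doteq> Q M" by (rule eqv_sym[OF 1])
  finally show ?thesis .
qed

text \<open>The tail after \<open>c\<close>, conjugated by the isometry of \<open>rep c\<close>, as
  a product over some list in \<open>Kc\<close>. Which list is chosen is immaterial by
  \<open>\<psi>_lim_gen\<close>.\<close>

definition Ms :: "nat \<Rightarrow> 'a set \<Rightarrow> 'a list" where
  "Ms n c = (SOME M. set M \<subseteq> Kc \<and> U (rep c) * Q (map rep (after c (hs n))) \<doteq> Q M * U (rep c))"

lemma after_hs_S: "set (map rep (after c (hs n))) \<subseteq> carrier S"
  using after_subset[of c "hs n"] hs_C[of n] rep_carrier by (auto simp: subset_iff)

lemma Ms:
  assumes c: "c \<in> C"
  shows "set (Ms n c) \<subseteq> Kc" "U (rep c) * Q (map rep (after c (hs n))) \<doteq> Q (Ms n c) * U (rep c)"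
proof -
  have "\<exists>M. set M \<subseteq> Kc \<and> U (rep c) * Q (map rep (after c (hs n))) \<doteq> Q M * U (rep c)"
  proof (rule conj_list[OF rep_carrier[OF c]])
    fix y assume y: "y \<in> set (map rep (after c (hs n)))"
    then obtain d where d: "d \<in> set (after c (hs n))" "y = rep d" unfolding set_map by (rule imageE)
    have dC: "d \<in> C" by (rule subsetD[OF hs_C subsetD[OF after_subset d(1)]])
    have "c \<noteq> d" using d(1) after_distinct[OF hs_distinct, of c n] by auto
    then have "\<not> sim (rep c) (rep d)" using class_eq[OF rep_carrier[OF c] rep_carrier[OF dC]] class_rep c dC by simp
    moreover have "N (rep c) \<le> N (rep d)" by (rule after_sorted[OF hs_sorted d(1)])
    ultimately show "y \<in> carrier S \<and> N (rep c) \<le> N y \<and> \<not> sim (rep c) y" using d(2) rep_carrier[OF dC] by simp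
  qed
  from someI_ex[OF this] show "set (Ms n c) \<subseteq> Kc" "U (rep c) * Q (map rep (after c (hs n))) \<doteq> Q (Ms n c) * U (rep c)"
    unfolding Ms_def by auto
qed

text \<open>The class of \<open>rep c \<otimes> s\<close> has strictly larger scale than
  \<open>c\<close>, so once both are listed it comes after \<open>c\<close>, and its factor becomes
  that of s under conjugation.\<close>

lemma Ms_absorb:
  assumes c: "c \<in> C" and s: "s \<in> Kc"
  shows "\<forall>\<^sub>F n in sequentially. (1 - P s) * Q (Ms n c) \<doteq> Q (Ms n c)"
proof -
  let ?x = "rep c"
  have x: "?x \<in> carrier S" and sS: "s \<in> carrier S" using c s by (auto simp: rep_carrier Kc_S)
  then have xs: "?x \<otimes> s \<in> carrier S" by simp
  let ?d = "cof (?x \<otimes> s)"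
  have "N (rep ?d) = N ?x * N s" using sim_N[OF rep_sim[OF xs]] N_mult[OF x sS] by simp
  moreover have "1 < N s" using s N_ge1[OF sS] by (simp add: Kc_iff)
  ultimately have lt: "N ?x < N (rep ?d)" using N_pos[OF x] by simp
  show ?thesis using hs_eventually[OF c] hs_eventually[OF class_in[OF xs]]
  proof eventually_elim
    case (elim n)
    have "?d \<in> set (after c (hs n))" by (rule after_mem[OF hs_sorted elim lt])
    then have "rep ?d \<in> set (map rep (after c (hs n)))" by simp
    then show ?case by (rule conj_absorb[OF x Ms(2)[OF c] after_hs_S sS _ P_rep[OF xs]])
  qed
qed

text \<open>Cycling \<open>V (rep c)\<close> to the back produces the weight of the class and turns
  its block into a translated corner.\<close>

lemma lin_block:
  assumes c: "c \<in> C"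
  shows "lin \<phi> (P (rep c) * Q (map rep (after c (hs n))) * f) =
    exp (- \<beta> * ln (N (rep c))) * lin \<phi> (Q (Ms n c) * (U (rep c) * f * V (rep c)))"
proof -
  let ?x = "rep c" and ?L = "map rep (after c (hs n))"
  have "lin \<phi> (P ?x * Q ?L * f) = lin \<phi> (V ?x * (U ?x * Q ?L * f))" by (simp add: mult.assoc)
  also have "\<dots> = exp (- \<beta> * ln (N ?x)) * lin \<phi> (U ?x * Q ?L * f * V ?x)" by (rule lin_V_mult)
  also have "lin \<phi> (U ?x * Q ?L * f * V ?x) = lin \<phi> (Q (Ms n c) * U ?x * f * V ?x)"
    by (intro eqv_lin eqv_mult_right Ms c)
  finally show ?thesis by (simp add: mult.assoc)
qed

lemma class_scale_exp: "c \<in> C \<Longrightarrow> class_scale N c powr (- \<beta>) = exp (- \<beta> * ln (N (rep c)))"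
  using N_pos[OF rep_carrier, of c] by (simp add: class_scale_rep powr_def)

lemma conj_word: "U x * wpoly w * V x = wpoly (Word [Adj x] + w + Word [Gen x])"
  unfolding wpoly_plus adj_poly_gen poly_gen_def by (simp add: word_adj_def)

text \<open>For every n the blocks add up to the value of \<open>\<phi>\<close>, while each single
  block converges to a translate of the corner. The limit passes through the sum by domination: the
  blocks are at most N(c)^(-\<beta>), since projections and words are contractive.\<close>

lemma phi_sum:
  "\<phi> w = (\<Sum>\<^sub>\<infinity>c\<in>C. of_real (class_scale N c powr (- \<beta>)) * lin \<psi> (U (rep c) * wpoly w * V (rep c)))"
proof -
  let ?g = "\<lambda>c. U (rep c) * wpoly w * V (rep c)"
  define f where "f n c = (if c \<in> set (hs n) then of_real (class_scale N c powr (- \<beta>)) * lin \<phi> (Q (Ms n c) * ?g c) else 0)" for n c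
  have fsum: "(\<Sum>\<^sub>\<infinity>c\<in>C. f n c) = \<phi> w" for n
  proof -
    have "(\<Sum>\<^sub>\<infinity>c\<in>C. f n c) = (\<Sum>\<^sub>\<infinity>c\<in>set (hs n). f n c)"
      by (rule infsum_cong_neutral) (use hs_C in \<open>auto simp: f_def\<close>)
    also have "\<dots> = (\<Sum>c\<in>set (hs n). lin \<phi> (P (rep c) * Q (map rep (after c (hs n))) * wpoly w))"
      using hs_C[of n] by (auto simp: f_def lin_block class_scale_exp subset_iff intro!: sum.cong)
    also have "\<dots> = lin \<phi> ((1 - Q (map rep (hs n))) * wpoly w)" by (rule lin_Q_telescope[OF hs_distinct, symmetric])
    also have "\<dots> = lin \<phi> ((1 - 0) * wpoly w)" by (intro eqv_lin eqv_mult_right eqv_diff eqv_refl Q_hs)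
    finally show ?thesis by simp
  qed
  have "(\<lambda>n. \<Sum>\<^sub>\<infinity>c\<in>C. f n c) \<longlonglongrightarrow> (\<Sum>\<^sub>\<infinity>c\<in>C. of_real (class_scale N c powr (- \<beta>)) * lin \<psi> (?g c))"
  proof (rule infsum_dominated_convergence[OF summable])
    fix n c assume c: "c \<in> C"
    have "set (Ms n c) \<subseteq> carrier S" using Ms(1)[OF c] Kc_S by blast
    from proj_bound[OF Q_proj[OF this]] have "cmod (lin \<phi> (Q (Ms n c) * ?g c)) \<le> nrm (?g c)" .
    also have "\<dots> \<le> 1" unfolding conj_word using nrm_word[of _ 1] nrm_one by (metis mult.right_neutral)
    finally show "cmod (f n c) \<le> class_scale N c powr (- \<beta>)"
      by (simp add: f_def norm_mult mult_left_le)
  next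
    fix c assume c: "c \<in> C"
    have "(\<lambda>n. of_real (class_scale N c powr (- \<beta>)) * lin \<phi> (Q (Ms n c) * ?g c))
        \<longlonglongrightarrow> of_real (class_scale N c powr (- \<beta>)) * lin \<psi> (?g c)"
      by (intro tendsto_mult tendsto_const \<psi>_lim_gen Ms(1) Ms_absorb c)
    then show "(\<lambda>n. f n c) \<longlonglongrightarrow> of_real (class_scale N c powr (- \<beta>)) * lin \<psi> (?g c)"
      by (rule Lim_transform_eventually) (use hs_eventually[OF c] in \<open>auto simp: f_def elim: eventually_mono\<close>)
  qed
  then have "(\<lambda>n. \<phi> w) \<longlonglongrightarrow> (\<Sum>\<^sub>\<infinity>c\<in>C. of_real (class_scale N c powr (- \<beta>)) * lin \<psi> (?g c))" by (simp only: fsum)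
  then show ?thesis using LIMSEQ_unique tendsto_const by blast
qed

lemma \<psi>_0: "\<psi> 0 * of_real \<zeta> = 1"
proof -
  have "lin \<psi> (U (rep c) * wpoly 0 * V (rep c)) = \<psi> 0" if "c \<in> C" for c
    using \<psi>_eqv[OF isom_eqv[OF rep_carrier[OF that]]] by simp
  then have "\<phi> 0 = (\<Sum>\<^sub>\<infinity>c\<in>C. of_real (class_scale N c powr (- \<beta>)) * \<psi> 0)"
    unfolding phi_sum[of 0] by (intro infsum_cong) simp
  also have "\<dots> = of_real \<zeta> * \<psi> 0"
    unfolding scale_zeta_def
    by (intro infsumI has_sum_cmult_left has_sum_of_real has_sum_infsum summable)
  finally show ?thesis by (simp add: unit mult.commute)
qed

lemma U_V_cases:
  assumes st: "s \<in> carrier S" "t \<in> carrier S"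
  obtains (disj) "(s <# carrier S) \<inter> (t <# carrier S) = {}" "U s * V t \<doteq> 0"
  | (lcm) z z' where "z \<in> carrier S" "z' \<in> carrier S" "s \<otimes> z = t \<otimes> z'" "U s * V t \<doteq> V z * U z'"
  using st
proof (cases rule: lcm_cases)
  case disj
  have "U s * V t = (U s * V t) * 1" by simp
  also have "\<dots> \<doteq> (U s * V t) * (U t * V t)" by (intro eqv_mult_left eqv_sym[OF isom_eqv] st)
  also have "\<dots> = (U s * P t) * V t" by (simp add: mult.assoc)
  also have "\<dots> \<doteq> 0 * V t" by (intro eqv_mult_right U_P_disj st disj)
  finally show ?thesis using that(1) disj by simp
next
  case (lcm z z')
  have "U s * V t = (U s * V t) * 1" by simp
  also have "\<dots> \<doteq> (U s * V t) * (U t * V t)" by (intro eqv_mult_left eqv_sym[OF isom_eqv] st)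
  also have "\<dots> = (U s * P t) * V t" by (simp add: mult.assoc)
  also have "\<dots> \<doteq> (U s * P (s \<otimes> z)) * V t" by (intro eqv_mult_right U_P_lcm st lcm)
  also have "\<dots> = U s * V (s \<otimes> z) * (U (t \<otimes> z') * V t)" by (simp only: lcm(3) mult.assoc)
  also have "\<dots> \<doteq> U s * (V s * V z) * ((U z' * U t) * V t)"
    by (intro eqv_mult eqv_refl eqv_sym[OF V_mult] eqv_sym[OF UU_mult] st lcm)
  also have "\<dots> = (U s * V s) * (V z * U z') * (U t * V t)" by (simp add: mult.assoc)
  also have "\<dots> \<doteq> 1 * (V z * U z') * 1" by (intro eqv_mult eqv_refl isom_eqv st)
  finally show ?thesis using that(2) lcm by simp
qed

text \<open>Anything ending in \<open>U y\<close> with y outside the kernel is killed by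
  \<open>\<psi>\<close>. This property survives right multiplication by a fraction of kernel
  elements.\<close>

lemma U_T_frac:
  assumes z: "z \<in> Kc" and ba: "b \<in> carrier T" "a \<in> carrier T"
  shows "\<exists>k. \<exists>y\<in>Kc. U z * (V b * U a) \<doteq> k * U y"
  using Kc_S[OF z] T_S[OF ba(1)]
proof (cases rule: U_V_cases)
  case disj
  have "U z * (V b * U a) = U z * V b * U a" by (simp add: mult.assoc)
  also have "\<dots> \<doteq> 0 * U a" by (intro eqv_mult_right disj)
  finally have "U z * (V b * U a) \<doteq> 0 * U z" by simp
  then show ?thesis using z by blast
next
  case (lcm y y')
  have "N z * N y = N b * N y'" using N_mult Kc_S[OF z] T_S[OF ba(1)] lcm by metis
  then have "N y' = N z * N y" using ba(1) by (simp add: carrier_T)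
  moreover have "N z \<noteq> 1" using z by (simp add: Kc_iff)
  ultimately have "y' \<in> Kc" using N_mult_1[OF Kc_S[OF z] lcm(1)] lcm(2) by (auto simp: Kc_iff)
  then have "a \<otimes> y' \<in> Kc" by (rule Kc_mult) (rule T_S[OF ba(2)])
  moreover have "U z * (V b * U a) \<doteq> V y * U (a \<otimes> y')"
  proof -
    have "U z * (V b * U a) = U z * V b * U a" by (simp add: mult.assoc)
    also have "\<dots> \<doteq> V y * U y' * U a" by (intro eqv_mult_right lcm)
    also have "\<dots> = V y * (U y' * U a)" by (simp add: mult.assoc)
    also have "\<dots> \<doteq> V y * U (a \<otimes> y')" by (intro eqv_mult_left UU_mult T_S ba lcm)
    finally show ?thesis .
  qed
  ultimately show ?thesis by blast
qed

lemma V_sim: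
  assumes xy: "x \<in> carrier S" "y \<in> carrier S" and ab: "a \<in> carrier T" "b \<in> carrier T" "y \<otimes> a = x \<otimes> b"
  shows "V y \<doteq> V x * (V b * U a)"
proof -
  have "V y = V y * 1" by simp
  also have "\<dots> \<doteq> V y * (V a * U a)" by (intro eqv_mult_left eqv_sym[OF F.VU] ab)
  also have "\<dots> = (V y * V a) * U a" by (simp add: mult.assoc)
  also have "\<dots> \<doteq> V (y \<otimes> a) * U a" by (intro eqv_mult_right V_mult xy T_S ab)
  also have "\<dots> \<doteq> (V x * V b) * U a" unfolding ab(3) by (intro eqv_mult_right eqv_sym[OF V_mult] xy T_S ab)
  finally show ?thesis by (simp add: mult.assoc)
qed

text \<open>The algebra imitates the action \<open>A\<close>: where a letter acts on (d, g), it
  carries the isometry of \<open>rep d\<close> to that of the new class times a kernel fraction;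
  where it does not, the result ends in a \<open>U z\<close> that \<open>\<psi>\<close> will
  kill.\<close>

lemma letter_cases:
  assumes k: "Word [k] \<in> words_over (carrier S)" and d: "d \<in> C" and g: "g \<in> carrier K.G"
  shows "case A.lact k (d, g) of
      Some (e, h) \<Rightarrow> e \<in> C \<and> (\<exists>b\<in>carrier T. \<exists>a\<in>carrier T. h = K.cls b a \<otimes>\<^bsub>K.G\<^esub> g \<and>
        wpoly (Word [k]) * V (rep d) \<doteq> V (rep e) * (V b * U a))
    | None \<Rightarrow> \<exists>f. \<exists>z\<in>Kc. wpoly (Word [k]) * V (rep d) \<doteq> f * U z"
proof (cases k)
  case (Gen s)
  with k have s: "s \<in> carrier S" by simp
  let ?e = "mv s d"
  have eC: "?e \<in> C" by (rule mv_C[OF s d])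
  obtain a b where ab: "a \<in> carrier T" "b \<in> carrier T" "s \<otimes> rep d \<otimes> a = rep ?e \<otimes> b" "th s d = K.cls b a"
    using sim_common[OF th_sim[OF s d]] unfolding th_def by blast
  have "V s * V (rep d) \<doteq> V (s \<otimes> rep d)" by (intro V_mult s rep_carrier d)
  also have "\<dots> \<doteq> V (rep ?e) * (V b * U a)"
    by (intro V_sim rep_carrier eC m_closed s d ab)
  finally have "V s * V (rep d) \<doteq> V (rep ?e) * (V b * U a)" .
  then show ?thesis using s eC ab by (auto simp: Gen poly_gen_def)
next
  case (Adj s)
  with k have s: "s \<in> carrier S" by simp
  show ?thesis
  proof (cases "d \<in> mv s ` C")
    case True
    then obtain e where e: "e \<in> C" "d = mv s e" by blast
    have ie: "inv_into C (mv s) d = e" using e by (simp add: mv_inj[OF s])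
    obtain a b where ab: "a \<in> carrier T" "b \<in> carrier T" "s \<otimes> rep e \<otimes> a = rep d \<otimes> b" "th s e = K.cls b a"
      using sim_common[OF th_sim[OF s e(1)]] unfolding th_def e(2) by blast
    have inv: "inv\<^bsub>K.G\<^esub> (th s e) = K.cls a b" unfolding ab(4) by (rule K.inv_cls[OF ab(2,1)])
    have "V (rep d) \<doteq> V (s \<otimes> rep e) * (V a * U b)"
      by (intro V_sim rep_carrier d m_closed s e ab ab(3)[symmetric])
    also have "\<dots> \<doteq> (V s * V (rep e)) * (V a * U b)"
      by (intro eqv_mult_right eqv_sym[OF V_mult] s rep_carrier e)
    finally have "U s * V (rep d) \<doteq> U s * ((V s * V (rep e)) * (V a * U b))" by (rule eqv_mult_left)
    also have "\<dots> = (U s * V s) * (V (rep e) * (V a * U b))" by (simp add: mult.assoc)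
    also have "\<dots> \<doteq> 1 * (V (rep e) * (V a * U b))" by (intro eqv_mult_right isom_eqv s)
    finally have "wpoly (Word [k]) * V (rep d) \<doteq> V (rep e) * (V a * U b)" by (simp add: Adj adj_poly_gen)
    then show ?thesis using s ab(1,2) e(1) True by (auto simp: Adj ie inv)
  next
    case False
    have "\<exists>f. \<exists>z\<in>Kc. U s * V (rep d) \<doteq> f * U z"
      using s rep_carrier[OF d]
    proof (cases rule: U_V_cases)
      case disj
      obtain z where "z \<in> Kc" using Kc_ne by blast
      moreover have "U s * V (rep d) \<doteq> 0 * U z" using disj by simp
      ultimately show ?thesis by blast
    next
      case (lcm z z')
      \<comment> \<open>A kernel element \<open>z'\<close> would put \<open>d\<close> into the range
        of \<open>mv s\<close>.\<close>
      have "z' \<notin> carrier T"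
      proof
        assume "z' \<in> carrier T"
        then have "sim (rep d) (s \<otimes> z)" unfolding lcm(3) by (rule sim_T[OF rep_carrier[OF d]])
        then have "d = cof (s \<otimes> z)"
          using class_eq[OF rep_carrier[OF d], of "s \<otimes> z"] class_rep[OF d] s lcm(1) by simp
        then show False using False mv_image[OF s] lcm(1) by blast
      qed
      then have "z' \<in> Kc" using lcm(2) by (simp add: Kc_def)
      then show ?thesis using lcm(4) by blast
    qed
    then show ?thesis using False by (auto simp: Adj adj_poly_gen)
  qed
qed

lemma word_cases:
  assumes w: "w \<in> words_over (carrier S)" and c: "c \<in> C"
  shows "case A.wact w (c, \<one>\<^bsub>K.G\<^esub>) of
      Some (e, h) \<Rightarrow> e \<in> C \<and> (\<exists>b\<in>carrier T. \<exists>a\<in>carrier T. h = K.cls b a \<and>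
        wpoly w * V (rep c) \<doteq> V (rep e) * (V b * U a))
    | None \<Rightarrow> \<exists>f. \<exists>z\<in>Kc. wpoly w * V (rep c) \<doteq> f * U z"
  using w
proof (induction w rule: star_word_induct)
  case zero
  have "V (rep c) = V (rep c) * 1" by simp
  also have "\<dots> \<doteq> V (rep c) * (V \<one> * U \<one>)" by (intro eqv_mult_left eqv_sym[OF F.VU]) (use K.one_closed in simp)
  finally have "V (rep c) \<doteq> V (rep c) * (V \<one> * U \<one>)" .
  then show ?case using c K.one_closed by (auto simp: K.one_G intro!: bexI[of _ \<one>])
next
  case (cons k w)
  then have kw: "Word [k] \<in> words_over (carrier S)" "w \<in> words_over (carrier S)" by auto
  have sp: "wpoly (Word [k] + w) * V (rep c) = wpoly (Word [k]) * (wpoly w * V (rep c))"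
    by (simp only: wpoly_plus mult.assoc)
  show ?case
  proof (cases "A.wact w (c, \<one>\<^bsub>K.G\<^esub>)")
    case None
    then obtain f z where fz: "z \<in> Kc" "wpoly w * V (rep c) \<doteq> f * U z" using cons.IH[OF kw(2)] by auto
    have "wpoly (Word [k] + w) * V (rep c) \<doteq> wpoly (Word [k]) * (f * U z)" unfolding sp by (intro eqv_mult_left fz)
    then have "wpoly (Word [k] + w) * V (rep c) \<doteq> (wpoly (Word [k]) * f) * U z" by (simp only: mult.assoc)
    then show ?thesis using None fz(1) by (auto simp: A.wact_plus)
  next
    case (Some dg)
    obtain d g where dg: "dg = (d, g)" by (cases dg)
    obtain b a where ba: "d \<in> C" "b \<in> carrier T" "a \<in> carrier T" "g = K.cls b a"
        "wpoly w * V (rep c) \<doteq> V (rep d) * (V b * U a)"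
      using cons.IH[OF kw(2)] Some dg by auto
    have gG: "g \<in> carrier K.G" using ba by simp
    have "wpoly (Word [k] + w) * V (rep c) \<doteq> wpoly (Word [k]) * (V (rep d) * (V b * U a))"
      unfolding sp by (intro eqv_mult_left ba)
    also have "\<dots> = (wpoly (Word [k]) * V (rep d)) * (V b * U a)" by (simp only: mult.assoc)
    finally have 1: "wpoly (Word [k] + w) * V (rep c) \<doteq> (wpoly (Word [k]) * V (rep d)) * (V b * U a)" .
    have act: "A.wact (Word [k] + w) (c, \<one>\<^bsub>K.G\<^esub>) = A.lact k (d, g)" using Some dg by (simp add: A.wact_plus)
    note L = letter_cases[OF kw(1) ba(1) gG]
    show ?thesis
    proof (cases "A.lact k (d, g)")
      case None
      then obtain f z where fz: "z \<in> Kc" "wpoly (Word [k]) * V (rep d) \<doteq> f * U z" using L by auto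
      obtain k' y where y: "y \<in> Kc" "U z * (V b * U a) \<doteq> k' * U y" using U_T_frac[OF fz(1) ba(2,3)] by blast
      note 1
      also have "(wpoly (Word [k]) * V (rep d)) * (V b * U a) \<doteq> (f * U z) * (V b * U a)" by (intro eqv_mult_right fz)
      also have "\<dots> = f * (U z * (V b * U a))" by (simp only: mult.assoc)
      also have "\<dots> \<doteq> f * (k' * U y)" by (intro eqv_mult_left y)
      also have "\<dots> = (f * k') * U y" by (simp only: mult.assoc)
      finally have "wpoly (Word [k] + w) * V (rep c) \<doteq> (f * k') * U y" .
      then show ?thesis using y(1) unfolding act None by auto
    next
      case (Some eh)
      obtain e h where eh: "eh = (e, h)" by (cases eh)
      obtain b' a' where ba': "e \<in> C" "b' \<in> carrier T" "a' \<in> carrier T" "h = K.cls b' a' \<otimes>\<^bsub>K.G\<^esub> g"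
          "wpoly (Word [k]) * V (rep d) \<doteq> V (rep e) * (V b' * U a')"
        using L Some eh by auto
      obtain q p where qp: "q \<in> carrier T" "p \<in> carrier T" "K.cls b' a' \<otimes>\<^bsub>K.G\<^esub> K.cls b a = K.cls q p"
          "(V b' * U a') * (V b * U a) \<doteq> V q * U p"
        using F.frac_mult[OF ba'(2,3) ba(2,3)] .
      note 1
      also have "(wpoly (Word [k]) * V (rep d)) * (V b * U a) \<doteq> (V (rep e) * (V b' * U a')) * (V b * U a)"
        by (intro eqv_mult_right ba')
      also have "\<dots> = V (rep e) * ((V b' * U a') * (V b * U a))" by (simp only: mult.assoc)
      also have "\<dots> \<doteq> V (rep e) * (V q * U p)" by (intro eqv_mult_left qp)
      finally have "wpoly (Word [k] + w) * V (rep c) \<doteq> V (rep e) * (V q * U p)" .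
      then show ?thesis using qp(1,2,3) ba'(1,4) ba(4) unfolding act Some eh by auto
    qed
  qed
qed

lemma \<psi>_0_nz: "\<psi> 0 \<noteq> 0"
  using \<psi>_0 by auto

text \<open>Returning from a class e different from c gives V z U z' with z or z' outside the
  kernel, for otherwise the two classes would agree; then \<open>\<psi>_V\<close> or
  \<open>\<psi>_U\<close> applies. On the diagonal only the kernel fraction remains.\<close>

lemma \<psi>_conj_word:
  assumes w: "w \<in> words_over (carrier S)" and c: "c \<in> C"
  shows "lin \<psi> (U (rep c) * wpoly w * V (rep c)) = \<psi> 0 * A.omega (F.chr \<psi>) c w"
proof (cases "A.wact w (c, \<one>\<^bsub>K.G\<^esub>)")
  case None
  then obtain f z where fz: "z \<in> Kc" "wpoly w * V (rep c) \<doteq> f * U z" using word_cases[OF w c] by auto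
  have "U (rep c) * wpoly w * V (rep c) = U (rep c) * (wpoly w * V (rep c))" by (simp only: mult.assoc)
  also have "lin \<psi> \<dots> = lin \<psi> (U (rep c) * (f * U z))" by (intro \<psi>_eqv eqv_mult_left fz)
  also have "\<dots> = lin \<psi> ((U (rep c) * f) * U z)" by (simp only: mult.assoc)
  also have "\<dots> = 0" by (rule \<psi>_U[OF fz(1)])
  finally show ?thesis by (simp add: A.omega_def None)
next
  case (Some eh)
  obtain e h where eh: "eh = (e, h)" by (cases eh)
  obtain b a where ba: "e \<in> C" "b \<in> carrier T" "a \<in> carrier T" "h = K.cls b a"
      "wpoly w * V (rep c) \<doteq> V (rep e) * (V b * U a)"
    using word_cases[OF w c] Some eh by auto
  have "U (rep c) * wpoly w * V (rep c) = U (rep c) * (wpoly w * V (rep c))" by (simp only: mult.assoc)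
  also have "lin \<psi> \<dots> = lin \<psi> (U (rep c) * (V (rep e) * (V b * U a)))" by (intro \<psi>_eqv eqv_mult_left ba)
  also have "\<dots> = lin \<psi> (U (rep c) * V (rep e) * (V b * U a))" by (simp only: mult.assoc)
  also have "\<dots> = (if e = c then \<psi> 0 * F.chr \<psi> h else 0)"
  proof (cases "e = c")
    case True
    have "lin \<psi> (U (rep c) * V (rep e) * (V b * U a)) = lin \<psi> (1 * (V b * U a))"
      unfolding True by (intro \<psi>_eqv eqv_mult_right isom_eqv rep_carrier c)
    moreover have "F.chr \<psi> h = lin \<psi> (V b * U a) / \<psi> 0"
      unfolding ba(4) by (rule F.chr_eq) (auto intro: \<psi>_eqv ba)
    ultimately show ?thesis using \<psi>_0_nz True by simp
  next
    case False
    have ns: "\<not> sim (rep c) (rep e)"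
      using False class_eq[OF rep_carrier[OF c] rep_carrier[OF ba(1)]] class_rep c ba(1) by auto
    have "lin \<psi> (U (rep c) * V (rep e) * (V b * U a)) = 0"
      using rep_carrier[OF c] rep_carrier[OF ba(1)]
    proof (cases rule: U_V_cases)
      case disj
      have "lin \<psi> (U (rep c) * V (rep e) * (V b * U a)) = lin \<psi> (0 * (V b * U a))"
        by (intro \<psi>_eqv eqv_mult_right disj)
      then show ?thesis by simp
    next
      case (lcm z z')
      have eq: "lin \<psi> (U (rep c) * V (rep e) * (V b * U a)) = lin \<psi> (V z * (U z' * (V b * U a)))"
        using \<psi>_eqv[OF eqv_mult_right[OF lcm(4), of "V b * U a"]] by (simp add: mult.assoc)
      show ?thesis
      proof (cases "z \<in> Kc")
        case True
        then show ?thesis unfolding eq by (rule \<psi>_V)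
      next
        case zT: False
        have "z' \<in> Kc"
        proof (rule ccontr)
          assume "z' \<notin> Kc"
          then have "z \<in> carrier T" "z' \<in> carrier T" using zT lcm(1,2) by (auto simp: Kc_def)
          then show False using ns lcm(3) rep_carrier[OF c] rep_carrier[OF ba(1)] unfolding sim_iff by blast
        qed
        then obtain k y where y: "y \<in> Kc" "U z' * (V b * U a) \<doteq> k * U y" using U_T_frac ba(2,3) by blast
        have "lin \<psi> (V z * (U z' * (V b * U a))) = lin \<psi> (V z * (k * U y))" by (intro \<psi>_eqv eqv_mult_left y)
        also have "\<dots> = lin \<psi> ((V z * k) * U y)" by (simp only: mult.assoc)
        also have "\<dots> = 0" by (rule \<psi>_U[OF y(1)])
        finally show ?thesis unfolding eq .
      qed
    qed
    then show ?thesis using False by simp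
  qed
  finally show ?thesis by (simp add: A.omega_def Some eh)
qed

lemma phi_state: "group_char K.G (F.chr \<psi>)" "\<phi> = A.state (F.chr \<psi>)"
proof -
  show gc: "group_char K.G (F.chr \<psi>)"
    by (rule F.group_char_chr) (auto intro: \<psi>_eqv \<psi>_pos \<psi>_trace simp: \<psi>_0_nz)
  show "\<phi> = A.state (F.chr \<psi>)"
  proof
    fix w show "\<phi> w = A.state (F.chr \<psi>) w"
    proof (cases "w \<in> words_over (carrier S)")
      case True
      have p: "\<psi> 0 = 1 / of_real \<zeta>" using \<psi>_0 zeta_pos by (simp add: field_simps)
      show ?thesis unfolding phi_sum[of w] A.state_def
        by (intro infsum_cong) (simp add: \<psi>_conj_word[OF True] wt_def p)
    next
      case False
      then show ?thesis using outside[OF False] alg_state.outside[OF alg_state_A[OF gc]] by simp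
    qed
  qed
qed

end


section \<open>Recovering the character and the explicit formula\<close>

lemma (in group) group_char_conj:
  assumes \<kappa>: "group_char G \<kappa>" and gk: "g \<in> carrier G" "k \<in> carrier G"
  shows "\<kappa> (k \<otimes> g \<otimes> inv k) = \<kappa> g"
proof -
  have "\<kappa> (k \<otimes> g \<otimes> inv k) = \<kappa> (inv k \<otimes> (k \<otimes> g))" using \<kappa> gk by (simp add: group_char_def)
  then show ?thesis using gk by (simp flip: m_assoc)
qed

lemma (in group) group_char_convex:
  assumes \<kappa>: "group_char G \<kappa>" "group_char G \<kappa>'" and r: "0 \<le> r" "r \<le> 1"
    and eq: "\<And>g. g \<in> carrier G \<Longrightarrow> \<kappa>'' g = complex_of_real (1 - r) * \<kappa> g + complex_of_real r * \<kappa>' g"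
  shows "group_char G \<kappa>''"
  unfolding group_char_def
proof (intro conjI ballI allI impI)
  show "\<kappa>'' \<one> = 1" using \<kappa> by (simp add: eq group_char_def)
  fix g h assume "g \<in> carrier G" "h \<in> carrier G"
  then show "\<kappa>'' (g \<otimes> h) = \<kappa>'' (h \<otimes> g)" using \<kappa> by (simp add: eq group_char_def)
next
  fix B :: "'a set" and a :: "'a \<Rightarrow> complex" assume B: "finite B" "B \<subseteq> carrier G"
  let ?S = "\<lambda>\<kappa>. \<Sum>g\<in>B. \<Sum>h\<in>B. cnj (a g) * a h * \<kappa> (inv g \<otimes> h)"
  have "?S \<kappa>'' = (\<Sum>g\<in>B. \<Sum>h\<in>B. complex_of_real (1 - r) * (cnj (a g) * a h * \<kappa> (inv g \<otimes> h))
      + complex_of_real r * (cnj (a g) * a h * \<kappa>' (inv g \<otimes> h)))"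
    using B by (intro sum.cong refl) (simp add: eq subset_iff algebra_simps)
  also have "\<dots> = complex_of_real (1 - r) * ?S \<kappa> + complex_of_real r * ?S \<kappa>'"
    by (simp only: sum.distrib sum_distrib_left)
  also have "\<dots> \<in> \<real>\<^sub>\<ge>\<^sub>0"
  proof (intro nonneg_Reals_add_I nonneg_Reals_mult_I)
    show "?S \<kappa> \<in> \<real>\<^sub>\<ge>\<^sub>0" "?S \<kappa>' \<in> \<real>\<^sub>\<ge>\<^sub>0" using \<kappa> B by (auto simp: group_char_def)
  qed (use r in \<open>simp_all add: nonneg_Reals_of_real_iff del: of_real_diff\<close>)
  finally show "?S \<kappa>'' \<in> \<real>\<^sub>\<ge>\<^sub>0" .
qed

lemma lin_combination:
  "(\<And>w. \<phi>'' w = a * \<phi> w + b * \<phi>' w) \<Longrightarrow> lin \<phi>'' f = a * lin \<phi> f + b * lin \<phi>' f"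
  by (induction f rule: star_poly_induct) (simp_all add: lin_add algebra_simps)

lemma (in cocycle_rep) state_cong:
  assumes "group_char G \<kappa>" "\<And>g. g \<in> carrier G \<Longrightarrow> \<kappa>' g = \<kappa> g"
  shows "state \<kappa>' = state \<kappa>"
proof
  fix w show "state \<kappa>' w = state \<kappa> w" using state_affine[of \<kappa> \<kappa> \<kappa>' 1 0 w] assms by simp
qed

lemma (in cocycle_rep) lin_omega_proj:
  assumes x: "x \<in> X" and c: "c \<in> C"
  shows "lin (omega \<kappa> c) ((1 - poly_gen x * poly_adj (poly_gen x)) * f) = (if c \<in> mv x ` C then 0 else lin (omega \<kappa> c) f)"
proof -
  have w: "omega \<kappa> c (Word [Gen x, Adj x] + w) = (if c \<in> mv x ` C then omega \<kappa> c w else 0)" for w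
  proof (cases "wact w (c, \<one>)")
    case None
    then show ?thesis by (simp add: omega_def wact_plus)
  next
    case (Some p)
    have "p \<in> D" by (rule wact_closed[OF _ Some]) (use c in simp)
    then show ?thesis using Some by (auto simp: omega_def wact_plus wact_proj[OF x])
  qed
  have p: "poly_gen x * poly_adj (poly_gen x) = wpoly (Word [Gen x, Adj x])"
    by (simp add: adj_poly_gen) (simp add: poly_gen_def mult_single plus_star_word_def)
  have "lin (omega \<kappa> c) (wpoly (Word [Gen x, Adj x]) * f) = (if c \<in> mv x ` C then lin (omega \<kappa> c) f else 0)"
    by (induction f rule: star_poly_induct) (auto simp: mult_single w distrib_left lin_add)
  then show ?thesis unfolding p by (simp add: left_diff_distrib lin_diff)
qed

text \<open>From q a = p b the fraction b/a is p^(-1) q, a conjugate of q/p.\<close>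

lemma (in directed_monoid) char_swap:
  assumes \<kappa>: "group_char G \<kappa>" and T: "q \<in> carrier T" "p \<in> carrier T" "a \<in> carrier T" "b \<in> carrier T"
    and eq: "q \<otimes> a = p \<otimes> b"
  shows "\<kappa> (cls b a) = \<kappa> (cls q p)"
proof -
  have "cls b a = cls \<one> p \<otimes>\<^bsub>G\<^esub> cls q \<one>" using cls_mult[of \<one> p q \<one> b a] T eq by simp
  then have "\<kappa> (cls b a) = \<kappa> (cls q \<one> \<otimes>\<^bsub>G\<^esub> cls \<one> p)" using \<kappa> T by (simp add: group_char_def)
  then show ?thesis using T by (simp add: cls_mult_mid)
qed

context scaled_semigroup
begin

text \<open>Makes the formula independent of representatives. Passing from \<open>rep\<close> of the
  class to x multiplies both cocycle values on the right by the same element, which cancels;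
  comparing through t x then conjugates q/p by some k, invisible to \<kappa>.\<close>

lemma char_th:
  assumes \<kappa>: "group_char K.G \<kappa>" and stx: "s \<in> carrier S" "t \<in> carrier S" "x \<in> carrier S"
    and pq: "p \<in> carrier T" "q \<in> carrier T" "s \<otimes> x \<otimes> p = t \<otimes> x \<otimes> q"
  shows "\<kappa> (th s (cof x) \<otimes>\<^bsub>K.G\<^esub> inv\<^bsub>K.G\<^esub> (th t (cof x))) = \<kappa> (K.cls q p)"
proof -
  define d where "d = cof x"
  define y where "y = rep d"
  define e where "e = mv s d"
  define z where "z = rep e"
  have dC: "d \<in> C" unfolding d_def by (rule class_in[OF stx(3)])
  have y: "y \<in> carrier S" unfolding y_def by (rule rep_carrier[OF dC])
  have yx: "sim y x" unfolding y_def d_def by (rule sim_sym[OF rep_sim[OF stx(3)]])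
  have stx': "sim (t \<otimes> x) (s \<otimes> x)" unfolding sim_iff using stx pq by (metis m_closed)
  have e: "e = cof (s \<otimes> x)" "mv t d = cof (t \<otimes> x)" unfolding e_def d_def using mv_class stx by auto
  then have et: "e = mv t d" using class_eq[of "s \<otimes> x" "t \<otimes> x"] sim_sym[OF stx'] stx by simp
  have zs: "sim z (s \<otimes> y)" unfolding z_def e_def y_def by (rule th_sim[OF stx(1) dC])
  have zt: "sim z (t \<otimes> y)" unfolding z_def et y_def by (rule th_sim[OF stx(2) dC])
  have ztx: "sim z (t \<otimes> x)" by (rule sim_trans[OF zt sim_mult[OF stx(2) yx]])
  define h where "h = tr y x"
  define k where "k = tr z (t \<otimes> x)"
  have hk: "h \<in> carrier K.G" "k \<in> carrier K.G" "K.cls q p \<in> carrier K.G"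
    unfolding h_def k_def using tr_carrier yx ztx pq by auto
  have ths: "th s d = tr z (s \<otimes> y)" unfolding th_def z_def e_def y_def ..
  have tht: "th t d = tr z (t \<otimes> y)" unfolding th_def z_def et y_def ..
  have c: "th s d \<in> carrier K.G" "th t d \<in> carrier K.G" using th_carrier stx dC by auto
  have qp: "tr (t \<otimes> x) (s \<otimes> x) = K.cls q p" by (rule tr_eq) (use stx pq in auto)
  have "th s d \<otimes>\<^bsub>K.G\<^esub> h = tr z (s \<otimes> x)"
    unfolding ths h_def tr_mult_left[OF stx(1) yx, symmetric] by (rule tr_trans[OF zs sim_mult[OF stx(1) yx]])
  also have "\<dots> = k \<otimes>\<^bsub>K.G\<^esub> K.cls q p" unfolding k_def qp[symmetric] by (rule tr_trans[OF ztx stx', symmetric])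
  finally have 1: "th s d \<otimes>\<^bsub>K.G\<^esub> h = k \<otimes>\<^bsub>K.G\<^esub> K.cls q p" .
  have 2: "th t d \<otimes>\<^bsub>K.G\<^esub> h = k"
    unfolding tht h_def k_def tr_mult_left[OF stx(2) yx, symmetric] by (rule tr_trans[OF zt sim_mult[OF stx(2) yx]])
  have "th s d \<otimes>\<^bsub>K.G\<^esub> inv\<^bsub>K.G\<^esub> (th t d) = (th s d \<otimes>\<^bsub>K.G\<^esub> h) \<otimes>\<^bsub>K.G\<^esub> inv\<^bsub>K.G\<^esub> (th t d \<otimes>\<^bsub>K.G\<^esub> h)"
  proof -
    have "h \<otimes>\<^bsub>K.G\<^esub> (inv\<^bsub>K.G\<^esub> h \<otimes>\<^bsub>K.G\<^esub> inv\<^bsub>K.G\<^esub> (th t d)) = inv\<^bsub>K.G\<^esub> (th t d)"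
      using c hk by (simp flip: K.G.m_assoc)
    then show ?thesis using c hk by (simp add: K.G.inv_mult_group K.G.m_assoc)
  qed
  also have "\<dots> = k \<otimes>\<^bsub>K.G\<^esub> K.cls q p \<otimes>\<^bsub>K.G\<^esub> inv\<^bsub>K.G\<^esub> k" unfolding 1 2 ..
  finally show ?thesis using K.G.group_char_conj[OF \<kappa> hk(3,2)] unfolding d_def by simp
qed

end

context scaled_setting
begin

lemma wact_gen_adj:
  assumes "s \<in> carrier S" "t \<in> carrier S" "d \<in> C"
  shows "A.wact (Word [Gen s, Adj t]) (mv t d, \<one>\<^bsub>K.G\<^esub>) = Some (mv s d, th s d \<otimes>\<^bsub>K.G\<^esub> inv\<^bsub>K.G\<^esub> (th t d))"
  using assms by (simp add: A.wact_def A.inv_mv th_carrier)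

text \<open>Only classes of the form mv t d that are also mv s d can be fixed. Reindexing by d and
  rewriting the weight of mv t d as that of mv s d extracts N(s)^(-\<beta>).\<close>

lemma state_gen_adj:
  assumes st: "s \<in> carrier S" "t \<in> carrier S"
  shows "A.state \<kappa> (Word [Gen s, Adj t]) = complex_of_real (N s powr (- \<beta>) / \<zeta>) *
    (\<Sum>\<^sub>\<infinity>d\<in>{d\<in>C. mv s d = mv t d}. complex_of_real (class_scale N d powr (- \<beta>)) *
      \<kappa> (th s d \<otimes>\<^bsub>K.G\<^esub> inv\<^bsub>K.G\<^esub> (th t d)))"
proof -
  let ?w = "Word [Gen s, Adj t]" and ?I = "{d\<in>C. mv s d = mv t d}"
  let ?k = "\<lambda>d. \<kappa> (th s d \<otimes>\<^bsub>K.G\<^esub> inv\<^bsub>K.G\<^esub> (th t d))"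
  have out: "A.omega \<kappa> c ?w = 0" if "c \<in> C - mv t ` ?I" for c
  proof (rule A.omega_eq_0)
    fix g show "A.wact ?w (c, \<one>\<^bsub>K.G\<^esub>) \<noteq> Some (c, g)"
    proof (cases "c \<in> mv t ` C")
      case True
      then obtain d where d: "d \<in> C" "c = mv t d" by blast
      with that have "mv s d \<noteq> mv t d" by blast
      then show ?thesis unfolding d(2) wact_gen_adj[OF st d(1)] by simp
    qed (simp add: A.wact_def)
  qed
  have wt: "wt (mv t d) = N s powr (- \<beta>) / \<zeta> * class_scale N d powr (- \<beta>)" if d: "d \<in> ?I" for d
  proof -
    have dC: "d \<in> C" and eq: "mv t d = mv s d" using d by auto
    have "0 < class_scale N d" using N_pos[OF rep_carrier[OF dC]] by (simp add: class_scale_rep)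
    then show ?thesis unfolding eq using N_pos[OF st(1)] by (simp add: wt_def class_scale_mv[OF st(1) dC] powr_mult)
  qed
  have "A.state \<kappa> ?w = (\<Sum>\<^sub>\<infinity>c\<in>mv t ` ?I. of_real (wt c) * A.omega \<kappa> c ?w)"
    unfolding A.state_def by (rule infsum_cong_neutral) (use out mv_C[OF st(2)] in auto)
  also have "\<dots> = (\<Sum>\<^sub>\<infinity>d\<in>?I. of_real (wt (mv t d)) * A.omega \<kappa> (mv t d) ?w)"
    by (subst infsum_reindex) (auto simp: o_def intro: inj_on_subset[OF mv_inj[OF st(2)]])
  also have "\<dots> = (\<Sum>\<^sub>\<infinity>d\<in>?I. of_real (N s powr (- \<beta>) / \<zeta>) * (of_real (class_scale N d powr (- \<beta>)) * ?k d))"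
  proof (intro infsum_cong)
    fix d assume d: "d \<in> ?I"
    then have "A.wact ?w (mv t d, \<one>\<^bsub>K.G\<^esub>) = Some (mv t d, th s d \<otimes>\<^bsub>K.G\<^esub> inv\<^bsub>K.G\<^esub> (th t d))"
      using wact_gen_adj[OF st, of d] by simp
    then show "of_real (wt (mv t d)) * A.omega \<kappa> (mv t d) ?w
        = of_real (N s powr (- \<beta>) / \<zeta>) * (of_real (class_scale N d powr (- \<beta>)) * ?k d)"
      using wt[OF d] by (simp add: A.omega_eqI)
  qed
  also have "\<dots> = of_real (N s powr (- \<beta>) / \<zeta>) * (\<Sum>\<^sub>\<infinity>d\<in>?I. of_real (class_scale N d powr (- \<beta>)) * ?k d)"
    by (rule infsum_cmult_right')
  finally show ?thesis .
qed

end

context S_functional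
begin

lemma lin_omega_Q:
  assumes c: "c \<in> C" and L: "set L \<subseteq> carrier S"
  shows "lin (A.omega \<kappa> c) (Q L * f) = (if \<exists>s\<in>set L. c \<in> mv s ` C then 0 else lin (A.omega \<kappa> c) f)"
  using L
proof (induction L)
  case (Cons s L)
  have "lin (A.omega \<kappa> c) (Q (s # L) * f) = lin (A.omega \<kappa> c) ((1 - P s) * (Q L * f))" by (simp add: mult.assoc)
  also have "\<dots> = (if c \<in> mv s ` C then 0 else lin (A.omega \<kappa> c) (Q L * f))"
    using Cons.prems by (intro A.lin_omega_proj c) auto
  finally show ?case using Cons by auto
qed simp

text \<open>The corner of an induced state sees only the class of 1, so \<kappa> can be read off
  there; this gives injectivity of the parametrization. The fraction that comes out is b/a rather
  than q/p, whence \<open>char_swap\<close>.\<close>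

lemma chr_state:
  assumes \<kappa>: "group_char K.G \<kappa>" and \<phi>: "\<phi> = A.state \<kappa>" and g: "g \<in> carrier K.G"
  shows "F.chr \<psi> g = \<kappa> g"
proof -
  let ?o = "cof \<one>"
  have oC: "?o \<in> C" by (rule class_in) simp
  have \<psi>_omega: "\<psi> w = of_real (wt ?o) * A.omega \<kappa> ?o w" for w
  proof -
    define f where "f n c = (if \<exists>s\<in>set (en n). c \<in> mv s ` C then 0 else of_real (wt c) * A.omega \<kappa> c w)" for n c
    have sum: "(\<Sum>\<^sub>\<infinity>c\<in>C. f n c) = lin \<phi> (Q (en n) * wpoly w)" for n
    proof -
      have "((\<lambda>c. of_real (wt c) * lin (A.omega \<kappa> c) (Q (en n) * wpoly w)) has_sum lin \<phi> (Q (en n) * wpoly w)) C"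
        unfolding \<phi> by (rule A.state_has_sum[OF \<kappa>])
      then have "lin \<phi> (Q (en n) * wpoly w) = (\<Sum>\<^sub>\<infinity>c\<in>C. of_real (wt c) * lin (A.omega \<kappa> c) (Q (en n) * wpoly w))"
        by (rule infsumI[symmetric])
      also have "\<dots> = (\<Sum>\<^sub>\<infinity>c\<in>C. f n c)"
        by (intro infsum_cong) (simp add: f_def lin_omega_Q[OF _ en_S])
      finally show ?thesis by simp
    qed
    have "(\<lambda>n. \<Sum>\<^sub>\<infinity>c\<in>C. f n c) \<longlonglongrightarrow> (\<Sum>\<^sub>\<infinity>c\<in>C. if c = ?o then of_real (wt c) * A.omega \<kappa> c w else 0)"
    proof (rule infsum_dominated_convergence[OF A.W_summable])
      fix n c assume "c \<in> C"
      then show "cmod (f n c) \<le> wt c" using A.W_omega_norm[OF \<kappa>] A.W_nonneg by (simp add: f_def)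
    next
      fix c assume c: "c \<in> C"
      show "(\<lambda>n. f n c) \<longlonglongrightarrow> (if c = ?o then of_real (wt c) * A.omega \<kappa> c w else 0)"
      proof (cases "c = ?o")
        case True
        have "c \<notin> mv s ` C" if s: "s \<in> set (en n)" for s n
        proof
          have sK: "s \<in> Kc" "s \<in> carrier S" using s en_Kc en_S by auto
          assume "c \<in> mv s ` C"
          then obtain d where d: "d \<in> C" "c = mv s d" by blast
          have "class_scale N c = N s * class_scale N d" unfolding d(2) by (rule class_scale_mv[OF sK(2) d(1)])
          then have "N s * N (rep d) = 1" using True class_scale_class[of \<one>] by (simp add: N_one class_scale_rep[of d])
          then show False using N_mult_1[OF sK(2) rep_carrier[OF d(1)]] sK(1) by (simp add: Kc_iff)
        qed
        then have "f n c = of_real (wt c) * A.omega \<kappa> c w" for n by (auto simp: f_def)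
        then show ?thesis using True by simp
      next
        case False
        \<comment> \<open>Every class other than that of 1 lies in the range of
          \<open>mv (rep c)\<close> with \<open>rep c\<close> outside the kernel, so the projections
          \<open>Q (en n)\<close> eventually remove it.\<close>
        have c1: "mv (rep c) ?o = c" using mv_class[OF rep_carrier[OF c], of \<one>] class_rep[OF c] rep_carrier[OF c] by simp
        have "rep c \<notin> carrier T"
        proof
          assume "rep c \<in> carrier T"
          then have "sim \<one> (\<one> \<otimes> rep c)" by (intro sim_T) auto
          then have "sim \<one> (rep c)" using rep_carrier[OF c] by simp
          then show False using False class_eq[of \<one> "rep c"] rep_carrier[OF c] class_rep[OF c] by simp
        qed
        then have "rep c \<in> Kc" using rep_carrier[OF c] by (simp add: Kc_def)
        then have "\<forall>\<^sub>F n in sequentially. f n c = 0"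
        proof (rule eventually_mono[OF en_eventually])
          fix n assume "rep c \<in> set (en n)"
          moreover have "c \<in> mv (rep c) ` C" using c1 oC by (metis imageI)
          ultimately show "f n c = 0" unfolding f_def by auto
        qed
        then show ?thesis using False by (simp add: tendsto_eventually)
      qed
    qed
    then have "(\<lambda>n. lin \<phi> (Q (en n) * wpoly w)) \<longlonglongrightarrow> (\<Sum>\<^sub>\<infinity>c\<in>C. if c = ?o then of_real (wt c) * A.omega \<kappa> c w else 0)"
      by (simp only: sum)
    then have "\<psi> w = (\<Sum>\<^sub>\<infinity>c\<in>C. if c = ?o then of_real (wt c) * A.omega \<kappa> c w else 0)"
      using \<psi>_word LIMSEQ_unique by blast
    also have "\<dots> = (\<Sum>\<^sub>\<infinity>c\<in>{?o}. of_real (wt c) * A.omega \<kappa> c w)"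
      by (rule infsum_cong_neutral) (use oC in auto)
    finally show ?thesis by simp
  qed
  have wt0: "wt ?o \<noteq> 0" using zeta_pos class_scale_class[of \<one>] by (simp add: wt_def N_one)
  obtain q p where qp: "q \<in> carrier T" "p \<in> carrier T" "g = K.cls q p" using K.carrier_GE[OF g] .
  have qpS: "q \<in> carrier S" "p \<in> carrier S" using qp T_S by auto
  obtain a b where ab: "a \<in> carrier T" "b \<in> carrier T" "q \<otimes> a = p \<otimes> b" using K.directed[OF qp(1,2)] by auto
  have mv1: "mv s ?o = ?o" if s: "s \<in> carrier T" for s
  proof -
    have "sim \<one> (\<one> \<otimes> s)" using s by (intro sim_T) auto
    then have "sim \<one> s" using T_S[OF s] by simp
    then show ?thesis using mv_class[OF T_S[OF s], of \<one>] class_eq[of \<one> s] T_S[OF s] by simp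
  qed
  have "A.wact (Word [Gen q, Adj p]) (?o, \<one>\<^bsub>K.G\<^esub>) = Some (?o, th q ?o \<otimes>\<^bsub>K.G\<^esub> inv\<^bsub>K.G\<^esub> (th p ?o))"
    using wact_gen_adj[OF qpS oC] mv1 qp by simp
  then have "A.omega \<kappa> ?o (Word [Gen q, Adj p]) = \<kappa> (th q ?o \<otimes>\<^bsub>K.G\<^esub> inv\<^bsub>K.G\<^esub> (th p ?o))" by (rule A.omega_eqI)
  also have "\<dots> = \<kappa> (K.cls b a)" by (rule char_th[OF \<kappa> qpS one_closed ab(1,2)]) (use ab qpS in simp)
  also have "\<dots> = \<kappa> g" unfolding qp(3) by (rule K.char_swap[OF \<kappa> qp(1,2) ab(1,2)]) (use ab in simp)
  finally have om: "A.omega \<kappa> ?o (Word [Gen q, Adj p]) = \<kappa> g" .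
  have om0: "A.omega \<kappa> ?o 0 = 1" using \<kappa> by (simp add: A.omega_def group_char_def)
  have VU: "V q * U p = wpoly (Word [Gen q, Adj p])"
    by (simp add: adj_poly_gen) (simp add: poly_gen_def mult_single plus_star_word_def)
  have "F.chr \<psi> g = lin \<psi> (V q * U p) / \<psi> 0"
    unfolding qp(3) by (rule F.chr_eq) (auto intro: \<psi>_eqv qp)
  then show ?thesis using wt0 by (simp add: VU \<psi>_omega om om0)
qed

end

section \<open>The parametrization of the KMS states\<close>

locale kms_setting = scaled_setting S N \<beta>
  for S :: "('a, 'b) monoid_scheme" (structure) and N :: "'a \<Rightarrow> real" and \<beta> :: real +
  assumes countable_S: "countable (carrier S)"
    and nontrivial: "\<exists>s\<in>carrier S. N s \<noteq> 1"
    and \<beta>_nz: "\<beta> \<noteq> 0"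
begin

abbreviation KMS :: "((nat \<Rightarrow> 'a star_poly) set \<Rightarrow> complex) set" where
  "KMS \<equiv> kms_states pres.A pres.dyn \<beta>"

lemma S_functionalI:
  fixes \<phi> :: "'a star_word \<Rightarrow> complex"
  assumes "alg_state (carrier S) (semigroup_relations S) \<phi>"
    and kms: "\<And>v w. \<phi> (w + v) = exp (- \<beta> * word_weight (\<lambda>s. ln (N s)) w) * \<phi> (v + w)"
  shows "S_functional S N \<beta> \<phi>"
proof -
  interpret alg_state "carrier S" "semigroup_relations S" \<phi> by fact
  show ?thesis by unfold_locales (rule kms countable_S nontrivial \<beta>_nz)+
qed

lemma KMS_character:
  assumes "\<psi> \<in> KMS"
  obtains \<kappa> where "group_char K.G \<kappa>" "\<psi> = pres.extend (A.state \<kappa>)"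
proof -
  have st: "\<psi> \<in> states pres.A" using assms by (simp add: kms_states_def)
  interpret F: S_functional S N \<beta> "pres.word_val \<psi>"
    by (rule S_functionalI[OF pres.alg_state_word_val[OF st] pres.kms_word[OF assms]])
  have "\<psi> = pres.extend (pres.word_val \<psi>)" by (rule pres.extend_word_val[OF st, symmetric])
  then show ?thesis using that F.phi_state by metis
qed

lemma state_inj:
  assumes \<kappa>: "group_char K.G \<kappa>" "group_char K.G \<kappa>'" and eq: "A.state \<kappa> = A.state \<kappa>'" and g: "g \<in> carrier K.G"
  shows "\<kappa> g = \<kappa>' g"
proof -
  interpret F: S_functional S N \<beta> "A.state \<kappa>"
    by (rule S_functionalI[OF alg_state_A[OF \<kappa>(1)] A.state_kms[OF \<kappa>(1)]])
  show ?thesis using F.chr_state[OF \<kappa>(1) refl g] F.chr_state[OF \<kappa>(2) eq g] by simp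
qed

lemma extend_KMS: "group_char K.G \<kappa> \<Longrightarrow> pres.extend (A.state \<kappa>) \<in> KMS"
proof -
  assume \<kappa>: "group_char K.G \<kappa>"
  show ?thesis
  proof (rule pres.kms_statesI[OF pres.extend_state[OF alg_state_A[OF \<kappa>]]])
    show "pres.word_val (pres.extend (A.state \<kappa>)) (w + v) =
        exp (- \<beta> * word_weight (\<lambda>s. ln (N s)) w) * pres.word_val (pres.extend (A.state \<kappa>)) (v + w)" for v w
      unfolding pres.word_val_extend[OF alg_state_A[OF \<kappa>]] by (rule A.state_kms[OF \<kappa>])
  qed
qed

text \<open>A continuous bijection from a compact to a Hausdorff space is a homeomorphism, so the
  inverse is never studied. \<open>eval\<close> makes each value of the character an evaluation,
  from which continuity and affinity follow; both trace spaces are treated by this one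
  lemma.\<close>

lemma affine_homeomorphism_character:
  fixes D :: "('d, 'e) star_algebra_scheme"
  assumes compact: "compact_space (weak_star D K0)" and top: "topspace (weak_star D K0) = K0"
    and gc: "\<And>\<tau>. \<tau> \<in> K0 \<Longrightarrow> group_char K.G (chr \<tau>)"
    and inj: "\<And>\<tau> \<tau>'. \<tau> \<in> K0 \<Longrightarrow> \<tau>' \<in> K0 \<Longrightarrow> (\<And>g. g \<in> carrier K.G \<Longrightarrow> chr \<tau> g = chr \<tau>' g) \<Longrightarrow> \<tau> = \<tau>'"
    and surj: "\<And>\<kappa>. group_char K.G \<kappa> \<Longrightarrow> \<exists>\<tau>\<in>K0. \<forall>g\<in>carrier K.G. chr \<tau> g = \<kappa> g"
    and eval: "\<And>g. g \<in> carrier K.G \<Longrightarrow> \<exists>a\<in>carrier D. \<forall>\<tau>. chr \<tau> g = \<tau> a"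
  shows "affine_homeomorphism D K0 pres.A KMS (\<lambda>\<tau>. pres.extend (A.state (chr \<tau>)))"
  unfolding affine_homeomorphism_def
proof (intro conjI ballI)
  let ?F = "\<lambda>\<tau>. pres.extend (A.state (chr \<tau>))"
  have KMS_states: "KMS \<subseteq> states pres.A" by (auto simp: kms_states_def)
  have ev: "?F \<tau> (pres.el (wpoly w)) = A.state (chr \<tau>) w" if "\<tau> \<in> K0" "w \<in> words_over (carrier S)" for \<tau> w
    using pres.extend_el[OF alg_state_A[OF gc[OF that(1)]] star_polys_single[OF that(2)]] by simp
  show "homeomorphic_map (weak_star D K0) (weak_star pres.A KMS) ?F"
  proof (rule continuous_imp_homeomorphic_map[OF _ compact pres.Hausdorff_weak_star])
    show "continuous_map (weak_star D K0) (weak_star pres.A KMS) ?F"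
    proof (rule pres.continuous_map_weak_star[OF KMS_states])
      show "?F \<tau> \<in> KMS" if "\<tau> \<in> topspace (weak_star D K0)" for \<tau>
        using that unfolding top by (intro extend_KMS gc)
      fix w assume w: "w \<in> words_over (carrier S)"
      have "continuous_map (weak_star D K0) euclidean (\<lambda>\<tau>. A.state (chr \<tau>) w)"
      proof (rule A.continuous_map_state)
        show "group_char K.G (chr \<tau>)" if "\<tau> \<in> topspace (weak_star D K0)" for \<tau>
          using that unfolding top by (rule gc)
        fix g assume "g \<in> carrier K.G"
        then obtain a where a: "a \<in> carrier D" "\<And>\<tau>. chr \<tau> g = \<tau> a" using eval by blast
        show "continuous_map (weak_star D K0) euclidean (\<lambda>\<tau>. chr \<tau> g)"
          unfolding a(2) weak_star_def
          by (intro continuous_map_from_subtopology continuous_map_product_projection a)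
      qed
      then show "continuous_map (weak_star D K0) euclidean (\<lambda>\<tau>. ?F \<tau> (pres.el (wpoly w)))"
        by (rule continuous_map_eq) (simp add: top ev w)
    qed
    show "?F ` topspace (weak_star D K0) = topspace (weak_star pres.A KMS)"
      unfolding top pres.topspace_weak_star[OF KMS_states]
    proof (intro equalityI subsetI)
      fix \<psi> assume "\<psi> \<in> KMS"
      then obtain \<kappa> where \<kappa>: "group_char K.G \<kappa>" "\<psi> = pres.extend (A.state \<kappa>)" using KMS_character by blast
      obtain \<tau> where \<tau>: "\<tau> \<in> K0" "\<And>g. g \<in> carrier K.G \<Longrightarrow> chr \<tau> g = \<kappa> g" using surj[OF \<kappa>(1)] by blast
      have "A.state (chr \<tau>) = A.state \<kappa>" by (rule A.state_cong[OF \<kappa>(1) \<tau>(2)])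
      then show "\<psi> \<in> ?F ` K0" using \<kappa>(2) \<tau>(1) by (intro image_eqI[of _ _ \<tau>]) auto
    qed (use gc extend_KMS in blast)
    show "inj_on ?F (topspace (weak_star D K0))"
      unfolding top
    proof (rule inj_onI)
      fix \<tau> \<tau>' assume \<tau>: "\<tau> \<in> K0" "\<tau>' \<in> K0" and eq: "?F \<tau> = ?F \<tau>'"
      have "A.state (chr \<tau>) = A.state (chr \<tau>')"
        using arg_cong[OF eq, of pres.word_val] by (simp add: pres.word_val_extend alg_state_A gc \<tau>)
      then show "\<tau> = \<tau>'" by (intro inj \<tau> state_inj[OF gc[OF \<tau>(1)] gc[OF \<tau>(2)]])
    qed
  qed
  fix \<tau> \<tau>' and r :: real assume \<tau>: "\<tau> \<in> K0" "\<tau>' \<in> K0" and r: "r \<in> {0..1}"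
  let ?c = "convex_comb D r \<tau> \<tau>'"
  have eq: "chr ?c g = complex_of_real (1 - r) * chr \<tau> g + complex_of_real r * chr \<tau>' g" if "g \<in> carrier K.G" for g
  proof -
    obtain a where a: "a \<in> carrier D" "\<And>\<tau>. chr \<tau> g = \<tau> a" using eval[OF \<open>g \<in> carrier K.G\<close>] by blast
    show ?thesis unfolding a(2) using a(1) by (simp add: convex_comb_def)
  qed
  have gcc: "group_char K.G (chr ?c)"
    by (rule K.G.group_char_convex[OF gc[OF \<tau>(1)] gc[OF \<tau>(2)] _ _ eq]) (use r in auto)
  have w: "A.state (chr ?c) w = complex_of_real (1 - r) * A.state (chr \<tau>) w + complex_of_real r * A.state (chr \<tau>') w" for w
    by (rule A.state_affine[OF gc[OF \<tau>(1)] gc[OF \<tau>(2)] eq])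
  have l: "lin (A.state (chr ?c)) f = complex_of_real (1 - r) * lin (A.state (chr \<tau>)) f + complex_of_real r * lin (A.state (chr \<tau>')) f" for f
    by (rule lin_combination) (rule w)
  show "?F ?c = convex_comb pres.A r (?F \<tau>) (?F \<tau>')"
  proof (rule extensionalityI[of _ "carrier pres.A"])
    fix a assume "a \<in> carrier pres.A"
    then obtain x where x: "x \<in> pres.cs" "a = pres.cl x" using pres.carrierE by blast
    have "(\<lambda>n. lin (A.state (chr ?c)) (x n)) \<longlonglongrightarrow> complex_of_real (1 - r) * ?F \<tau> a + complex_of_real r * ?F \<tau>' a"
      unfolding l x(2) by (intro tendsto_intros pres.extend_cl[OF alg_state_A[OF gc]] \<tau> x)
    moreover have "(\<lambda>n. lin (A.state (chr ?c)) (x n)) \<longlonglongrightarrow> ?F ?c a"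
      unfolding x(2) by (rule pres.extend_cl[OF alg_state_A[OF gcc] x(1)])
    ultimately show "?F ?c a = convex_comb pres.A r (?F \<tau>) (?F \<tau>') a"
      using LIMSEQ_unique \<open>a \<in> carrier pres.A\<close> by (fastforce simp: convex_comb_def)
  qed (simp_all add: pres.extend_def convex_comb_def)
qed

lemma homeomorphism_B:
  "affine_homeomorphism K.presB.A (tracial_states K.presB.A) pres.A KMS (\<lambda>\<tau>. pres.extend (A.state (K.chrB \<tau>)))"
proof (rule affine_homeomorphism_character)
  show "compact_space (weak_star K.presB.A (tracial_states K.presB.A))" by (rule K.presB.compact_tracial_states)
  show "topspace (weak_star K.presB.A (tracial_states K.presB.A)) = tracial_states K.presB.A"
    by (rule K.presB.topspace_weak_star) (auto simp: tracial_states_def)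
  show "group_char K.G (K.chrB \<tau>)" if "\<tau> \<in> tracial_states K.presB.A" for \<tau> by (rule K.chrB(1)[OF that])
  show "\<tau> = \<tau>'" if \<tau>: "\<tau> \<in> tracial_states K.presB.A" "\<tau>' \<in> tracial_states K.presB.A"
    and eq: "\<And>g. g \<in> carrier K.G \<Longrightarrow> K.chrB \<tau> g = K.chrB \<tau>' g" for \<tau> \<tau>'
  proof -
    have st: "\<tau> \<in> states K.presB.A" "\<tau>' \<in> states K.presB.A" using \<tau> by (auto simp: tracial_states_def)
    have "K.presB.word_val \<tau> = K.presB.word_val \<tau>'"
      unfolding K.chrB(2)[OF \<tau>(1)] K.chrB(2)[OF \<tau>(2)] by (rule K.B.state_cong[OF K.chrB(1)[OF \<tau>(2)] eq])
    then show ?thesis using K.presB.extend_word_val st by metis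
  qed
  show "\<exists>\<tau>\<in>tracial_states K.presB.A. \<forall>g\<in>carrier K.G. K.chrB \<tau> g = \<kappa> g" if "group_char K.G \<kappa>" for \<kappa>
    using K.extend_B_tracial[OF that] K.chrB_extend[OF that] by blast
  show "\<exists>a\<in>carrier K.presB.A. \<forall>\<tau>. K.chrB \<tau> g = \<tau> a" if g: "g \<in> carrier K.G" for g
  proof -
    obtain s t where r: "K.rep_frac g = (s, t)" "s \<in> carrier T" "t \<in> carrier T" "g = K.cls s t" using K.rep_fracE[OF g] .
    have "K.presB.el (wpoly (Word [Gen s, Adj t])) \<in> carrier K.presB.A"
      using r by (intro K.presB.cl_carrier K.presB.cs_const star_polys_single) auto
    then show ?thesis by (rule rev_bexI) (simp add: K.chrB_def r(1))
  qed
qed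

lemma homeomorphism_C:
  "affine_homeomorphism K.presC.A (tracial_states K.presC.A) pres.A KMS (\<lambda>\<tau>. pres.extend (A.state (K.chrC \<tau>)))"
proof (rule affine_homeomorphism_character)
  show "compact_space (weak_star K.presC.A (tracial_states K.presC.A))" by (rule K.presC.compact_tracial_states)
  show "topspace (weak_star K.presC.A (tracial_states K.presC.A)) = tracial_states K.presC.A"
    by (rule K.presC.topspace_weak_star) (auto simp: tracial_states_def)
  show "group_char K.G (K.chrC \<tau>)" if "\<tau> \<in> tracial_states K.presC.A" for \<tau> by (rule K.chrC(1)[OF that])
  show "\<tau> = \<tau>'" if \<tau>: "\<tau> \<in> tracial_states K.presC.A" "\<tau>' \<in> tracial_states K.presC.A"
    and eq: "\<And>g. g \<in> carrier K.G \<Longrightarrow> K.chrC \<tau> g = K.chrC \<tau>' g" for \<tau> \<tau>'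
  proof -
    have st: "\<tau> \<in> states K.presC.A" "\<tau>' \<in> states K.presC.A" using \<tau> by (auto simp: tracial_states_def)
    have "K.presC.word_val \<tau> = K.presC.word_val \<tau>'"
      unfolding K.chrC(2)[OF \<tau>(1)] K.chrC(2)[OF \<tau>(2)] by (rule K.Cg.state_cong[OF K.chrC(1)[OF \<tau>(2)] eq])
    then show ?thesis using K.presC.extend_word_val st by metis
  qed
  show "\<exists>\<tau>\<in>tracial_states K.presC.A. \<forall>g\<in>carrier K.G. K.chrC \<tau> g = \<kappa> g" if "group_char K.G \<kappa>" for \<kappa>
    using K.extend_C_tracial[OF that] K.chrC_extend[OF that] by blast
  show "\<exists>a\<in>carrier K.presC.A. \<forall>\<tau>. K.chrC \<tau> g = \<tau> a" if g: "g \<in> carrier K.G" for g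
  proof -
    have "K.presC.el (poly_gen g) \<in> carrier K.presC.A"
      unfolding poly_gen_def using g by (intro K.presC.cl_carrier K.presC.cs_const star_polys_single) auto
    then show ?thesis by (rule rev_bexI) (simp add: K.chrC_def)
  qed
qed

lemma chrB_cls:
  assumes \<tau>: "\<tau> \<in> tracial_states K.presB.A" and qp: "q \<in> carrier T" "p \<in> carrier T"
  shows "K.chrB \<tau> (K.cls q p) = \<tau> (K.presB.el (poly_gen q) \<otimes>\<^bsub>K.presB.A\<^esub> invol K.presB.A (K.presB.el (poly_gen p)))"
proof -
  have w: "Word [Gen q, Adj p] \<in> words_over (carrier T)" using qp by simp
  have "K.chrB \<tau> (K.cls q p) = K.B.state (K.chrB \<tau>) (Word [Gen q, Adj p])" by (rule K.B_state_frac[OF qp, symmetric])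
  also have "\<dots> = K.presB.word_val \<tau> (Word [Gen q, Adj p])" by (simp only: K.chrB(2)[OF \<tau>])
  also have "\<dots> = \<tau> (K.presB.el (wpoly (Word [Gen q, Adj p])))" using w by (simp add: K.presB.word_val_def)
  also have "wpoly (Word [Gen q, Adj p]) = poly_gen q * poly_adj (poly_gen p)"
    by (simp add: adj_poly_gen) (simp add: poly_gen_def mult_single plus_star_word_def)
  also have "K.presB.el \<dots> = K.presB.el (poly_gen q) \<otimes>\<^bsub>K.presB.A\<^esub> invol K.presB.A (K.presB.el (poly_gen p))"
    using qp by (subst K.presB.el_unary_ops) (auto simp: poly_gen_def intro!: star_polys_single star_polys_adj K.presB.el_ops(2)[symmetric])
  finally show ?thesis .
qed

lemma extend_gen_adj:
  assumes \<kappa>: "group_char K.G \<kappa>" and st: "s \<in> carrier S" "t \<in> carrier S"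
  shows "pres.extend (A.state \<kappa>) (pres.el (poly_gen s) \<otimes>\<^bsub>pres.A\<^esub> invol pres.A (pres.el (poly_gen t))) = A.state \<kappa> (Word [Gen s, Adj t])"
proof -
  have w: "Word [Gen s, Adj t] \<in> words_over (carrier S)" using st by simp
  have p: "poly_gen s * poly_adj (poly_gen t) = wpoly (Word [Gen s, Adj t])"
    by (simp add: adj_poly_gen) (simp add: poly_gen_def mult_single plus_star_word_def)
  have "pres.el (poly_gen s) \<otimes>\<^bsub>pres.A\<^esub> invol pres.A (pres.el (poly_gen t)) = pres.el (poly_gen s * poly_adj (poly_gen t))"
    using st by (subst pres.el_unary_ops) (auto simp: poly_gen_def intro!: star_polys_single star_polys_adj pres.el_ops(2))
  then show ?thesis unfolding p using pres.extend_el[OF alg_state_A[OF \<kappa>] star_polys_single[OF w]] by simp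
qed

lemma dynamics: "scale_dynamics S N = pres.dyn"
proof
  fix t
  have "complex_of_real (N s) powr (\<i> * complex_of_real t) = exp (\<i> * of_real t * of_real (ln (N s)))" if "s \<in> carrier S" for s
    using N_pos[OF that] by (simp add: powr_def Ln_of_real)
  then have "scale_dynamics S N t = (THE \<alpha>. star_automorphism pres.A \<alpha> \<and>
      (\<forall>s\<in>carrier S. \<alpha> (pres.el (poly_gen s)) = exp (\<i> * of_real t * of_real (ln (N s))) \<odot>\<^bsub>pres.A\<^esub> pres.el (poly_gen s)))"
    unfolding scale_dynamics_def semigroup_cstar_def semigroup_gen_def universal_gen_def
    by (intro arg_cong[of _ _ The] ext conj_cong ball_cong refl) simp
  also have "\<dots> = pres.dyn t" by (rule pres.the_dyn)
  finally show "scale_dynamics S N t = pres.dyn t" .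
qed

lemma formula:
  assumes \<tau>: "\<tau> \<in> tracial_states K.presB.A" and st: "s \<in> carrier S" "t \<in> carrier S"
    and x: "\<And>c. c \<in> C \<Longrightarrow> x c \<in> c"
    and pq: "\<And>c. c \<in> C \<Longrightarrow> cof (s \<otimes> x c) = cof (t \<otimes> x c) \<Longrightarrow>
      p c \<in> carrier T \<and> q c \<in> carrier T \<and> s \<otimes> x c \<otimes> p c = t \<otimes> x c \<otimes> q c"
  shows "pres.extend (A.state (K.chrB \<tau>)) (pres.el (poly_gen s) \<otimes>\<^bsub>pres.A\<^esub> invol pres.A (pres.el (poly_gen t))) =
    complex_of_real (N s powr (- \<beta>) / \<zeta>) *
    (\<Sum>\<^sub>\<infinity>c | c \<in> C \<and> cof (s \<otimes> x c) = cof (t \<otimes> x c).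
       complex_of_real (N (x c) powr (- \<beta>)) *
       \<tau> (K.presB.el (poly_gen (q c)) \<otimes>\<^bsub>K.presB.A\<^esub> invol K.presB.A (K.presB.el (poly_gen (p c)))))"
proof -
  have gc: "group_char K.G (K.chrB \<tau>)" by (rule K.chrB(1)[OF \<tau>])
  have xc: "x c \<in> carrier S" "cof (x c) = c" if "c \<in> C" for c using class_member[OF that x[OF that]] by auto
  have mv: "mv s c = cof (s \<otimes> x c)" "mv t c = cof (t \<otimes> x c)" if "c \<in> C" for c
    using mv_class[OF st(1) xc(1)[OF that]] mv_class[OF st(2) xc(1)[OF that]] xc(2)[OF that] by auto
  have I: "{c \<in> C. mv s c = mv t c} = {c. c \<in> C \<and> cof (s \<otimes> x c) = cof (t \<otimes> x c)}"
    by (intro Collect_cong conj_cong refl) (simp only: mv)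
  show ?thesis unfolding extend_gen_adj[OF gc st] state_gen_adj[OF st] I
  proof (rule arg_cong[of _ _ "(*) (complex_of_real (N s powr (- \<beta>) / \<zeta>))"], rule infsum_cong)
    fix c assume "c \<in> {c. c \<in> C \<and> cof (s \<otimes> x c) = cof (t \<otimes> x c)}"
    then have c: "c \<in> C" "cof (s \<otimes> x c) = cof (t \<otimes> x c)" by auto
    note pqc = pq[OF c]
    have "class_scale N c = N (x c)" using class_scale_class[OF xc(1)[OF c(1)]] xc(2)[OF c(1)] by simp
    moreover have "K.chrB \<tau> (th s c \<otimes>\<^bsub>K.G\<^esub> inv\<^bsub>K.G\<^esub> (th t c)) = K.chrB \<tau> (K.cls (q c) (p c))"
      using char_th[OF gc st xc(1)[OF c(1)], of "p c" "q c"] pqc xc(2)[OF c(1)] by simp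
    ultimately show "complex_of_real (class_scale N c powr (- \<beta>)) * K.chrB \<tau> (th s c \<otimes>\<^bsub>K.G\<^esub> inv\<^bsub>K.G\<^esub> (th t c)) =
        complex_of_real (N (x c) powr (- \<beta>)) *
        \<tau> (K.presB.el (poly_gen (q c)) \<otimes>\<^bsub>K.presB.A\<^esub> invol K.presB.A (K.presB.el (poly_gen (p c))))"
      using chrB_cls[OF \<tau>, of "q c" "p c"] pqc by simp
  qed
qed

end

section \<open>From the hypotheses of the theorem to the setting of the proof\<close>

lemma unit_cosets_directed_common:
  assumes T: "monoid T" and dir: "unit_cosets_directed T" and ab: "a \<in> carrier T" "b \<in> carrier T"
  shows "\<exists>c\<in>carrier T. \<exists>d\<in>carrier T. a \<otimes>\<^bsub>T\<^esub> c = b \<otimes>\<^bsub>T\<^esub> d"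
proof -
  interpret monoid T by (rule T)
  have mem: "z \<in> x <#\<^bsub>T\<^esub> carrier T"
    if le: "unit_coset_le T (x <#\<^bsub>T\<^esub> Units T) (z <#\<^bsub>T\<^esub> Units T)" and xz: "x \<in> carrier T" "z \<in> carrier T" for x z
  proof -
    obtain u w where uw: "u \<in> Units T" "w \<in> Units T" "(z \<otimes>\<^bsub>T\<^esub> w) <#\<^bsub>T\<^esub> carrier T \<subseteq> (x \<otimes>\<^bsub>T\<^esub> u) <#\<^bsub>T\<^esub> carrier T"
      using le by (auto simp: unit_coset_le_def l_coset_def)
    have "z = (z \<otimes>\<^bsub>T\<^esub> w) \<otimes>\<^bsub>T\<^esub> inv\<^bsub>T\<^esub> w" using uw xz by (simp add: m_assoc Units_closed)
    then have "z \<in> (z \<otimes>\<^bsub>T\<^esub> w) <#\<^bsub>T\<^esub> carrier T" using uw by (auto simp: l_coset_def)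
    then obtain y where "y \<in> carrier T" "z = (x \<otimes>\<^bsub>T\<^esub> u) \<otimes>\<^bsub>T\<^esub> y" using uw(3) by (auto simp: l_coset_def)
    then show ?thesis using uw(1) xz(1) by (auto simp: l_coset_def m_assoc Units_closed)
  qed
  obtain z where "z \<in> carrier T" "unit_coset_le T (a <#\<^bsub>T\<^esub> Units T) (z <#\<^bsub>T\<^esub> Units T)"
      "unit_coset_le T (b <#\<^bsub>T\<^esub> Units T) (z <#\<^bsub>T\<^esub> Units T)"
    using dir ab unfolding unit_cosets_directed_def unit_cosets_def by blast
  then have "z \<in> a <#\<^bsub>T\<^esub> carrier T" "z \<in> b <#\<^bsub>T\<^esub> carrier T" using mem ab by auto
  then show ?thesis unfolding l_coset_def by auto
qed

lemma scaled_semigroupI: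
  assumes S: "right_lcm_semigroup S" and N: "scale S N" and dir: "unit_cosets_directed (scale_ker S N)"
  shows "scaled_semigroup S N"
proof -
  interpret right_lcm_semigroup S by (rule S)
  have N1: "N \<one>\<^bsub>S\<^esub> = 1"
  proof -
    have "N (\<one>\<^bsub>S\<^esub> \<otimes>\<^bsub>S\<^esub> \<one>\<^bsub>S\<^esub>) = N \<one>\<^bsub>S\<^esub> * N \<one>\<^bsub>S\<^esub>" "1 \<le> N \<one>\<^bsub>S\<^esub>"
      using N one_closed unfolding scale_def by blast+
    then show ?thesis by simp
  qed
  have "monoid (scale_ker S N)"
    by (rule monoidI) (use N N1 in \<open>auto simp: scale_ker_def scale_def m_assoc\<close>)
  note common = unit_cosets_directed_common[OF this dir]
  show ?thesis
  proof (unfold_locales, rule N)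
    fix a b assume "a \<in> carrier S" "N a = 1" "b \<in> carrier S" "N b = 1"
    then show "\<exists>c\<in>carrier S. \<exists>d\<in>carrier S. N c = 1 \<and> N d = 1 \<and> a \<otimes>\<^bsub>S\<^esub> c = b \<otimes>\<^bsub>S\<^esub> d"
      using common[of a b] by (auto simp: scale_ker_def)
  qed
qed

context scaled_semigroup
begin

text \<open>A class of maximal scale would be moved to one of larger scale by an element of scale
  above 1.\<close>

lemma infinite_classes:
  assumes "\<exists>s\<in>carrier S. N s \<noteq> 1"
  shows "infinite C"
proof
  assume "finite C"
  then have fin: "finite (class_scale N ` C)" by simp
  have "cof \<one> \<in> C" by (rule class_in) simp
  then have "Max (class_scale N ` C) \<in> class_scale N ` C" using fin by (intro Max_in) auto
  then obtain c where c: "c \<in> C" "class_scale N c = Max (class_scale N ` C)" by auto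
  obtain s where s: "s \<in> carrier S" "N s \<noteq> 1" using assms by blast
  have "class_scale N (mv s c) \<le> class_scale N c" unfolding c(2) using fin mv_C[OF s(1) c(1)] by simp
  moreover have "1 < N s" using s N_ge1[OF s(1)] by simp
  moreover have "0 < class_scale N c" using N_pos[OF rep_carrier[OF c(1)]] by (simp add: class_scale_rep)
  ultimately show False by (simp add: class_scale_mv[OF s(1) c(1)])
qed

lemma summable_above_abscissa:
  assumes "scale_abscissa S N < ereal \<beta>"
  shows "(\<lambda>c. class_scale N c powr (- \<beta>)) summable_on C"
proof -
  obtain \<beta>' where \<beta>': "\<beta>' < \<beta>" "(\<lambda>c. class_scale N c powr (- \<beta>')) summable_on C"
    using assms unfolding scale_abscissa_def Inf_less_iff by auto
  show ?thesis
  proof (rule summable_on_comparison_test[OF \<beta>'(2)])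
    fix c assume "c \<in> C"
    then have "1 \<le> class_scale N c" using N_ge1[OF rep_carrier] by (simp add: class_scale_rep)
    then show "class_scale N c powr (- \<beta>) \<le> class_scale N c powr (- \<beta>')" using \<beta>'(1) by (intro powr_mono) auto
  qed auto
qed

text \<open>At exponent 0 the series would add 1 over infinitely many classes.\<close>

lemma summable_exponent_nz:
  assumes nt: "\<exists>s\<in>carrier S. N s \<noteq> 1" and sum: "(\<lambda>c. class_scale N c powr (- \<beta>)) summable_on C"
  shows "\<beta> \<noteq> 0"
proof
  assume "\<beta> = 0"
  moreover have pos: "class_scale N c > 0" if "c \<in> C" for c
    using N_pos[OF rep_carrier[OF that]] by (simp add: class_scale_rep)
  ultimately have one: "class_scale N c powr (- \<beta>) = 1" if "c \<in> C" for c using pos[OF that] by simp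
  obtain n :: nat where n: "(\<Sum>\<^sub>\<infinity>c\<in>C. class_scale N c powr (- \<beta>)) < real n" using reals_Archimedean2 by blast
  obtain F where F: "finite F" "card F = n" "F \<subseteq> C" using infinite_arbitrarily_large[OF infinite_classes[OF nt]] by blast
  have "(\<Sum>c\<in>F. class_scale N c powr (- \<beta>)) \<le> (\<Sum>\<^sub>\<infinity>c\<in>C. class_scale N c powr (- \<beta>))"
    by (rule finite_sum_le_infsum[OF sum F(1,3)]) simp
  moreover have "(\<Sum>c\<in>F. class_scale N c powr (- \<beta>)) = (\<Sum>c\<in>F. 1)" by (intro sum.cong refl one) (use F in auto)
  ultimately show False using n F(2) by simp
qed

end

theorem theorem4p5:
  fixes S :: "('s, 'm) monoid_scheme" and N :: "'s \<Rightarrow> real" and \<beta> :: real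
  assumes "right_lcm_semigroup S" and "countable (carrier S)"
    and "nontrivial_scale S N"
    and "unit_cosets_directed (scale_ker S N)"
    and "\<bar>scale_abscissa S N\<bar> \<noteq> \<infinity>"
    and "scale_abscissa S N < ereal \<beta>"
  defines "T \<equiv> scale_ker S N"
  defines "A \<equiv> semigroup_cstar S" and "B \<equiv> semigroup_cstar T"
    and "C \<equiv> group_cstar (max_group_image (left_inverse_hull T))"
  defines "v \<equiv> semigroup_gen S" and "w \<equiv> semigroup_gen T"
  defines "KMS \<equiv> kms_states A (scale_dynamics S N) \<beta>"
  shows "(\<exists>\<Phi>. affine_homeomorphism B (tracial_states B) A KMS \<Phi> \<and>
            (\<forall>\<tau>\<in>tracial_states B. \<forall>s\<in>carrier S. \<forall>t\<in>carrier S. \<forall>x p q.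
               (\<forall>c\<in>scale_classes S N. x c \<in> c) \<longrightarrow>
               (\<forall>c\<in>scale_classes S N.
                  scale_class S N (s \<otimes>\<^bsub>S\<^esub> x c) = scale_class S N (t \<otimes>\<^bsub>S\<^esub> x c) \<longrightarrow>
                  p c \<in> carrier T \<and> q c \<in> carrier T \<and>
                  s \<otimes>\<^bsub>S\<^esub> x c \<otimes>\<^bsub>S\<^esub> p c = t \<otimes>\<^bsub>S\<^esub> x c \<otimes>\<^bsub>S\<^esub> q c) \<longrightarrow>
               \<Phi> \<tau> (v s \<otimes>\<^bsub>A\<^esub> invol A (v t)) =
                 complex_of_real (N s powr (- \<beta>) / scale_zeta S N \<beta>) *
                 (\<Sum>\<^sub>\<infinity>c | c \<in> scale_classes S N \<and>
                      scale_class S N (s \<otimes>\<^bsub>S\<^esub> x c) = scale_class S N (t \<otimes>\<^bsub>S\<^esub> x c).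
                    complex_of_real (N (x c) powr (- \<beta>)) *
                    \<tau> (w (q c) \<otimes>\<^bsub>B\<^esub> invol B (w (p c)))))) \<and>
         (\<exists>\<Psi>. affine_homeomorphism C (tracial_states C) A KMS \<Psi>)"
proof -
  have N: "scale S N" and nt: "\<exists>s\<in>carrier S. N s \<noteq> 1" using assms(3) by (auto simp: nontrivial_scale_def)
  have ss: "scaled_semigroup S N" by (rule scaled_semigroupI[OF assms(1) N assms(4)])
  have sum: "(\<lambda>c. class_scale N c powr (- \<beta>)) summable_on scale_classes S N"
    by (rule scaled_semigroup.summable_above_abscissa[OF ss assms(6)])
  interpret kms_setting S N \<beta>
    unfolding kms_setting_def kms_setting_axioms_def scaled_setting_def scaled_setting_axioms_def
    using ss sum assms(2) nt scaled_semigroup.summable_exponent_nz[OF ss nt sum] by blast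
  have eqs: "A = pres.A" "B = K.presB.A" "C = K.presC.A" "KMS = kms_states pres.A pres.dyn \<beta>"
      "v = (\<lambda>s. pres.el (poly_gen s))" "w = (\<lambda>s. K.presB.el (poly_gen s))"
    unfolding A_def B_def C_def KMS_def v_def w_def T_def dynamics
    by (simp_all add: semigroup_cstar_def group_cstar_def semigroup_gen_def[abs_def] universal_gen_def)
  show ?thesis unfolding eqs T_def
  proof (intro conjI)
    show "\<exists>\<Psi>. affine_homeomorphism K.presC.A (tracial_states K.presC.A) pres.A (kms_states pres.A pres.dyn \<beta>) \<Psi>"
      by (rule exI, rule homeomorphism_C)
  qed (intro exI[of _ "\<lambda>\<tau>. pres.extend (A.state (K.chrB \<tau>))"] conjI homeomorphism_B ballI allI impI,
       rule formula, simp_all)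
qed

end
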